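(* Let $t>0$ be fixed and let $\epsilon_k=k^{-1}N_k^{-1/2}$. Then for every fixed $0<\rho<1$, $$\lim_{k\to\infty}\left(\partial_\rho I_{2,k}\right)(\epsilon_k^{-2}t,\rho)=-\frac{\log(1-\rho)}{\rho},$$ where $I_{2,k}(t,\rho)$ is the variance term of the two-point function of the random Bergman potential with respect to the heat kernel measure at time $t$ on $SL(N_k,\mathbb{C})/SU(N_k)$.
   Context: Let $M$ be a compact Kähler manifold of dimension $n\geq 1$, $L\to M$ an ample line bundle with Hermitian metric $h_0$ such that $\omega_0=-i\partial\bar\partial\log h_0$ is a Kähler form. Put $N=N_k=\dim H^0(M,L^k)$ ($k$ large) and let $s=(s_1,\dots,s_N)$ be a basis of $H^0(M,L^k)$ orthonormal in the sense $\frac1V\int_M \bar s_i s_j h_0^k\,\frac{\omega_0^n}{n!}=\delta_{ij}$, $V=\int_M\omega_0^n/n!$. To a positive definite Hermitian $N\times N$ matrix $P$ with $\det P=1$ associate the Bergman potential $\phi_P(z)=\frac1k\log\sum_{i,j}\bar s_i(z)P_{ij}s_j(z)$ (in a local frame of $L$); write $|s(z)|^2=\sum_j|s_j(z)|^2$. The Berezin kernel is $$\rho(z_1,z_2)=\frac{\left|\sum_j s_j(z_1)\overline{s_j(z_2)}\right|^2}{|s(z_1)|^2|s(z_2)|^2}\in[0,1].$$ Heat kernel measure: identify $SL(N,\mathbb{C})/SU(N)$ with the positive definite Hermitian matrices $P$ of determinant $1$, with the Riemannian metric $ds^2=\mathrm{Tr}(P^{-1}dP)^2$. $\mu_t$ is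 the probability measure $p(t,I,P)\,dV(P)$, where $p(t,\cdot,\cdot)$ is the kernel of $e^{t\Delta}$, $I$ is the identity matrix and $dV$ the Riemannian volume. Writing $P=U^\dagger e^\Lambda U$ with $U$ unitary and $\Lambda=\mathrm{diag}(\lambda_1,\dots,\lambda_N)$, it is, up to a normalizing constant, $$\delta\Big(\sum_j\lambda_j\Big)\Delta(\lambda)\Delta(e^\lambda)e^{-\frac1{4t}\sum_j\lambda_j^2}\prod_j d\lambda_j\,[dU],$$ where $\Delta(\lambda)=\prod_{i<j}(\lambda_j-\lambda_i)$, $\Delta(e^\lambda)=\prod_{i<j}(e^{\lambda_j}-e^{\lambda_i})$, and $[dU]$ is Haar measure on the unitary group modulo the diagonal torus. Variance term: let $\mathbf{E}_k$ denote expectation with respect to $\mu_t$. The quantity $$\mathbf{E}_k\left[\log\frac{\sum_{i,j}\bar s_i(z_1)P_{ij}s_j(z_1)}{|s(z_1)|^2}\;\log\frac{\sum_{i,j}\bar s_i(z_2)P_{ij}s_j(z_2)}{|s(z_2)|^2}\right]$$ depends on $(z_1,z_2)$ only through $\rho=\rho(z_1,z_2)$, by unitary invariance of $\mu_t$, and is denoted $I_{2,k}(t,\rho)$. For arbitrary $\rho\in[0,1]$, $I_{2,k}(t,\rho)=\mathbf{E}_k[\log(u^\dagger Pu)\log(v^\dagger Pv)]$ for any unit vectors $u,v\in\mathbb{C}^N$ with $|u^\dagger v|^2=\rho$. *)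

theory Defs
  imports
    "HOL-Analysis.Analysis"
    "HOL-Probability.Probability"
    "HOL-Library.Function_Algebras"
    "Jordan_Normal_Form.Schur_Decomposition"
begin

section \<open>Complex manifolds\<close>

text \<open>
  A complex manifold of dimension \<open>CARD('n)\<close> is a Hausdorff, second countable type \<open>'m\<close> with an
  atlas, i.e. a set of pairs \<open>(U, \<phi>)\<close>.  A chart \<open>\<phi>\<close> is only meaningful on its domain \<open>U\<close>.
\<close>

type_synonym ('m, 'n) atlas = "('m set \<times> ('m \<Rightarrow> complex ^ 'n)) set"

definition holo_on :: "(complex ^ 'n::finite \<Rightarrow> complex) \<Rightarrow> (complex ^ 'n) set \<Rightarrow> bool" where
  "holo_on f S \<longleftrightarrow>
     (\<forall>z\<in>S. \<exists>D. (f has_derivative D) (at z) \<and> (\<forall>c v. D (c *s v) = c * D v))"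

definition complex_atlas ::
    "('m::{t2_space, second_countable_topology}, 'n::finite) atlas \<Rightarrow> bool" where
  "complex_atlas A \<longleftrightarrow>
     (\<Union>(U, \<phi>)\<in>A. U) = UNIV \<and>
     (\<forall>(U, \<phi>)\<in>A. open U \<and> open (\<phi> ` U) \<and> homeomorphism U (\<phi> ` U) \<phi> (inv_into U \<phi>)) \<and>
     (\<forall>(U, \<phi>)\<in>A. \<forall>(V, \<psi>)\<in>A. \<forall>i.
        holo_on (\<lambda>z. vec_nth (\<phi> (inv_into V \<psi> z)) i) (\<psi> ` (U \<inter> V)))"

definition holo_mfd ::
    "('m, 'n::finite) atlas \<Rightarrow> 'm set \<Rightarrow> ('m \<Rightarrow> complex) \<Rightarrow> bool" where
  "holo_mfd A S f \<longleftrightarrow> (\<forall>(U, \<phi>)\<in>A. holo_on (\<lambda>z. f (inv_into U \<phi> z)) (\<phi> ` (U \<inter> S)))"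

primrec Ck_on :: "nat \<Rightarrow> ('a::real_normed_vector \<Rightarrow> real) \<Rightarrow> 'a set \<Rightarrow> bool" where
  "Ck_on 0 f S \<longleftrightarrow> continuous_on S f"
| "Ck_on (Suc k) f S \<longleftrightarrow>
     (\<forall>x\<in>S. f differentiable (at x)) \<and> (\<forall>v. Ck_on k (\<lambda>x. frechet_derivative f (at x) v) S)"

definition smooth_mfd :: "('m, 'n::finite) atlas \<Rightarrow> 'm set \<Rightarrow> ('m \<Rightarrow> real) \<Rightarrow> bool" where
  "smooth_mfd A S f \<longleftrightarrow> (\<forall>(U, \<phi>)\<in>A. \<forall>k. Ck_on k (\<lambda>z. f (inv_into U \<phi> z)) (\<phi> ` (U \<inter> S)))"

text \<open>The Wirtinger derivatives with respect to \<open>z\<^sub>i\<close> and to the conjugate of \<open>z\<^sub>i\<close>.\<close>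

definition dz :: "'n::finite \<Rightarrow> (complex ^ 'n \<Rightarrow> complex) \<Rightarrow> complex ^ 'n \<Rightarrow> complex" where
  "dz i f z = (frechet_derivative f (at z) (axis i 1)
               - \<i> * frechet_derivative f (at z) (axis i \<i>)) / 2"

definition dzbar :: "'n::finite \<Rightarrow> (complex ^ 'n \<Rightarrow> complex) \<Rightarrow> complex ^ 'n \<Rightarrow> complex" where
  "dzbar i f z = (frechet_derivative f (at z) (axis i 1)
                  + \<i> * frechet_derivative f (at z) (axis i \<i>)) / 2"

section \<open>Line bundles\<close>

text \<open>
  A holomorphic line bundle \<open>L\<close> is given by an open cover \<open>W\<close> over which it is trivial and by its
  transition functions: a section with components \<open>s\<^sub>a\<close> in the local frames satisfies
  \<open>s\<^sub>a = g\<^sub>a\<^sub>b s\<^sub>b\<close>.  The bundle \<open>L^k\<close> has the transition functions \<open>g\<^sub>a\<^sub>b ^ k\<close>.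
\<close>

definition line_bundle ::
    "('m::topological_space, 'n::finite) atlas \<Rightarrow> ('i \<Rightarrow> 'm set) \<Rightarrow> ('i \<Rightarrow> 'i \<Rightarrow> 'm \<Rightarrow> complex) \<Rightarrow> bool"
  where
  "line_bundle A W g \<longleftrightarrow>
     (\<Union>a. W a) = UNIV \<and> (\<forall>a. open (W a)) \<and>
     (\<forall>a b. holo_mfd A (W a \<inter> W b) (g a b)) \<and>
     (\<forall>a b. \<forall>x\<in>W a \<inter> W b. g a b x \<noteq> 0) \<and>
     (\<forall>a b c. \<forall>x\<in>W a \<inter> W b \<inter> W c. g a b x * g b c x = g a c x)"

text \<open>
  The space \<open>H\<^sup>0(M, L^k)\<close>.  Components are set to 0 outside the domain of their frame, so that
  equal sections are equal functions and the dimension below is that of the section space.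
\<close>

definition H0 ::
    "('m, 'n::finite) atlas \<Rightarrow> ('i \<Rightarrow> 'm set) \<Rightarrow> ('i \<Rightarrow> 'i \<Rightarrow> 'm \<Rightarrow> complex) \<Rightarrow> nat
      \<Rightarrow> ('i \<Rightarrow> 'm \<Rightarrow> complex) set" where
  "H0 A W g k =
     {s. (\<forall>a. holo_mfd A (W a) (s a)) \<and>
         (\<forall>a b. \<forall>x\<in>W a \<inter> W b. s a x = g a b x ^ k * s b x) \<and>
         (\<forall>a. \<forall>x. x \<notin> W a \<longrightarrow> s a x = 0)}"

definition dim_H0 ::
    "('m, 'n::finite) atlas \<Rightarrow> ('i \<Rightarrow> 'm set) \<Rightarrow> ('i \<Rightarrow> 'i \<Rightarrow> 'm \<Rightarrow> complex) \<Rightarrow> nat \<Rightarrow> nat" where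
  "dim_H0 A W g k =
     vector_space.dim (\<lambda>(c::complex) (s::'i \<Rightarrow> 'm \<Rightarrow> complex) a x. c * s a x) (H0 A W g k)"

text \<open>
  \<open>L^k\<close> is very ample if the evaluation maps from \<open>H\<^sup>0(M, L^k)\<close> to \<open>L^k\<^sub>x \<oplus> L^k\<^sub>y\<close> (\<open>x \<noteq> y\<close>)
  and to the 1-jets at \<open>x\<close> are surjective, i.e. if its sections embed \<open>M\<close> into projective space.
  \<open>L\<close> is ample if all sufficiently high powers are very ample (Demailly's definition).
\<close>

definition very_ample_power ::
    "('m, 'n::finite) atlas \<Rightarrow> ('i \<Rightarrow> 'm set) \<Rightarrow> ('i \<Rightarrow> 'i \<Rightarrow> 'm \<Rightarrow> complex) \<Rightarrow> nat \<Rightarrow> bool" where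
  "very_ample_power A W g k \<longleftrightarrow>
     (\<forall>x y a b c d. x \<noteq> y \<longrightarrow> x \<in> W a \<longrightarrow> y \<in> W b \<longrightarrow>
        (\<exists>s\<in>H0 A W g k. s a x = c \<and> s b y = d)) \<and>
     (\<forall>(U, \<phi>)\<in>A. \<forall>a. \<forall>x\<in>U \<inter> W a. \<forall>(c::complex) (v::complex ^ 'n).
        \<exists>s\<in>H0 A W g k. s a x = c \<and>
          ((\<lambda>z. s a (inv_into U \<phi> z)) has_derivative
             (\<lambda>w. \<Sum>i\<in>UNIV. vec_nth v i * vec_nth w i)) (at (\<phi> x)))"

definition ample ::
    "('m, 'n::finite) atlas \<Rightarrow> ('i \<Rightarrow> 'm set) \<Rightarrow> ('i \<Rightarrow> 'i \<Rightarrow> 'm \<Rightarrow> complex) \<Rightarrow> bool" where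
  "ample A W g \<longleftrightarrow> (\<exists>k0. \<forall>k\<ge>k0. very_ample_power A W g k)"

text \<open>A Hermitian metric: the squared norm of a section is \<open>|s\<^sub>a|^2 h\<^sub>a\<close>.\<close>

definition hermitian_metric ::
    "('m, 'n::finite) atlas \<Rightarrow> ('i \<Rightarrow> 'm set) \<Rightarrow> ('i \<Rightarrow> 'i \<Rightarrow> 'm \<Rightarrow> complex)
      \<Rightarrow> ('i \<Rightarrow> 'm \<Rightarrow> real) \<Rightarrow> bool" where
  "hermitian_metric A W g h \<longleftrightarrow>
     (\<forall>a. smooth_mfd A (W a) (h a)) \<and> (\<forall>a. \<forall>x\<in>W a. h a x > 0) \<and>
     (\<forall>a b. \<forall>x\<in>W a \<inter> W b. h b x = (cmod (g a b x))\<^sup>2 * h a x)"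

text \<open>
  The coefficient matrix \<open>G\<close> of the curvature form
  \<open>\<omega>\<^sub>0 = -\<i> \<partial>\<partial>bar log h = \<i> \<Sum> G\<^sub>i\<^sub>j dz\<^sub>i \<and> dzbar\<^sub>j\<close> in a chart, as a function of the coordinates.
  It does not depend on the local frame \<open>a\<close>.
\<close>

definition curvature_matrix ::
    "('i \<Rightarrow> 'm \<Rightarrow> real) \<Rightarrow> 'm set \<Rightarrow> ('m \<Rightarrow> complex ^ 'n::finite) \<Rightarrow> 'i \<Rightarrow> complex ^ 'n
      \<Rightarrow> complex ^ 'n ^ 'n" where
  "curvature_matrix h U \<phi> a z =
     (\<chi> i j. - dz i (dzbar j (\<lambda>w. complex_of_real (ln (h a (inv_into U \<phi> w))))) z)"

text \<open>
  \<open>\<omega>\<^sub>0\<close> is closed by construction, so it is a Kaehler form iff it is positive.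
\<close>

definition positive_curvature ::
    "('m, 'n::finite) atlas \<Rightarrow> ('i \<Rightarrow> 'm set) \<Rightarrow> ('i \<Rightarrow> 'm \<Rightarrow> real) \<Rightarrow> bool" where
  "positive_curvature A W h \<longleftrightarrow>
     (\<forall>(U, \<phi>)\<in>A. \<forall>a. \<forall>x\<in>U \<inter> W a. \<forall>v. v \<noteq> 0 \<longrightarrow>
        0 < Re (\<Sum>i\<in>UNIV. \<Sum>j\<in>UNIV.
                 vec_nth (vec_nth (curvature_matrix h U \<phi> a (\<phi> x)) i) j
                 * vec_nth v i * cnj (vec_nth v j)))"

text \<open>
  The volume \<open>\<omega>\<^sub>0^n / n!\<close>, whose density in local coordinates is \<open>2^n det G\<close>, because
  \<open>\<i> dz \<and> dzbar = 2 dx \<and> dy\<close>.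
\<close>

definition kahler_volume ::
    "('m::topological_space, 'n::finite) atlas \<Rightarrow> ('i \<Rightarrow> 'm set) \<Rightarrow> ('i \<Rightarrow> 'm \<Rightarrow> real) \<Rightarrow> 'm measure"
  where
  "kahler_volume A W h =
     (THE m. sets m = sets borel \<and>
        (\<forall>(U, \<phi>)\<in>A. \<forall>a. \<forall>B\<in>sets borel. B \<subseteq> U \<inter> W a \<longrightarrow>
           emeasure m B =
             (\<integral>\<^sup>+z\<in>\<phi> ` B. ennreal (2 ^ CARD('n) * Re (Determinants.det (curvature_matrix h U \<phi> a z)))
              \<partial>lborel)))"

text \<open>
  The Hermitian pairing of two sections of \<open>L^k\<close> at a point, antilinear in the first argument;
  it has the same value in every local frame \<open>a\<close> around the point.
\<close>

definition pairing ::
    "('i \<Rightarrow> 'm set) \<Rightarrow> ('i \<Rightarrow> 'm \<Rightarrow> real) \<Rightarrow> nat \<Rightarrow> ('i \<Rightarrow> 'm \<Rightarrow> complex) \<Rightarrow> ('i \<Rightarrow> 'm \<Rightarrow> complex)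
      \<Rightarrow> 'm \<Rightarrow> complex" where
  "pairing W h k s s' x =
     (THE c. \<forall>a. x \<in> W a \<longrightarrow> c = cnj (s a x) * s' a x * complex_of_real (h a x ^ k))"

definition orthonormal_basis ::
    "('m::topological_space, 'n::finite) atlas \<Rightarrow> ('i \<Rightarrow> 'm set) \<Rightarrow> ('i \<Rightarrow> 'i \<Rightarrow> 'm \<Rightarrow> complex)
      \<Rightarrow> ('i \<Rightarrow> 'm \<Rightarrow> real) \<Rightarrow> nat \<Rightarrow> nat \<Rightarrow> (nat \<Rightarrow> 'i \<Rightarrow> 'm \<Rightarrow> complex) \<Rightarrow> bool" where
  "orthonormal_basis A W g h k N s \<longleftrightarrow>
     (\<forall>j<N. s j \<in> H0 A W g k) \<and>
     (\<forall>\<sigma>\<in>H0 A W g k. \<exists>c. \<forall>a x. \<sigma> a x = (\<Sum>j<N. c j * s j a x)) \<and>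
     (let m = kahler_volume A W h in
      \<forall>i<N. \<forall>j<N.
        integral\<^sup>L m (pairing W h k (s i) (s j)) / complex_of_real (measure m (space m))
        = (if i = j then 1 else 0))"

section \<open>The heat kernel measure on \<open>SL(N,\<complex>)/SU(N)\<close>\<close>

definition mat_borel :: "nat \<Rightarrow> complex mat measure" where
  "mat_borel N = vimage_algebra (carrier_mat N N)
     (\<lambda>B. restrict (($$) B) ({..<N} \<times> {..<N})) (PiM ({..<N} \<times> {..<N}) (\<lambda>_. borel))"

definition unitary_group :: "nat \<Rightarrow> complex mat set" where
  "unitary_group N = {U \<in> carrier_mat N N. mat_adjoint U * U = 1\<^sub>m N}"

definition is_haar_unitary :: "nat \<Rightarrow> complex mat measure \<Rightarrow> bool" where
  "is_haar_unitary N H \<longleftrightarrow>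
     prob_space H \<and> sets H = sets (restrict_space (mat_borel N) (unitary_group N)) \<and>
     (\<forall>V\<in>unitary_group N. distr H H (\<lambda>U. V * U) = H)"

definition haar_unitary :: "nat \<Rightarrow> complex mat measure" where
  "haar_unitary N = (THE H. is_haar_unitary N H)"

text \<open>The positive definite Hermitian matrices of determinant 1, i.e. \<open>SL(N,\<complex>)/SU(N)\<close>.\<close>

definition SL_SU :: "nat \<Rightarrow> complex mat set" where
  "SL_SU N =
     {P \<in> carrier_mat N N. mat_adjoint P = P \<and> Determinant.det P = 1 \<and>
        (\<forall>v\<in>carrier_vec N. v \<noteq> 0\<^sub>v N \<longrightarrow> 0 < Re ((P *\<^sub>v v) \<bullet>c v))}"

text \<open>
  The measure \<open>\<delta>(\<Sum>\<^sub>j \<lambda>\<^sub>j) \<Prod>\<^sub>j d\<lambda>\<^sub>j\<close>: integrating the delta function over the last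
  variable gives Lebesgue measure in the others, with the last one minus their sum.
\<close>

definition delta_sum :: "nat \<Rightarrow> (nat \<Rightarrow> real) measure" where
  "delta_sum N =
     distr (PiM {..<N - 1} (\<lambda>_. lborel))
       (restrict_space (PiM {..<N} (\<lambda>_. borel)) {l. (\<Sum>j<N. l j) = 0})
       (\<lambda>x. \<lambda>j\<in>{..<N}. if j = N - 1 then - (\<Sum>i<N - 1. x i) else x j)"

definition vandermonde :: "nat \<Rightarrow> (nat \<Rightarrow> real) \<Rightarrow> real" where
  "vandermonde N l = (\<Prod>j<N. \<Prod>i<j. l j - l i)"

text \<open>
  The heat kernel measure \<open>p(t, I, P) dV(P)\<close>, \<open>p\<close> the kernel of \<open>e^(t \<Delta>)\<close> for the metric
  \<open>Tr (P\<^sup>-\<^sup>1 dP)\<^sup>2\<close>, in its explicit form in the coordinates \<open>P = U\<^sup>\<dagger> e\<^sup>\<Lambda> U\<close>, before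
  normalization.  The matrix \<open>P\<close> depends on \<open>U\<close> only modulo the diagonal torus, so Haar measure
  of the unitary group may be used instead of its image on the quotient.
\<close>

definition heat_kernel_unnormalized :: "nat \<Rightarrow> real \<Rightarrow> complex mat measure" where
  "heat_kernel_unnormalized N t =
     distr
       (density (delta_sum N)
          (\<lambda>l. ennreal (vandermonde N l * vandermonde N (\<lambda>j. exp (l j))
                        * exp (- (1 / (4 * t)) * (\<Sum>j<N. (l j)\<^sup>2))))
        \<Otimes>\<^sub>M haar_unitary N)
       (restrict_space (mat_borel N) (SL_SU N))
       (\<lambda>(l, U). mat_adjoint U
           * mat_diag N (\<lambda>j. complex_of_real (exp (l j))) * U)"

definition heat_kernel_measure :: "nat \<Rightarrow> real \<Rightarrow> complex mat measure" where
  "heat_kernel_measure N t =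
     (let M = heat_kernel_unnormalized N t in scale_measure (1 / emeasure M (space M)) M)"

section \<open>The variance term\<close>

text \<open>\<open>quad P u\<close> is \<open>u\<^sup>\<dagger> P u\<close>, as \<open>v \<bullet>c u\<close> conjugates \<open>u\<close>.\<close>

definition quad :: "complex mat \<Rightarrow> complex Matrix.vec \<Rightarrow> real" where
  "quad P u = Re ((P *\<^sub>v u) \<bullet>c u)"

definition unit_vectors :: "nat \<Rightarrow> complex Matrix.vec set" where
  "unit_vectors N = {u \<in> carrier_vec N. u \<bullet>c u = 1}"

definition I2 :: "nat \<Rightarrow> real \<Rightarrow> real \<Rightarrow> real" where
  "I2 N t \<rho> =
     (THE c. \<forall>u\<in>unit_vectors N. \<forall>v\<in>unit_vectors N. (cmod (v \<bullet>c u))\<^sup>2 = \<rho> \<longrightarrow>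
        c = (\<integral>P. ln (quad P u) * ln (quad P v) \<partial>heat_kernel_measure N t))"

end

theory Submission
  imports Defs "HOL-Complex_Analysis.Complex_Analysis" "HOL-Real_Asymp.Real_Asymp"
begin

text \<open>
  By unitary invariance, \<open>I\<^sub>2\<close> may be averaged over all pairs of unit vectors with \<open>\<bar>u\<^sup>\<dagger> v\<bar>\<^sup>2 = \<rho>\<close> in the
  plane of the first two coordinates.  The compression of \<open>P\<close> to that plane has eigenvalues \<open>a \<ge> b > 0\<close>,
  and the average over \<open>SU(2)\<close> and over the phase of \<open>u\<^sup>\<dagger> v\<close> depends on \<open>\<rho>\<close> only through \<open>r = b / a\<close>.
  Hence \<open>\<partial>\<^sub>\<rho> I\<^sub>2\<close> is the expectation of a bounded function \<open>var_deriv \<rho> r\<close>, which tends to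
  \<open>- ln (1 - \<rho>) / \<rho>\<close> as \<open>r\<close> tends to 0.

  It remains to see that \<open>r\<close> tends to 0 in probability.  If \<open>\<gamma>\<close> is the gap between the two largest \<open>\<lambda>\<^sub>j\<close> and \<open>m\<close>
  is the index of the largest, then \<open>r \<le> exp (- \<gamma>) / \<bar>U\<^sub>m\<^sub>0\<bar>\<^sup>2\<close>.  Small entries of \<open>U\<close> have probability
  at most \<open>N\<^sup>2\<close> times their squared size, and \<open>exp (- \<gamma> / 2)\<close> has mean at most \<open>exp (N / T - T / 2)\<close>: in the Weyl
  chamber both Vandermonde factors are bounded by exponentials of linear functions, with equality to leading
  order at the saddle point \<open>2 T\<close> times the half sum of the positive roots, and the resulting Gaussian integral
  is compared with the exact normalization.  As \<open>T = k\<^sup>2 N t\<close>, the geometry enters only through \<open>N \<ge> 2\<close>.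
\<close>

text \<open>The obstacle is uniformity in \<open>N\<close>, which may grow with \<open>k\<close>: a
  Vandermonde product has about N^2/2 factors, and a bound that lost a constant in each of them
  could swamp the gain exp(-T/2). Each difference is therefore bounded by the exponential tangent to
  it at the saddle point, and the accumulated loss is the sum of the squares of
  \<open>recip_sum\<close> divided by 4 T, at most N/T = 1/(k^2 t). The gain comes from tilting by
  half a simple root: its square costs T/2, its pairing with the saddle point yields T. The factor N
  produced by small entries of U is absorbed by N exp(-T/2) <= 2/(k^2 t). The integrals are computed
  on the whole of R^N, where determinants expand into products of one-dimensional moments; the
  hyperplane of sum zero is recovered because every quantity involved is invariant under adding a
  constant to all coordinates. Haar measure and the variance term are definite descriptions, so
  existence and uniqueness of both objects belong to the proof.\<close>

section \<open>Vandermonde determinants of monic polynomials\<close>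

definition leibniz :: "nat \<Rightarrow> (nat \<Rightarrow> nat \<Rightarrow> real) \<Rightarrow> real" where
  "leibniz N M = (\<Sum>\<sigma> | \<sigma> permutes {..<N}. of_int (sign \<sigma>) * (\<Prod>i<N. M i (\<sigma> i)))"

text \<open>The sum over permutations is the form on which Gaussian integrals act term by term; the
  matrix form supplies multiplicativity, triangular determinants and the sign under row
  permutations.\<close>

lemma leibniz_eq_det: "leibniz N M = Determinant.det (mat N N (\<lambda>(i, j). M i j))"
proof -
  have *: "(\<Prod>i = 0..<N. mat N N (\<lambda>(i, j). M i j) $$ (i, p i)) = (\<Prod>i<N. M i (p i))"
    if "p permutes {..<N}" for p
    using permutes_in_image[OF that] by (intro prod.cong) (auto simp: atLeast0LessThan)
  show ?thesis
    unfolding leibniz_def Determinant.det_def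
    by (auto simp: atLeast0LessThan * intro!: sum.cong)
qed

text \<open>The matrix of values is the matrix of powers times the matrix of coefficients, and the
  latter is upper triangular with ones on the diagonal.\<close>

lemma leibniz_monic_eq:
  fixes q q' :: "nat \<Rightarrow> real poly"
  assumes q: "\<And>j. degree (q j) = j" "\<And>j. lead_coeff (q j) = 1"
  shows "leibniz N (\<lambda>i j. poly (q j) (x i)) = Determinant.det (mat N N (\<lambda>(i, j). x i ^ j))"
proof -
  let ?V = "mat N N (\<lambda>(i, j). x i ^ j)"
  let ?C = "mat N N (\<lambda>(i, j). coeff (q j) i)"
  have "Determinant.det ?C = prod_list (diag_mat ?C)"
    by (rule det_upper_triangular) (auto simp: upper_triangular_def coeff_eq_0 q)
  also have "\<dots> = 1"
    using q(2) by (intro prod_list_neutral) (auto simp: diag_mat_def q(1))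
  finally have C: "Determinant.det ?C = 1" .
  have "?V * ?C = mat N N (\<lambda>(i, j). poly (q j) (x i))"
  proof (rule eq_matI)
    fix i j assume ij: "i < dim_row (mat N N (\<lambda>(i, j). poly (q j) (x i)))"
      "j < dim_col (mat N N (\<lambda>(i, j). poly (q j) (x i)))"
    have "(\<Sum>k<N. x i ^ k * coeff (q j) k) = (\<Sum>k\<le>j. coeff (q j) k * x i ^ k)"
      using ij by (intro sum.mono_neutral_cong_right) (auto simp: coeff_eq_0 q mult.commute)
    then show "(?V * ?C) $$ (i, j) = mat N N (\<lambda>(i, j). poly (q j) (x i)) $$ (i, j)"
      using ij by (auto simp: scalar_prod_def atLeast0LessThan poly_altdef q)
  qed auto
  then have "Determinant.det (mat N N (\<lambda>(i, j). poly (q j) (x i))) = Determinant.det ?V * Determinant.det ?C"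
    by (metis det_mult mat_carrier)
  then show ?thesis
    by (simp add: leibniz_eq_det C)
qed

text \<open>All monic families give the same determinant, so it may be computed with the Newton
  polynomials that vanish at the preceding nodes. Their matrix of values is lower triangular, with
  the inner products of \<open>vandermonde\<close> on the diagonal. This is what later allows moment
  polynomials to be traded for plain powers.\<close>

lemma leibniz_monic:
  fixes q :: "nat \<Rightarrow> real poly"
  assumes "\<And>j. degree (q j) = j" "\<And>j. lead_coeff (q j) = 1"
  shows "leibniz N (\<lambda>i j. poly (q j) (x i)) = vandermonde N x"
proof -
  let ?n = "\<lambda>j. \<Prod>k<j. [:- x k, 1:]"
  have n: "degree (?n j) = j" "lead_coeff (?n j) = 1" for j
    by (subst degree_prod_sum_eq, auto) (subst lead_coeff_prod, auto)
  have "leibniz N (\<lambda>i j. poly (?n j) (x i))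
      = Determinant.det (mat N N (\<lambda>(i, j). poly (?n j) (x i)))"
    by (rule leibniz_eq_det)
  also have "\<dots> = prod_list (diag_mat (mat N N (\<lambda>(i, j). poly (?n j) (x i))))"
    by (rule det_lower_triangular[of N]) (auto simp: poly_prod intro!: prod_zero)
  also have "\<dots> = (\<Prod>j<N. poly (?n j) (x j))"
    by (auto simp: diag_mat_def prod.list_conv_set_nth atLeast0LessThan)
  also have "\<dots> = vandermonde N x"
    by (simp add: vandermonde_def poly_prod)
  finally show ?thesis
    using leibniz_monic_eq[OF assms, of N x] leibniz_monic_eq[OF n, of N x] by simp
qed

lemma vandermonde_leibniz: "vandermonde N x = leibniz N (\<lambda>i j. x i ^ j)"
  using leibniz_monic[of "\<lambda>j. monom 1 j" N x] by (simp add: degree_monom_eq poly_monom)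

lemma vandermonde_permute:
  assumes "\<sigma> permutes {..<N}"
  shows "vandermonde N (\<lambda>i. x (\<sigma> i)) = of_int (sign \<sigma>) * vandermonde N x"
proof -
  have *: "mat N N (\<lambda>(i, j). mat N N (\<lambda>(i, j). x i ^ j) $$ (\<sigma> i, j)) = mat N N (\<lambda>(i, j). x (\<sigma> i) ^ j)"
    by (rule eq_matI) (use permutes_in_image[OF assms] in \<open>simp_all flip: lessThan_iff\<close>)
  have "Determinant.det (mat N N (\<lambda>(i, j). x (\<sigma> i) ^ j))
      = of_int (sign \<sigma>) * Determinant.det (mat N N (\<lambda>(i, j). x i ^ j))"
    using det_permute_rows[of "mat N N (\<lambda>(i, j). x i ^ j)" N \<sigma>, unfolded *] assms
    by (metis mat_carrier atLeast0LessThan)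
  then show ?thesis
    unfolding vandermonde_leibniz leibniz_eq_det .
qed

subsection \<open>Gaussian moments\<close>

text \<open>The variance is \<open>2 * T\<close>, so that the density is proportional to
  exp(-y^2/(4T)), one coordinate of the Gaussian factor in the heat kernel measure.\<close>

definition gauss :: "real \<Rightarrow> real measure" where
  "gauss T = density lborel (normal_density 0 (sqrt (2 * T)))"

lemma prob_gauss: "T > 0 \<Longrightarrow> prob_space (gauss T)"
  unfolding gauss_def by (rule prob_space_normal_density) simp

lemma sets_gauss [simp, measurable_cong]: "sets (gauss T) = sets borel"
  by (simp add: gauss_def)

lemma space_gauss [simp]: "space (gauss T) = UNIV"
  by (simp add: gauss_def)

text \<open>Completing the square: an exponential tilt by \<open>s\<close> moves the mean to
  \<open>2 * T * s\<close> and costs the factor exp(T s^2).\<close>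

lemma normal_density_exp:
  assumes "T > 0"
  shows "normal_density 0 (sqrt (2 * T)) y * exp (s * y)
       = exp (T * s\<^sup>2) * normal_density (2 * T * s) (sqrt (2 * T)) y"
proof -
  have "- (y\<^sup>2) / (4 * T) + s * y = T * s\<^sup>2 + - ((y - 2 * T * s)\<^sup>2) / (4 * T)"
    using assms by (simp add: field_simps power2_eq_square)
  then have "exp (- (y\<^sup>2) / (4 * T)) * exp (s * y) = exp (T * s\<^sup>2) * exp (- ((y - 2 * T * s)\<^sup>2) / (4 * T))"
    by (metis exp_add)
  then show ?thesis
    using assms by (simp add: normal_density_def field_simps)
qed

text \<open>After the tilt, the \<open>j\<close>-th moment of a Gaussian is a polynomial of degree
  \<open>j\<close> in its mean. Only its degree and leading coefficient matter, because
  \<open>leibniz_monic\<close> forgets the rest; hence the existential form.\<close>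

lemma gauss_exp_moment:
  assumes "T > 0"
  shows "\<exists>q. (\<forall>j. degree (q j) = j \<and> lead_coeff (q j) = 1) \<and>
     (\<forall>j s. has_bochner_integral (gauss T) (\<lambda>y. y ^ j * exp (s * y))
        (exp (T * s\<^sup>2) * poly (q j) (2 * T * s)))"
proof -
  let ?s = "sqrt (2 * T)"
  define m where "m i = (\<integral>y. normal_density 0 ?s y * y ^ i \<partial>lborel)" for i
  \<comment> \<open>Binomial expansion of the expectation of (\<mu> + z)^j, with \<open>m\<close>
    the moments of the centred variable z; the coefficient of \<mu>^j is
    \<open>m 0 = 1\<close>.\<close>
  define q where "q j = (\<Sum>k\<le>j. monom (real (j choose k) * m (j - k)) k)" for j
  have m0: "m 0 = 1"
    using assms by (simp add: m_def)
  have co: "coeff (q j) i = (if i \<le> j then real (j choose i) * m (j - i) else 0)" for i j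
    by (simp add: q_def coeff_sum coeff_monom)
  have deg: "degree (q j) = j" for j
    by (intro antisym degree_le le_degree) (auto simp: co m0)
  have lc: "lead_coeff (q j) = 1" for j
    by (simp add: deg co m0)
  have mom: "has_bochner_integral lborel (\<lambda>y. normal_density \<mu> ?s y * y ^ j) (poly (q j) \<mu>)" for j \<mu>
  proof -
    have int: "integrable lborel (\<lambda>y. normal_density \<mu> ?s y * (y - \<mu>) ^ i)" for i
      using assms by (intro integrable_normal_moment) simp
    have val: "(\<integral>y. normal_density \<mu> ?s y * (y - \<mu>) ^ i \<partial>lborel) = m i" for i
      unfolding m_def by (subst lborel_integral_real_affine[where c=1 and t=\<mu>])
        (auto simp: normal_density_def)
    have h: "has_bochner_integral lborel (\<lambda>y. normal_density \<mu> ?s y * (y - \<mu>) ^ i) (m i)" for i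
      using int[of i] val[of i] by (simp add: has_bochner_integral_iff)
    have "has_bochner_integral lborel
        (\<lambda>y. \<Sum>k\<le>j. (real (j choose k) * \<mu> ^ k) * (normal_density \<mu> ?s y * (y - \<mu>) ^ (j - k)))
        (\<Sum>k\<le>j. (real (j choose k) * \<mu> ^ k) * m (j - k))"
      by (intro has_bochner_integral_sum has_bochner_integral_mult_right h)
    moreover have "(\<Sum>k\<le>j. (real (j choose k) * \<mu> ^ k) * (normal_density \<mu> ?s y * (y - \<mu>) ^ (j - k)))
        = normal_density \<mu> ?s y * y ^ j" for y
      using binomial_ring[of \<mu> "y - \<mu>" j]
      by (simp add: sum_distrib_left mult_ac)
    moreover have "(\<Sum>k\<le>j. (real (j choose k) * \<mu> ^ k) * m (j - k)) = poly (q j) \<mu>"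
      by (simp add: q_def poly_sum poly_monom mult_ac)
    ultimately show ?thesis by simp
  qed
  have "has_bochner_integral (gauss T) (\<lambda>y. y ^ j * exp (s * y)) (exp (T * s\<^sup>2) * poly (q j) (2 * T * s))" for j s
  proof -
    have "has_bochner_integral lborel (\<lambda>y. exp (T * s\<^sup>2) * (normal_density (2 * T * s) ?s y * y ^ j))
       (exp (T * s\<^sup>2) * poly (q j) (2 * T * s))"
      by (intro has_bochner_integral_mult_right mom)
    moreover have "exp (T * s\<^sup>2) * (normal_density (2 * T * s) ?s y * y ^ j)
        = normal_density 0 ?s y *\<^sub>R (y ^ j * exp (s * y))" for y
      using normal_density_exp[OF assms, of y s] by (simp add: mult_ac)
    ultimately have "has_bochner_integral lborel (\<lambda>y. normal_density 0 ?s y *\<^sub>R (y ^ j * exp (s * y)))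
       (exp (T * s\<^sup>2) * poly (q j) (2 * T * s))" by simp
    then show ?thesis
      unfolding gauss_def by (intro has_bochner_integral_density) auto
  qed
  then show ?thesis
    using deg lc by blast
qed

section \<open>Reciprocal differences and the exponent at the saddle point\<close>

lemma sum_pairs_symmetric:
  fixes f :: "nat \<Rightarrow> nat \<Rightarrow> real"
  assumes "\<And>i j. f i j = f j i" "\<And>i. f i i = 0"
  shows "(\<Sum>j<N. \<Sum>i<N. f j i) = 2 * (\<Sum>j<N. \<Sum>i<j. f j i)"
proof (induction N)
  case (Suc N)
  have "(\<Sum>j<N. f j N) = (\<Sum>i<N. f N i)"
    by (intro sum.cong) (auto simp: assms(1))
  then show ?case
    using Suc by (simp add: sum.distrib assms(2))
qed simp

text \<open>For j < N this is the gradient of the logarithm of the Vandermonde product at the nodes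
  0, ..., N - 1. The term i = j drops out because division by zero gives 0.\<close>

definition recip_sum :: "nat \<Rightarrow> nat \<Rightarrow> real" where
  "recip_sum N j = (\<Sum>i<N. 1 / (real j - real i))"

text \<open>Each quotient is symmetric in its two indices, so the sum over ordered pairs is twice
  the sum over i < j; splitting the numerator and renaming the indices in one half collects the
  coefficient of \<open>z j\<close>. It turns pairwise exponents into a form that factorizes over
  coordinates.\<close>

lemma sum_difference_quotients:
  fixes z :: "nat \<Rightarrow> real"
  shows "(\<Sum>j<N. \<Sum>i<j. (z j - z i) / (real j - real i)) = (\<Sum>j<N. recip_sum N j * z j)"
proof -
  have sym: "(z j - z i) / (real j - real i) = (z i - z j) / (real i - real j)" for i j
    using minus_divide_divide[of "z j - z i" "real j - real i"] by simp
  have split: "(z j - z i) / (real j - real i) = z j * (1 / (real j - real i)) + z i * (1 / (real i - real j))" for i j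
  proof -
    have "1 / (real i - real j) = - (1 / (real j - real i))"
      by (metis minus_diff_eq minus_divide_right)
    then show ?thesis by (simp add: diff_divide_distrib)
  qed
  have "2 * (\<Sum>j<N. \<Sum>i<j. (z j - z i) / (real j - real i))
      = (\<Sum>j<N. \<Sum>i<N. (z j - z i) / (real j - real i))"
    by (rule sum_pairs_symmetric[symmetric]) (use sym in auto)
  also have "\<dots> = (\<Sum>j<N. \<Sum>i<N. z j * (1 / (real j - real i))) + (\<Sum>j<N. \<Sum>i<N. z i * (1 / (real i - real j)))"
    unfolding sum.distrib[symmetric] by (intro sum.cong refl split)
  also have "(\<Sum>j<N. \<Sum>i<N. z i * (1 / (real i - real j))) = (\<Sum>j<N. \<Sum>i<N. z j * (1 / (real j - real i)))"
    by (rule sum.swap)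
  finally have "(\<Sum>j<N. \<Sum>i<j. (z j - z i) / (real j - real i)) = (\<Sum>j<N. \<Sum>i<N. z j * (1 / (real j - real i)))"
    by linarith
  then show ?thesis
    unfolding recip_sum_def sum_distrib_right by (simp add: mult.commute)
qed

text \<open>Telescoping through 1/(n+1)^2 <= 1/n - 1/(n+1); the step from n = 0 is separate, since
  there 1/n is 0.\<close>

lemma sum_inverse_squares_le: "(\<Sum>d<n. 1 / (real (Suc d))\<^sup>2) \<le> 2 - 1 / real n"
proof (induction n)
  case (Suc n)
  show ?case
  proof (cases "n = 0")
    case False
    then have "1 / (real (Suc n))\<^sup>2 \<le> 1 / real n - 1 / real (Suc n)"
      by (simp add: divide_simps power2_eq_square)
    then show ?thesis using Suc by simp
  qed simp
qed simp

text \<open>The indices below and above \<open>j\<close> each contribute at most the sum of all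
  inverse squares, which is at most 2. The upper range is enlarged to length N so that its
  reindexing does not depend on \<open>j\<close>.\<close>

lemma sum_inverse_square_differences_le: "(\<Sum>i<N. 1 / (real j - real i)\<^sup>2) \<le> 4"
proof -
  have le2: "(\<Sum>d<n. 1 / (real (Suc d))\<^sup>2) \<le> 2" for n
    by (rule order_trans[OF sum_inverse_squares_le]) simp
  have "(\<Sum>i<N. 1 / (real j - real i)\<^sup>2)
      \<le> (\<Sum>i\<in>{..<j} \<union> {j} \<union> {j<..<j + N + 1}. 1 / (real j - real i)\<^sup>2)"
    by (rule sum_mono2) auto
  also have "\<dots> = (\<Sum>i<j. 1 / (real j - real i)\<^sup>2) + (\<Sum>i\<in>{j<..<j + N + 1}. 1 / (real j - real i)\<^sup>2)"
    by (subst sum.union_disjoint, auto)+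
  also have "(\<Sum>i<j. 1 / (real j - real i)\<^sup>2) = (\<Sum>d<j. 1 / (real (Suc d))\<^sup>2)"
    by (rule sum.reindex_bij_witness[of _ "\<lambda>d. j - Suc d" "\<lambda>i. j - Suc i"]) (auto simp: of_nat_diff)
  also have "(\<Sum>i\<in>{j<..<j + N + 1}. 1 / (real j - real i)\<^sup>2) = (\<Sum>d<N. 1 / (real (Suc d))\<^sup>2)"
    by (rule sum.reindex_bij_witness[of _ "\<lambda>d. j + Suc d" "\<lambda>i. i - Suc j"])
      (auto simp: of_nat_diff power2_eq_square algebra_simps)
  finally show ?thesis
    using le2[of j] le2[of N] by linarith
qed

text \<open>For distinct points this is the partial fraction identity with value 0. If two points
  coincide, the products containing 1/0 vanish and one square survives. Listing these cases on the
  right allows summation over all triples without excluding the diagonal.\<close>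

lemma recip_product_cyclic:
  fixes i j k :: real
  shows "1 / (j - i) * (1 / (j - k)) + 1 / (i - j) * (1 / (i - k)) + 1 / (k - i) * (1 / (k - j))
    = (if i = k then 1 / (j - i)\<^sup>2 else 0) + (if i = j then 1 / (k - i)\<^sup>2 else 0)
      + (if j = k then 1 / (i - j)\<^sup>2 else 0)"
proof (cases "i = j \<or> j = k \<or> i = k")
  case False
  then have ne: "i - j \<noteq> 0" "i - k \<noteq> 0" "j - k \<noteq> 0" by auto
  have "1 / (j - i) = - (1 / (i - j))" "1 / (k - i) = - (1 / (i - k))" "1 / (k - j) = - (1 / (j - k))"
    by (metis minus_diff_eq minus_divide_right)+
  then show ?thesis using False ne
    by (simp add: divide_simps) (simp add: algebra_simps)
qed (auto simp: power2_eq_square)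

text \<open>The terms of the triple sum over distinct indices cancel by the partial fraction identity above.\<close>

lemma sum_recip_sum_squares_le: "(\<Sum>j<N. (recip_sum N j)\<^sup>2) \<le> 4 * real N"
proof -
  let ?r = "\<lambda>i j. 1 / (real i - real j)"
  let ?S = "\<Sum>j<N. \<Sum>i<N. \<Sum>k<N. ?r j i * ?r j k"
  let ?Q = "\<Sum>j<N. \<Sum>i<N. 1 / (real j - real i)\<^sup>2"
  have 1: "(\<Sum>j<N. (recip_sum N j)\<^sup>2) = ?S"
    by (simp add: recip_sum_def power2_eq_square sum_product)
  have 2: "(\<Sum>j<N. \<Sum>i<N. \<Sum>k<N. ?r i j * ?r i k) = ?S"
    by (rule sum.swap)
  have "(\<Sum>j<N. \<Sum>i<N. \<Sum>k<N. ?r k i * ?r k j) = (\<Sum>j<N. \<Sum>k<N. \<Sum>i<N. ?r k i * ?r k j)"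
    by (intro sum.cong refl sum.swap)
  also have "\<dots> = (\<Sum>k<N. \<Sum>j<N. \<Sum>i<N. ?r k i * ?r k j)"
    by (rule sum.swap)
  also have "\<dots> = ?S"
    by (intro sum.cong refl) (simp add: mult.commute)
  finally have 3: "(\<Sum>j<N. \<Sum>i<N. \<Sum>k<N. ?r k i * ?r k j) = ?S" .
  have q1: "(\<Sum>j<N. \<Sum>i<N. \<Sum>k<N. if real i = real k then 1 / (real j - real i)\<^sup>2 else 0) = ?Q"
    by (intro sum.cong) (auto simp: sum.delta)
  have q2: "(\<Sum>j<N. \<Sum>i<N. \<Sum>k<N. if real i = real j then 1 / (real k - real i)\<^sup>2 else 0) = ?Q"
  proof -
    have "(\<Sum>i<N. \<Sum>k<N. if real i = real j then 1 / (real k - real i)\<^sup>2 else 0) = (\<Sum>k<N. 1 / (real j - real k)\<^sup>2)"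
      if "j < N" for j
    proof -
      have "(\<Sum>i<N. \<Sum>k<N. if real i = real j then 1 / (real k - real i)\<^sup>2 else 0)
          = (\<Sum>i<N. if i = j then (\<Sum>k<N. 1 / (real j - real k)\<^sup>2) else 0)"
        by (intro sum.cong) (auto simp: power2_commute)
      then show ?thesis using that by simp
    qed
    then show ?thesis by (rule sum.cong[OF refl]) simp
  qed
  have q3: "(\<Sum>j<N. \<Sum>i<N. \<Sum>k<N. if real j = real k then 1 / (real i - real j)\<^sup>2 else 0) = ?Q"
    by (intro sum.cong) (auto simp: power2_commute)
  \<comment> \<open>The three cyclic relabellings of the summand have the same total, so the
    identity is applied to three copies of the triple sum.\<close>
  have "3 * ?S = ?S + (\<Sum>j<N. \<Sum>i<N. \<Sum>k<N. ?r i j * ?r i k) + (\<Sum>j<N. \<Sum>i<N. \<Sum>k<N. ?r k i * ?r k j)"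
    unfolding 2 3 by simp
  also have "\<dots> = (\<Sum>j<N. \<Sum>i<N. \<Sum>k<N. ?r j i * ?r j k + ?r i j * ?r i k + ?r k i * ?r k j)"
    by (simp only: sum.distrib)
  also have "\<dots> = 3 * ?Q"
    unfolding recip_product_cyclic sum.distrib q1 q2 q3 by simp
  finally have "?S = ?Q" by simp
  also have "?Q \<le> (\<Sum>j<N. 4)"
    by (intro sum_mono sum_inverse_square_differences_le)
  finally show ?thesis
    using 1 by simp
qed

lemma recip_sum_last_ge: "recip_sum (n + 2) n \<le> recip_sum (n + 2) (n + 1)"
proof -
  have "recip_sum (n + 2) (n + 1) = (\<Sum>k<Suc n. 1 / (real (n + 1) - real k))"
    by (simp add: recip_sum_def)
  also have "\<dots> = 1 / real (n + 1) + (\<Sum>k<n. 1 / (real n - real k))"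
    by (subst sum.lessThan_Suc_shift) simp
  finally have "recip_sum (n + 2) (n + 1) = 1 / real (n + 1) + (\<Sum>k<n. 1 / (real n - real k))" .
  moreover have "- 1 \<le> 1 / real (n + 1)"
    by (rule order_trans[of _ 0]) auto
  ultimately show ?thesis by (simp add: recip_sum_def)
qed

lemma sum_real_lessThan: "(\<Sum>j<N. real j) = real N * (real N - 1) / 2"
  by (induction N) (auto simp: field_simps)

text \<open>\<open>weyl N\<close> is the half sum \<open>\<delta>\<close> of the positive roots of \<open>SL(N)\<close>.\<close>

definition weyl :: "nat \<Rightarrow> nat \<Rightarrow> real" where
  "weyl N j = real j - (real N - 1) / 2"

text \<open>Differences of \<open>weyl\<close> are differences of indices, so every difference
  quotient is 1 and the sum counts pairs. The same number enters with the opposite sign through the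
  constants of the tangent bounds.\<close>

lemma sum_weyl_recip_sum: "(\<Sum>j<N. weyl N j * recip_sum N j) = real N * (real N - 1) / 2"
proof -
  have "(\<Sum>j<N. recip_sum N j * weyl N j) = (\<Sum>j<N. \<Sum>i<j. (weyl N j - weyl N i) / (real j - real i))"
    by (rule sum_difference_quotients[symmetric])
  also have "\<dots> = (\<Sum>j<N. real j)"
    by (intro sum.cong) (auto simp: weyl_def)
  finally show ?thesis
    by (simp add: sum_real_lessThan mult.commute)
qed

text \<open>\<open>c\<close> is the total slope: saddle point, tangent correction, and minus half
  the simple root of the two largest entries. On expanding the square, the root has square norm 2
  and pairs to 1 with \<open>weyl\<close>, giving T/2 - T; the term \<open>weyl\<close> times
  \<open>recip_sum\<close> cancels the number of pairs; the squares of \<open>recip_sum\<close>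
  leave at most N/T.\<close>

lemma exponent_bound:
  assumes "T > 0" "N = n + 2"
  defines "c \<equiv> \<lambda>i. weyl N i + recip_sum N i / (2 * T) - (if i = n + 1 then 1/2 else if i = n then - 1/2 else 0)"
  shows "(\<Sum>i<N. T * (c i)\<^sup>2) - real N * (real N - 1) / 2 \<le> (\<Sum>i<N. T * (weyl N i)\<^sup>2) + real N / T - T / 2"
proof -
  let ?b = "recip_sum N" and ?al = "\<lambda>i. if i = n + 1 then 1 else if i = n then - 1 else 0 :: real"
  have al: "(\<Sum>i<N. ?al i * f i) = f (n + 1) - f n" for f :: "nat \<Rightarrow> real"
    using assms(2) by simp
  have c: "T * (c i)\<^sup>2 = T * (weyl N i)\<^sup>2 + (?b i)\<^sup>2 / (4 * T) + (T / 4) * (?al i * ?al i)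
      + weyl N i * ?b i - T * (?al i * weyl N i) - (1/2) * (?al i * ?b i)" for i
    using assms(1) unfolding c_def by (simp add: field_simps power2_eq_square)
  have "(\<Sum>i<N. T * (c i)\<^sup>2) = (\<Sum>i<N. T * (weyl N i)\<^sup>2) + (\<Sum>i<N. (?b i)\<^sup>2) / (4 * T) + (T / 4) * (\<Sum>i<N. ?al i * ?al i)
      + (\<Sum>i<N. weyl N i * ?b i) - T * (\<Sum>i<N. ?al i * weyl N i) - (1/2) * (\<Sum>i<N. ?al i * ?b i)"
    unfolding c sum.distrib sum_subtractf sum_distrib_left sum_divide_distrib ..
  also have "(T / 4) * (\<Sum>i<N. ?al i * ?al i) = T / 2"
    unfolding al by simp
  also have "(\<Sum>i<N. ?al i * weyl N i) = 1"
    unfolding al by (simp add: weyl_def)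
  also have "(\<Sum>i<N. ?al i * ?b i) = ?b (n + 1) - ?b n" by (rule al)
  also have "(\<Sum>i<N. weyl N i * ?b i) = real N * (real N - 1) / 2" by (rule sum_weyl_recip_sum)
  finally have e: "(\<Sum>i<N. T * (c i)\<^sup>2) = (\<Sum>i<N. T * (weyl N i)\<^sup>2) + (\<Sum>i<N. (?b i)\<^sup>2) / (4 * T) + T / 2
      + real N * (real N - 1) / 2 - T * 1 - (1/2) * (?b (n + 1) - ?b n)" .
  have "(\<Sum>i<N. (?b i)\<^sup>2) / (4 * T) \<le> (4 * real N) / (4 * T)"
    using assms(1) by (intro divide_right_mono sum_recip_sum_squares_le) simp
  then have "(\<Sum>i<N. (?b i)\<^sup>2) / (4 * T) \<le> real N / T" by simp
  moreover have "?b n \<le> ?b (n + 1)"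
    using recip_sum_last_ge[of n] assms(2) by simp
  moreover have "u + v + T / 2 + w - T * 1 - (1/2) * (b' - b) - w \<le> u + v' - T / 2"
    if "v \<le> v'" "b \<le> b'" for u v w v' b b' :: real
    using that by argo
  ultimately show ?thesis unfolding e by blast
qed

section \<open>Gaussian integral of the product of the two Vandermonde factors\<close>

text \<open>The last factor is 1 on the hyperplane of sum zero and makes the product invariant under
  adding a constant to all entries, so that the hyperplane can be replaced by the whole
  space.\<close>

definition vdm_weight :: "nat \<Rightarrow> (nat \<Rightarrow> real) \<Rightarrow> real" where
  "vdm_weight N y = vandermonde N y * vandermonde N (\<lambda>j. exp (y j)) * exp (- ((real N - 1) / 2) * (\<Sum>j<N. y j))"

definition gauss_prod :: "nat \<Rightarrow> real \<Rightarrow> (nat \<Rightarrow> real) measure" where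
  "gauss_prod N T = PiM {..<N} (\<lambda>_. gauss T)"

lemma sets_gauss_prod [measurable_cong]: "sets (gauss_prod N T) = sets (PiM {..<N} (\<lambda>_. borel))"
  unfolding gauss_prod_def by (intro sets_PiM_cong) auto

lemma vandermonde_measurable [measurable]: "vandermonde N \<in> borel_measurable (PiM {..<N} (\<lambda>_. borel))"
  unfolding vandermonde_def by measurable

lemma vandermonde_exp_measurable [measurable]:
  "(\<lambda>l. vandermonde N (\<lambda>j. exp (l j))) \<in> borel_measurable (PiM {..<N} (\<lambda>_. borel))"
  unfolding vandermonde_def by measurable

lemma vdm_weight_measurable [measurable]: "vdm_weight N \<in> borel_measurable (PiM {..<N} (\<lambda>_. borel))"
  unfolding vdm_weight_def by measurable

text \<open>Exponentiation is increasing, so the factors belonging to the same pair have the same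
  sign.\<close>

lemma vandermonde_exp_product_nonneg: "0 \<le> vandermonde N y * vandermonde N (\<lambda>j. exp (y j))"
proof -
  have "0 \<le> (\<Prod>j<N. \<Prod>i<j. (y j - y i) * (exp (y j) - exp (y i)))"
    by (intro prod_nonneg) (auto simp: zero_le_mult_iff)
  then show ?thesis
    by (simp add: vandermonde_def prod.distrib)
qed

lemma vdm_weight_nonneg: "0 \<le> vdm_weight N y"
  unfolding vdm_weight_def by (intro mult_nonneg_nonneg vandermonde_exp_product_nonneg) auto

lemma vdm_weight_permute:
  assumes "\<sigma> permutes {..<N}"
  shows "vdm_weight N (\<lambda>i. y (\<sigma> i)) = vdm_weight N y"
proof -
  have "(\<Sum>j<N. y (\<sigma> j)) = (\<Sum>j<N. y j)"
    using sum.permute[OF assms, of y] by (simp add: comp_def)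
  moreover have "(of_int (sign \<sigma>) :: real) * of_int (sign \<sigma>) = 1"
    by (metis of_int_1 of_int_mult sign_idempotent)
  ultimately show ?thesis
    unfolding vdm_weight_def vandermonde_permute[OF assms, of y]
      vandermonde_permute[OF assms, of "\<lambda>j. exp (y j)"]
    by (simp add: algebra_simps)
qed

text \<open>Shifting by \<open>c\<close> multiplies the exponential Vandermonde by exp(c) once per
  pair, which the shift of the linear factor compensates exactly.\<close>

lemma vdm_weight_translate: "vdm_weight N (\<lambda>j. y j + c) = vdm_weight N y"
proof -
  have "vandermonde N (\<lambda>j. exp (y j + c)) = (\<Prod>j<N. \<Prod>i<j. exp c * (exp (y j) - exp (y i)))"
    by (simp add: vandermonde_def exp_add algebra_simps)
  also have "\<dots> = (\<Prod>j<N. exp c ^ j) * vandermonde N (\<lambda>j. exp (y j))"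
    by (simp add: vandermonde_def prod.distrib)
  also have "(\<Prod>j<N. exp c ^ j) = exp (c * (\<Sum>j<N. real j))"
    by (simp add: exp_sum sum_distrib_left exp_of_nat2_mult[symmetric] mult.commute flip: exp_of_nat_mult)
  finally show ?thesis
    by (simp add: vdm_weight_def vandermonde_def sum_real_lessThan sum.distrib exp_add[symmetric] algebra_simps)
qed

text \<open>Both determinants are expanded over permutations; the linear factor recentres the
  exponents 0, ..., N - 1 to \<open>weyl\<close>. Every term is a product over coordinates and hence
  integrates to a product of one-dimensional moments.\<close>

lemma vdm_weight_expand:
  "vdm_weight N y = (\<Sum>\<sigma> | \<sigma> permutes {..<N}. \<Sum>\<tau> | \<tau> permutes {..<N}. of_int (sign \<sigma>) * of_int (sign \<tau>) *
      (\<Prod>i<N. y i ^ \<tau> i * exp (weyl N (\<sigma> i) * y i)))"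
proof -
  have pw: "exp (- ((real N - 1) / 2) * x) * exp x ^ k = exp (weyl N k * x)" for x k
  proof -
    have "exp (- ((real N - 1) / 2) * x) * exp x ^ k = exp (- ((real N - 1) / 2) * x + real k * x)"
      by (simp only: exp_add exp_of_nat_mult)
    also have "- ((real N - 1) / 2) * x + real k * x = weyl N k * x"
      unfolding weyl_def by (simp add: field_simps)
    finally show ?thesis .
  qed
  have E: "exp (- ((real N - 1) / 2) * (\<Sum>j<N. y j)) * (\<Prod>i<N. exp (y i) ^ \<sigma> i) = (\<Prod>i<N. exp (weyl N (\<sigma> i) * y i))" for \<sigma>
  proof -
    have "exp (- ((real N - 1) / 2) * (\<Sum>j<N. y j)) = (\<Prod>i<N. exp (- ((real N - 1) / 2) * y i))"
      unfolding sum_distrib_left by (rule exp_sum) simp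
    then show ?thesis
      by (simp only: prod.distrib[symmetric] pw)
  qed
  have reassoc: "s * P * e = s * (e * P)" for s P e :: real by (simp add: mult_ac)
  have *: "vandermonde N (\<lambda>j. exp (y j)) * exp (- ((real N - 1) / 2) * (\<Sum>j<N. y j))
     = (\<Sum>\<sigma> | \<sigma> permutes {..<N}. of_int (sign \<sigma>) * (\<Prod>i<N. exp (weyl N (\<sigma> i) * y i)))"
    unfolding vandermonde_leibniz leibniz_def sum_distrib_right
    by (simp only: reassoc E)
  have "vdm_weight N y = (\<Sum>\<sigma> | \<sigma> permutes {..<N}. of_int (sign \<sigma>) * (\<Prod>i<N. exp (weyl N (\<sigma> i) * y i)))
      * (\<Sum>\<tau> | \<tau> permutes {..<N}. of_int (sign \<tau>) * (\<Prod>i<N. y i ^ \<tau> i))"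
    unfolding vdm_weight_def mult.assoc * vandermonde_leibniz[of N y] leibniz_def by (rule mult.commute)
  also have "\<dots> = (\<Sum>\<sigma> | \<sigma> permutes {..<N}. \<Sum>\<tau> | \<tau> permutes {..<N}. of_int (sign \<sigma>) * of_int (sign \<tau>) *
      (\<Prod>i<N. y i ^ \<tau> i * exp (weyl N (\<sigma> i) * y i)))"
    unfolding sum_product prod.distrib by (intro sum.cong refl) (simp only: mult_ac)
  finally show ?thesis .
qed

lemma gauss_prod_has_integral_prod:
  fixes f :: "nat \<Rightarrow> real \<Rightarrow> real"
  assumes "T > 0" "\<And>i. i < N \<Longrightarrow> has_bochner_integral (gauss T) (f i) (a i)"
  shows "has_bochner_integral (gauss_prod N T) (\<lambda>y. \<Prod>i<N. f i (y i)) (\<Prod>i<N. a i)"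
proof -
  interpret prob_space "gauss T" by (rule prob_gauss[OF assms(1)])
  interpret product_sigma_finite "\<lambda>_::nat. gauss T" by standard
  have "integrable (gauss T) (f i)" "integral\<^sup>L (gauss T) (f i) = a i" if "i < N" for i
    using assms(2)[OF that] by (auto simp: has_bochner_integral_iff)
  then show ?thesis
    unfolding has_bochner_integral_iff gauss_prod_def
    by (subst product_integral_prod) (auto intro!: product_integrable_prod)
qed

text \<open>In every term of the expansion the extra square only raises the power of coordinate
  \<open>k\<close> by 2. The second moment later dominates the product of the two
  logarithms.\<close>

lemma vdm_weight_second_moment_integrable:
  assumes "T > 0" "k < N"
  shows "integrable (gauss_prod N T) (\<lambda>y. (y k)\<^sup>2 * vdm_weight N y)"
proof -
  obtain q where q: "\<And>j s. has_bochner_integral (gauss T) (\<lambda>y. y ^ j * exp (s * y))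
        (exp (T * s\<^sup>2) * poly (q j) (2 * T * s))"
    using gauss_exp_moment[OF assms(1)] by blast
  have *: "(y k)\<^sup>2 * (\<Prod>i<N. y i ^ \<tau> i * exp (weyl N (\<sigma> i) * y i))
      = (\<Prod>i<N. y i ^ (\<tau> i + (if i = k then 2 else 0)) * exp (weyl N (\<sigma> i) * y i))" for y \<sigma> \<tau>
  proof -
    have "(\<Prod>i<N. y i ^ (if i = k then 2 else 0)) = (\<Prod>i<N. if i = k then (y i)\<^sup>2 else 1)"
      by (intro prod.cong) auto
    then have "(y k)\<^sup>2 = (\<Prod>i<N. y i ^ (if i = k then 2 else 0))"
      using assms(2) by (simp only: prod.delta finite_lessThan lessThan_iff if_True)
    then show ?thesis
      by (simp only: prod.distrib power_add mult_ac)
  qed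
  have one: "integrable (gauss_prod N T) (\<lambda>y. \<Prod>i<N. y i ^ (\<tau> i + (if i = k then 2 else 0)) * exp (weyl N (\<sigma> i) * y i))"
    for \<sigma> \<tau> :: "nat \<Rightarrow> nat"
    by (rule integrable.intros[OF gauss_prod_has_integral_prod[where
          f = "\<lambda>i u. u ^ (\<tau> i + (if i = k then 2 else 0)) * exp (weyl N (\<sigma> i) * u)", OF assms(1) q]])
  have "integrable (gauss_prod N T) (\<lambda>y. \<Sum>\<sigma> | \<sigma> permutes {..<N}. \<Sum>\<tau> | \<tau> permutes {..<N}. of_int (sign \<sigma>) * of_int (sign \<tau>) *
      (\<Prod>i<N. y i ^ (\<tau> i + (if i = k then 2 else 0)) * exp (weyl N (\<sigma> i) * y i)))"
    by (intro Bochner_Integration.integrable_sum integrable_mult_right one)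
  then show ?thesis
    unfolding vdm_weight_expand sum_distrib_left mult.left_commute[of "(_)\<^sup>2"] * .
qed

text \<open>For a fixed permutation of the exponents, the sum over the other permutation is a
  determinant of moment polynomials at the points \<open>2 * T * weyl N i\<close>, hence a
  Vandermonde product. The two signs cancel, so all \<open>fact N\<close> permutations contribute
  equally and the mass is exact.\<close>

lemma vdm_weight_has_integral:
  assumes "T > 0"
  shows "has_bochner_integral (gauss_prod N T) (vdm_weight N)
     (fact N * (\<Prod>i<N. exp (T * (weyl N i)\<^sup>2)) * vandermonde N (\<lambda>i. 2 * T * weyl N i))"
proof -
  obtain q where q: "\<And>j. degree (q j) = j" "\<And>j. lead_coeff (q j) = 1"
      "\<And>j s. has_bochner_integral (gauss T) (\<lambda>y. y ^ j * exp (s * y))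
        (exp (T * s\<^sup>2) * poly (q j) (2 * T * s))"
    using gauss_exp_moment[OF assms(1)] by blast
  let ?x = "\<lambda>i. 2 * T * weyl N i"
  have "has_bochner_integral (gauss_prod N T) (\<lambda>y. vdm_weight N y)
     (\<Sum>\<sigma> | \<sigma> permutes {..<N}. \<Sum>\<tau> | \<tau> permutes {..<N}. of_int (sign \<sigma>) * of_int (sign \<tau>) *
      (\<Prod>i<N. exp (T * (weyl N (\<sigma> i))\<^sup>2) * poly (q (\<tau> i)) (2 * T * weyl N (\<sigma> i))))"
    unfolding vdm_weight_expand
    by (intro has_bochner_integral_sum has_bochner_integral_mult_right gauss_prod_has_integral_prod assms q)
  also have "(\<Sum>\<sigma> | \<sigma> permutes {..<N}. \<Sum>\<tau> | \<tau> permutes {..<N}. of_int (sign \<sigma>) * of_int (sign \<tau>) *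
      (\<Prod>i<N. exp (T * (weyl N (\<sigma> i))\<^sup>2) * poly (q (\<tau> i)) (2 * T * weyl N (\<sigma> i))))
    = (\<Sum>\<sigma> | \<sigma> permutes {..<N}. (\<Prod>i<N. exp (T * (weyl N i)\<^sup>2)) * vandermonde N ?x)"
  proof (intro sum.cong refl)
    fix \<sigma> assume "\<sigma> \<in> {\<sigma>. \<sigma> permutes {..<N}}"
    then have \<sigma>: "\<sigma> permutes {..<N}" by simp
    have sg: "(of_int (sign \<sigma>) :: real) * of_int (sign \<sigma>) = 1"
      by (metis of_int_1 of_int_mult sign_idempotent)
    have e: "(\<Prod>i<N. exp (T * (weyl N (\<sigma> i))\<^sup>2)) = (\<Prod>i<N. exp (T * (weyl N i)\<^sup>2))"
      using prod.permute[OF \<sigma>, of "\<lambda>i. exp (T * (weyl N i)\<^sup>2)"] by (simp add: comp_def)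
    have "(\<Sum>\<tau> | \<tau> permutes {..<N}. of_int (sign \<sigma>) * of_int (sign \<tau>) *
      (\<Prod>i<N. exp (T * (weyl N (\<sigma> i))\<^sup>2) * poly (q (\<tau> i)) (2 * T * weyl N (\<sigma> i))))
      = of_int (sign \<sigma>) * (\<Prod>i<N. exp (T * (weyl N i)\<^sup>2)) * leibniz N (\<lambda>i j. poly (q j) (?x (\<sigma> i)))"
      unfolding leibniz_def sum_distrib_left prod.distrib e
      by (intro sum.cong refl) (simp only: mult_ac)
    also have "leibniz N (\<lambda>i j. poly (q j) (?x (\<sigma> i))) = of_int (sign \<sigma>) * vandermonde N ?x"
      by (subst leibniz_monic[OF q(1,2)]) (rule vandermonde_permute[OF \<sigma>])
    finally have c: "(\<Sum>\<tau> | \<tau> permutes {..<N}. of_int (sign \<sigma>) * of_int (sign \<tau>) *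
      (\<Prod>i<N. exp (T * (weyl N (\<sigma> i))\<^sup>2) * poly (q (\<tau> i)) (2 * T * weyl N (\<sigma> i))))
      = of_int (sign \<sigma>) * (\<Prod>i<N. exp (T * (weyl N i)\<^sup>2)) * (of_int (sign \<sigma>) * vandermonde N ?x)" .
    have *: "a * b * (a * c) = b * c" if "a * a = 1" for a b c :: real
      using that by (metis mult.assoc mult.left_commute mult_1)
    show "(\<Sum>\<tau> | \<tau> permutes {..<N}. of_int (sign \<sigma>) * of_int (sign \<tau>) *
      (\<Prod>i<N. exp (T * (weyl N (\<sigma> i))\<^sup>2) * poly (q (\<tau> i)) (2 * T * weyl N (\<sigma> i))))
      = (\<Prod>i<N. exp (T * (weyl N i)\<^sup>2)) * vandermonde N ?x"
      by (rule trans[OF c *[OF sg]])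
  qed
  also have "\<dots> = fact N * (\<Prod>i<N. exp (T * (weyl N i)\<^sup>2)) * vandermonde N ?x"
    by (simp add: card_permutations[of "{..<N}" N])
  finally show ?thesis .
qed

section \<open>Bounds in the Weyl chamber and the gap at the top\<close>

definition chamber :: "nat \<Rightarrow> (nat \<Rightarrow> real) set" where
  "chamber N = {y. \<forall>j<N. \<forall>i<j. y i < y j}"

text \<open>On distinct \<open>y\<close> this is \<open>exp (- gap / 2)\<close>, where \<open>gap\<close> is the difference of the two largest entries.\<close>

definition top_gap_factor :: "nat \<Rightarrow> (nat \<Rightarrow> real) \<Rightarrow> real" where
  "top_gap_factor N y = (\<Sum>\<sigma> | \<sigma> permutes {..<N}.
     indicator (chamber N) (\<lambda>i. y (\<sigma> i)) * exp (- (y (\<sigma> (N - 1)) - y (\<sigma> (N - 2))) / 2))"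

lemma chamber_measurable [measurable]: "{y \<in> space (PiM {..<N} (\<lambda>_. borel)). y \<in> chamber N} \<in> sets (PiM {..<N} (\<lambda>_. borel))"
proof -
  have "Measurable.pred (PiM {..<N} (\<lambda>_. borel)) (\<lambda>y::nat \<Rightarrow> real. \<forall>j\<in>{..<N}. \<forall>i\<in>{..<j}. y i < y j)"
    by measurable
  then show ?thesis
    by (simp add: chamber_def pred_def Ball_def)
qed

text \<open>In each factor the smaller exponential is dropped; the index \<open>j\<close> is the
  larger one exactly \<open>j\<close> times. The relative loss in a factor is exp(-(y_j - y_i)),
  which is negligible at the saddle point, where adjacent entries differ by 2 T.\<close>

lemma vandermonde_exp_chamber_le:
  assumes "y \<in> chamber N"
  shows "vandermonde N (\<lambda>j. exp (y j)) * exp (- ((real N - 1) / 2) * (\<Sum>j<N. y j)) \<le> (\<Prod>i<N. exp (weyl N i * y i))"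
proof -
  have "vandermonde N (\<lambda>j. exp (y j)) \<le> (\<Prod>j<N. \<Prod>i<j. exp (y j))"
    unfolding vandermonde_def using assms
    by (intro prod_mono conjI prod_nonneg) (auto simp: chamber_def intro: less_imp_le)
  also have "\<dots> = (\<Prod>j<N. exp (real j * y j))"
    by (simp add: exp_of_nat_mult)
  finally have le: "vandermonde N (\<lambda>j. exp (y j)) \<le> (\<Prod>j<N. exp (real j * y j))" .
  have e: "exp (- ((real N - 1) / 2) * (\<Sum>j<N. y j)) = (\<Prod>i<N. exp (- ((real N - 1) / 2) * y i))"
    unfolding sum_distrib_left by (rule exp_sum) simp
  have "(\<Prod>j<N. exp (real j * y j)) * exp (- ((real N - 1) / 2) * (\<Sum>j<N. y j)) = (\<Prod>i<N. exp (weyl N i * y i))"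
    unfolding e prod.distrib[symmetric] exp_add[symmetric]
    by (intro prod.cong refl arg_cong[where f = exp]) (simp add: weyl_def field_simps)
  then show ?thesis
    using mult_right_mono[OF le, of "exp (- ((real N - 1) / 2) * (\<Sum>j<N. y j))"] by simp
qed

text \<open>The tangent bound x <= exp(x - 1), an equality at x = 1, is applied to the ratio of each
  difference to its value at the saddle point. The pairwise exponents combine by
  \<open>sum_difference_quotients\<close> into a linear form with coefficients from
  \<open>recip_sum\<close>, and the constants -1 add up to minus the number of pairs.\<close>

lemma vandermonde_chamber_le:
  assumes "y \<in> chamber N" "T > 0"
  shows "vandermonde N y \<le> vandermonde N (\<lambda>i. 2 * T * weyl N i) * exp (- (real N * (real N - 1) / 2))
     * (\<Prod>i<N. exp (recip_sum N i / (2 * T) * y i))"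
proof -
  let ?e = "\<lambda>j i. (y j - y i) / (real j - real i) * (1 / (2 * T)) + - 1"
  have "y j - y i \<le> (2 * T * weyl N j - 2 * T * weyl N i) * exp (?e j i)" if "i < j" "j < N" for i j
  proof -
    let ?d = "2 * T * (real j - real i)"
    have d: "?d > 0" using that assms(2) by simp
    have "y j - y i = ?d * ((y j - y i) / ?d)"
      unfolding times_divide_eq_right by (rule nonzero_mult_div_cancel_left[symmetric]) (use d in linarith)
    also have "\<dots> \<le> ?d * exp ((y j - y i) / ?d - 1)"
      using exp_ge_add_one_self[of "(y j - y i) / ?d - 1"] less_imp_le[OF d]
      by (intro mult_left_mono) simp_all
    also have "(y j - y i) / ?d - 1 = ?e j i"
      by (simp add: mult.commute)
    also have "?d = 2 * T * weyl N j - 2 * T * weyl N i"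
      unfolding weyl_def by (simp add: field_simps)
    finally show ?thesis .
  qed
  moreover have "0 \<le> y j - y i" if "i < j" "j < N" for i j
    using assms(1) that by (auto simp: chamber_def intro: less_imp_le)
  ultimately have "vandermonde N y \<le> (\<Prod>j<N. \<Prod>i<j. (2 * T * weyl N j - 2 * T * weyl N i) * exp (?e j i))"
    unfolding vandermonde_def
    by (intro prod_mono conjI prod_nonneg ballI) (simp_all only: lessThan_iff)
  also have "\<dots> = vandermonde N (\<lambda>i. 2 * T * weyl N i) * exp (\<Sum>j<N. \<Sum>i<j. ?e j i)"
    by (simp only: prod.distrib exp_sum finite_lessThan vandermonde_def)
  also have "(\<Sum>j<N. \<Sum>i<j. ?e j i)
     = (\<Sum>j<N. recip_sum N j * y j) * (1 / (2 * T)) + - (\<Sum>j<N. real j)"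
    unfolding sum_difference_quotients[symmetric] sum_distrib_right sum.distrib
    by (simp add: sum_negf)
  also have "\<dots> = - (real N * (real N - 1) / 2) + (\<Sum>j<N. recip_sum N j / (2 * T) * y j)"
    unfolding sum_real_lessThan by (simp add: sum_divide_distrib)
  finally show ?thesis
    by (simp only: exp_add exp_sum finite_lessThan mult.assoc)
qed

lemma nn_integral_gauss_prod_exp:
  assumes "T > 0"
  shows "(\<integral>\<^sup>+y. ennreal (\<Prod>i<N. exp (c i * y i)) \<partial>gauss_prod N T) = ennreal (\<Prod>i<N. exp (T * (c i)\<^sup>2))"
proof -
  obtain q where q: "\<And>j. degree (q j) = j" "\<And>j. lead_coeff (q j) = 1"
      "\<And>j s. has_bochner_integral (gauss T) (\<lambda>y. y ^ j * exp (s * y))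
        (exp (T * s\<^sup>2) * poly (q j) (2 * T * s))"
    using gauss_exp_moment[OF assms(1)] by blast
  have q0: "q 0 = 1"
    using q(1)[of 0] q(2)[of 0] by (metis degree_eq_zeroE lead_coeff_pCons(2) one_pCons coeff_pCons_0)
  have "has_bochner_integral (gauss_prod N T) (\<lambda>y. \<Prod>i<N. exp (c i * y i)) (\<Prod>i<N. exp (T * (c i)\<^sup>2))"
    using q(3)[of 0] by (intro gauss_prod_has_integral_prod[OF assms, where f = "\<lambda>i u. exp (c i * u)"]) (simp add: q0)
  then show ?thesis
    by (simp add: has_bochner_integral_iff nn_integral_eq_integral prod_nonneg)
qed

text \<open>Reindexing a product measure yields functions restricted to the index set;
  \<open>ext\<close> says that \<open>f\<close> does not notice the restriction.\<close>

lemma nn_integral_gauss_prod_permute: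
  assumes "T > 0" "\<sigma> permutes {..<N}" and [measurable]: "f \<in> borel_measurable (PiM {..<N} (\<lambda>_. borel))"
    and ext: "\<And>y. f (\<lambda>i\<in>{..<N}. y (\<sigma> i)) = f (\<lambda>i. y (\<sigma> i))"
  shows "(\<integral>\<^sup>+y. f (\<lambda>i. y (\<sigma> i)) \<partial>gauss_prod N T) = (\<integral>\<^sup>+y. f y \<partial>gauss_prod N T)"
proof -
  have s: "\<sigma> \<in> {..<N} \<rightarrow> {..<N}"
    using permutes_in_image[OF assms(2)] by blast
  have "distr (gauss_prod N T) (gauss_prod N T) (\<lambda>y. \<lambda>i\<in>{..<N}. y (\<sigma> i)) = gauss_prod N T"
    unfolding gauss_prod_def using s permutes_inj_on[OF assms(2)]
    by (intro distr_PiM_reindex prob_gauss assms(1)) auto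
  moreover have "(\<lambda>y. \<lambda>i\<in>{..<N}. y (\<sigma> i)) \<in> gauss_prod N T \<rightarrow>\<^sub>M gauss_prod N T"
    unfolding gauss_prod_def using s by (intro measurable_restrict measurable_component_singleton) auto
  moreover have "f \<in> borel_measurable (gauss_prod N T)" by measurable
  ultimately have "(\<integral>\<^sup>+y. f y \<partial>gauss_prod N T) = (\<integral>\<^sup>+y. f (\<lambda>i\<in>{..<N}. y (\<sigma> i)) \<partial>gauss_prod N T)"
    by (metis nn_integral_distr)
  then show ?thesis by (simp add: ext)
qed

lemma vdm_weight_cong: "(\<And>i. i < N \<Longrightarrow> y i = y' i) \<Longrightarrow> vdm_weight N y = vdm_weight N y'"
  unfolding vdm_weight_def vandermonde_def
  by (intro arg_cong2[where f = "(*)"] arg_cong[where f = exp] sum.cong prod.cong refl) auto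

lemma chamber_cong: "(\<And>i. i < N \<Longrightarrow> y i = y' i) \<Longrightarrow> y \<in> chamber N \<longleftrightarrow> y' \<in> chamber N"
  by (force simp: chamber_def)

text \<open>By symmetry of the weight, all chambers contribute as much as the increasing one. There
  the two chamber bounds and the gap factor multiply to one exponential of a linear form, whose
  Gaussian integral is explicit, and \<open>exponent_bound\<close> compares it with the exact
  mass.\<close>

lemma top_gap_bound:
  assumes "T > 0" "N \<ge> 2"
  shows "(\<integral>\<^sup>+y. ennreal (top_gap_factor N y * vdm_weight N y) \<partial>gauss_prod N T)
     \<le> ennreal (exp (real N / T - T / 2)) * (\<integral>\<^sup>+y. ennreal (vdm_weight N y) \<partial>gauss_prod N T)"
proof -
  obtain n where n: "N = n + 2" using assms(2) by (metis add.commute le_Suc_ex)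
  \<comment> \<open>Contribution of the increasing chamber; \<open>c\<close> below is the slope of
    the exponential that bounds it.\<close>
  define f where "f y = ennreal (indicator (chamber N) y * exp (- (y (n + 1) - y n) / 2) * vdm_weight N y)" for y
  define c where "c i = weyl N i + recip_sum N i / (2 * T) - (if i = n + 1 then 1/2 else if i = n then - 1/2 else 0)" for i
  let ?V = "vandermonde N (\<lambda>i. 2 * T * weyl N i)"
  have [measurable]: "(\<lambda>y. y (n + 1)) \<in> borel_measurable (PiM {..<N} (\<lambda>_. borel :: real measure))"
      "(\<lambda>y. y n) \<in> borel_measurable (PiM {..<N} (\<lambda>_. borel :: real measure))"
    by (auto intro!: measurable_component_singleton simp: n)
  have fm [measurable]: "f \<in> borel_measurable (PiM {..<N} (\<lambda>_. borel))"
    unfolding f_def by measurable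
  have V: "?V \<ge> 0"
    unfolding vandermonde_def using assms(1) by (intro prod_nonneg) (auto simp: weyl_def)
  have fle: "f y \<le> ennreal (?V * exp (- (real N * (real N - 1) / 2))) * ennreal (\<Prod>i<N. exp (c i * y i))" for y
  proof (cases "y \<in> chamber N")
    case True
    have "vandermonde N y \<ge> 0"
      unfolding vandermonde_def using True by (intro prod_nonneg) (auto simp: chamber_def less_imp_le)
    then have "vdm_weight N y \<le> vandermonde N y * (\<Prod>i<N. exp (weyl N i * y i))"
      unfolding vdm_weight_def mult.assoc by (intro mult_left_mono vandermonde_exp_chamber_le True)
    also have "\<dots> \<le> (?V * exp (- (real N * (real N - 1) / 2)) * (\<Prod>i<N. exp (recip_sum N i / (2 * T) * y i)))
        * (\<Prod>i<N. exp (weyl N i * y i))"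
      by (intro mult_right_mono vandermonde_chamber_le True assms(1) prod_nonneg) auto
    finally have le: "exp (- (y (n + 1) - y n) / 2) * vdm_weight N y \<le> exp (- (y (n + 1) - y n) / 2) *
      ((?V * exp (- (real N * (real N - 1) / 2)) * (\<Prod>i<N. exp (recip_sum N i / (2 * T) * y i)))
        * (\<Prod>i<N. exp (weyl N i * y i)))"
      by (intro mult_left_mono) auto
    \<comment> \<open>The gap factor is written as a product over all coordinates, so that it merges
      with the other two products.\<close>
    have e: "exp (- (y (n + 1) - y n) / 2) = (\<Prod>i<N. exp (- (if i = n + 1 then 1/2 else if i = n then - 1/2 else 0) * y i))"
      unfolding n by (simp add: exp_add[symmetric] field_simps)
    have "exp (- (y (n + 1) - y n) / 2) * ((?V * exp (- (real N * (real N - 1) / 2)) * (\<Prod>i<N. exp (recip_sum N i / (2 * T) * y i)))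
        * (\<Prod>i<N. exp (weyl N i * y i)))
       = (?V * exp (- (real N * (real N - 1) / 2))) * (\<Prod>i<N. exp (- (if i = n + 1 then 1/2 else if i = n then - 1/2 else 0) * y i)
          * (exp (recip_sum N i / (2 * T) * y i) * exp (weyl N i * y i)))"
      unfolding e by (simp only: prod.distrib mult_ac)
    also have "(\<Prod>i<N. exp (- (if i = n + 1 then 1/2 else if i = n then - 1/2 else 0) * y i)
          * (exp (recip_sum N i / (2 * T) * y i) * exp (weyl N i * y i))) = (\<Prod>i<N. exp (c i * y i))"
      unfolding exp_add[symmetric] c_def left_diff_distrib distrib_right
      by (intro prod.cong refl arg_cong[where f = exp]) simp
    finally have eq: "exp (- (y (n + 1) - y n) / 2) * ((?V * exp (- (real N * (real N - 1) / 2)) * (\<Prod>i<N. exp (recip_sum N i / (2 * T) * y i)))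
        * (\<Prod>i<N. exp (weyl N i * y i)))
      = ?V * exp (- (real N * (real N - 1) / 2)) * (\<Prod>i<N. exp (c i * y i))" .
    have "f y = ennreal (exp (- (y (n + 1) - y n) / 2) * vdm_weight N y)"
      unfolding f_def by (simp only: indicator_simps(1)[OF True] mult_1)
    also have "\<dots> \<le> ennreal (?V * exp (- (real N * (real N - 1) / 2)) * (\<Prod>i<N. exp (c i * y i)))"
      using le unfolding eq by (rule ennreal_leI)
    also have "\<dots> = ennreal (?V * exp (- (real N * (real N - 1) / 2))) * ennreal (\<Prod>i<N. exp (c i * y i))"
      using V by (intro ennreal_mult mult_nonneg_nonneg prod_nonneg) auto
    finally show ?thesis .
  qed (simp add: f_def)
  have me: "(\<lambda>y. ennreal (\<Prod>i<N. exp (c i * y i))) \<in> borel_measurable (gauss_prod N T)"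
  proof -
    have "(\<lambda>y. exp (c i * y i)) \<in> borel_measurable (PiM {..<N} (\<lambda>_. borel))" if "i \<in> {..<N}" for i
    proof -
      have [measurable]: "(\<lambda>y. y i) \<in> borel_measurable (PiM {..<N} (\<lambda>_. borel :: real measure))"
        using that by (rule measurable_component_singleton)
      show ?thesis by measurable
    qed
    then show ?thesis
      unfolding measurable_cong_sets[OF sets_gauss_prod refl]
      by (intro measurable_compose[OF _ measurable_ennreal] borel_measurable_prod)
  qed
  have "(\<integral>\<^sup>+y. f y \<partial>gauss_prod N T)
      \<le> (\<integral>\<^sup>+y. ennreal (?V * exp (- (real N * (real N - 1) / 2))) * ennreal (\<Prod>i<N. exp (c i * y i)) \<partial>gauss_prod N T)"
    by (rule nn_integral_mono) (rule fle)
  also have "\<dots> = ennreal (?V * exp (- (real N * (real N - 1) / 2))) * ennreal (\<Prod>i<N. exp (T * (c i)\<^sup>2))"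
    by (simp only: nn_integral_cmult[OF me] nn_integral_gauss_prod_exp[OF assms(1)])
  also have "\<dots> = ennreal (?V * exp ((\<Sum>i<N. T * (c i)\<^sup>2) - real N * (real N - 1) / 2))"
  proof -
    have "exp ((\<Sum>i<N. T * (c i)\<^sup>2) - real N * (real N - 1) / 2)
        = exp (- (real N * (real N - 1) / 2)) * (\<Prod>i<N. exp (T * (c i)\<^sup>2))"
      unfolding exp_sum[OF finite_lessThan, symmetric] exp_add[symmetric] by simp
    note eqe = this
    have "ennreal (?V * exp (- (real N * (real N - 1) / 2))) * ennreal (\<Prod>i<N. exp (T * (c i)\<^sup>2))
        = ennreal (?V * exp (- (real N * (real N - 1) / 2)) * (\<Prod>i<N. exp (T * (c i)\<^sup>2)))"
      by (intro ennreal_mult[symmetric] mult_nonneg_nonneg V prod_nonneg) auto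
    then show ?thesis
      unfolding eqe by (simp only: mult.assoc)
  qed
  also have "\<dots> \<le> ennreal (?V * exp ((\<Sum>i<N. T * (weyl N i)\<^sup>2) + real N / T - T / 2))"
    using exponent_bound[OF assms(1) n] V unfolding c_def
    by (intro ennreal_leI mult_left_mono) (simp_all only: exp_le_cancel_iff)
  also have "\<dots> = ennreal (exp (real N / T - T / 2) * ((\<Prod>i<N. exp (T * (weyl N i)\<^sup>2)) * ?V))"
  proof -
    have "exp ((\<Sum>i<N. T * (weyl N i)\<^sup>2) + real N / T - T / 2)
        = exp (real N / T - T / 2) * (\<Prod>i<N. exp (T * (weyl N i)\<^sup>2))"
      unfolding exp_sum[OF finite_lessThan, symmetric] exp_add[symmetric] by simp
    then show ?thesis by (simp only: mult_ac)
  qed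
  finally have fint: "(\<integral>\<^sup>+y. f y \<partial>gauss_prod N T) \<le> ennreal (exp (real N / T - T / 2) * ((\<Prod>i<N. exp (T * (weyl N i)\<^sup>2)) * ?V))" .
  have "(\<integral>\<^sup>+y. ennreal (top_gap_factor N y * vdm_weight N y) \<partial>gauss_prod N T)
      = (\<integral>\<^sup>+y. (\<Sum>\<sigma> | \<sigma> permutes {..<N}. f (\<lambda>i. y (\<sigma> i))) \<partial>gauss_prod N T)"
  proof (intro nn_integral_cong)
    fix y
    have "ennreal (top_gap_factor N y * vdm_weight N y) = ennreal (\<Sum>\<sigma> | \<sigma> permutes {..<N}.
         indicator (chamber N) (\<lambda>i. y (\<sigma> i)) * exp (- (y (\<sigma> (n + 1)) - y (\<sigma> n)) / 2) * vdm_weight N (\<lambda>i. y (\<sigma> i)))"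
      unfolding top_gap_factor_def sum_distrib_right using n
      by (intro arg_cong[where f = ennreal] sum.cong refl) (simp add: vdm_weight_permute)
    also have "\<dots> = (\<Sum>\<sigma> | \<sigma> permutes {..<N}. f (\<lambda>i. y (\<sigma> i)))"
      unfolding f_def by (rule sum_ennreal[symmetric]) (auto simp: vdm_weight_nonneg)
    finally show "ennreal (top_gap_factor N y * vdm_weight N y) = (\<Sum>\<sigma> | \<sigma> permutes {..<N}. f (\<lambda>i. y (\<sigma> i)))" .
  qed
  also have "\<dots> = (\<Sum>\<sigma> | \<sigma> permutes {..<N}. \<integral>\<^sup>+y. f (\<lambda>i. y (\<sigma> i)) \<partial>gauss_prod N T)"
  proof (rule nn_integral_sum)
    fix \<sigma> assume "\<sigma> \<in> {\<sigma>. \<sigma> permutes {..<N}}"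
    then have "\<sigma> permutes {..<N}" by simp
    then have s: "\<sigma> \<in> {..<N} \<rightarrow> {..<N}" by (simp add: permutes_imp_bij bij_betw_imp_funcset)
    have "(\<lambda>y. f (\<lambda>i\<in>{..<N}. y (\<sigma> i))) \<in> borel_measurable (PiM {..<N} (\<lambda>_. borel))"
      using s by (intro measurable_compose[OF measurable_restrict fm] measurable_component_singleton) auto
    moreover have "f (\<lambda>i\<in>{..<N}. y (\<sigma> i)) = f (\<lambda>i. y (\<sigma> i))" for y
      using vdm_weight_cong[of N "\<lambda>i\<in>{..<N}. y (\<sigma> i)" "\<lambda>i. y (\<sigma> i)"] chamber_cong[of N "\<lambda>i\<in>{..<N}. y (\<sigma> i)" "\<lambda>i. y (\<sigma> i)"] n
      by (simp add: f_def indicator_def)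
    ultimately show "(\<lambda>y. f (\<lambda>i. y (\<sigma> i))) \<in> borel_measurable (gauss_prod N T)"
      unfolding measurable_cong_sets[OF sets_gauss_prod refl] by simp
  qed
  also have "\<dots> = (\<Sum>\<sigma> | \<sigma> permutes {..<N}. \<integral>\<^sup>+y. f y \<partial>gauss_prod N T)"
  proof (intro sum.cong refl nn_integral_gauss_prod_permute assms)
    show "f (\<lambda>i\<in>{..<N}. y (\<sigma> i)) = f (\<lambda>i. y (\<sigma> i))" for y \<sigma>
      using vdm_weight_cong[of N "\<lambda>i\<in>{..<N}. y (\<sigma> i)" "\<lambda>i. y (\<sigma> i)"] chamber_cong[of N "\<lambda>i\<in>{..<N}. y (\<sigma> i)" "\<lambda>i. y (\<sigma> i)"] n
      by (simp add: f_def indicator_def)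
  qed (use fm in auto)
  also have "\<dots> = of_nat (fact N) * (\<integral>\<^sup>+y. f y \<partial>gauss_prod N T)"
    by (simp add: card_permutations[of "{..<N}" N])
  also have "\<dots> \<le> of_nat (fact N) * ennreal (exp (real N / T - T / 2) * ((\<Prod>i<N. exp (T * (weyl N i)\<^sup>2)) * ?V))"
    by (intro mult_left_mono fint) auto
  also have "\<dots> = ennreal (exp (real N / T - T / 2)) * ennreal (fact N * (\<Prod>i<N. exp (T * (weyl N i)\<^sup>2)) * ?V)"
    using V by (simp add: ennreal_of_nat_eq_real_of_nat ennreal_mult'[symmetric] prod_nonneg mult_ac)
  \<comment> \<open>\<open>fact N\<close>, the Gaussian factors and \<open>?V\<close> are exactly
    the mass of the weight, so the quotient is the bare exponential.\<close>
  also have "ennreal (fact N * (\<Prod>i<N. exp (T * (weyl N i)\<^sup>2)) * ?V) = (\<integral>\<^sup>+y. ennreal (vdm_weight N y) \<partial>gauss_prod N T)"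
    using vdm_weight_has_integral[OF assms(1), of N]
    by (simp add: has_bochner_integral_iff nn_integral_eq_integral vdm_weight_nonneg)
  finally show ?thesis .
qed

section \<open>From the Gaussian product to the hyperplane of sum zero\<close>

lemma PiM_lborel_translate:
  fixes c :: "'i \<Rightarrow> 'a::euclidean_space"
  assumes "finite I"
  shows "distr (PiM I (\<lambda>_. lborel)) (PiM I (\<lambda>_. lborel)) (\<lambda>x. \<lambda>i\<in>I. x i + c i) = PiM I (\<lambda>_. lborel)"
proof -
  interpret product_sigma_finite "\<lambda>_::'i. lborel :: 'a measure" by standard
  have m: "(\<lambda>x. \<lambda>i\<in>I. x i + c i) \<in> PiM I (\<lambda>_. lborel) \<rightarrow>\<^sub>M PiM I (\<lambda>_. lborel :: 'a measure)"
    by (intro measurable_restrict) measurable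
  show ?thesis
  proof (rule PiM_eqI[OF assms])
    fix A :: "'i \<Rightarrow> 'a set" assume A: "\<And>i. i \<in> I \<Longrightarrow> A i \<in> sets lborel"
    have "(\<lambda>x. \<lambda>i\<in>I. x i + c i) -` (Pi\<^sub>E I A) \<inter> space (PiM I (\<lambda>_. lborel)) = (\<Pi>\<^sub>E i\<in>I. (\<lambda>y. y + c i) -` A i)"
      by (auto simp: space_PiM PiE_iff)
    then have "emeasure (distr (PiM I (\<lambda>_. lborel)) (PiM I (\<lambda>_. lborel)) (\<lambda>x. \<lambda>i\<in>I. x i + c i)) (Pi\<^sub>E I A)
        = emeasure (PiM I (\<lambda>_. lborel)) (\<Pi>\<^sub>E i\<in>I. (\<lambda>y. y + c i) -` A i)"
      using A by (subst emeasure_distr[OF m]) (auto intro!: sets_PiM_I_finite assms)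
    also have "\<dots> = (\<Prod>i\<in>I. emeasure lborel ((\<lambda>y. y + c i) -` A i))"
      using A by (intro emeasure_PiM assms) (auto intro!: measurable_sets_borel[of _ borel])
    also have "\<dots> = (\<Prod>i\<in>I. emeasure lborel (A i))"
    proof (intro prod.cong refl)
      fix i assume "i \<in> I"
      then have "emeasure (distr lborel borel (\<lambda>y. c i + y)) (A i) = emeasure lborel ((\<lambda>y. c i + y) -` A i \<inter> space lborel)"
        using A by (intro emeasure_distr) auto
      then show "emeasure lborel ((\<lambda>y. y + c i) -` A i) = emeasure lborel (A i)"
        by (simp add: lborel_distr_plus add.commute[of _ "c i"])
    qed
    finally show "emeasure (distr (PiM I (\<lambda>_. lborel)) (PiM I (\<lambda>_. lborel)) (\<lambda>x. \<lambda>i\<in>I. x i + c i)) (Pi\<^sub>E I A)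
        = (\<Prod>i\<in>I. emeasure lborel (A i))" .
  qed simp
qed

lemma nn_integral_PiM_lborel_translate:
  fixes c :: "'i \<Rightarrow> 'a::euclidean_space"
  assumes "finite I" and [measurable]: "f \<in> borel_measurable (PiM I (\<lambda>_. borel))"
  shows "(\<integral>\<^sup>+x. f (\<lambda>i\<in>I. x i + c i) \<partial>PiM I (\<lambda>_. lborel)) = (\<integral>\<^sup>+x. f x \<partial>PiM I (\<lambda>_. lborel))"
proof -
  have s: "sets (PiM I (\<lambda>_. lborel)) = sets (PiM I (\<lambda>_. borel :: 'a measure))"
    by (intro sets_PiM_cong) auto
  have m: "(\<lambda>x. \<lambda>i\<in>I. x i + c i) \<in> PiM I (\<lambda>_. lborel) \<rightarrow>\<^sub>M PiM I (\<lambda>_. lborel :: 'a measure)"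
    by (intro measurable_restrict) measurable
  have "(\<integral>\<^sup>+x. f x \<partial>distr (PiM I (\<lambda>_. lborel)) (PiM I (\<lambda>_. lborel)) (\<lambda>x. \<lambda>i\<in>I. x i + c i))
      = (\<integral>\<^sup>+x. f (\<lambda>i\<in>I. x i + c i) \<partial>PiM I (\<lambda>_. lborel))"
    by (rule nn_integral_distr[OF m]) (simp add: measurable_cong_sets[OF s refl])
  then show ?thesis
    by (simp add: PiM_lborel_translate[OF assms(1)])
qed

lemma PiM_density_eq:
  fixes f :: "'a::euclidean_space \<Rightarrow> real" and I :: "'i set"
  assumes "finite I" and [measurable]: "f \<in> borel_measurable borel" and "\<And>x. f x \<ge> 0"
    and sf: "sigma_finite_measure (density lborel f)"
  shows "PiM I (\<lambda>_. density lborel f) = density (PiM I (\<lambda>_. lborel)) (\<lambda>y. ennreal (\<Prod>i\<in>I. f (y i)))"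
proof -
  interpret p: product_sigma_finite "\<lambda>_::'i. density lborel f"
    using sf by (simp add: product_sigma_finite_def)
  interpret l: product_sigma_finite "\<lambda>_::'i. lborel :: 'a measure" by standard
  have dm: "(\<lambda>y. ennreal (\<Prod>i\<in>I. f (y i))) \<in> borel_measurable (PiM I (\<lambda>_. lborel))"
    by measurable
  show ?thesis
  proof (rule p.PiM_eqI[OF assms(1), symmetric])
    show "sets (density (PiM I (\<lambda>_. lborel)) (\<lambda>y. ennreal (\<Prod>i\<in>I. f (y i)))) = sets (PiM I (\<lambda>_. density lborel f))"
      by (simp cong: sets_PiM_cong)
    fix A :: "'i \<Rightarrow> 'a set" assume "\<And>i::'i. i \<in> I \<Longrightarrow> A i \<in> sets (density lborel f)"
    then have A: "\<And>i. i \<in> I \<Longrightarrow> A i \<in> sets borel" by simp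
    have "emeasure (density (PiM I (\<lambda>_. lborel)) (\<lambda>y. ennreal (\<Prod>i\<in>I. f (y i)))) (Pi\<^sub>E I A)
        = (\<integral>\<^sup>+y. ennreal (\<Prod>i\<in>I. f (y i)) * indicator (Pi\<^sub>E I A) y \<partial>PiM I (\<lambda>_. lborel))"
      by (rule emeasure_density[OF dm]) (auto intro!: sets_PiM_I_finite assms A)
    also have "\<dots> = (\<integral>\<^sup>+y. (\<Prod>i\<in>I. ennreal (f (y i)) * indicator (A i) (y i)) \<partial>PiM I (\<lambda>_. lborel))"
    proof (rule nn_integral_cong)
      fix y :: "'i \<Rightarrow> 'a" assume y: "y \<in> space (PiM I (\<lambda>_. lborel))"
      have "indicator (Pi\<^sub>E I A) y = (\<Prod>i\<in>I. indicator (A i) (y i) :: ennreal)"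
      proof (cases "y \<in> Pi\<^sub>E I A")
        case False
        then obtain i where "i \<in> I" "y i \<notin> A i"
          using y by (auto simp: space_PiM PiE_iff)
        then have "(\<Prod>i\<in>I. indicator (A i) (y i) :: ennreal) = 0"
          using assms(1) by (intro prod_zero bexI[of _ i]) auto
        then show ?thesis using False by simp
      qed (auto simp: PiE_iff intro!: prod.neutral[symmetric])
      then show "ennreal (\<Prod>i\<in>I. f (y i)) * indicator (Pi\<^sub>E I A) y = (\<Prod>i\<in>I. ennreal (f (y i)) * indicator (A i) (y i))"
        using assms(3) by (simp add: prod_ennreal prod.distrib)
    qed
    also have "\<dots> = (\<Prod>i\<in>I. \<integral>\<^sup>+y. ennreal (f y) * indicator (A i) y \<partial>lborel)"
      using A by (intro l.product_nn_integral_prod assms) auto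
    also have "\<dots> = (\<Prod>i\<in>I. emeasure (density lborel f) (A i))"
      using A by (intro prod.cong refl emeasure_density[symmetric]) auto
    finally show "emeasure (density (PiM I (\<lambda>_. lborel)) (\<lambda>y. ennreal (\<Prod>i\<in>I. f (y i)))) (Pi\<^sub>E I A)
       = (\<Prod>i\<in>I. emeasure (density lborel f) (A i))" .
  qed
qed

text \<open>In the coordinates \<open>y = l + t / N\<close>, where \<open>l\<close> has sum 0 and \<open>t\<close> is the sum of \<open>y\<close>, Lebesgue measure is
  \<open>dt\<close> times \<open>delta_sum\<close>; both substitutions are translations.\<close>

definition hyperplane_point :: "nat \<Rightarrow> (nat \<Rightarrow> real) \<Rightarrow> nat \<Rightarrow> real" where
  "hyperplane_point N x = (\<lambda>j\<in>{..<N}. if j = N - 1 then - (\<Sum>i<N - 1. x i) else x j)"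

lemma hyperplane_point_sum: "N > 0 \<Longrightarrow> (\<Sum>j<N. hyperplane_point N x j) = 0"
  by (cases N) (simp_all add: hyperplane_point_def)

lemma hyperplane_point_measurable:
  assumes "N > 0"
  shows "hyperplane_point N \<in> PiM {..<N - 1} (\<lambda>_. lborel) \<rightarrow>\<^sub>M restrict_space (PiM {..<N} (\<lambda>_. borel)) {l. (\<Sum>j<N. l j) = 0}"
proof (rule measurable_restrict_space2)
  show "hyperplane_point N \<in> space (PiM {..<N - 1} (\<lambda>_. lborel)) \<rightarrow> {l. (\<Sum>j<N. l j) = 0}"
    using hyperplane_point_sum[OF assms] by auto
  have "(\<lambda>x. if j = N - 1 then - (\<Sum>i<N - 1. x i) else x j) \<in> PiM {..<N - 1} (\<lambda>_. lborel) \<rightarrow>\<^sub>M borel" if "j \<in> {..<N}" for j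
    using that by (cases "j = N - 1") (auto intro!: borel_measurable_uminus borel_measurable_sum measurable_component_singleton simp del: sum.lessThan_Suc)
  then show "hyperplane_point N \<in> PiM {..<N - 1} (\<lambda>_. lborel) \<rightarrow>\<^sub>M PiM {..<N} (\<lambda>_. borel)"
    unfolding hyperplane_point_def by (rule measurable_restrict)
qed

lemma delta_sum_eq: "delta_sum N = distr (PiM {..<N - 1} (\<lambda>_. lborel))
       (restrict_space (PiM {..<N} (\<lambda>_. borel)) {l. (\<Sum>j<N. l j) = 0}) (hyperplane_point N)"
  unfolding delta_sum_def hyperplane_point_def ..

lemma sets_delta_sum [measurable_cong]: "sets (delta_sum N) = sets (restrict_space (PiM {..<N} (\<lambda>_. borel)) {l. (\<Sum>j<N. l j) = 0})"
  by (simp add: delta_sum_eq)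

lemma space_delta_sum: "space (delta_sum N) = {l \<in> {..<N} \<rightarrow>\<^sub>E UNIV. (\<Sum>j<N. l j) = 0}"
  by (auto simp: delta_sum_eq space_restrict_space space_PiM)

lemma measurable_delta_sum: "f \<in> PiM {..<N} (\<lambda>_. borel) \<rightarrow>\<^sub>M M \<Longrightarrow> f \<in> delta_sum N \<rightarrow>\<^sub>M M"
  unfolding measurable_cong_sets[OF sets_delta_sum refl] by (rule measurable_restrict_space1)

lemma nn_integral_delta_sum:
  assumes "N > 0" "f \<in> borel_measurable (PiM {..<N} (\<lambda>_. borel))"
  shows "(\<integral>\<^sup>+l. f l \<partial>delta_sum N) = (\<integral>\<^sup>+x. f (hyperplane_point N x) \<partial>PiM {..<N - 1} (\<lambda>_. lborel))"
  unfolding delta_sum_eq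
  by (rule nn_integral_distr[OF hyperplane_point_measurable[OF assms(1)]])
    (simp add: measurable_restrict_space1 assms(2))

lemma nn_integral_hyperplane:
  assumes "N > 0" and f [measurable]: "f \<in> borel_measurable (PiM {..<N} (\<lambda>_. borel))"
  shows "(\<integral>\<^sup>+y. f y \<partial>PiM {..<N} (\<lambda>_. lborel))
     = (\<integral>\<^sup>+t. \<integral>\<^sup>+l. f (\<lambda>j\<in>{..<N}. l j + t / real N) \<partial>delta_sum N \<partial>lborel)"
proof -
  interpret product_sigma_finite "\<lambda>_::nat. lborel :: real measure" by standard
  obtain n where n: "N = Suc n" using assms(1) gr0_conv_Suc by auto
  interpret n: finite_product_sigma_finite "\<lambda>_::nat. lborel :: real measure" "{..<n}" by standard simp
  interpret pair_sigma_finite "PiM {..<n} (\<lambda>_. lborel :: real measure)" "lborel :: real measure" ..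
  have s: "sets (PiM I (\<lambda>_. lborel)) = sets (PiM I (\<lambda>_. borel :: real measure))" for I :: "nat set"
    by (intro sets_PiM_cong) auto
  have I: "{..<N} = insert n {..<n}" using n by auto
  have fm: "f \<in> borel_measurable (PiM (insert n {..<n}) (\<lambda>_. lborel))"
    using f unfolding I measurable_cong_sets[OF s refl] .
  have upd: "(\<lambda>(x, s). x(n := s)) \<in> PiM {..<n} (\<lambda>_. lborel) \<Otimes>\<^sub>M lborel \<rightarrow>\<^sub>M PiM (insert n {..<n}) (\<lambda>_. lborel :: real measure)"
    by (rule measurable_add_dim)
  have shift: "(\<lambda>(x, t). (x, t - (\<Sum>i<n. x i))) \<in> PiM {..<n} (\<lambda>_. lborel :: real measure) \<Otimes>\<^sub>M lborel \<rightarrow>\<^sub>M PiM {..<n} (\<lambda>_. lborel) \<Otimes>\<^sub>M lborel"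
    by measurable
  have g: "(\<lambda>(x, t). f (x(n := t - (\<Sum>i<n. x i)))) \<in> borel_measurable (PiM {..<n} (\<lambda>_. lborel) \<Otimes>\<^sub>M lborel)"
    using measurable_compose[OF measurable_compose[OF shift upd] fm] by (simp add: case_prod_beta)
  have "(\<integral>\<^sup>+y. f y \<partial>PiM {..<N} (\<lambda>_. lborel)) = (\<integral>\<^sup>+x. \<integral>\<^sup>+s. f (x(n := s)) \<partial>lborel \<partial>PiM {..<n} (\<lambda>_. lborel))"
    unfolding I by (rule product_nn_integral_insert) (use fm in auto)
  also have "\<dots> = (\<integral>\<^sup>+x. \<integral>\<^sup>+t. f (x(n := t - (\<Sum>i<n. x i))) \<partial>lborel \<partial>PiM {..<n} (\<lambda>_. lborel))"
  proof (rule nn_integral_cong)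
    fix x :: "nat \<Rightarrow> real" assume x: "x \<in> space (PiM {..<n} (\<lambda>_. lborel))"
    have "(\<lambda>s. f (x(n := s))) \<in> borel_measurable lborel"
      using measurable_compose[OF measurable_Pair1'[OF x] measurable_compose[OF upd fm]] by (simp add: case_prod_beta)
    then have m: "(\<lambda>s. f (x(n := s))) \<in> borel_measurable borel" by simp
    show "(\<integral>\<^sup>+s. f (x(n := s)) \<partial>lborel) = (\<integral>\<^sup>+t. f (x(n := t - (\<Sum>i<n. x i))) \<partial>lborel)"
      using nn_integral_real_affine[OF m, of 1 "- (\<Sum>i<n. x i)"] by simp
  qed
  also have "\<dots> = (\<integral>\<^sup>+t. \<integral>\<^sup>+x. f (x(n := t - (\<Sum>i<n. x i))) \<partial>PiM {..<n} (\<lambda>_. lborel) \<partial>lborel)"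
    by (rule Fubini'[symmetric]) (rule g)
  also have "\<dots> = (\<integral>\<^sup>+t. \<integral>\<^sup>+l. f (\<lambda>j\<in>{..<N}. l j + t / real N) \<partial>delta_sum N \<partial>lborel)"
  proof (rule nn_integral_cong)
    fix t :: real
    have gt: "(\<lambda>x. f (x(n := t - (\<Sum>i<n. x i)))) \<in> borel_measurable (PiM {..<n} (\<lambda>_. borel))"
      using measurable_compose[OF measurable_Pair2'[of t lborel "PiM {..<n} (\<lambda>_. lborel :: real measure)"] g]
      by (simp add: measurable_cong_sets[OF s refl])
    \<comment> \<open>With \<open>N = Suc n\<close>, shifting the first \<open>n\<close> coordinates
      by t/N turns the last one into minus their unshifted sum plus t/N, the same shift of a
      hyperplane point.\<close>
    have "(\<integral>\<^sup>+x. f (x(n := t - (\<Sum>i<n. x i))) \<partial>PiM {..<n} (\<lambda>_. lborel))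
        = (\<integral>\<^sup>+x. f ((\<lambda>i\<in>{..<n}. x i + t / real N)(n := t - (\<Sum>i<n. x i + t / real N))) \<partial>PiM {..<n} (\<lambda>_. lborel))"
      using nn_integral_PiM_lborel_translate[OF _ gt, of "\<lambda>_. t / real N"] by simp
    also have "\<dots> = (\<integral>\<^sup>+x. f (\<lambda>j\<in>{..<N}. hyperplane_point N x j + t / real N) \<partial>PiM {..<N - 1} (\<lambda>_. lborel))"
    proof -
      have "(\<lambda>i\<in>{..<n}. x i + t / real N)(n := t - (\<Sum>i<n. x i + t / real N)) = (\<lambda>j\<in>{..<N}. hyperplane_point N x j + t / real N)" for x
      proof -
        have "(\<Sum>i<n. x i + t / real N) = (\<Sum>i<n. x i) + real n * (t / real N)"
          by (simp add: sum.distrib)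
        moreover have "t - (S + real n * (t / real N)) = - S + t / real N" for S
          by (simp add: n field_simps)
        ultimately show ?thesis
          by (intro ext) (auto simp: hyperplane_point_def n)
      qed
      then show ?thesis by (simp add: n)
    qed
    also have "\<dots> = (\<integral>\<^sup>+l. f (\<lambda>j\<in>{..<N}. l j + t / real N) \<partial>delta_sum N)"
      by (rule nn_integral_delta_sum[symmetric, OF assms(1)]) measurable
    finally show "(\<integral>\<^sup>+x. f (x(n := t - (\<Sum>i<n. x i))) \<partial>PiM {..<n} (\<lambda>_. lborel))
       = (\<integral>\<^sup>+l. f (\<lambda>j\<in>{..<N}. l j + t / real N) \<partial>delta_sum N)" .
  qed
  finally show ?thesis .
qed

text \<open>Vectors of sum zero are orthogonal to the constant ones, so the sum of squares is that
  of \<open>l\<close> plus t^2/N. A translation invariant \<open>h\<close> does not see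
  \<open>t\<close>, which integrates out as a Gaussian. The constant \<open>K\<close> is left
  unspecified because only ratios of such integrals are formed.\<close>

lemma nn_integral_gauss_prod_hyperplane:
  assumes "N > 0" "T > 0"
  obtains K where "K > 0"
    "\<And>h. h \<in> borel_measurable (PiM {..<N} (\<lambda>_. borel)) \<Longrightarrow>
       (\<And>y c. h (\<lambda>j\<in>{..<N}. y j + c) = h y) \<Longrightarrow>
       (\<integral>\<^sup>+y. h y \<partial>gauss_prod N T)
         = ennreal K * (\<integral>\<^sup>+l. h l * ennreal (exp (- (1 / (4 * T)) * (\<Sum>j<N. (l j)\<^sup>2))) \<partial>delta_sum N)"
proof
  \<comment> \<open>\<open>?s'\<close> is the standard deviation of the sum of the \<open>N\<close>
    coordinates; \<open>?K\<close> is the ratio of the normalizing constants.\<close>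
  let ?s = "sqrt (2 * T)" and ?s' = "sqrt (2 * T * real N)"
  let ?C = "(1 / sqrt (2 * pi * ?s\<^sup>2)) ^ N"
  let ?K = "?C * sqrt (2 * pi * ?s'\<^sup>2)"
  show "?K > 0" using assms by simp
  fix h :: "(nat \<Rightarrow> real) \<Rightarrow> ennreal"
  assume h [measurable]: "h \<in> borel_measurable (PiM {..<N} (\<lambda>_. borel))"
    and inv: "\<And>y c. h (\<lambda>j\<in>{..<N}. y j + c) = h y"
  let ?e = "\<lambda>l. exp (- (1 / (4 * T)) * (\<Sum>j<N. (l j)\<^sup>2))"
  interpret prob_space "gauss T" by (rule prob_gauss[OF assms(2)])
  have sf: "sigma_finite_measure (density lborel (normal_density 0 ?s))"
    using sigma_finite_measure_axioms by (simp add: gauss_def)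
  have dm: "(\<lambda>y. ennreal (\<Prod>i<N. normal_density 0 ?s (y i))) \<in> borel_measurable (PiM {..<N} (\<lambda>_. lborel))"
    by measurable
  have s: "sets (PiM {..<N} (\<lambda>_. lborel)) = sets (PiM {..<N} (\<lambda>_. borel :: real measure))"
    by (intro sets_PiM_cong) auto
  have hm: "h \<in> borel_measurable (PiM {..<N} (\<lambda>_. lborel))"
    using h unfolding measurable_cong_sets[OF s refl] .
  have prod: "(\<Prod>i<N. normal_density 0 ?s (if i \<in> {..<N} then l i + t / real N else undefined))
      = ?K * normal_density 0 ?s' t * ?e l" if "(\<Sum>j<N. l j) = 0" for l t
  proof -
    have "(\<Sum>i<N. (l i + c)\<^sup>2) = (\<Sum>i<N. (l i)\<^sup>2) + 2 * c * (\<Sum>i<N. l i) + real N * c\<^sup>2" for c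
      by (simp add: power2_sum sum.distrib sum_distrib_left mult_ac)
    then have "(\<Sum>i<N. (l i + t / real N)\<^sup>2) = (\<Sum>i<N. (l i)\<^sup>2) + 2 * (t / real N) * (\<Sum>i<N. l i) + real N * (t / real N)\<^sup>2" .
    also have "\<dots> = (\<Sum>i<N. (l i)\<^sup>2) + t\<^sup>2 / real N"
      using assms(1) that by (simp add: power2_eq_square)
    finally have sq: "(\<Sum>i<N. (l i + t / real N)\<^sup>2) = (\<Sum>i<N. (l i)\<^sup>2) + t\<^sup>2 / real N" .
    have "(\<Prod>i<N. normal_density 0 ?s (if i \<in> {..<N} then l i + t / real N else undefined))
        = ?C * exp (\<Sum>i<N. - (1 / (4 * T)) * (l i + t / real N)\<^sup>2)"
      using assms(2) by (simp add: normal_density_def prod.distrib prod_dividef exp_sum power_divide)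
    also have "(\<Sum>i<N. - (1 / (4 * T)) * (l i + t / real N)\<^sup>2) = - (1 / (4 * T)) * (\<Sum>i<N. (l i)\<^sup>2) + - (t\<^sup>2) / (4 * T * real N)"
      unfolding sum_distrib_left[symmetric] sq by (simp add: distrib_left)
    also have "?C * exp (- (1 / (4 * T)) * (\<Sum>i<N. (l i)\<^sup>2) + - (t\<^sup>2) / (4 * T * real N)) = ?K * normal_density 0 ?s' t * ?e l"
      unfolding exp_add using assms by (simp add: normal_density_def)
    finally show ?thesis .
  qed
  have em: "(\<lambda>l. h l * ennreal (?e l)) \<in> borel_measurable (delta_sum N)"
    by (rule measurable_delta_sum) measurable
  have "(\<integral>\<^sup>+y. h y \<partial>gauss_prod N T)
      = (\<integral>\<^sup>+y. ennreal (\<Prod>i<N. normal_density 0 ?s (y i)) * h y \<partial>PiM {..<N} (\<lambda>_. lborel))"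
    unfolding gauss_prod_def gauss_def
    by (subst PiM_density_eq[OF _ _ _ sf]) (auto intro!: nn_integral_density dm hm)
  also have "\<dots> = (\<integral>\<^sup>+t. \<integral>\<^sup>+l. ennreal (\<Prod>i<N. normal_density 0 ?s (if i \<in> {..<N} then l i + t / real N else undefined)) * h l \<partial>delta_sum N \<partial>lborel)"
    by (subst nn_integral_hyperplane[OF assms(1)]) (simp_all only: inv[unfolded restrict_def] restrict_def, measurable)
  also have "\<dots> = (\<integral>\<^sup>+t. ennreal (?K * normal_density 0 ?s' t) * (\<integral>\<^sup>+l. h l * ennreal (?e l) \<partial>delta_sum N) \<partial>lborel)"
  proof (rule nn_integral_cong)
    fix t :: real
    have "(\<integral>\<^sup>+l. ennreal (\<Prod>i<N. normal_density 0 ?s (if i \<in> {..<N} then l i + t / real N else undefined)) * h l \<partial>delta_sum N)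
        = (\<integral>\<^sup>+l. ennreal (?K * normal_density 0 ?s' t) * (h l * ennreal (?e l)) \<partial>delta_sum N)"
    proof (rule nn_integral_cong)
      fix l assume "l \<in> space (delta_sum N)"
      then have l: "(\<Sum>j<N. l j) = 0" by (simp add: space_delta_sum)
      have "ennreal (?K * normal_density 0 ?s' t * ?e l) = ennreal (?K * normal_density 0 ?s' t) * ennreal (?e l)"
        using assms by (intro ennreal_mult) auto
      then show "ennreal (\<Prod>i<N. normal_density 0 ?s (if i \<in> {..<N} then l i + t / real N else undefined)) * h l
          = ennreal (?K * normal_density 0 ?s' t) * (h l * ennreal (?e l))"
        unfolding prod[OF l] by (simp only: mult_ac)
    qed
    then show "(\<integral>\<^sup>+l. ennreal (\<Prod>i<N. normal_density 0 ?s (if i \<in> {..<N} then l i + t / real N else undefined)) * h l \<partial>delta_sum N)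
        = ennreal (?K * normal_density 0 ?s' t) * (\<integral>\<^sup>+l. h l * ennreal (?e l) \<partial>delta_sum N)"
      by (simp only: nn_integral_cmult[OF em])
  qed
  also have "\<dots> = (\<integral>\<^sup>+t. ennreal (?K * normal_density 0 ?s' t) \<partial>lborel) * (\<integral>\<^sup>+l. h l * ennreal (?e l) \<partial>delta_sum N)"
    by (rule nn_integral_multc) measurable
  also have "(\<integral>\<^sup>+t. ennreal (?K * normal_density 0 ?s' t) \<partial>lborel) = ennreal ?K"
    using assms by (subst nn_integral_eq_integral) (auto intro!: integrable_mult_right)
  finally show "(\<integral>\<^sup>+y. h y \<partial>gauss_prod N T) = ennreal ?K * (\<integral>\<^sup>+l. h l * ennreal (?e l) \<partial>delta_sum N)" .
qed

section \<open>The uniform distribution on the unit interval\<close>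

text \<open>It will turn out to be the law of the squared modulus of one coordinate of a uniform
  point on the unit sphere of C^2.\<close>

definition unif01 :: "real measure" where
  "unif01 = density lborel (\<lambda>x. ennreal (indicator {0<..<1} x))"

lemma sets_unif01 [simp, measurable_cong]: "sets unif01 = sets borel"
  by (simp add: unif01_def)

lemma space_unif01 [simp]: "space unif01 = UNIV"
  by (simp add: unif01_def)

lemma prob_unif01: "prob_space unif01"
proof (rule prob_spaceI)
  have "emeasure unif01 (space unif01) = (\<integral>\<^sup>+x. ennreal (indicator {0<..<1} x) * indicator UNIV x \<partial>(lborel :: real measure))"
    unfolding unif01_def space_density by (subst emeasure_density) auto
  also have "\<dots> = (\<integral>\<^sup>+x. indicator {0<..<1} x \<partial>(lborel :: real measure))"
    by (simp only: ennreal_indicator indicator_UNIV mult_1_right)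
  also have "\<dots> = emeasure lborel {0<..<1::real}"
    by (rule nn_integral_indicator) simp
  finally show "emeasure unif01 (space unif01) = 1"
    by simp
qed

lemma AE_unif01: "AE x in unif01. 0 < x \<and> x < 1"
  unfolding unif01_def by (subst AE_density) (auto intro!: AE_I2 simp: indicator_def)

lemma has_bochner_integral_unif01:
  fixes f :: "real \<Rightarrow> real"
  assumes "(f has_integral I) {0..1}" "set_integrable lebesgue {0..1} f" and [measurable]: "f \<in> borel_measurable borel"
  shows "has_bochner_integral unif01 f I"
proof -
  have 1: "set_integrable lborel {0..1} f"
  proof -
    have "(\<lambda>x. indicator {0..1} x *\<^sub>R f x) \<in> borel_measurable lborel"
      by measurable
    then show ?thesis
      using assms(2) unfolding set_integrable_def by (metis integrable_completion)
  qed
  have "set_integrable lborel {0<..<1} f"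
    by (rule set_integrable_subset[OF 1]) auto
  moreover have "(LINT x:{0<..<1}|lborel. f x) = I"
  proof -
    have "(LINT x:{0<..<1}|lborel. f x) = (LINT x:{0..1}|lborel. f x)"
    proof (rule set_integral_cong_set)
      show "AE x in lborel. (x \<in> {0..1::real}) = (x \<in> {0<..<1})"
        using AE_lborel_singleton[of "0::real"] AE_lborel_singleton[of "1::real"] by eventually_elim auto
    qed (auto simp: set_borel_measurable_def)
    also have "\<dots> = I"
      using set_borel_integral_eq_integral[OF 1] assms(1) by (simp add: integral_unique)
    finally show ?thesis .
  qed
  ultimately have "has_bochner_integral lborel (\<lambda>x. indicator {0<..<1} x *\<^sub>R f x) I"
    by (simp add: has_bochner_integral_iff set_integrable_def set_lebesgue_integral_def)
  then show ?thesis
    unfolding unif01_def by (intro has_bochner_integral_density) auto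
qed

text \<open>The antiderivative x ln x - x extends continuously to 0 with value 0, which is also what
  the formula returns at a = 0. So the fundamental theorem only has to differentiate in the
  interior.\<close>

lemma has_integral_ln:
  assumes "0 \<le> a" "a \<le> b"
  shows "(ln has_integral (b * ln b - b - (a * ln a - a))) {a..b::real}"
proof (rule fundamental_theorem_of_calculus_interior)
  have "continuous (at x within {a..b}) (\<lambda>x. x * ln x - x)" if "x \<in> {a..b}" for x
  proof (cases "x = 0")
    case True
    have "((\<lambda>x::real. x * ln x - x) \<longlongrightarrow> 0 * ln 0 - 0) (at_right 0)"
      by real_asymp
    moreover have "at 0 within {a..b} \<le> at_right (0::real)"
      unfolding at_within_def using assms by (intro inf_mono) auto
    ultimately show ?thesis
      using True by (auto simp: continuous_within intro: tendsto_mono)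
  next
    case False
    then show ?thesis using that assms by (intro continuous_intros) auto
  qed
  then show "continuous_on {a..b} (\<lambda>x. x * ln x - x)"
    by (simp add: continuous_on_eq_continuous_within)
  show "((\<lambda>x. x * ln x - x) has_vector_derivative ln x) (at x)" if "x \<in> {a<..<b}" for x
    unfolding has_real_derivative_iff_has_vector_derivative[symmetric]
    using that assms by (auto intro!: derivative_eq_intros)
qed (use assms in auto)

lemma unif01_ln: "has_bochner_integral unif01 (\<lambda>x. - ln x) 1"
proof (rule has_bochner_integral_unif01)
  show "((\<lambda>x. - ln x) has_integral 1) {0..1::real}"
    using has_integral_neg[OF has_integral_ln[of 0 1]] by simp
  show "set_integrable lebesgue {0..1} (\<lambda>x::real. - ln x)"
  proof (rule nonnegative_absolutely_integrable_1)
    show "(\<lambda>x::real. - ln x) integrable_on {0..1}"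
      using has_integral_neg[OF has_integral_ln[of 0 1]] by (auto simp: integrable_on_def)
    show "0 \<le> - ln x" if "x \<in> {0..1::real}" for x
      using that by (cases "x = 0") auto
  qed
qed measurable

subsection \<open>The average over the circle\<close>

text \<open>The values \<alpha> + c z have positive real part for z in the closed unit disc, so
  their principal logarithm is holomorphic inside and Cauchy's formula gives its mean over the
  circle as the value at the centre; then real parts are taken.\<close>

lemma circle_average_ln:
  fixes \<alpha> :: real and c :: complex
  assumes "cmod c < \<alpha>"
  shows "((\<lambda>t. ln (cmod (of_real \<alpha> + c * cis (2 * pi * t)))) has_integral ln \<alpha>) {0..1}"
proof -
  have a: "\<alpha> > 0" using assms norm_ge_zero[of c] by linarith
  have pos: "0 < Re (of_real \<alpha> + c * z)" if "cmod z \<le> 1" for z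
  proof -
    have "\<bar>Re (c * z)\<bar> \<le> cmod c * 1"
      using abs_Re_le_cmod[of "c * z"] mult_left_mono[OF that, of "cmod c"] by (simp add: norm_mult)
    then show ?thesis using assms by simp
  qed
  have "((\<lambda>u. Ln (of_real \<alpha> + c * u) / (u - 0)) has_contour_integral (2 * of_real pi * \<i> * Ln (of_real \<alpha> + c * 0))) (circlepath 0 1)"
  proof (rule Cauchy_integral_circlepath)
    show "continuous_on (cball 0 1) (\<lambda>u. Ln (of_real \<alpha> + c * u))"
      using pos by (intro continuous_intros) (auto simp: complex_nonpos_Reals_iff, smt (verit))
    show "(\<lambda>u. Ln (of_real \<alpha> + c * u)) holomorphic_on ball 0 1"
      using pos by (intro holomorphic_intros) (auto simp: complex_nonpos_Reals_iff, smt (verit))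
  qed auto
  then have "((\<lambda>t. 2 * of_real pi * \<i> * Ln (of_real \<alpha> + c * exp (2 * of_real pi * \<i> * of_real t))) has_integral 2 * of_real pi * \<i> * Ln (of_real \<alpha> + c * 0)) {0..1}"
    unfolding has_contour_integral_def
  proof (rule has_integral_eq[rotated])
    fix t :: real assume "t \<in> {0..1}"
    then have "vector_derivative (circlepath 0 1) (at t within {0..1}) = 2 * of_real pi * \<i> * exp (2 * of_real pi * \<i> * of_real t)"
      by (subst vector_derivative_circlepath01) auto
    then show "Ln (of_real \<alpha> + c * circlepath 0 1 t) / (circlepath 0 1 t - 0) * vector_derivative (circlepath 0 1) (at t within {0..1})
        = 2 * of_real pi * \<i> * Ln (of_real \<alpha> + c * exp (2 * of_real pi * \<i> * of_real t))"
      by (simp add: circlepath)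
  qed
  from has_integral_mult_right[OF this, of "1 / (2 * of_real pi * \<i>)"]
  have "((\<lambda>t. Ln (of_real \<alpha> + c * exp (2 * of_real pi * \<i> * of_real t))) has_integral Ln (of_real \<alpha>)) {0..1}"
    by simp
  from has_integral_Re[OF this]
  have "((\<lambda>t. Re (Ln (of_real \<alpha> + c * exp (2 * of_real pi * \<i> * of_real t)))) has_integral ln \<alpha>) {0..1}"
    using a by simp
  then show ?thesis
  proof (rule has_integral_eq[rotated])
    fix t :: real
    have e: "exp (2 * of_real pi * \<i> * of_real t) = cis (2 * pi * t)"
      by (simp add: cis_conv_exp mult_ac)
    have "of_real \<alpha> + c * cis (2 * pi * t) \<noteq> 0"
    proof
      assume "of_real \<alpha> + c * cis (2 * pi * t) = 0"
      then show False
        using pos[of "cis (2 * pi * t)"] by (metis less_irrefl norm_cis order_refl zero_complex.sel(1))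
    qed
    then show "Re (Ln (of_real \<alpha> + c * exp (2 * of_real pi * \<i> * of_real t))) = ln (cmod (of_real \<alpha> + c * cis (2 * pi * t)))"
      unfolding e by simp
  qed
qed

text \<open>The positive trigonometric polynomial is a squared modulus: A + 2 Re (d e) = |\<alpha> +
  c e|^2 for |e| = 1, where \<alpha>^2 = m is the larger root of m^2 - A m + |d|^2 = 0 and c =
  d/\<alpha>. As |c| < \<alpha>, the mean is 2 ln \<alpha> = ln m.\<close>

lemma circle_average_ln_quadratic:
  fixes A :: real and d :: complex
  assumes "2 * cmod d < A"
  shows "has_bochner_integral unif01 (\<lambda>t. ln (A + 2 * Re (d * cis (2 * pi * t)))) (ln ((A + sqrt (A\<^sup>2 - 4 * (cmod d)\<^sup>2)) / 2))"
proof -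
  define S where "S = sqrt (A\<^sup>2 - 4 * (cmod d)\<^sup>2)"
  define m where "m = (A + S) / 2"
  have A: "A > 0" using assms norm_ge_zero[of d] by linarith
  have "(2 * cmod d)\<^sup>2 < A\<^sup>2"
    using assms by (intro power_strict_mono) auto
  then have S: "S > 0" "S\<^sup>2 = A\<^sup>2 - 4 * (cmod d)\<^sup>2"
    by (auto simp: S_def power_mult_distrib)
  have m: "m > 0" "m > cmod d" using A S assms by (auto simp: m_def)
  \<comment> \<open>The quadratic equation for \<open>m\<close>; it makes the constant terms of both
    expressions agree.\<close>
  have mq: "m\<^sup>2 + (cmod d)\<^sup>2 = A * m"
    using S(2) by (simp add: m_def power2_eq_square field_simps)
  define \<alpha> where "\<alpha> = sqrt m"
  have al: "\<alpha> > 0" "\<alpha>\<^sup>2 = m" using m by (auto simp: \<alpha>_def)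
  define c where "c = d / of_real \<alpha>"
  have "cmod c < \<alpha>"
    using m(2) al by (simp add: c_def norm_divide divide_less_eq power2_eq_square)
  note int = has_integral_mult_right[OF circle_average_ln[OF this], of 2]
  have eq: "A + 2 * Re (d * cis \<theta>) = (cmod (of_real \<alpha> + c * cis \<theta>))\<^sup>2" for \<theta>
  proof -
    have "(cmod (of_real \<alpha> + c * cis \<theta>))\<^sup>2 = \<alpha>\<^sup>2 + 2 * Re (of_real \<alpha> * (c * cis \<theta>)) + (cmod (c * cis \<theta>))\<^sup>2"
      unfolding cmod_power2 by (simp add: power2_eq_square algebra_simps)
    also have "of_real \<alpha> * (c * cis \<theta>) = d * cis \<theta>"
      using al by (simp add: c_def)
    also have "(cmod (c * cis \<theta>))\<^sup>2 = (cmod d)\<^sup>2 / m"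
      using al by (simp add: c_def norm_mult norm_divide power_divide)
    also have "\<alpha>\<^sup>2 + 2 * Re (d * cis \<theta>) + (cmod d)\<^sup>2 / m = A + 2 * Re (d * cis \<theta>)"
      using mq m(1) al by (simp add: field_simps power2_eq_square)
    finally show ?thesis by simp
  qed
  have pos: "0 < A + 2 * Re (d * cis \<theta>)" for \<theta>
    using abs_Re_le_cmod[of "d * cis \<theta>"] assms by (simp add: norm_mult)
  have hi: "((\<lambda>t. ln (A + 2 * Re (d * cis (2 * pi * t)))) has_integral ln m) {0..1}"
  proof (rule has_integral_eq_rhs[OF has_integral_eq[OF _ int]])
    show "ln m = 2 * ln \<alpha>" using al by (metis ln_realpow of_nat_numeral)
    fix t :: real
    have "0 < cmod (of_real \<alpha> + c * cis (2 * pi * t))"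
      using pos[of "2 * pi * t"] unfolding eq by (metis norm_ge_zero order_less_le power_zero_numeral)
    then show "2 * ln (cmod (of_real \<alpha> + c * cis (2 * pi * t))) = ln (A + 2 * Re (d * cis (2 * pi * t)))"
      unfolding eq by (metis ln_realpow of_nat_numeral)
  qed
  have cont: "continuous_on UNIV (\<lambda>t. ln (A + 2 * Re (d * cis (2 * pi * t))))"
  proof -
    have "\<forall>t\<in>UNIV. A + 2 * Re (d * cis (2 * pi * t)) \<noteq> 0"
      using pos by (metis less_irrefl)
    then show ?thesis
      by (intro continuous_on_ln continuous_intros)
  qed
  have "has_bochner_integral unif01 (\<lambda>t. ln (A + 2 * Re (d * cis (2 * pi * t)))) (ln m)"
  proof (rule has_bochner_integral_unif01[OF hi])
    show "set_integrable lebesgue {0..1} (\<lambda>t. ln (A + 2 * Re (d * cis (2 * pi * t))))"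
      using absolutely_integrable_continuous_real[OF continuous_on_subset[OF cont]] by simp
    show "(\<lambda>t. ln (A + 2 * Re (d * cis (2 * pi * t)))) \<in> borel_measurable borel"
      using cont by (rule borel_measurable_continuous_onI)
  qed
  then show ?thesis by (simp add: m_def S_def)
qed

text \<open>\<open>ln (circle_mean r \<rho> x)\<close> is the mean of \<open>ln (r + (1 - r) \<bar>sqrt \<rho> z - sqrt (1 - \<rho>) e w\<bar>\<^sup>2)\<close> over the unit circle \<open>\<bar>e\<bar> = 1\<close>,
  where \<open>\<bar>z\<bar>\<^sup>2 = x\<close> and \<open>\<bar>w\<bar>\<^sup>2 = 1 - x\<close>; \<open>dlog_circle_mean\<close> is its derivative in \<open>\<rho>\<close>.\<close>

definition pp :: "real \<Rightarrow> real \<Rightarrow> real \<Rightarrow> real" where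
  "pp r \<rho> x = (1 - r) * x * \<rho>"

definition qq :: "real \<Rightarrow> real \<Rightarrow> real \<Rightarrow> real" where
  "qq r \<rho> x = (1 - r) * (1 - x) * (1 - \<rho>)"

text \<open>The square root of the discriminant in the circle mean, with the radicand arranged so as
  to be visibly nonnegative; \<open>ss_alt\<close> gives the form that arises from the quadratic
  equation.\<close>

definition ss :: "real \<Rightarrow> real \<Rightarrow> real \<Rightarrow> real" where
  "ss r \<rho> x = sqrt (r\<^sup>2 + 2 * r * (pp r \<rho> x + qq r \<rho> x) + (pp r \<rho> x - qq r \<rho> x)\<^sup>2)"

definition circle_mean :: "real \<Rightarrow> real \<Rightarrow> real \<Rightarrow> real" where
  "circle_mean r \<rho> x = (r + pp r \<rho> x + qq r \<rho> x + ss r \<rho> x) / 2"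

definition dlog_circle_mean :: "real \<Rightarrow> real \<Rightarrow> real \<Rightarrow> real" where
  "dlog_circle_mean r \<rho> x = ((1 - r) * x * (circle_mean r \<rho> x - qq r \<rho> x) - (1 - r) * (1 - x) * (circle_mean r \<rho> x - pp r \<rho> x))
     / (circle_mean r \<rho> x * ss r \<rho> x)"

lemma ss_alt: "ss r \<rho> x = sqrt ((r + pp r \<rho> x + qq r \<rho> x)\<^sup>2 - 4 * (pp r \<rho> x * qq r \<rho> x))"
  unfolding ss_def by (rule arg_cong[where f = sqrt]) (simp add: power2_eq_square algebra_simps)

context
  fixes r \<rho> x :: real
  assumes r: "0 \<le> r" "r \<le> 1" and \<rho>: "0 \<le> \<rho>" "\<rho> \<le> 1" and x: "0 \<le> x" "x \<le> 1"
begin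

lemma pp_nonneg: "0 \<le> pp r \<rho> x" and qq_nonneg: "0 \<le> qq r \<rho> x"
  using r \<rho> x by (auto simp: pp_def qq_def)

lemma radicand_nonneg: "0 \<le> r\<^sup>2 + 2 * r * (pp r \<rho> x + qq r \<rho> x) + (pp r \<rho> x - qq r \<rho> x)\<^sup>2"
  using r pp_nonneg qq_nonneg by simp

lemma ss_ge: "\<bar>pp r \<rho> x - qq r \<rho> x\<bar> \<le> ss r \<rho> x"
  unfolding ss_def using r pp_nonneg qq_nonneg
  by (intro real_le_rsqrt) simp

lemma ss_square: "(ss r \<rho> x)\<^sup>2 = r\<^sup>2 + 2 * r * (pp r \<rho> x + qq r \<rho> x) + (pp r \<rho> x - qq r \<rho> x)\<^sup>2"
  unfolding ss_def by (rule real_sqrt_pow2[OF radicand_nonneg])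

lemma circle_mean_ge: "pp r \<rho> x \<le> circle_mean r \<rho> x" "qq r \<rho> x \<le> circle_mean r \<rho> x"
  using ss_ge r unfolding circle_mean_def by (auto simp: field_simps)

text \<open>Both claims reduce to r + (p - q) <= s and its mirror image, where s^2 exceeds the
  square of the left side by 4 r q, respectively 4 r p.\<close>

lemma circle_mean_le_ss: "circle_mean r \<rho> x - qq r \<rho> x \<le> ss r \<rho> x" "circle_mean r \<rho> x - pp r \<rho> x \<le> ss r \<rho> x"
proof -
  have s2: "(r + (pp r \<rho> x - qq r \<rho> x))\<^sup>2 \<le> (ss r \<rho> x)\<^sup>2" "(r + (qq r \<rho> x - pp r \<rho> x))\<^sup>2 \<le> (ss r \<rho> x)\<^sup>2"
    unfolding ss_square using r pp_nonneg qq_nonneg by (auto simp: power2_eq_square algebra_simps)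
  have s0: "0 \<le> ss r \<rho> x" using ss_ge by linarith
  have "r + (pp r \<rho> x - qq r \<rho> x) \<le> ss r \<rho> x" "r + (qq r \<rho> x - pp r \<rho> x) \<le> ss r \<rho> x"
    using s2[THEN power2_le_imp_le] s0 by auto
  then show "circle_mean r \<rho> x - qq r \<rho> x \<le> ss r \<rho> x" "circle_mean r \<rho> x - pp r \<rho> x \<le> ss r \<rho> x"
    unfolding circle_mean_def by (auto simp: field_simps)
qed

text \<open>The point is uniformity in \<open>r\<close> and \<open>x\<close>. The two parts of the
  numerator enter with opposite signs, so they are bounded separately: (1 - r) x = p/\<rho> is at
  most m/\<rho>, and m - q <= s; likewise for the other part. A vanishing denominator makes the
  quotient 0.\<close>

lemma dlog_circle_mean_bound:
  assumes "0 < \<rho>" "\<rho> < 1"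
  shows "\<bar>dlog_circle_mean r \<rho> x\<bar> \<le> max (1 / \<rho>) (1 / (1 - \<rho>))"
proof -
  let ?m = "circle_mean r \<rho> x" and ?s = "ss r \<rho> x" and ?p = "pp r \<rho> x" and ?q = "qq r \<rho> x"
  have s0: "0 \<le> ?s" using ss_ge by linarith
  have m0: "0 \<le> ?m" using circle_mean_ge(1) pp_nonneg by linarith
  have pos: "0 < 1 / \<rho>" "0 < 1 / (1 - \<rho>)" using assms by auto
  show ?thesis
  proof (cases "?m * ?s = 0")
    case True
    then have "dlog_circle_mean r \<rho> x = 0" unfolding dlog_circle_mean_def by (simp only: div_by_0)
    then show ?thesis using pos by (simp add: max_def)
  next
    case False
    then have ms: "0 < ?m" "0 < ?s" using m0 s0 by (metis less_le mult_zero_left, metis less_le mult_zero_right)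
    have a: "(1 - r) * x * (?m - ?q) \<le> (1 / \<rho>) * (?m * ?s)"
    proof -
      have "(1 - r) * x = ?p / \<rho>" using assms by (simp add: pp_def)
      also have "\<dots> \<le> ?m / \<rho>" using assms circle_mean_ge(1) by (intro divide_right_mono) auto
      finally have "(1 - r) * x * (?m - ?q) \<le> ?m / \<rho> * ?s"
        using circle_mean_le_ss(1) circle_mean_ge(2) r x m0 assms by (intro mult_mono) auto
      then show ?thesis by simp
    qed
    have b: "(1 - r) * (1 - x) * (?m - ?p) \<le> (1 / (1 - \<rho>)) * (?m * ?s)"
    proof -
      have "(1 - r) * (1 - x) = ?q / (1 - \<rho>)" using assms by (simp add: qq_def)
      also have "\<dots> \<le> ?m / (1 - \<rho>)" using assms circle_mean_ge(2) by (intro divide_right_mono) auto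
      finally have "(1 - r) * (1 - x) * (?m - ?p) \<le> ?m / (1 - \<rho>) * ?s"
        using circle_mean_le_ss(2) circle_mean_ge(1) r x m0 assms by (intro mult_mono) auto
      then show ?thesis by simp
    qed
    have nn: "0 \<le> (1 - r) * x * (?m - ?q)" "0 \<le> (1 - r) * (1 - x) * (?m - ?p)"
      using circle_mean_ge r x by auto
    have "dlog_circle_mean r \<rho> x \<le> 1 / \<rho>" "- (1 / (1 - \<rho>)) \<le> dlog_circle_mean r \<rho> x"
      unfolding dlog_circle_mean_def pos_divide_le_eq[OF mult_pos_pos[OF ms]] pos_le_divide_eq[OF mult_pos_pos[OF ms]]
      using a b nn by simp_all
    then show ?thesis by (auto simp: abs_le_iff max_def)
  qed
qed

text \<open>The argument lies between x and 1. The resulting bound is integrable in x and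
  independent of \<open>r\<close>, which is what the limit r to 0 requires.\<close>

lemma ln_compression_bound:
  assumes "0 < x"
  shows "\<bar>ln (r + (1 - r) * x)\<bar> \<le> - ln x"
proof -
  have "x \<le> r + (1 - r) * x"
    using r x mult_nonneg_nonneg[of r "1 - x"] by (simp add: algebra_simps)
  moreover have "r + (1 - r) * x \<le> 1"
    using r x mult_nonneg_nonneg[of "1 - r" "1 - x"] by (simp add: algebra_simps)
  ultimately have "ln x \<le> ln (r + (1 - r) * x)" "ln (r + (1 - r) * x) \<le> 0"
    using assms by auto
  then show ?thesis by linarith
qed

end

text \<open>Positivity of \<open>r\<close> keeps the radicand of \<open>ss\<close> away from 0,
  where the square root is not differentiable.\<close>

lemma circle_mean_has_derivative:
  assumes r: "0 < r" "r \<le> 1" and \<rho>: "0 \<le> \<rho>" "\<rho> \<le> 1" and x: "0 \<le> x" "x \<le> 1"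
  shows "((\<lambda>\<rho>. ln (circle_mean r \<rho> x)) has_real_derivative dlog_circle_mean r \<rho> x) (at \<rho>)"
proof -
  note r' = less_imp_le[OF r(1)] r(2)
  let ?m = "circle_mean r \<rho> x" and ?s = "ss r \<rho> x" and ?p = "pp r \<rho> x" and ?q = "qq r \<rho> x"
  have rad: "0 < r\<^sup>2 + 2 * r * (?p + ?q) + (?p - ?q)\<^sup>2"
    using pp_nonneg[OF r' \<rho> x] qq_nonneg[OF r' \<rho> x] r by (intro add_pos_nonneg) auto
  have s: "0 < ?s" unfolding ss_def using rad by simp
  have m: "0 < ?m" unfolding circle_mean_def using s r pp_nonneg[OF r' \<rho> x] qq_nonneg[OF r' \<rho> x] by simp
  define p' where "p' = (1 - r) * x"
  define q' where "q' = - ((1 - r) * (1 - x))"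
  have dp: "((\<lambda>\<rho>. pp r \<rho> x) has_real_derivative p') (at \<rho>)"
    unfolding pp_def p'_def by (auto intro!: derivative_eq_intros)
  have dq: "((\<lambda>\<rho>. qq r \<rho> x) has_real_derivative q') (at \<rho>)"
    unfolding qq_def q'_def by (auto intro!: derivative_eq_intros)
  define R where "R = r * (p' + q') + (?p - ?q) * (p' - q')"
  have ds: "((\<lambda>\<rho>. ss r \<rho> x) has_real_derivative (R / ?s)) (at \<rho>)"
  proof -
    have "((\<lambda>\<rho>. r\<^sup>2 + 2 * r * (pp r \<rho> x + qq r \<rho> x) + (pp r \<rho> x - qq r \<rho> x)\<^sup>2) has_real_derivative 2 * R) (at \<rho>)"
      by (auto intro!: derivative_eq_intros dp dq simp: R_def algebra_simps)
    from DERIV_chain2[OF DERIV_real_sqrt[OF rad] this] show ?thesis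
      by (simp add: ss_def field_simps)
  qed
  have dm: "((\<lambda>\<rho>. circle_mean r \<rho> x) has_real_derivative ((p' + q' + R / ?s) / 2)) (at \<rho>)"
    unfolding circle_mean_def by (auto intro!: derivative_eq_intros dp dq ds)
  have "((\<lambda>\<rho>. ln (circle_mean r \<rho> x)) has_real_derivative (1 / ?m * ((p' + q' + R / ?s) / 2))) (at \<rho>)"
    by (rule DERIV_chain2[OF DERIV_ln_divide[OF m] dm])
  moreover have "1 / ?m * ((p' + q' + R / ?s) / 2) = dlog_circle_mean r \<rho> x"
  proof -
    define n where "n = p' * (?m - ?q) + q' * (?m - ?p)"
    \<comment> \<open>Expressing s through m turns the chain rule numerator into twice the numerator
      of \<open>dlog_circle_mean\<close>.\<close>
    have s2: "?s = 2 * ?m - (r + ?p + ?q)" unfolding circle_mean_def by argo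
    have e: "(p' + q') * ?s + R = 2 * n"
      unfolding s2 R_def n_def by (simp add: algebra_simps)
    have "p' + q' + R / ?s = ((p' + q') * ?s + R) / ?s"
      using s by (simp add: add_divide_distrib)
    then have "1 / ?m * ((p' + q' + R / ?s) / 2) = n / (?m * ?s)"
      unfolding e by simp
    also have "\<dots> = dlog_circle_mean r \<rho> x"
      by (simp add: dlog_circle_mean_def p'_def q'_def n_def)
    finally show ?thesis .
  qed
  ultimately show ?thesis by simp
qed

text \<open>The mean value theorem with the uniform derivative bound; on the interval from c to 1 -
  c both 1/\<rho> and 1/(1 - \<rho>) are at most 1/c. Independence of \<open>r\<close> lets one
  constant serve for every random matrix.\<close>

lemma ln_circle_mean_lipschitz:
  assumes r: "0 < r" "r \<le> 1" and x: "0 \<le> x" "x \<le> 1" and c: "0 < c" and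
    \<rho>: "\<rho>1 \<in> {c..1 - c}" "\<rho>2 \<in> {c..1 - c}"
  shows "\<bar>ln (circle_mean r \<rho>1 x) - ln (circle_mean r \<rho>2 x)\<bar> \<le> (1 / c) * \<bar>\<rho>1 - \<rho>2\<bar>"
proof -
  have "norm (ln (circle_mean r \<rho>1 x) - ln (circle_mean r \<rho>2 x)) \<le> (1 / c) * norm (\<rho>1 - \<rho>2)"
  proof (rule field_differentiable_bound[where f' = "\<lambda>\<rho>. dlog_circle_mean r \<rho> x" and S = "{c..1 - c}"])
    fix \<rho> assume h: "\<rho> \<in> {c..1 - c}"
    then show "((\<lambda>\<rho>. ln (circle_mean r \<rho> x)) has_field_derivative dlog_circle_mean r \<rho> x) (at \<rho> within {c..1 - c})"
      by (intro DERIV_subset[OF circle_mean_has_derivative[OF r _ _ x]]) (use c in auto)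
    have \<rho>': "0 < \<rho>" "\<rho> < 1" "c \<le> \<rho>" "c \<le> 1 - \<rho>" using h c by auto
    have "1 / \<rho> \<le> 1 / c" "1 / (1 - \<rho>) \<le> 1 / c"
      using \<rho>' c by (auto intro!: frac_le)
    moreover have "\<bar>dlog_circle_mean r \<rho> x\<bar> \<le> max (1 / \<rho>) (1 / (1 - \<rho>))"
      using r x \<rho>' by (intro dlog_circle_mean_bound) auto
    ultimately show "norm (dlog_circle_mean r \<rho> x) \<le> 1 / c"
      unfolding real_norm_def by (meson max.boundedI order_trans)
  qed (use \<rho> in auto)
  then show ?thesis by simp
qed

lemma circle_mean_measurable [measurable]: "(\<lambda>(r, x). circle_mean r \<rho> x) \<in> borel_measurable (borel \<Otimes>\<^sub>M borel)"
  unfolding circle_mean_def ss_def pp_def qq_def by measurable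

lemma dlog_circle_mean_measurable [measurable]: "(\<lambda>(r, x). dlog_circle_mean r \<rho> x) \<in> borel_measurable (borel \<Otimes>\<^sub>M borel)"
  unfolding dlog_circle_mean_def circle_mean_def ss_def pp_def qq_def by measurable

section \<open>The derivative as a function of the eigenvalue ratio and its limit\<close>

definition var_deriv :: "real \<Rightarrow> real \<Rightarrow> real" where
  "var_deriv \<rho> r = (\<integral>x. ln (r + (1 - r) * x) * dlog_circle_mean r \<rho> x \<partial>unif01)"

lemma ln_dlog_circle_mean_bound:
  assumes "0 \<le> r" "r \<le> 1" "0 < \<rho>" "\<rho> < 1" "0 < x" "x < 1"
  shows "\<bar>ln (r + (1 - r) * x) * dlog_circle_mean r \<rho> x\<bar> \<le> max (1 / \<rho>) (1 / (1 - \<rho>)) * (- ln x)"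
proof -
  have "\<bar>ln (r + (1 - r) * x)\<bar> * \<bar>dlog_circle_mean r \<rho> x\<bar> \<le> (- ln x) * max (1 / \<rho>) (1 / (1 - \<rho>))"
    using assms by (intro mult_mono ln_compression_bound dlog_circle_mean_bound) auto
  then show ?thesis by (simp add: abs_mult mult.commute)
qed

lemma var_deriv_bound:
  assumes "0 \<le> r" "r \<le> 1" "0 < \<rho>" "\<rho> < 1"
  shows "\<bar>var_deriv \<rho> r\<bar> \<le> max (1 / \<rho>) (1 / (1 - \<rho>))"
proof -
  let ?C = "max (1 / \<rho>) (1 / (1 - \<rho>))"
  have b: "has_bochner_integral unif01 (\<lambda>x. ?C * (- ln x)) (?C * 1)"
    by (intro has_bochner_integral_mult_right unif01_ln)
  have "norm (var_deriv \<rho> r) \<le> (\<integral>x. ?C * (- ln x) \<partial>unif01)"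
  proof -
    have i: "integrable unif01 (\<lambda>x. ?C * (- ln x))" using b by (simp only: has_bochner_integral_iff)
    have ae: "AE x in unif01. norm (ln (r + (1 - r) * x) * dlog_circle_mean r \<rho> x) \<le> ?C * (- ln x)"
      using AE_unif01
    proof eventually_elim
      case (elim x)
      then show ?case using ln_dlog_circle_mean_bound[of r \<rho> x] assms by simp
    qed
    have m: "(\<lambda>x. ln (r + (1 - r) * x) * dlog_circle_mean r \<rho> x) \<in> borel_measurable unif01"
      by measurable
    have i2: "integrable unif01 (\<lambda>x. ln (r + (1 - r) * x) * dlog_circle_mean r \<rho> x)"
      by (rule Bochner_Integration.integrable_bound[OF i m]) (use ae in \<open>auto elim!: eventually_mono\<close>)
    have "norm (var_deriv \<rho> r) \<le> (\<integral>x. norm (ln (r + (1 - r) * x) * dlog_circle_mean r \<rho> x) \<partial>unif01)"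
      unfolding var_deriv_def by (rule integral_norm_bound)
    also have "\<dots> \<le> (\<integral>x. ?C * (- ln x) \<partial>unif01)"
      by (rule integral_mono_AE[OF integrable_norm[OF i2] i ae])
    finally show ?thesis .
  qed
  then show ?thesis using b by (simp add: has_bochner_integral_iff)
qed

text \<open>At r = 0 the square root becomes |p - q| and the circle mean the maximum of p = x \<rho>
  and q = (1 - x)(1 - \<rho>). Since p - q = x - (1 - \<rho>), the maximum is p or q according to
  the side of 1 - \<rho>, and its logarithmic derivative in \<rho> is 1/\<rho> or -1/(1 -
  \<rho>).\<close>

lemma dlog_circle_mean_tendsto:
  assumes "0 < \<rho>" "\<rho> < 1" "0 < x" "x < 1" "x \<noteq> 1 - \<rho>"
  shows "((\<lambda>r. dlog_circle_mean r \<rho> x) \<longlongrightarrow> (if x > 1 - \<rho> then 1 / \<rho> else - 1 / (1 - \<rho>))) (at_right 0)"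
proof -
  let ?p = "x * \<rho>" and ?q = "(1 - x) * (1 - \<rho>)"
  have pq: "?p - ?q = x - (1 - \<rho>)" by (simp add: algebra_simps)
  then have ne: "?p - ?q \<noteq> 0" using assms by simp
  have pos: "0 < ?p" "0 < ?q" using assms by auto
  have s: "((\<lambda>r. ss r \<rho> x) \<longlongrightarrow> sqrt (0\<^sup>2 + 2 * 0 * ((1 - 0) * x * \<rho> + (1 - 0) * (1 - x) * (1 - \<rho>)) + ((1 - 0) * x * \<rho> - (1 - 0) * (1 - x) * (1 - \<rho>))\<^sup>2)) (at_right 0)"
    unfolding ss_def pp_def qq_def by (intro tendsto_intros)
  then have s: "((\<lambda>r. ss r \<rho> x) \<longlongrightarrow> \<bar>?p - ?q\<bar>) (at_right 0)"
    by simp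
  have p: "((\<lambda>r. pp r \<rho> x) \<longlongrightarrow> ?p) (at_right 0)"
    unfolding pp_def by (auto intro!: tendsto_eq_intros)
  have q: "((\<lambda>r. qq r \<rho> x) \<longlongrightarrow> ?q) (at_right 0)"
    unfolding qq_def by (auto intro!: tendsto_eq_intros)
  have m: "((\<lambda>r. circle_mean r \<rho> x) \<longlongrightarrow> max ?p ?q) (at_right 0)"
  proof -
    have "((\<lambda>r. (r + pp r \<rho> x + qq r \<rho> x + ss r \<rho> x) / 2) \<longlongrightarrow> (0 + ?p + ?q + \<bar>?p - ?q\<bar>) / 2) (at_right 0)"
      by (intro tendsto_intros p q s) simp
    moreover have "(0 + P + Q + \<bar>P - Q\<bar>) / 2 = max P Q" for P Q :: real
      by (simp add: max_def abs_if)
    ultimately show ?thesis unfolding circle_mean_def by simp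
  qed
  have "((\<lambda>r. dlog_circle_mean r \<rho> x) \<longlongrightarrow> ((1 - 0) * x * (max ?p ?q - ?q) - (1 - 0) * (1 - x) * (max ?p ?q - ?p))
     / (max ?p ?q * \<bar>?p - ?q\<bar>)) (at_right 0)"
    unfolding dlog_circle_mean_def by (intro tendsto_intros m s p q) (use pos ne in \<open>auto simp: max_def\<close>)
  moreover have "((1 - 0) * x * (max ?p ?q - ?q) - (1 - 0) * (1 - x) * (max ?p ?q - ?p))
     / (max ?p ?q * \<bar>?p - ?q\<bar>) = (if x > 1 - \<rho> then 1 / \<rho> else - 1 / (1 - \<rho>))"
  proof (cases "x > 1 - \<rho>")
    case True
    then have a: "\<bar>?p - ?q\<bar> = ?p - ?q" "max ?p ?q = ?p" using pq by auto
    have "x * (?p - ?q) / (?p * (?p - ?q)) = x / ?p"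
      using ne by (rule nonzero_mult_divide_mult_cancel_right)
    also have "\<dots> = 1 / \<rho>" using assms by simp
    finally show ?thesis unfolding a using True by simp
  next
    case False
    then have a: "\<bar>?p - ?q\<bar> = ?q - ?p" "max ?p ?q = ?q" using pq by auto
    have "(1 - x) * (?q - ?p) / (?q * (?q - ?p)) = (1 - x) / ?q"
      using ne by (intro nonzero_mult_divide_mult_cancel_right) simp
    also have "\<dots> = 1 / (1 - \<rho>)" using assms by simp
    finally show ?thesis unfolding a using False by simp
  qed
  ultimately show ?thesis by simp
qed

text \<open>With L = ln (1 - \<rho>), the antiderivative x ln x - x gives 1 - L on the left of 1 -
  \<rho> and -1 - (1 - \<rho>) L/\<rho> on the right.\<close>

lemma limit_integral:
  assumes "0 < \<rho>" "\<rho> < 1"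
  shows "(\<integral>x. ln x * (if x > 1 - \<rho> then 1 / \<rho> else - 1 / (1 - \<rho>)) \<partial>unif01) = - ln (1 - \<rho>) / \<rho>"
proof -
  let ?f = "\<lambda>x. ln x * (if x > 1 - \<rho> then 1 / \<rho> else - 1 / (1 - \<rho>))"
  let ?C = "max (1 / \<rho>) (1 / (1 - \<rho>))"
  have i1: "(?f has_integral ((1 - \<rho>) * ln (1 - \<rho>) - (1 - \<rho>) - (0 * ln 0 - 0)) * (- 1 / (1 - \<rho>))) {0..1 - \<rho>}"
    by (rule has_integral_eq[OF _ has_integral_mult_left[OF has_integral_ln]]) (use assms in auto)
  have i2: "(?f has_integral (1 * ln 1 - 1 - ((1 - \<rho>) * ln (1 - \<rho>) - (1 - \<rho>))) * (1 / \<rho>)) {1 - \<rho>..1}"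
    by (rule has_integral_spike_finite[OF _ _ has_integral_mult_left[OF has_integral_ln], of "{1 - \<rho>}"]) (use assms in auto)
  have hi: "(?f has_integral (- ln (1 - \<rho>) / \<rho>)) {0..1}"
  proof (rule has_integral_eq_rhs[OF has_integral_combine[OF _ _ i1 i2]])
    show "- ln (1 - \<rho>) / \<rho> = ((1 - \<rho>) * ln (1 - \<rho>) - (1 - \<rho>) - (0 * ln 0 - 0)) * (- 1 / (1 - \<rho>))
      + (1 * ln 1 - 1 - ((1 - \<rho>) * ln (1 - \<rho>) - (1 - \<rho>))) * (1 / \<rho>)"
      using assms by (simp add: field_simps)
  qed (use assms in auto)
  have "set_integrable lebesgue {0..1} ?f"
  proof (rule set_integrable_bound)
    have "(\<lambda>x::real. - ln x) absolutely_integrable_on {0..1}"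
    proof (rule nonnegative_absolutely_integrable_1)
      show "(\<lambda>x::real. - ln x) integrable_on {0..1}"
        using has_integral_neg[OF has_integral_ln[of 0 1]] by (auto simp: integrable_on_def)
      show "0 \<le> - ln x" if "x \<in> {0..1::real}" for x
        using that by (cases "x = 0") auto
    qed
    from set_integrable_mult_right[OF this] show "set_integrable lebesgue {0..1} (\<lambda>x::real. ?C * - ln x)" by simp
    show "set_borel_measurable lebesgue {0..1} ?f"
      unfolding set_borel_measurable_def by (rule measurable_completion) measurable
    have "norm (?f x) \<le> norm (?C * - ln x)" for x
    proof -
      let ?w = "if x > 1 - \<rho> then 1 / \<rho> else - 1 / (1 - \<rho>)"
      have "\<bar>?w\<bar> \<le> \<bar>?C\<bar>" using assms by auto
      then have "\<bar>?w\<bar> * \<bar>ln x\<bar> \<le> \<bar>?C\<bar> * \<bar>ln x\<bar>" by (rule mult_right_mono) simp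
      then show ?thesis
        unfolding real_norm_def abs_mult abs_minus_cancel by (simp only: mult.commute)
    qed
    then show "AE x in lebesgue. x \<in> {0..1} \<longrightarrow> norm (?f x) \<le> norm (?C * - ln x)"
      by simp
  qed
  from has_bochner_integral_unif01[OF hi this] show ?thesis
    by (simp add: has_bochner_integral_iff)
qed

text \<open>Dominated convergence along sequences, with a multiple of -ln x as majorant; the
  breakpoint 1 - \<rho> is a null set.\<close>

lemma var_deriv_tendsto:
  assumes "0 < \<rho>" "\<rho> < 1"
  shows "((\<lambda>r. var_deriv \<rho> r) \<longlongrightarrow> - ln (1 - \<rho>) / \<rho>) (at_right 0)"
proof (rule tendsto_at_right_sequentially[of 0 1])
  fix S :: "nat \<Rightarrow> real"
  assume S: "\<And>n. 0 < S n" "\<And>n. S n < 1" "S \<longlonglongrightarrow> 0"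
  then have Sf: "filterlim S (at_right 0) sequentially"
    unfolding filterlim_at using S(3) by (auto intro!: always_eventually simp: S(1) less_imp_neq[OF S(1), symmetric])
  let ?C = "max (1 / \<rho>) (1 / (1 - \<rho>))"
  have "(\<lambda>n. \<integral>x. ln (S n + (1 - S n) * x) * dlog_circle_mean (S n) \<rho> x \<partial>unif01)
     \<longlonglongrightarrow> (\<integral>x. ln x * (if x > 1 - \<rho> then 1 / \<rho> else - 1 / (1 - \<rho>)) \<partial>unif01)"
  proof (rule integral_dominated_convergence)
    show "integrable unif01 (\<lambda>x. ?C * (- ln x))"
      using unif01_ln by (auto simp: has_bochner_integral_iff intro!: integrable_mult_right)
    have "AE x in unif01. x \<noteq> 1 - \<rho>"
      unfolding unif01_def using AE_lborel_singleton[of "1 - \<rho>"]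
      by (subst AE_density) (auto elim!: eventually_mono)
    then show "AE x in unif01. (\<lambda>n. ln (S n + (1 - S n) * x) * dlog_circle_mean (S n) \<rho> x)
        \<longlonglongrightarrow> ln x * (if x > 1 - \<rho> then 1 / \<rho> else - 1 / (1 - \<rho>))"
      using AE_unif01
    proof eventually_elim
      case (elim x)
      have "(\<lambda>n. dlog_circle_mean (S n) \<rho> x) \<longlonglongrightarrow> (if x > 1 - \<rho> then 1 / \<rho> else - 1 / (1 - \<rho>))"
        using elim assms by (intro filterlim_compose[OF dlog_circle_mean_tendsto Sf]) auto
      moreover have "(\<lambda>n. ln (S n + (1 - S n) * x)) \<longlonglongrightarrow> ln (0 + (1 - 0) * x)"
        using elim by (intro tendsto_intros S(3)) auto
      ultimately show ?case
        by (intro tendsto_mult) auto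
    qed
    show "AE x in unif01. norm (ln (S n + (1 - S n) * x) * dlog_circle_mean (S n) \<rho> x) \<le> ?C * (- ln x)" for n
      using AE_unif01
    proof eventually_elim
      case (elim x)
      then show ?case
        using ln_dlog_circle_mean_bound[of "S n" \<rho> x] assms S(1,2)[of n] by simp
    qed
  qed measurable
  then show "(\<lambda>n. var_deriv \<rho> (S n)) \<longlonglongrightarrow> - ln (1 - \<rho>) / \<rho>"
    by (simp add: var_deriv_def limit_integral[OF assms])
qed simp

section \<open>Invariance of Lebesgue measure under linear isometries\<close>

lemma emeasure_distr_nn_integral:
  assumes "f \<in> M \<rightarrow>\<^sub>M N" "A \<in> sets N"
  shows "emeasure (distr M N f) A = (\<integral>\<^sup>+x. indicator A (f x) \<partial>M)"
proof -
  have "emeasure (distr M N f) A = (\<integral>\<^sup>+y. indicator A y \<partial>distr M N f)"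
    using assms(2) by simp
  also have "\<dots> = (\<integral>\<^sup>+x. indicator A (f x) \<partial>M)"
    using assms by (intro nn_integral_distr) auto
  finally show ?thesis .
qed

text \<open>With \<open>f\<close> radial, two translations and Fubini turn
  \<open>(\<integral> f) (\<integral> g (V y)) = \<integral>\<integral> f x g (V y) = \<integral>\<integral> f x g (V y + x)\<close> into \<open>\<integral>\<integral> f (x - V y) g x = (\<integral> f) (\<integral> g)\<close>.\<close>

lemma nn_integral_isometry_invariant:
  fixes M :: "'a measure" and V V' :: "'a \<Rightarrow> 'a" and add sub :: "'a \<Rightarrow> 'a \<Rightarrow> 'a" and f g :: "'a \<Rightarrow> ennreal"
  assumes sf: "sigma_finite_measure M"
    and V: "V \<in> M \<rightarrow>\<^sub>M M" and V': "V' \<in> M \<rightarrow>\<^sub>M M"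
    and add: "(\<lambda>(x, y). add x y) \<in> M \<Otimes>\<^sub>M M \<rightarrow>\<^sub>M M" and sub: "(\<lambda>(x, y). sub x y) \<in> M \<Otimes>\<^sub>M M \<rightarrow>\<^sub>M M"
    and f: "f \<in> borel_measurable M" and g: "g \<in> borel_measurable M"
    and add_inv: "\<And>h x. h \<in> borel_measurable M \<Longrightarrow> x \<in> space M \<Longrightarrow> (\<integral>\<^sup>+y. h (add y x) \<partial>M) = (\<integral>\<^sup>+y. h y \<partial>M)"
    and sub_inv: "\<And>h x. h \<in> borel_measurable M \<Longrightarrow> x \<in> space M \<Longrightarrow> (\<integral>\<^sup>+y. h (sub y x) \<partial>M) = (\<integral>\<^sup>+y. h y \<partial>M)"
    and V_add: "\<And>x y. x \<in> space M \<Longrightarrow> y \<in> space M \<Longrightarrow> V (add y (V' x)) = add (V y) x"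
    and add_sub: "\<And>x v. x \<in> space M \<Longrightarrow> v \<in> space M \<Longrightarrow> add v (sub x v) = x"
    and f_sym: "\<And>x y. x \<in> space M \<Longrightarrow> y \<in> space M \<Longrightarrow> f (sub x (V y)) = f (sub y (V' x))"
    and f_pos: "(\<integral>\<^sup>+x. f x \<partial>M) \<noteq> 0" and f_fin: "(\<integral>\<^sup>+x. f x \<partial>M) \<noteq> \<infinity>"
  shows "(\<integral>\<^sup>+y. g (V y) \<partial>M) = (\<integral>\<^sup>+y. g y \<partial>M)"
proof -
  interpret sigma_finite_measure M by (rule sf)
  interpret pair_sigma_finite M M ..
  let ?c = "\<integral>\<^sup>+x. f x \<partial>M"
  have Vs: "y \<in> space M \<Longrightarrow> V y \<in> space M" "y \<in> space M \<Longrightarrow> V' y \<in> space M" for y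
    using measurable_space[OF V] measurable_space[OF V'] by auto
  have addm: "(\<lambda>x. add (u x) (v x)) \<in> N \<rightarrow>\<^sub>M M" if "u \<in> N \<rightarrow>\<^sub>M M" "v \<in> N \<rightarrow>\<^sub>M M" for u v and N :: "('a \<times> 'a) measure"
    using measurable_compose[OF measurable_Pair[OF that] add] by simp
  have addm1: "(\<lambda>x. add v x) \<in> M \<rightarrow>\<^sub>M M" "(\<lambda>x. sub x v) \<in> M \<rightarrow>\<^sub>M M" if "v \<in> space M" for v
    using measurable_compose[OF measurable_Pair1'[OF that] add] measurable_compose[OF measurable_Pair2'[OF that] sub] by simp_all
  have subm: "(\<lambda>x. sub (u x) (v x)) \<in> N \<rightarrow>\<^sub>M M" if "u \<in> N \<rightarrow>\<^sub>M M" "v \<in> N \<rightarrow>\<^sub>M M" for u v and N :: "('a \<times> 'a) measure"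
    using measurable_compose[OF measurable_Pair[OF that] sub] by simp
  note gV = measurable_compose[OF V g]
  have "?c * (\<integral>\<^sup>+y. g (V y) \<partial>M) = (\<integral>\<^sup>+x. f x * (\<integral>\<^sup>+y. g (V y) \<partial>M) \<partial>M)"
    by (rule nn_integral_multc[symmetric]) (rule f)
  also have "\<dots> = (\<integral>\<^sup>+x. \<integral>\<^sup>+y. f x * g (add (V y) x) \<partial>M \<partial>M)"
  proof (rule nn_integral_cong)
    fix x assume x: "x \<in> space M"
    have "(\<integral>\<^sup>+y. g (V y) \<partial>M) = (\<integral>\<^sup>+y. g (V (add y (V' x))) \<partial>M)"
      by (rule add_inv[symmetric, OF gV Vs(2)[OF x]])
    also have "\<dots> = (\<integral>\<^sup>+y. g (add (V y) x) \<partial>M)"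
      by (intro nn_integral_cong) (simp add: V_add x)
    finally have e: "(\<integral>\<^sup>+y. g (V y) \<partial>M) = (\<integral>\<^sup>+y. g (add (V y) x) \<partial>M)" .
    have "(\<lambda>y. g (add (V y) x)) \<in> borel_measurable M"
      using measurable_compose[OF V measurable_compose[OF measurable_compose[OF measurable_Pair2'[OF x] add] g]] by simp
    then show "f x * (\<integral>\<^sup>+y. g (V y) \<partial>M) = (\<integral>\<^sup>+y. f x * g (add (V y) x) \<partial>M)"
      unfolding e by (rule nn_integral_cmult[symmetric])
  qed
  also have "\<dots> = (\<integral>\<^sup>+y. \<integral>\<^sup>+x. f x * g (add (V y) x) \<partial>M \<partial>M)"
    by (rule Fubini'[symmetric])
      (unfold split_beta', intro borel_measurable_times_ennreal measurable_compose[OF _ f] measurable_compose[OF addm g]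
        measurable_fst measurable_compose[OF measurable_snd V])
  also have "\<dots> = (\<integral>\<^sup>+y. \<integral>\<^sup>+x. f (sub x (V y)) * g x \<partial>M \<partial>M)"
  proof (rule nn_integral_cong)
    fix y assume y: "y \<in> space M"
    let ?h = "\<lambda>x. f x * g (add (V y) x)"
    have "?h \<in> borel_measurable M"
      by (intro borel_measurable_times_ennreal f measurable_compose[OF addm1(1) g] Vs y)
    from sub_inv[OF this Vs(1)[OF y], symmetric]
    show "(\<integral>\<^sup>+x. f x * g (add (V y) x) \<partial>M) = (\<integral>\<^sup>+x. f (sub x (V y)) * g x \<partial>M)"
      by (simp add: add_sub Vs y cong: nn_integral_cong)
  qed
  also have "\<dots> = (\<integral>\<^sup>+x. \<integral>\<^sup>+y. f (sub x (V y)) * g x \<partial>M \<partial>M)"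
    by (rule Fubini')
      (unfold split_beta', intro borel_measurable_times_ennreal measurable_compose[OF _ g] measurable_compose[OF subm f]
        measurable_fst measurable_compose[OF measurable_snd V])
  also have "\<dots> = (\<integral>\<^sup>+x. ?c * g x \<partial>M)"
  proof (rule nn_integral_cong)
    fix x assume x: "x \<in> space M"
    have "(\<integral>\<^sup>+y. f (sub x (V y)) * g x \<partial>M) = (\<integral>\<^sup>+y. f (sub y (V' x)) * g x \<partial>M)"
      by (intro nn_integral_cong) (simp add: f_sym x)
    also have "\<dots> = (\<integral>\<^sup>+y. f (sub y (V' x)) \<partial>M) * g x"
      by (intro nn_integral_multc measurable_compose[OF addm1(2) f] Vs x)
    also have "(\<integral>\<^sup>+y. f (sub y (V' x)) \<partial>M) = ?c"
      by (intro sub_inv f Vs x)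
    finally show "(\<integral>\<^sup>+y. f (sub x (V y)) * g x \<partial>M) = ?c * g x" .
  qed
  also have "\<dots> = ?c * (\<integral>\<^sup>+x. g x \<partial>M)"
    by (rule nn_integral_cmult) (rule g)
  finally show ?thesis
    using f_pos f_fin by (simp add: ennreal_mult_cancel_left)
qed

lemma nn_integral_lborel_translate:
  fixes c :: "'a::euclidean_space"
  assumes "f \<in> borel_measurable borel"
  shows "(\<integral>\<^sup>+x. f (x + c) \<partial>lborel) = (\<integral>\<^sup>+x. f x \<partial>lborel)"
proof -
  have "(\<integral>\<^sup>+x. f x \<partial>distr lborel borel ((+) c)) = (\<integral>\<^sup>+x. f (c + x) \<partial>lborel)"
    using assms by (intro nn_integral_distr) auto
  then show ?thesis by (simp add: lborel_distr_plus add.commute)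
qed

text \<open>Here the radial function is the indicator of the unit ball, of positive finite volume;
  that x - V y and y - V' x have the same norm is the isometry property.\<close>

lemma nn_integral_lborel_isometry:
  fixes V :: "'a::euclidean_space \<Rightarrow> 'a"
  assumes lin: "linear V" and nrm: "\<And>x. norm (V x) = norm x" and g: "g \<in> borel_measurable borel"
  shows "(\<integral>\<^sup>+x. g (V x) \<partial>lborel) = (\<integral>\<^sup>+x. g x \<partial>lborel)"
proof -
  have "inj V"
    using linear_injective_0[OF lin] nrm by (metis norm_eq_zero)
  then obtain V' where V': "linear V'" "\<And>x. V' (V x) = x" "\<And>x. V (V' x) = x"
    using linear_injective_isomorphism[OF lin] by blast
  have m: "V \<in> borel_measurable borel" "V' \<in> borel_measurable borel"
    using lin V'(1) by (auto intro!: borel_measurable_continuous_onI linear_continuous_on linear_conv_bounded_linear[THEN iffD1])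
  have n': "norm (x - V y) = norm (y - V' x)" for x y
  proof -
    have "norm (y - V' x) = norm (V (y - V' x))" by (simp add: nrm)
    also have "\<dots> = norm (V y - x)" by (simp add: linear_diff[OF lin] V'(3))
    finally show ?thesis by (simp add: norm_minus_commute)
  qed
  show ?thesis
  proof (rule nn_integral_isometry_invariant[where V' = V' and add = "(+)" and sub = "(-)" and f = "indicator (ball 0 1)"])
    show "(\<integral>\<^sup>+y. h (y + x) \<partial>lborel) = (\<integral>\<^sup>+y. h y \<partial>lborel)" if "h \<in> borel_measurable lborel" for h and x :: 'a
      using that by (intro nn_integral_lborel_translate) simp
    show "(\<integral>\<^sup>+y. h (y - x) \<partial>lborel) = (\<integral>\<^sup>+y. h y \<partial>lborel)" if "h \<in> borel_measurable lborel" for h and x :: 'a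
      using nn_integral_lborel_translate[of h "- x"] that by simp
    show "V (y + V' x) = V y + x" for x y by (simp add: linear_add[OF lin] V'(3))
    show "indicator (ball 0 1) (x - V y) = (indicator (ball 0 1) (y - V' x) :: ennreal)" for x y
      by (simp only: indicator_def mem_ball_0 n')
    have "emeasure lborel (ball (0::'a) 1) \<noteq> 0"
      using open_not_negligible[of "ball (0::'a) 1"] by (auto simp: negligible_iff_null_sets null_sets_def)
    then show "(\<integral>\<^sup>+x. indicator (ball (0::'a) 1) x \<partial>lborel) \<noteq> 0" by simp
    show "(\<integral>\<^sup>+x. indicator (ball (0::'a) 1) x \<partial>lborel) \<noteq> \<infinity>"
      using emeasure_lborel_ball_finite[of "0::'a" 1] by simp
    show "indicator (ball 0 1) \<in> borel_measurable (lborel :: 'a measure)"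
      by (rule borel_measurable_indicator) simp
  qed (use m g lborel.sigma_finite_measure_axioms in \<open>auto simp: measurable_lborel1 space_borel split_beta\<close>)
qed

subsection \<open>The uniform distribution on the unit sphere of \<open>\<complex>\<^sup>2\<close>\<close>

lemma borel_measurable_fst_snd [measurable]:
  "(fst :: 'a::euclidean_space \<times> 'b::euclidean_space \<Rightarrow> 'a) \<in> borel_measurable borel"
  "(snd :: 'a::euclidean_space \<times> 'b::euclidean_space \<Rightarrow> 'b) \<in> borel_measurable borel"
  by (auto intro!: borel_measurable_continuous_onI continuous_intros)

text \<open>The disc of squared radius \<open>a\<close> has area \<pi> a. The measures are infinite
  but agree on the half-lines, which form an intersection-stable generator and exhaust the line with
  finite mass.\<close>

lemma distr_cmod_square: "distr (lborel :: complex measure) borel (\<lambda>z. (cmod z)\<^sup>2) = density lborel (\<lambda>u. ennreal (pi * indicator {0..} u))"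
proof (rule measure_eqI_generator_eq[where E = "range (\<lambda>a::real. {..a})" and \<Omega> = UNIV and A = "\<lambda>i. {..real i}"])
  have L: "emeasure (distr (lborel :: complex measure) borel (\<lambda>z. (cmod z)\<^sup>2)) {..a} = ennreal (pi * max 0 a)" for a
  proof -
    have "(cmod z)\<^sup>2 \<le> a \<longleftrightarrow> cmod z \<le> sqrt a" if "0 \<le> a" for z
      using that by (metis norm_ge_zero real_sqrt_ge_0_iff real_sqrt_le_iff real_sqrt_pow2 real_sqrt_unique)
    moreover have "\<not> (cmod z)\<^sup>2 \<le> a" if "a < 0" for z
      using that zero_le_power2[of "cmod z"] by linarith
    ultimately have "(\<lambda>z. (cmod z)\<^sup>2) -` {..a} = (if a < 0 then {} else cball 0 (sqrt a))"
      by (auto simp: mem_cball_0)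
    then have "emeasure (distr (lborel :: complex measure) borel (\<lambda>z. (cmod z)\<^sup>2)) {..a}
        = (if a < 0 then 0 else emeasure lborel (cball (0::complex) (sqrt a)))"
      by (subst emeasure_distr) auto
    then show ?thesis
      by (simp add: emeasure_cball unit_ball_vol_2 mult.commute max_def)
  qed
  have R: "emeasure (density lborel (\<lambda>u. ennreal (pi * indicator {0..} u))) {..a} = ennreal (pi * max 0 a)" for a
  proof -
    have "emeasure (density lborel (\<lambda>u. ennreal (pi * indicator {0..} u))) {..a} = (\<integral>\<^sup>+u. ennreal (pi * indicator {0..} u) * indicator {..a} u \<partial>lborel)"
      by (rule emeasure_density) auto
    also have "\<dots> = (\<integral>\<^sup>+u. ennreal pi * indicator {0..a} u \<partial>lborel)"
      by (intro nn_integral_cong) (auto split: split_indicator)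
    also have "\<dots> = ennreal pi * emeasure lborel {0..a}"
      by (rule nn_integral_cmult_indicator) simp
    also have "\<dots> = ennreal (pi * max 0 a)"
      by (cases "0 \<le> a") (auto simp: ennreal_mult'[symmetric])
    finally show ?thesis .
  qed
  show "emeasure (distr lborel borel (\<lambda>z::complex. (cmod z)\<^sup>2)) X = emeasure (density lborel (\<lambda>u. ennreal (pi * indicator {0..} u))) X"
    if "X \<in> range (\<lambda>a::real. {..a})" for X
    using that L R by auto
  show "emeasure (distr lborel borel (\<lambda>z::complex. (cmod z)\<^sup>2)) {..real i} \<noteq> \<infinity>" for i
    by (simp add: L)
  show "Int_stable (range (\<lambda>a::real. {..a}))"
    by (auto simp: Int_stable_def intro: range_eqI[of _ _ "min _ _"])
qed (auto simp: borel_eq_atMost real_arch_simple intro: sigma_sets.Basic)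

lemma nn_integral_cmod_square:
  assumes [measurable]: "h \<in> borel_measurable borel"
  shows "(\<integral>\<^sup>+z. h ((cmod z)\<^sup>2) \<partial>lborel) = (\<integral>\<^sup>+u. ennreal (pi * indicator {0..} u) * h u \<partial>lborel)"
proof -
  have "(\<integral>\<^sup>+z. h ((cmod z)\<^sup>2) \<partial>lborel) = (\<integral>\<^sup>+u. h u \<partial>distr lborel borel (\<lambda>z. (cmod z)\<^sup>2))"
    by (rule nn_integral_distr[symmetric]) auto
  also have "\<dots> = (\<integral>\<^sup>+u. ennreal (pi * indicator {0..} u) * h u \<partial>lborel)"
    unfolding distr_cmod_square by (rule nn_integral_density) auto
  finally show ?thesis .
qed

lemma nn_integral_exp_tail:
  assumes "0 < a"
  shows "(\<integral>\<^sup>+u. ennreal (exp (- a * u)) * indicator {b..} u \<partial>lborel) = ennreal (exp (- a * b) / a)"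
proof -
  have "(\<integral>\<^sup>+u. ennreal (exp (- a * u)) * indicator {b..} u \<partial>lborel) = 0 - (- exp (- a * b) / a)"
  proof (rule nn_integral_FTC_atLeast)
    show "((\<lambda>u. - exp (- a * u) / a) has_real_derivative exp (- a * u)) (at u)" for u
      using assms by (auto intro!: derivative_eq_intros)
    show "((\<lambda>u. - exp (- a * u) / a) \<longlongrightarrow> 0) at_top"
      using assms by real_asymp
  qed auto
  then show ?thesis by simp
qed

definition sphere_gauss :: "complex \<times> complex \<Rightarrow> real" where
  "sphere_gauss p = exp (- (norm p)\<^sup>2) / pi\<^sup>2"

text \<open>The direction of a standard Gaussian vector in C^2. Rotation invariance is inherited
  from Lebesgue measure, and the coordinates become independent exponentials after squaring. The
  origin, sent to itself since the inverse of 0 is 0, is null.\<close>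

definition sph :: "(complex \<times> complex) measure" where
  "sph = distr (density lborel sphere_gauss) borel (\<lambda>p. p /\<^sub>R norm p)"

lemma sphere_gauss_measurable [measurable]: "sphere_gauss \<in> borel_measurable borel"
  unfolding sphere_gauss_def by measurable

lemma sets_sph [simp, measurable_cong]: "sets sph = sets borel"
  by (simp add: sph_def)

lemma space_sph [simp]: "space sph = UNIV"
  by (simp add: sph_def)

lemma nn_integral_sph:
  assumes [measurable]: "h \<in> borel_measurable borel"
  shows "(\<integral>\<^sup>+p. h p \<partial>sph) = (\<integral>\<^sup>+p. ennreal (sphere_gauss p) * h (p /\<^sub>R norm p) \<partial>lborel)"
  unfolding sph_def by (subst nn_integral_distr) (auto intro!: nn_integral_density)

text \<open>The squared moduli s and t of the two Gaussian coordinates are independent standard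
  exponentials, and normalizing turns the first into s/(s + t).\<close>

lemma nn_integral_sph_fst:
  assumes [measurable]: "h \<in> borel_measurable borel"
  shows "(\<integral>\<^sup>+p. h ((cmod (fst p))\<^sup>2) \<partial>sph)
     = (\<integral>\<^sup>+t. (\<integral>\<^sup>+s. h (s / (s + t)) * (ennreal (exp (- s)) * indicator {0..} s) \<partial>lborel) * (ennreal (exp (- t)) * indicator {0..} t) \<partial>lborel)"
proof -
  have n2: "(norm (z, w))\<^sup>2 = (cmod z)\<^sup>2 + (cmod w)\<^sup>2" for z w :: complex
    by (simp add: norm_Pair)
  have sc: "(cmod (z /\<^sub>R n))\<^sup>2 = (cmod z)\<^sup>2 / n\<^sup>2" for z n
    by (simp add: power_mult_distrib power_inverse divide_inverse mult.commute)
  have "(\<integral>\<^sup>+p. h ((cmod (fst p))\<^sup>2) \<partial>sph)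
      = (\<integral>\<^sup>+p. ennreal (sphere_gauss p) * h ((cmod (fst (p /\<^sub>R norm p)))\<^sup>2) \<partial>(lborel \<Otimes>\<^sub>M lborel))"
    unfolding lborel_prod by (rule nn_integral_sph) measurable
  also have "\<dots> = (\<integral>\<^sup>+w. \<integral>\<^sup>+z. ennreal (sphere_gauss (z, w)) * h ((cmod (fst ((z, w) /\<^sub>R norm (z, w))))\<^sup>2) \<partial>lborel \<partial>lborel)"
    by (rule lborel_pair.nn_integral_snd[symmetric]) (unfold lborel_prod, measurable)
  also have "\<dots> = (\<integral>\<^sup>+w. \<integral>\<^sup>+z. ennreal (exp (- ((cmod z)\<^sup>2 + (cmod w)\<^sup>2)) / pi\<^sup>2) * h ((cmod z)\<^sup>2 / ((cmod z)\<^sup>2 + (cmod w)\<^sup>2)) \<partial>lborel \<partial>lborel)"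
    unfolding sphere_gauss_def fst_scaleR fst_conv sc n2 ..
  also have "\<dots> = (\<integral>\<^sup>+w. \<integral>\<^sup>+s. ennreal (pi * indicator {0..} s) * (ennreal (exp (- (s + (cmod w)\<^sup>2)) / pi\<^sup>2) * h (s / (s + (cmod w)\<^sup>2))) \<partial>lborel \<partial>lborel)"
    by (intro nn_integral_cong nn_integral_cmod_square) measurable
  also have "\<dots> = (\<integral>\<^sup>+t. ennreal (pi * indicator {0..} t) * (\<integral>\<^sup>+s. ennreal (pi * indicator {0..} s) * (ennreal (exp (- (s + t)) / pi\<^sup>2) * h (s / (s + t))) \<partial>lborel) \<partial>lborel)"
    by (rule nn_integral_cmod_square) measurable
  also have "\<dots> = (\<integral>\<^sup>+t. (\<integral>\<^sup>+s. h (s / (s + t)) * (ennreal (exp (- s)) * indicator {0..} s) \<partial>lborel) * (ennreal (exp (- t)) * indicator {0..} t) \<partial>lborel)"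
  proof (rule nn_integral_cong)
    fix t :: real
    have "ennreal (pi * indicator {0..} t) * (\<integral>\<^sup>+s. ennreal (pi * indicator {0..} s) * (ennreal (exp (- (s + t)) / pi\<^sup>2) * h (s / (s + t))) \<partial>lborel)
        = (\<integral>\<^sup>+s. ennreal (pi * indicator {0..} t) * (ennreal (pi * indicator {0..} s) * (ennreal (exp (- (s + t)) / pi\<^sup>2) * h (s / (s + t)))) \<partial>lborel)"
      by (rule nn_integral_cmult[symmetric]) measurable
    also have "\<dots> = (\<integral>\<^sup>+s. h (s / (s + t)) * (ennreal (exp (- s)) * indicator {0..} s) * (ennreal (exp (- t)) * indicator {0..} t) \<partial>lborel)"
    proof (rule nn_integral_cong)
      fix s :: real
      have "ennreal pi * (ennreal pi * ennreal (exp (- (s + t)) / pi\<^sup>2)) = ennreal (exp (- s)) * ennreal (exp (- t))"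
        by (simp add: ennreal_mult'[symmetric] exp_add[symmetric] power2_eq_square)
      then show "ennreal (pi * indicator {0..} t) * (ennreal (pi * indicator {0..} s) * (ennreal (exp (- (s + t)) / pi\<^sup>2) * h (s / (s + t))))
          = h (s / (s + t)) * (ennreal (exp (- s)) * indicator {0..} s) * (ennreal (exp (- t)) * indicator {0..} t)"
        by (cases "0 \<le> s"; cases "0 \<le> t") (simp_all add: mult_ac, metis mult.assoc mult.commute)
    qed
    also have "\<dots> = (\<integral>\<^sup>+s. h (s / (s + t)) * (ennreal (exp (- s)) * indicator {0..} s) \<partial>lborel) * (ennreal (exp (- t)) * indicator {0..} t)"
      by (rule nn_integral_multc) measurable
    finally show "ennreal (pi * indicator {0..} t) * (\<integral>\<^sup>+s. ennreal (pi * indicator {0..} s) * (ennreal (exp (- (s + t)) / pi\<^sup>2) * h (s / (s + t))) \<partial>lborel)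
      = (\<integral>\<^sup>+s. h (s / (s + t)) * (ennreal (exp (- s)) * indicator {0..} s) \<partial>lborel) * (ennreal (exp (- t)) * indicator {0..} t)" .
  qed
  finally show ?thesis .
qed

lemma prob_sph: "prob_space sph"
proof (rule prob_spaceI)
  have "emeasure sph UNIV = (\<integral>\<^sup>+p. 1 \<partial>sph)" by simp
  also have "\<dots> = 1"
    using nn_integral_exp_tail[of 1 0] nn_integral_sph_fst[of "\<lambda>_. 1"] by simp
  finally show "emeasure sph (space sph) = 1" by simp
qed

text \<open>For independent standard exponentials, s/(s + t) exceeds x exactly when s > c t with c =
  x/(1 - x). Given t this has probability exp(-c t), and integrating over t gives 1/(1 + c) = 1 -
  x.\<close>

lemma distr_sph_fst: "distr sph borel (\<lambda>p. (cmod (fst p))\<^sup>2) = unif01"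
proof (rule measure_eqI_lessThan)
  interpret S: prob_space sph by (rule prob_sph)
  show "emeasure (distr sph borel (\<lambda>p. (cmod (fst p))\<^sup>2)) {x<..} < \<infinity>" for x
    by (subst emeasure_distr) (auto simp: S.emeasure_eq_measure)
  fix x :: real
  have u: "emeasure unif01 {x<..} = emeasure lborel ({0<..<1} \<inter> {x<..})"
  proof -
    have "emeasure unif01 {x<..} = (\<integral>\<^sup>+y. ennreal (indicator {0<..<1} y) * indicator {x<..} y \<partial>lborel)"
      unfolding unif01_def by (rule emeasure_density) auto
    also have "\<dots> = (\<integral>\<^sup>+y. indicator ({0<..<1} \<inter> {x<..}) y \<partial>lborel)"
      by (intro nn_integral_cong) (auto split: split_indicator)
    finally show ?thesis by simp
  qed
  have d: "emeasure (distr sph borel (\<lambda>p. (cmod (fst p))\<^sup>2)) {x<..} = (\<integral>\<^sup>+p. indicator {x<..} ((cmod (fst p))\<^sup>2) \<partial>sph)"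
    by (rule emeasure_distr_nn_integral) auto
  consider "x < 0" | "0 \<le> x" "x < 1" | "1 \<le> x" by linarith
  then show "emeasure (distr sph borel (\<lambda>p. (cmod (fst p))\<^sup>2)) {x<..} = emeasure unif01 {x<..}"
  proof cases
    case 1
    then have "{0<..<1} \<inter> {x<..} = {0<..<1}" by auto
    moreover have "(\<integral>\<^sup>+p. indicator {x<..} ((cmod (fst p))\<^sup>2) \<partial>sph) = (\<integral>\<^sup>+p. 1 \<partial>sph)"
      using 1 by (intro nn_integral_cong) (auto simp: indicator_def intro: less_le_trans)
    ultimately show ?thesis unfolding d u by (simp add: S.emeasure_space_1[simplified])
  next
    case 2
    define c where "c = x / (1 - x)"
    have c: "0 \<le> c" "1 + c = 1 / (1 - x)" using 2 by (auto simp: c_def field_simps)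
    have "(\<integral>\<^sup>+s. indicator {x<..} (s / (s + t)) * (ennreal (exp (- s)) * indicator {0..} s) \<partial>lborel) = ennreal (exp (- (c * t)))"
      if "0 < t" for t
    proof -
      have "(\<integral>\<^sup>+s. indicator {x<..} (s / (s + t)) * (ennreal (exp (- s)) * indicator {0..} s) \<partial>lborel)
          = (\<integral>\<^sup>+s. ennreal (exp (- 1 * s)) * indicator {c * t..} s \<partial>lborel)"
      proof (rule nn_integral_cong_AE)
        show "AE s in lborel. indicator {x<..} (s / (s + t)) * (ennreal (exp (- s)) * indicator {0..} s)
          = ennreal (exp (- 1 * s)) * indicator {c * t..} s"
          using AE_lborel_singleton[of "c * t"]
        proof eventually_elim
          case (elim s)
          have "x < s / (s + t) \<longleftrightarrow> c * t < s" if "0 \<le> s"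
          proof -
            have "x < s / (s + t) \<longleftrightarrow> x * (s + t) < s" using that \<open>0 < t\<close> by (simp add: pos_less_divide_eq)
            also have "\<dots> \<longleftrightarrow> x * t < s * (1 - x)" by (simp add: algebra_simps)
            also have "\<dots> \<longleftrightarrow> c * t < s" using 2 by (simp add: c_def pos_divide_less_eq)
            finally show ?thesis .
          qed
          moreover have "0 \<le> c * t" using c \<open>0 < t\<close> by simp
          ultimately show ?case using elim by (cases "0 \<le> s") (auto simp: indicator_def)
        qed
      qed
      then show ?thesis using nn_integral_exp_tail[of 1 "c * t"] by simp
    qed
    then have "(\<integral>\<^sup>+p. indicator {x<..} ((cmod (fst p))\<^sup>2) \<partial>sph) = (\<integral>\<^sup>+t. ennreal (exp (- (1 + c) * t)) * indicator {0..} t \<partial>lborel)"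
    proof -
      assume inner: "\<And>t. 0 < t \<Longrightarrow> (\<integral>\<^sup>+s. indicator {x<..} (s / (s + t)) * (ennreal (exp (- s)) * indicator {0..} s) \<partial>lborel) = ennreal (exp (- (c * t)))"
      have "(\<integral>\<^sup>+t. (\<integral>\<^sup>+s. indicator {x<..} (s / (s + t)) * (ennreal (exp (- s)) * indicator {0..} s) \<partial>lborel) * (ennreal (exp (- t)) * indicator {0..} t) \<partial>lborel)
        = (\<integral>\<^sup>+t. ennreal (exp (- (1 + c) * t)) * indicator {0..} t \<partial>lborel)"
      proof (rule nn_integral_cong_AE)
        show "AE t in lborel. (\<integral>\<^sup>+s. indicator {x<..} (s / (s + t)) * (ennreal (exp (- s)) * indicator {0..} s) \<partial>lborel) * (ennreal (exp (- t)) * indicator {0..} t)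
          = ennreal (exp (- (1 + c) * t)) * indicator {0..} t"
          using AE_lborel_singleton[of "0::real"]
        proof eventually_elim
          case (elim t)
          show ?case
          proof (cases "0 < t")
            case True
            have "ennreal (exp (- (c * t))) * ennreal (exp (- t)) = ennreal (exp (- (1 + c) * t))"
              by (simp add: ennreal_mult'[symmetric] exp_add[symmetric] algebra_simps)
            then show ?thesis unfolding inner[OF True] by (simp add: mult.assoc[symmetric])
          next
            case False
            then show ?thesis using elim by simp
          qed
        qed
      qed
      then show ?thesis
        by (subst nn_integral_sph_fst[of "indicator {x<..}"]) auto
    qed
    also have "\<dots> = ennreal (1 - x)"
      using nn_integral_exp_tail[of "1 + c" 0] c 2 by simp
    also have "\<dots> = emeasure lborel ({0<..<1} \<inter> {x<..})"
    proof -
      have "{0<..<1} \<inter> {x<..} = {x<..<1}" using 2 by auto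
      then show ?thesis using 2 by simp
    qed
    finally show ?thesis unfolding d u .
  next
    case 3
    have "s / (s + t) \<le> x" if "0 \<le> s" "0 \<le> t" for s t
    proof -
      have "s / (s + t) \<le> 1" using that by (cases "s + t = 0") (auto simp: divide_le_eq_1)
      then show ?thesis using 3 by linarith
    qed
    then have z: "indicator {x<..} (s / (s + t)) * (ennreal (exp (- s)) * indicator {0..} s) = 0" if "0 \<le> t" for s t
      using that by (cases "0 \<le> s") (auto simp: indicator_def not_less)
    have "(\<integral>\<^sup>+s. indicator {x<..} (s / (s + t)) * (ennreal (exp (- s)) * indicator {0..} s) \<partial>lborel) * (ennreal (exp (- t)) * indicator {0..} t) = 0" for t
    proof (cases "0 \<le> t")
      case True
      show ?thesis unfolding z[OF True] by simp
    qed simp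
    note zz = this
    have "(\<integral>\<^sup>+p. indicator {x<..} ((cmod (fst p))\<^sup>2) \<partial>sph) = (\<integral>\<^sup>+t. (\<integral>\<^sup>+s. indicator {x<..} (s / (s + t)) * (ennreal (exp (- s)) * indicator {0..} s) \<partial>lborel) * (ennreal (exp (- t)) * indicator {0..} t) \<partial>lborel)"
      by (rule nn_integral_sph_fst) simp
    also have "\<dots> = 0" unfolding zz by simp
    finally have "(\<integral>\<^sup>+p. indicator {x<..} ((cmod (fst p))\<^sup>2) \<partial>sph) = 0" .
    moreover have "{0<..<1} \<inter> {x<..} = {}" using 3 by auto
    ultimately show ?thesis unfolding d u by simp
  qed
qed auto

lemma sph_isometry:
  assumes lin: "linear V" and nrm: "\<And>p. norm (V p) = norm p"
  shows "distr sph borel V = sph"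
proof (rule measure_eqI)
  have m [measurable]: "V \<in> borel_measurable borel"
    using lin by (intro borel_measurable_continuous_onI linear_continuous_on) (simp add: linear_conv_bounded_linear)
  fix A assume "A \<in> sets (distr sph borel V)"
  then have [measurable]: "A \<in> sets borel" by simp
  have "emeasure (distr sph borel V) A = (\<integral>\<^sup>+p. indicator A (V p) \<partial>sph)"
    by (rule emeasure_distr_nn_integral) auto
  also have "\<dots> = (\<integral>\<^sup>+p. ennreal (sphere_gauss p) * indicator A (V (p /\<^sub>R norm p)) \<partial>lborel)"
    by (rule nn_integral_sph) measurable
  also have "\<dots> = (\<integral>\<^sup>+p. ennreal (sphere_gauss (V p)) * indicator A (V p /\<^sub>R norm (V p)) \<partial>lborel)"
    by (simp add: sphere_gauss_def nrm linear_scale[OF lin])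
  also have "\<dots> = (\<integral>\<^sup>+p. ennreal (sphere_gauss p) * indicator A (p /\<^sub>R norm p) \<partial>lborel)"
    by (rule nn_integral_lborel_isometry[OF lin nrm, of "\<lambda>p. ennreal (sphere_gauss p) * indicator A (p /\<^sub>R norm p)"]) measurable
  also have "\<dots> = emeasure sph A"
    by (subst nn_integral_sph[symmetric]) auto
  finally show "emeasure (distr sph borel V) A = emeasure sph A" .
qed simp

lemma AE_sph: "AE p in sph. (cmod (fst p))\<^sup>2 + (cmod (snd p))\<^sup>2 = 1"
proof -
  have n2: "(norm p)\<^sup>2 = (cmod (fst p))\<^sup>2 + (cmod (snd p))\<^sup>2" for p :: "complex \<times> complex"
    by (cases p) (simp add: norm_Pair)
  have "AE p in lborel. p \<noteq> (0 :: complex \<times> complex)"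
    by (rule AE_lborel_singleton)
  then have "AE p in lborel. norm ((p :: complex \<times> complex) /\<^sub>R norm p) = 1"
    by eventually_elim (simp add: field_simps)
  then have "AE p in sph. norm p = 1"
    unfolding sph_def by (subst AE_distr_iff) (auto simp: AE_density)
  then show ?thesis
    by eventually_elim (metis n2 one_power2)
qed

subsection \<open>Measurability of matrix-valued maps\<close>

lemma space_mat_borel [simp]: "space (mat_borel N) = carrier_mat N N"
  by (simp add: mat_borel_def)

lemma measurable_mat_borelI:
  assumes "\<And>x. x \<in> space M \<Longrightarrow> f x \<in> carrier_mat N N"
    and "\<And>i j. i < N \<Longrightarrow> j < N \<Longrightarrow> (\<lambda>x. f x $$ (i, j)) \<in> borel_measurable M"
  shows "f \<in> M \<rightarrow>\<^sub>M mat_borel N"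
  unfolding mat_borel_def using assms
  by (intro measurable_vimage_algebra2 measurable_restrict) auto

lemma measurable_mat_entry:
  assumes "i < N" "j < N"
  shows "(\<lambda>B. B $$ (i, j)) \<in> borel_measurable (mat_borel N)"
proof -
  have "(\<lambda>B. restrict (($$) B) ({..<N} \<times> {..<N})) \<in> mat_borel N \<rightarrow>\<^sub>M PiM ({..<N} \<times> {..<N}) (\<lambda>_. borel)"
    unfolding mat_borel_def by (rule measurable_vimage_algebra1) (auto simp: space_PiM)
  from measurable_compose[OF this measurable_component_singleton[of "(i, j)"]] show ?thesis
    using assms by simp
qed

lemma index_mat_adjoint:
  assumes "A \<in> carrier_mat n m" "i < m" "j < n"
  shows "mat_adjoint A $$ (i, j) = cnj (A $$ (j, i) :: complex)"
  using assms by (simp add: mat_adjoint_def mat_of_rows_index)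

lemma mat_adjoint_carrier [simp]: "A \<in> carrier_mat n m \<Longrightarrow> mat_adjoint A \<in> carrier_mat m n"
  by (auto simp: mat_adjoint_def)

lemma mat_adjoint_dim [simp]: "dim_row (mat_adjoint A) = dim_col A" "dim_col (mat_adjoint A) = dim_row A"
  by (simp_all add: mat_adjoint_def)

lemma mat_adjoint_adjoint: "A \<in> carrier_mat n m \<Longrightarrow> mat_adjoint (mat_adjoint A) = (A :: complex mat)"
  by (rule eq_matI) (auto simp: index_mat_adjoint[of A n m] index_mat_adjoint[of "mat_adjoint A" m n])

lemma index_mult_mat_sum:
  assumes "A \<in> carrier_mat n m" "B \<in> carrier_mat m k" "i < n" "j < k"
  shows "(A * B) $$ (i, j) = (\<Sum>l<m. A $$ (i, l) * B $$ (l, j))"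
  using assms by (auto simp: scalar_prod_def atLeast0LessThan)

lemma mat_adjoint_mult:
  assumes "A \<in> carrier_mat n m" "B \<in> carrier_mat m k"
  shows "mat_adjoint (A * B) = mat_adjoint B * mat_adjoint (A :: complex mat)"
proof (rule eq_matI)
  have AB: "A * B \<in> carrier_mat n k" using assms by simp
  fix i j assume "i < dim_row (mat_adjoint B * mat_adjoint A)" "j < dim_col (mat_adjoint B * mat_adjoint A)"
  then have ij: "i < k" "j < n" using assms by (auto simp: mat_adjoint_def)
  have "mat_adjoint (A * B) $$ (i, j) = cnj ((A * B) $$ (j, i))"
    by (rule index_mat_adjoint[OF AB ij])
  also have "\<dots> = (\<Sum>l<m. mat_adjoint B $$ (i, l) * mat_adjoint A $$ (l, j))"
    unfolding index_mult_mat_sum[OF assms ij(2,1)] cnj_sum complex_cnj_mult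
    using ij by (intro sum.cong) (simp_all add: index_mat_adjoint[OF assms(1)] index_mat_adjoint[OF assms(2)])
  also have "\<dots> = (mat_adjoint B * mat_adjoint A) $$ (i, j)"
    using ij assms by (intro index_mult_mat_sum[symmetric]) auto
  finally show "mat_adjoint (A * B) $$ (i, j) = (mat_adjoint B * mat_adjoint A) $$ (i, j)" .
qed (use assms in \<open>auto simp: mat_adjoint_def\<close>)

subsection \<open>The unitary group\<close>

lemma unitary_carrier: "U \<in> unitary_group N \<Longrightarrow> U \<in> carrier_mat N N"
  by (simp add: unitary_group_def)

lemma unitary_left: "U \<in> unitary_group N \<Longrightarrow> mat_adjoint U * U = 1\<^sub>m N"
  by (simp add: unitary_group_def)

lemma unitary_right: "U \<in> unitary_group N \<Longrightarrow> U * mat_adjoint U = 1\<^sub>m N"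
  by (rule mat_mult_left_right_inverse[of "mat_adjoint U" N U]) (auto simp: unitary_group_def)

lemma unitary_adjoint: "U \<in> unitary_group N \<Longrightarrow> mat_adjoint U \<in> unitary_group N"
  using unitary_right[of U N] by (auto simp: unitary_group_def mat_adjoint_adjoint)

lemma unitary_mult: "U \<in> unitary_group N \<Longrightarrow> V \<in> unitary_group N \<Longrightarrow> U * V \<in> unitary_group N"
proof -
  assume U: "U \<in> unitary_group N" and V: "V \<in> unitary_group N"
  note c = unitary_carrier[OF U] unitary_carrier[OF V]
  have "mat_adjoint (U * V) * (U * V) = mat_adjoint V * (mat_adjoint U * (U * V))"
    unfolding mat_adjoint_mult[OF c] using c by (intro assoc_mult_mat[of _ N N _ N _ N]) auto
  also have "mat_adjoint U * (U * V) = (mat_adjoint U * U) * V"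
    using c by (intro assoc_mult_mat[of _ N N _ N _ N, symmetric]) auto
  also have "\<dots> = V" using unitary_left[OF U] c by simp
  finally show ?thesis using unitary_left[OF V] c by (simp add: unitary_group_def)
qed

lemma unitary_one: "1\<^sub>m N \<in> unitary_group N"
proof -
  have "mat_adjoint (1\<^sub>m N) = (1\<^sub>m N :: complex mat)"
    by (rule eq_matI) (auto simp: index_mat_adjoint[of _ N N])
  then show ?thesis by (simp add: unitary_group_def)
qed

lemma unitary_columns:
  assumes "U \<in> unitary_group N" "i < N" "j < N"
  shows "(\<Sum>a<N. cnj (U $$ (a, i)) * U $$ (a, j)) = (if i = j then 1 else 0)"
proof -
  have "(mat_adjoint U * U) $$ (i, j) = (\<Sum>a<N. cnj (U $$ (a, i)) * U $$ (a, j))"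
    using assms unitary_carrier[OF assms(1)]
    by (subst index_mult_mat_sum[of _ N N _ N]) (auto simp: index_mat_adjoint[of U N N])
  then show ?thesis using unitary_left[OF assms(1)] assms by simp
qed

lemma unitary_rows:
  assumes "U \<in> unitary_group N" "i < N" "j < N"
  shows "(\<Sum>a<N. U $$ (i, a) * cnj (U $$ (j, a))) = (if i = j then 1 else 0)"
proof -
  have "(U * mat_adjoint U) $$ (i, j) = (\<Sum>a<N. U $$ (i, a) * cnj (U $$ (j, a)))"
    using assms unitary_carrier[OF assms(1)]
    by (subst index_mult_mat_sum[of _ N N _ N]) (auto simp: index_mat_adjoint[of U N N])
  then show ?thesis using unitary_right[OF assms(1)] assms by simp
qed

definition unitary_borel :: "nat \<Rightarrow> complex mat measure" where
  "unitary_borel N = restrict_space (mat_borel N) (unitary_group N)"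

lemma space_unitary_borel [simp]: "space (unitary_borel N) = unitary_group N"
  by (auto simp: unitary_borel_def space_restrict_space unitary_carrier)

lemma measurable_unitary_borelI:
  assumes "\<And>x. x \<in> space M \<Longrightarrow> f x \<in> unitary_group N"
    and "\<And>i j. i < N \<Longrightarrow> j < N \<Longrightarrow> (\<lambda>x. f x $$ (i, j)) \<in> borel_measurable M"
  shows "f \<in> M \<rightarrow>\<^sub>M unitary_borel N"
  unfolding unitary_borel_def using assms
  by (intro measurable_restrict_space2 measurable_mat_borelI) (auto simp: unitary_carrier)

lemma measurable_unitary_entry:
  assumes "i < N" "j < N" "f \<in> M \<rightarrow>\<^sub>M unitary_borel N"
  shows "(\<lambda>x. f x $$ (i, j)) \<in> borel_measurable M"
  using measurable_compose[OF assms(3) measurable_restrict_space1[OF measurable_mat_entry[OF assms(1,2)],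
      of "unitary_group N", folded unitary_borel_def]] .

lemma measurable_unitary_mult:
  assumes "f \<in> M \<rightarrow>\<^sub>M unitary_borel N" "g \<in> M \<rightarrow>\<^sub>M unitary_borel N"
  shows "(\<lambda>x. f x * g x) \<in> M \<rightarrow>\<^sub>M unitary_borel N"
proof (rule measurable_unitary_borelI)
  have sp: "f x \<in> unitary_group N" "g x \<in> unitary_group N" if "x \<in> space M" for x
    using measurable_space[OF assms(1) that] measurable_space[OF assms(2) that] by auto
  show "f x * g x \<in> unitary_group N" if "x \<in> space M" for x
    using sp[OF that] by (rule unitary_mult)
  fix i j assume ij: "i < N" "j < N"
  have "(\<lambda>x. \<Sum>l<N. f x $$ (i, l) * g x $$ (l, j)) \<in> borel_measurable M"
    using ij assms by (intro borel_measurable_sum borel_measurable_times measurable_unitary_entry) auto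
  moreover have "(f x * g x) $$ (i, j) = (\<Sum>l<N. f x $$ (i, l) * g x $$ (l, j))" if "x \<in> space M" for x
    using sp[OF that] ij by (intro index_mult_mat_sum) (auto simp: unitary_carrier)
  ultimately show "(\<lambda>x. (f x * g x) $$ (i, j)) \<in> borel_measurable M"
    by (simp cong: measurable_cong)
qed

lemma measurable_unitary_adjoint:
  assumes "f \<in> M \<rightarrow>\<^sub>M unitary_borel N"
  shows "(\<lambda>x. mat_adjoint (f x)) \<in> M \<rightarrow>\<^sub>M unitary_borel N"
proof (rule measurable_unitary_borelI)
  have sp: "f x \<in> unitary_group N" if "x \<in> space M" for x
    using measurable_space[OF assms(1) that] by auto
  show "mat_adjoint (f x) \<in> unitary_group N" if "x \<in> space M" for x
    using sp[OF that] by (rule unitary_adjoint)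
  fix i j assume ij: "i < N" "j < N"
  have "(\<lambda>x. cnj (f x $$ (j, i))) \<in> borel_measurable M"
    using measurable_compose[OF measurable_unitary_entry[OF ij(2,1) assms], of cnj borel]
    by (simp add: borel_measurable_continuous_onI continuous_on_cnj)
  moreover have "mat_adjoint (f x) $$ (i, j) = cnj (f x $$ (j, i))" if "x \<in> space M" for x
    using ij unitary_carrier[OF sp[OF that]] by (intro index_mat_adjoint)
  ultimately show "(\<lambda>x. mat_adjoint (f x) $$ (i, j)) \<in> borel_measurable M"
    by (simp cong: measurable_cong)
qed

subsection \<open>Uniqueness and right invariance of Haar measure\<close>

lemma is_haar_unitaryD:
  assumes "is_haar_unitary N H"
  shows "prob_space H" "sets H = sets (unitary_borel N)" "space H = unitary_group N"
    "\<And>V. V \<in> unitary_group N \<Longrightarrow> distr H H (\<lambda>U. V * U) = H"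
proof -
  show "prob_space H" and s: "sets H = sets (unitary_borel N)"
    and "\<And>V. V \<in> unitary_group N \<Longrightarrow> distr H H (\<lambda>U. V * U) = H"
    using assms by (auto simp: is_haar_unitary_def unitary_borel_def)
  show "space H = unitary_group N"
    using sets_eq_imp_space_eq[OF s] by simp
qed

lemma haar_left_nn_integral:
  assumes H: "is_haar_unitary N H" and V: "V \<in> unitary_group N" and f: "f \<in> borel_measurable (unitary_borel N)"
  shows "(\<integral>\<^sup>+U. f (V * U) \<partial>H) = (\<integral>\<^sup>+U. f U \<partial>H)"
proof -
  note h = is_haar_unitaryD[OF H]
  have "(\<lambda>U. V * U) \<in> H \<rightarrow>\<^sub>M H"
    unfolding measurable_cong_sets[OF h(2) h(2)]
    by (intro measurable_unitary_mult measurable_const measurable_ident_sets[OF refl]) (simp_all add: V)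
  from nn_integral_distr[OF this, of f] show ?thesis
    using f by (simp add: h(4)[OF V] measurable_cong_sets[OF h(2) refl])
qed

text \<open>In the double integral of f at the inverse of V times U, left invariance in U removes V.
  Since the same product is also the inverse of (inverse of U) times V, left invariance in V removes
  U. The two evaluations are the two sides.\<close>

lemma haar_swap:
  assumes H1: "is_haar_unitary N H1" and H2: "is_haar_unitary N H2" and f: "f \<in> borel_measurable (unitary_borel N)"
  shows "(\<integral>\<^sup>+U. f U \<partial>H1) = (\<integral>\<^sup>+U. f (mat_adjoint U) \<partial>H2)"
proof -
  note h1 = is_haar_unitaryD[OF H1] and h2 = is_haar_unitaryD[OF H2]
  interpret A: prob_space H1 by (rule h1)
  interpret B: prob_space H2 by (rule h2)
  interpret pair_sigma_finite H1 H2 ..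
  have m1: "fst \<in> H1 \<Otimes>\<^sub>M H2 \<rightarrow>\<^sub>M unitary_borel N" "snd \<in> H1 \<Otimes>\<^sub>M H2 \<rightarrow>\<^sub>M unitary_borel N"
    using measurable_fst[of H1 H2] measurable_snd[of H1 H2]
    by (simp_all add: measurable_cong_sets[OF refl h1(2)] measurable_cong_sets[OF refl h2(2)])
  have m: "(\<lambda>(U, V). f (mat_adjoint V * U)) \<in> borel_measurable (H1 \<Otimes>\<^sub>M H2)"
    unfolding split_beta' by (intro measurable_compose[OF _ f] measurable_unitary_mult measurable_unitary_adjoint m1)
  have fa: "(\<lambda>U. f (mat_adjoint U)) \<in> borel_measurable (unitary_borel N)"
    by (intro measurable_compose[OF _ f] measurable_unitary_adjoint measurable_ident_sets[OF refl])
  have "(\<integral>\<^sup>+U. f U \<partial>H1) = (\<integral>\<^sup>+V. \<integral>\<^sup>+U. f (mat_adjoint V * U) \<partial>H1 \<partial>H2)"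
  proof -
    have "(\<integral>\<^sup>+V. \<integral>\<^sup>+U. f (mat_adjoint V * U) \<partial>H1 \<partial>H2) = (\<integral>\<^sup>+V. (\<integral>\<^sup>+U. f U \<partial>H1) \<partial>H2)"
      by (intro nn_integral_cong haar_left_nn_integral[OF H1 _ f] unitary_adjoint) (simp add: h2)
    then show ?thesis by (simp add: B.emeasure_space_1)
  qed
  also have "\<dots> = (\<integral>\<^sup>+U. \<integral>\<^sup>+V. f (mat_adjoint V * U) \<partial>H2 \<partial>H1)"
    by (rule Fubini'[OF m])
  also have "\<dots> = (\<integral>\<^sup>+U. (\<integral>\<^sup>+V. f (mat_adjoint V) \<partial>H2) \<partial>H1)"
  proof (rule nn_integral_cong)
    fix U assume "U \<in> space H1"
    then have U: "U \<in> unitary_group N" by (simp add: h1)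
    have "(\<integral>\<^sup>+V. f (mat_adjoint V * U) \<partial>H2) = (\<integral>\<^sup>+V. f (mat_adjoint (mat_adjoint U * V)) \<partial>H2)"
    proof (rule nn_integral_cong)
      fix V assume "V \<in> space H2"
      then have V: "V \<in> unitary_group N" by (simp add: h2)
      have "mat_adjoint (mat_adjoint U * V) = mat_adjoint V * mat_adjoint (mat_adjoint U)"
        using unitary_carrier[OF U] unitary_carrier[OF V] by (intro mat_adjoint_mult) auto
      then show "f (mat_adjoint V * U) = f (mat_adjoint (mat_adjoint U * V))"
        by (simp add: mat_adjoint_adjoint[OF unitary_carrier[OF U]])
    qed
    also have "\<dots> = (\<integral>\<^sup>+V. f (mat_adjoint V) \<partial>H2)"
      by (rule haar_left_nn_integral[OF H2 unitary_adjoint[OF U] fa])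
    finally show "(\<integral>\<^sup>+V. f (mat_adjoint V * U) \<partial>H2) = (\<integral>\<^sup>+V. f (mat_adjoint V) \<partial>H2)" .
  qed
  also have "\<dots> = (\<integral>\<^sup>+V. f (mat_adjoint V) \<partial>H2)"
    by (simp add: A.emeasure_space_1)
  finally show ?thesis .
qed

text \<open>Both integrals equal the integral of \<open>f\<close> at the inverse with respect to the
  second measure.\<close>

lemma haar_unique:
  assumes H1: "is_haar_unitary N H1" and H2: "is_haar_unitary N H2"
  shows "H1 = H2"
proof (rule measure_eqI)
  note h1 = is_haar_unitaryD[OF H1] and h2 = is_haar_unitaryD[OF H2]
  show "sets H1 = sets H2" by (simp add: h1 h2)
  fix A assume A: "A \<in> sets H1"
  then have f: "indicator A \<in> borel_measurable (unitary_borel N)" by (simp add: h1)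
  have "(\<integral>\<^sup>+U. indicator A U \<partial>H1) = (\<integral>\<^sup>+U. indicator A U \<partial>H2)"
    using haar_swap[OF H1 H2 f] haar_swap[OF H2 H2 f] by simp
  then show "emeasure H1 A = emeasure H2 A"
    using A by (simp add: h1 h2)
qed

text \<open>Inversion preserves the measure, by the swap lemma with equal measures, and exchanges
  right with left multiplication.\<close>

lemma haar_right_nn_integral:
  assumes H: "is_haar_unitary N H" and W: "W \<in> unitary_group N" and f: "f \<in> borel_measurable (unitary_borel N)"
  shows "(\<integral>\<^sup>+U. f (U * W) \<partial>H) = (\<integral>\<^sup>+U. f U \<partial>H)"
proof -
  note h = is_haar_unitaryD[OF H]
  have fW: "(\<lambda>U. f (U * W)) \<in> borel_measurable (unitary_borel N)"
    by (intro measurable_compose[OF _ f] measurable_unitary_mult measurable_const measurable_ident_sets[OF refl]) (simp_all add: W)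
  have fa: "(\<lambda>U. f (mat_adjoint U)) \<in> borel_measurable (unitary_borel N)"
    by (intro measurable_compose[OF _ f] measurable_unitary_adjoint measurable_ident_sets[OF refl])
  have "(\<integral>\<^sup>+U. f (U * W) \<partial>H) = (\<integral>\<^sup>+U. f (mat_adjoint U * W) \<partial>H)"
    by (rule haar_swap[OF H H fW])
  also have "\<dots> = (\<integral>\<^sup>+U. f (mat_adjoint (mat_adjoint W * U)) \<partial>H)"
  proof (rule nn_integral_cong)
    fix U assume "U \<in> space H"
    then have U: "U \<in> unitary_group N" by (simp add: h)
    have "mat_adjoint (mat_adjoint W * U) = mat_adjoint U * mat_adjoint (mat_adjoint W)"
      using unitary_carrier[OF U] unitary_carrier[OF W] by (intro mat_adjoint_mult) auto
    then show "f (mat_adjoint U * W) = f (mat_adjoint (mat_adjoint W * U))"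
      by (simp add: mat_adjoint_adjoint[OF unitary_carrier[OF W]])
  qed
  also have "\<dots> = (\<integral>\<^sup>+U. f (mat_adjoint U) \<partial>H)"
    by (rule haar_left_nn_integral[OF H unitary_adjoint[OF W] fa])
  also have "\<dots> = (\<integral>\<^sup>+U. f U \<partial>H)"
    by (rule haar_swap[OF H H f, symmetric])
  finally show ?thesis .
qed

subsection \<open>Existence of Haar measure\<close>

text \<open>Haar measure arises as the law of the Gram-Schmidt basis of a random matrix whose law is
  invariant under left multiplication. The recursion is on the column index; \<open>gs_resid\<close>
  and \<open>gs_norm\<close> name its numerator and pivot afterwards.\<close>

function gram_schmidt_col :: "nat \<Rightarrow> (nat \<times> nat \<Rightarrow> complex) \<Rightarrow> nat \<Rightarrow> nat \<Rightarrow> complex" where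
  "gram_schmidt_col N x j = (\<lambda>a.
     (x (a, j) - (\<Sum>i<j. (\<Sum>b<N. x (b, j) * cnj (gram_schmidt_col N x i b)) * gram_schmidt_col N x i a))
     / of_real (sqrt (\<Sum>c<N. (cmod (x (c, j) - (\<Sum>i<j. (\<Sum>b<N. x (b, j) * cnj (gram_schmidt_col N x i b)) * gram_schmidt_col N x i c)))\<^sup>2)))"
  by pat_completeness auto
termination by (relation "Wellfounded.measure (\<lambda>(N, x, j). j)") auto

declare gram_schmidt_col.simps [simp del]

definition gs_resid :: "nat \<Rightarrow> (nat \<times> nat \<Rightarrow> complex) \<Rightarrow> nat \<Rightarrow> nat \<Rightarrow> complex" where
  "gs_resid N x j a = x (a, j) - (\<Sum>i<j. (\<Sum>b<N. x (b, j) * cnj (gram_schmidt_col N x i b)) * gram_schmidt_col N x i a)"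

definition gs_norm :: "nat \<Rightarrow> (nat \<times> nat \<Rightarrow> complex) \<Rightarrow> nat \<Rightarrow> real" where
  "gs_norm N x j = sqrt (\<Sum>c<N. (cmod (gs_resid N x j c))\<^sup>2)"

lemma gram_schmidt_col_eq: "gram_schmidt_col N x j a = gs_resid N x j a / of_real (gs_norm N x j)"
  by (subst gram_schmidt_col.simps) (simp add: gs_resid_def gs_norm_def)

definition gs_generic :: "nat \<Rightarrow> (nat \<times> nat \<Rightarrow> complex) \<Rightarrow> bool" where
  "gs_generic N x \<longleftrightarrow> (\<forall>j<N. gs_norm N x j \<noteq> 0)"

lemma gs_orthogonal:
  assumes "gs_generic N x" "j < N"
  shows "i \<le> j \<Longrightarrow> (\<Sum>a<N. gram_schmidt_col N x j a * cnj (gram_schmidt_col N x i a)) = (if i = j then 1 else 0)"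
  using assms(2)
proof (induction j arbitrary: i rule: less_induct)
  case (less j)
  let ?g = "gram_schmidt_col N x" and ?n = "gs_norm N x j"
  have n: "?n \<noteq> 0" using assms(1) less.prems by (simp add: gs_generic_def)
  have sym: "(\<Sum>a<N. ?g k a * cnj (?g i a)) = (if i = k then 1 else 0)" if "i < j" "k < j" for i k
  proof (cases "i \<le> k")
    case True
    then show ?thesis using less.IH[of k i] that less.prems by auto
  next
    case False
    then have "(\<Sum>a<N. ?g i a * cnj (?g k a)) = 0" using less.IH[of i k] that less.prems by auto
    then have "cnj (\<Sum>a<N. ?g i a * cnj (?g k a)) = 0" by simp
    then show ?thesis using False by (simp add: mult.commute)
  qed
  show ?case
  proof (cases "i = j")
    case True
    have "(\<Sum>a<N. ?g j a * cnj (?g j a)) = of_real ((\<Sum>a<N. (cmod (gs_resid N x j a))\<^sup>2) / ?n\<^sup>2)"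
      by (simp add: gram_schmidt_col_eq sum_divide_distrib complex_norm_square[symmetric] power2_eq_square)
    also have "(\<Sum>a<N. (cmod (gs_resid N x j a))\<^sup>2) = ?n\<^sup>2"
      unfolding gs_norm_def by (rule real_sqrt_pow2[symmetric]) (simp add: sum_nonneg)
    finally show ?thesis using n True by simp
  next
    case False
    then have ij: "i < j" using less.prems by simp
    have "(\<Sum>a<N. gs_resid N x j a * cnj (?g i a))
        = (\<Sum>a<N. x (a, j) * cnj (?g i a)) - (\<Sum>a<N. (\<Sum>k<j. (\<Sum>b<N. x (b, j) * cnj (?g k b)) * ?g k a) * cnj (?g i a))"
      by (simp add: gs_resid_def left_diff_distrib sum_subtractf)
    also have "(\<Sum>a<N. (\<Sum>k<j. (\<Sum>b<N. x (b, j) * cnj (?g k b)) * ?g k a) * cnj (?g i a))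
        = (\<Sum>k<j. (\<Sum>b<N. x (b, j) * cnj (?g k b)) * (\<Sum>a<N. ?g k a * cnj (?g i a)))"
      unfolding sum_distrib_right sum_distrib_left by (subst sum.swap) (simp only: mult.assoc)
    also have "\<dots> = (\<Sum>k<j. (\<Sum>b<N. x (b, j) * cnj (?g k b)) * (if i = k then 1 else 0))"
      using sym[OF ij] by (intro sum.cong) auto
    also have "\<dots> = (\<Sum>b<N. x (b, j) * cnj (?g i b))"
      using ij by (simp add: if_distrib cong: if_cong)
    finally have "(\<Sum>a<N. gs_resid N x j a * cnj (?g i a)) = 0" by simp
    then have "(\<Sum>a<N. ?g j a * cnj (?g i a)) = 0"
      by (simp add: gram_schmidt_col_eq[of N x j] sum_divide_distrib[symmetric])
    then show ?thesis using False by simp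
  qed
qed

text \<open>The identity serves as default for degenerate input, so that every value is unitary; the
  construction of Haar measure evaluates it only on generic input.\<close>

definition gs_matrix :: "nat \<Rightarrow> (nat \<times> nat \<Rightarrow> complex) \<Rightarrow> complex mat" where
  "gs_matrix N x = (if gs_generic N x then mat N N (\<lambda>(a, j). gram_schmidt_col N x j a) else 1\<^sub>m N)"

lemma gs_matrix_unitary: "gs_matrix N x \<in> unitary_group N"
proof (cases "gs_generic N x")
  case True
  let ?U = "mat N N (\<lambda>(a, j). gram_schmidt_col N x j a)"
  have U: "?U \<in> carrier_mat N N" by simp
  have "mat_adjoint ?U * ?U = 1\<^sub>m N"
  proof (rule eq_matI)
    fix i j assume "i < dim_row (1\<^sub>m N :: complex mat)" "j < dim_col (1\<^sub>m N :: complex mat)"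
    then have ij: "i < N" "j < N" by auto
    have "(mat_adjoint ?U * ?U) $$ (i, j) = (\<Sum>a<N. mat_adjoint ?U $$ (i, a) * ?U $$ (a, j))"
      using ij by (intro index_mult_mat_sum) auto
    also have "\<dots> = (\<Sum>a<N. gram_schmidt_col N x j a * cnj (gram_schmidt_col N x i a))"
      using ij by (intro sum.cong refl) (subst index_mat_adjoint[OF U], auto)
    also have "\<dots> = (if i = j then 1 else 0)"
    proof (cases "i \<le> j")
      case False
      then have "cnj (\<Sum>a<N. gram_schmidt_col N x i a * cnj (gram_schmidt_col N x j a)) = 0"
        using gs_orthogonal[OF True ij(1), of j] by simp
      then show ?thesis using False by (simp add: mult.commute)
    qed (use gs_orthogonal[OF True ij(2), of i] in simp)
    finally show "(mat_adjoint ?U * ?U) $$ (i, j) = 1\<^sub>m N $$ (i, j)" using ij by simp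
  qed auto
  then show ?thesis using True by (simp add: gs_matrix_def unitary_group_def)
qed (simp add: gs_matrix_def unitary_one)

text \<open>Matrices appear as functions of the index pair, because Lebesgue measure on them is a
  product measure whose points are such functions; outside the index set the value is the default
  one.\<close>

definition left_act :: "nat \<Rightarrow> complex mat \<Rightarrow> (nat \<times> nat \<Rightarrow> complex) \<Rightarrow> nat \<times> nat \<Rightarrow> complex" where
  "left_act N V x = (\<lambda>p\<in>{..<N} \<times> {..<N}. \<Sum>k<N. V $$ (fst p, k) * x (k, snd p))"

lemma unitary_inner_product:
  assumes "V \<in> unitary_group N"
  shows "(\<Sum>a<N. (\<Sum>k<N. V $$ (a, k) * f k) * cnj (\<Sum>l<N. V $$ (a, l) * g l)) = (\<Sum>k<N. f k * cnj (g k))"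
proof -
  have "(\<Sum>a<N. (\<Sum>k<N. V $$ (a, k) * f k) * cnj (\<Sum>l<N. V $$ (a, l) * g l))
      = (\<Sum>a<N. \<Sum>k<N. \<Sum>l<N. (cnj (V $$ (a, l)) * V $$ (a, k)) * (f k * cnj (g l)))"
    by (simp add: sum_product mult_ac)
  also have "\<dots> = (\<Sum>k<N. \<Sum>a<N. \<Sum>l<N. (cnj (V $$ (a, l)) * V $$ (a, k)) * (f k * cnj (g l)))"
    by (rule sum.swap)
  also have "\<dots> = (\<Sum>k<N. \<Sum>l<N. \<Sum>a<N. (cnj (V $$ (a, l)) * V $$ (a, k)) * (f k * cnj (g l)))"
    by (intro sum.cong refl sum.swap)
  also have "\<dots> = (\<Sum>k<N. \<Sum>l<N. (if l = k then 1 else 0) * (f k * cnj (g l)))"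
    unfolding sum_distrib_right[symmetric] by (intro sum.cong refl) (simp add: unitary_columns[OF assms])
  also have "\<dots> = (\<Sum>k<N. f k * cnj (g k))"
    by (simp add: if_distrib[of "\<lambda>c. c * _"] cong: if_cong)
  finally show ?thesis .
qed

text \<open>A unitary matrix preserves all inner products, so by induction over the columns the
  projection coefficients and the pivots stay the same and only the vectors are moved.\<close>

lemma gs_left_act:
  assumes V: "V \<in> unitary_group N" and "j < N"
  shows "(\<forall>a<N. gram_schmidt_col N (left_act N V x) j a = (\<Sum>k<N. V $$ (a, k) * gram_schmidt_col N x j k))
    \<and> gs_norm N (left_act N V x) j = gs_norm N x j"
  using assms(2)
proof (induction j rule: less_induct)
  case (less j)
  let ?y = "left_act N V x"
  have y: "?y (a, j) = (\<Sum>k<N. V $$ (a, k) * x (k, j))" if "a < N" for a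
    using that less.prems by (simp add: left_act_def)
  have IH: "gram_schmidt_col N ?y i a = (\<Sum>k<N. V $$ (a, k) * gram_schmidt_col N x i k)" if "i < j" "a < N" for i a
    using less.IH[of i] that less.prems by auto
  have c: "(\<Sum>b<N. ?y (b, j) * cnj (gram_schmidt_col N ?y i b)) = (\<Sum>b<N. x (b, j) * cnj (gram_schmidt_col N x i b))"
    if "i < j" for i
  proof -
    have "(\<Sum>b<N. ?y (b, j) * cnj (gram_schmidt_col N ?y i b))
        = (\<Sum>a<N. (\<Sum>k<N. V $$ (a, k) * x (k, j)) * cnj (\<Sum>l<N. V $$ (a, l) * gram_schmidt_col N x i l))"
      using y IH[OF that] by (intro sum.cong refl) auto
    also have "\<dots> = (\<Sum>k<N. x (k, j) * cnj (gram_schmidt_col N x i k))"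
      by (rule unitary_inner_product[OF V])
    finally show ?thesis .
  qed
  have r: "gs_resid N ?y j a = (\<Sum>k<N. V $$ (a, k) * gs_resid N x j k)" if "a < N" for a
  proof -
    have "gs_resid N ?y j a = (\<Sum>k<N. V $$ (a, k) * x (k, j))
       - (\<Sum>i<j. (\<Sum>b<N. x (b, j) * cnj (gram_schmidt_col N x i b)) * (\<Sum>k<N. V $$ (a, k) * gram_schmidt_col N x i k))"
      unfolding gs_resid_def y[OF that] using c IH that by (intro arg_cong2[where f = "(-)"] sum.cong refl) auto
    also have "(\<Sum>i<j. (\<Sum>b<N. x (b, j) * cnj (gram_schmidt_col N x i b)) * (\<Sum>k<N. V $$ (a, k) * gram_schmidt_col N x i k))
       = (\<Sum>k<N. V $$ (a, k) * (\<Sum>i<j. (\<Sum>b<N. x (b, j) * cnj (gram_schmidt_col N x i b)) * gram_schmidt_col N x i k))"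
      unfolding sum_distrib_left by (subst sum.swap) (simp only: mult.left_commute)
    finally show ?thesis
      by (simp add: gs_resid_def right_diff_distrib sum_subtractf)
  qed
  have "of_real (\<Sum>c<N. (cmod (gs_resid N ?y j c))\<^sup>2) = (\<Sum>c<N. gs_resid N ?y j c * cnj (gs_resid N ?y j c))"
    by (simp only: of_real_sum complex_norm_square)
  also have "\<dots> = (\<Sum>c<N. (\<Sum>k<N. V $$ (c, k) * gs_resid N x j k) * cnj (\<Sum>k<N. V $$ (c, k) * gs_resid N x j k))"
    using r by (intro sum.cong refl) auto
  also have "\<dots> = (\<Sum>c<N. gs_resid N x j c * cnj (gs_resid N x j c))"
    by (rule unitary_inner_product[OF V])
  also have "\<dots> = of_real (\<Sum>c<N. (cmod (gs_resid N x j c))\<^sup>2)"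
    by (simp only: of_real_sum complex_norm_square)
  finally have "(\<Sum>c<N. (cmod (gs_resid N ?y j c))\<^sup>2) = (\<Sum>c<N. (cmod (gs_resid N x j c))\<^sup>2)"
    by (simp only: of_real_eq_iff)
  then have n: "gs_norm N ?y j = gs_norm N x j" by (simp add: gs_norm_def)
  show ?case
    using r n by (simp add: gram_schmidt_col_eq[of N _ j] sum_divide_distrib)
qed

lemma gs_generic_left_act: "V \<in> unitary_group N \<Longrightarrow> gs_generic N (left_act N V x) \<longleftrightarrow> gs_generic N x"
  using gs_left_act[of V N _ x] by (auto simp: gs_generic_def)

lemma gs_matrix_left_act:
  assumes V: "V \<in> unitary_group N" and x: "gs_generic N x"
  shows "gs_matrix N (left_act N V x) = V * gs_matrix N x"
proof (rule eq_matI)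
  note Vc = unitary_carrier[OF V] and Gc = unitary_carrier[OF gs_matrix_unitary[of N x]]
  fix i j assume "i < dim_row (V * gs_matrix N x)" "j < dim_col (V * gs_matrix N x)"
  then have ij: "i < N" "j < N" using Vc Gc by auto
  have "(V * gs_matrix N x) $$ (i, j) = (\<Sum>k<N. V $$ (i, k) * gs_matrix N x $$ (k, j))"
    using ij by (intro index_mult_mat_sum[OF Vc Gc])
  also have "\<dots> = (\<Sum>k<N. V $$ (i, k) * gram_schmidt_col N x j k)"
    using x ij by (intro sum.cong) (auto simp: gs_matrix_def)
  also have "\<dots> = gs_matrix N (left_act N V x) $$ (i, j)"
    using gs_left_act[OF V ij(2), of x] x ij by (simp add: gs_matrix_def gs_generic_left_act[OF V])
  finally show "gs_matrix N (left_act N V x) $$ (i, j) = (V * gs_matrix N x) $$ (i, j)" ..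
qed (use unitary_carrier[OF V] unitary_carrier[OF gs_matrix_unitary, of N x] unitary_carrier[OF gs_matrix_unitary, of N "left_act N V x"] in auto)

text \<open>Column \<open>j\<close> itself enters with coefficient 1, so a vanishing residual is a
  nontrivial linear dependence between the columns, with the same coefficients in every row.\<close>

lemma gs_resid_span: "\<exists>e. \<forall>a. gs_resid N x j a = x (a, j) + (\<Sum>l<j. e l * x (a, l))"
proof (induction j rule: less_induct)
  case (less j)
  then obtain e where e: "gs_resid N x i a = x (a, i) + (\<Sum>l<i. e i l * x (a, l))" if "i < j" for i a
    by metis
  define e' where "e' i l = (if l = i then 1 else if l < i then e i l else 0) / of_real (gs_norm N x i)" for i l
  have g: "gram_schmidt_col N x i a = (\<Sum>l<j. e' i l * x (a, l))" if "i < j" for i a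
  proof -
    have "(\<Sum>l<j. e' i l * x (a, l)) = (\<Sum>l\<in>insert i {..<i}. e' i l * x (a, l))"
      using that by (intro sum.mono_neutral_right) (auto simp: e'_def)
    also have "\<dots> = (x (a, i) + (\<Sum>l<i. e i l * x (a, l))) / of_real (gs_norm N x i)"
      by (simp add: e'_def add_divide_distrib sum_divide_distrib)
    finally show ?thesis using e[OF that] by (simp add: gram_schmidt_col_eq)
  qed
  define c where "c i = (\<Sum>b<N. x (b, j) * cnj (gram_schmidt_col N x i b))" for i
  have "gs_resid N x j a = x (a, j) + (\<Sum>l<j. (- (\<Sum>i<j. c i * e' i l)) * x (a, l))" for a
  proof -
    have "(\<Sum>i<j. c i * gram_schmidt_col N x i a) = (\<Sum>i<j. \<Sum>l<j. c i * e' i l * x (a, l))"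
      by (intro sum.cong refl) (simp add: g sum_distrib_left mult.assoc)
    also have "\<dots> = (\<Sum>l<j. (\<Sum>i<j. c i * e' i l) * x (a, l))"
      unfolding sum_distrib_right by (rule sum.swap)
    finally show ?thesis
      unfolding gs_resid_def c_def[symmetric] by (simp add: sum_negf)
  qed
  then show ?case
    by (intro exI[of _ "\<lambda>l. - (\<Sum>i<j. c i * e' i l)"] allI)
qed

text \<open>Strict diagonal dominance: near a multiple of the identity no Gram--Schmidt pivot vanishes.\<close>

lemma gs_generic_near_scalar:
  assumes c: "0 < c" and x: "\<And>a b. a < N \<Longrightarrow> b < N \<Longrightarrow> cmod (x (a, b) - (if a = b then of_real c else 0)) < c / (2 * real N)"
  shows "gs_generic N x"
  unfolding gs_generic_def
proof (intro allI impI notI)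
  fix j assume j: "j < N" and "gs_norm N x j = 0"
  then have N: "N > 0" by simp
  have r0: "gs_resid N x j a = 0" if "a < N" for a
    using \<open>gs_norm N x j = 0\<close> that by (auto simp: gs_norm_def sum_nonneg_eq_0_iff)
  obtain e where e: "\<And>a. gs_resid N x j a = x (a, j) + (\<Sum>l<j. e l * x (a, l))"
    using gs_resid_span by metis
  define E where "E l = (if l = j then 1 else e l)" for l
  have E: "(\<Sum>l\<le>j. E l * x (a, l)) = 0" if "a < N" for a
    using e[of a] r0[OF that] by (simp add: E_def lessThan_Suc_atMost[symmetric] add.commute)
  \<comment> \<open>In a dependence, row \<open>p\<close> is read where the coefficient has largest
    modulus \<open>m\<close>: the diagonal contributes m c and the deviations from it at most half
    of that.\<close>
  define m where "m = Max ((\<lambda>l. cmod (E l)) ` {..j})"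
  have "m \<in> (\<lambda>l. cmod (E l)) ` {..j}" unfolding m_def by (rule Max_in) auto
  then obtain p where p: "p \<le> j" "m = cmod (E p)" by auto
  have m: "cmod (E l) \<le> m" if "l \<le> j" for l unfolding m_def using that by (intro Max_ge) auto
  have m1: "1 \<le> m" using m[of j] by (simp add: E_def)
  let ?d = "\<lambda>l. x (p, l) - (if p = l then of_real c else 0)"
  have pN: "p < N" using p j by simp
  have "0 = (\<Sum>l\<le>j. E l * (?d l + (if p = l then of_real c else 0)))" using E[OF pN] by simp
  also have "\<dots> = (\<Sum>l\<le>j. E l * ?d l) + (\<Sum>l\<le>j. E l * (if p = l then of_real c else 0))"
    by (simp only: distrib_left sum.distrib)
  also have "(\<Sum>l\<le>j. E l * (if p = l then of_real c else 0)) = E p * of_real c"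
    using p by (simp add: if_distrib cong: if_cong)
  finally have "E p * of_real c = - (\<Sum>l\<le>j. E l * ?d l)" by (simp add: eq_neg_iff_add_eq_0 add.commute)
  then have "cmod (E p * of_real c) = cmod (\<Sum>l\<le>j. E l * ?d l)" by simp
  also have "\<dots> \<le> (\<Sum>l\<le>j. cmod (E l * ?d l))" by (rule norm_sum)
  also have "\<dots> \<le> (\<Sum>l\<le>j. m * (c / (2 * real N)))"
  proof (rule sum_mono)
    fix l assume "l \<in> {..j}"
    then show "cmod (E l * ?d l) \<le> m * (c / (2 * real N))"
      unfolding norm_mult using m[of l] x[OF pN, of l] j m1 by (intro mult_mono) auto
  qed
  also have "\<dots> \<le> real N * (m * (c / (2 * real N)))"
  proof -
    have "(\<Sum>l\<le>j. m * (c / (2 * real N))) = real (Suc j) * (m * (c / (2 * real N)))"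
      by simp
    also have "\<dots> \<le> real N * (m * (c / (2 * real N)))"
      using j c m1 by (intro mult_right_mono mult_nonneg_nonneg) auto
    finally show ?thesis .
  qed
  also have "\<dots> = m * (c / 2)" using N by simp
  finally have "m * c \<le> m * (c / 2)" using c p by (simp add: norm_mult)
  then have "c \<le> c / 2" using m1 by (subst (asm) mult_le_cancel_left_pos) auto
  then show False using c by simp
qed

abbreviation gs_index :: "nat \<Rightarrow> (nat \<times> nat) set" where
  "gs_index N \<equiv> {..<N} \<times> {..<N}"

definition mat_lebesgue :: "nat \<Rightarrow> (nat \<times> nat \<Rightarrow> complex) measure" where
  "mat_lebesgue N = PiM (gs_index N) (\<lambda>_. lborel)"

lemma sets_mat_lebesgue: "sets (mat_lebesgue N) = sets (PiM (gs_index N) (\<lambda>_. borel))"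
  unfolding mat_lebesgue_def by (intro sets_PiM_cong) auto

lemma space_mat_lebesgue: "space (mat_lebesgue N) = (gs_index N) \<rightarrow>\<^sub>E UNIV"
  by (simp add: mat_lebesgue_def space_PiM)

lemma measurable_mat_lebesgue_component:
  assumes "p \<in> gs_index N"
  shows "(\<lambda>x. x p) \<in> borel_measurable (mat_lebesgue N)"
  using measurable_component_singleton[OF assms, of "\<lambda>_. lborel :: complex measure"] by (simp add: mat_lebesgue_def)

lemma measurable_mat_lebesgueI:
  assumes "\<And>p. p \<in> gs_index N \<Longrightarrow> (\<lambda>x. f x p) \<in> borel_measurable M"
  shows "(\<lambda>x. \<lambda>p\<in>gs_index N. f x p) \<in> M \<rightarrow>\<^sub>M mat_lebesgue N"
  unfolding mat_lebesgue_def using assms by (intro measurable_restrict) simp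

lemma gs_measurable:
  assumes "j < N"
  shows "(\<forall>a<N. (\<lambda>x. gram_schmidt_col N x j a) \<in> borel_measurable (mat_lebesgue N))
    \<and> (\<lambda>x. gs_norm N x j) \<in> borel_measurable (mat_lebesgue N)"
  using assms
proof (induction j rule: less_induct)
  case (less j)
  have IH: "(\<lambda>x. gram_schmidt_col N x i a) \<in> borel_measurable (mat_lebesgue N)" if "i < j" "a < N" for i a
    using less.IH[of i] that less.prems by auto
  have x: "(\<lambda>x. x (a, j)) \<in> borel_measurable (mat_lebesgue N)" if "a < N" for a
    using that less.prems by (intro measurable_mat_lebesgue_component) auto
  have cn: "(\<lambda>x. cnj (f x)) \<in> borel_measurable (mat_lebesgue N)" if "f \<in> borel_measurable (mat_lebesgue N)" for f
    using measurable_compose[OF that, of cnj borel] by (simp add: borel_measurable_continuous_onI continuous_on_cnj)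
  have r: "(\<lambda>x. gs_resid N x j a) \<in> borel_measurable (mat_lebesgue N)" if "a < N" for a
    unfolding gs_resid_def
    by (intro borel_measurable_diff borel_measurable_sum borel_measurable_times x cn IH that) auto
  have n: "(\<lambda>x. gs_norm N x j) \<in> borel_measurable (mat_lebesgue N)"
  proof -
    have [measurable]: "(\<lambda>x. \<Sum>c<N. (cmod (gs_resid N x j c))\<^sup>2) \<in> borel_measurable (mat_lebesgue N)"
      by (intro borel_measurable_sum borel_measurable_power measurable_compose[OF _ borel_measurable_norm] r) auto
    show ?thesis unfolding gs_norm_def by measurable
  qed
  moreover have "(\<lambda>x. gram_schmidt_col N x j a) \<in> borel_measurable (mat_lebesgue N)" if "a < N" for a
  proof -
    note [measurable] = r[OF that] n
    show ?thesis unfolding gram_schmidt_col_eq by measurable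
  qed
  ultimately show ?case by auto
qed

lemma gs_generic_measurable: "Measurable.pred (mat_lebesgue N) (gs_generic N)"
proof -
  have "Measurable.pred (mat_lebesgue N) (\<lambda>x. gs_norm N x j \<noteq> 0)" if "j \<in> {..<N}" for j
  proof -
    have [measurable]: "(\<lambda>x. gs_norm N x j) \<in> borel_measurable (mat_lebesgue N)" using gs_measurable that by auto
    show ?thesis by measurable
  qed
  then have "Measurable.pred (mat_lebesgue N) (\<lambda>x. \<forall>j\<in>{..<N}. gs_norm N x j \<noteq> 0)"
    by (intro pred_intros_finite) auto
  moreover have "gs_generic N = (\<lambda>x. \<forall>j\<in>{..<N}. gs_norm N x j \<noteq> 0)"
    by (rule ext) (simp only: gs_generic_def Ball_def lessThan_iff)
  ultimately show ?thesis by metis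
qed

lemma gs_matrix_measurable: "gs_matrix N \<in> mat_lebesgue N \<rightarrow>\<^sub>M unitary_borel N"
proof (rule measurable_unitary_borelI)
  show "gs_matrix N x \<in> unitary_group N" for x by (rule gs_matrix_unitary)
  fix i j assume ij: "i < N" "j < N"
  have [measurable]: "(\<lambda>x. gram_schmidt_col N x j i) \<in> borel_measurable (mat_lebesgue N)" "Measurable.pred (mat_lebesgue N) (gs_generic N)"
    using gs_measurable ij gs_generic_measurable by auto
  have "(\<lambda>x. if gs_generic N x then gram_schmidt_col N x j i else 1\<^sub>m N $$ (i, j)) \<in> borel_measurable (mat_lebesgue N)"
    by measurable
  moreover have "gs_matrix N x $$ (i, j) = (if gs_generic N x then gram_schmidt_col N x j i else 1\<^sub>m N $$ (i, j))" for x
    using ij by (simp add: gs_matrix_def)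
  ultimately show "(\<lambda>x. gs_matrix N x $$ (i, j)) \<in> borel_measurable (mat_lebesgue N)" by simp
qed

definition frob :: "nat \<Rightarrow> (nat \<times> nat \<Rightarrow> complex) \<Rightarrow> real" where
  "frob N x = (\<Sum>j<N. \<Sum>a<N. (cmod (x (a, j)))\<^sup>2)"

lemma frob_cong: "(\<And>p. p \<in> gs_index N \<Longrightarrow> x p = y p) \<Longrightarrow> frob N x = frob N y"
  unfolding frob_def by (intro sum.cong refl) auto

lemma frob_left_act:
  assumes V: "V \<in> unitary_group N"
  shows "frob N (left_act N V x) = frob N x"
  unfolding frob_def
proof (rule sum.cong[OF refl])
  fix j assume j: "j \<in> {..<N}"
  have "of_real (\<Sum>a<N. (cmod (left_act N V x (a, j)))\<^sup>2)
      = (\<Sum>a<N. (\<Sum>k<N. V $$ (a, k) * x (k, j)) * cnj (\<Sum>k<N. V $$ (a, k) * x (k, j)))"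
    unfolding of_real_sum complex_norm_square using j by (intro sum.cong refl) (simp add: left_act_def)
  also have "\<dots> = (\<Sum>k<N. x (k, j) * cnj (x (k, j)))"
    by (rule unitary_inner_product[OF V])
  also have "\<dots> = of_real (\<Sum>a<N. (cmod (x (a, j)))\<^sup>2)"
    by (simp only: of_real_sum complex_norm_square)
  finally show "(\<Sum>a<N. (cmod (left_act N V x (a, j)))\<^sup>2) = (\<Sum>a<N. (cmod (x (a, j)))\<^sup>2)"
    by (simp only: of_real_eq_iff)
qed

lemma left_act_measurable: "left_act N V \<in> mat_lebesgue N \<rightarrow>\<^sub>M mat_lebesgue N"
  unfolding left_act_def[abs_def]
  by (intro measurable_mat_lebesgueI borel_measurable_sum borel_measurable_times borel_measurable_const
      measurable_mat_lebesgue_component) auto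

lemma left_act_space: "left_act N V x \<in> space (mat_lebesgue N)"
  by (auto simp: left_act_def space_mat_lebesgue)

lemma left_act_inverse:
  assumes V: "V \<in> unitary_group N" and p: "p \<in> gs_index N"
  shows "left_act N V (left_act N (mat_adjoint V) x) p = x p"
proof -
  obtain a j where aj: "p = (a, j)" "a < N" "j < N" using p by auto
  have Va: "mat_adjoint V \<in> carrier_mat N N" using unitary_carrier[OF V] by simp
  have "left_act N V (left_act N (mat_adjoint V) x) p = (\<Sum>k<N. V $$ (a, k) * (\<Sum>l<N. mat_adjoint V $$ (k, l) * x (l, j)))"
    using aj by (simp add: left_act_def)
  also have "\<dots> = (\<Sum>l<N. (\<Sum>k<N. V $$ (a, k) * mat_adjoint V $$ (k, l)) * x (l, j))"
    unfolding sum_distrib_left sum_distrib_right by (subst sum.swap) (simp only: mult.assoc)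
  also have "\<dots> = (\<Sum>l<N. (V * mat_adjoint V) $$ (a, l) * x (l, j))"
    using aj by (intro sum.cong refl) (simp only: lessThan_iff index_mult_mat_sum[OF unitary_carrier[OF V] Va])
  also have "\<dots> = x (a, j)"
    using aj by (simp add: unitary_right[OF V] if_distrib[of "\<lambda>c. c * _"] cong: if_cong)
  finally show ?thesis using aj by simp
qed

lemma left_act_diff:
  "p \<in> gs_index N \<Longrightarrow> left_act N V (\<lambda>p\<in>gs_index N. x p - y p) p = left_act N V x p - left_act N V y p"
  by (auto simp: left_act_def right_diff_distrib sum_subtractf)

lemma left_act_add:
  "p \<in> gs_index N \<Longrightarrow> left_act N V (\<lambda>p\<in>gs_index N. x p + y p) p = left_act N V x p + left_act N V y p"
  by (auto simp: left_act_def distrib_left sum.distrib)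

lemma frob_measurable: "frob N \<in> borel_measurable (mat_lebesgue N)"
  unfolding frob_def[abs_def]
  by (intro borel_measurable_sum borel_measurable_power measurable_compose[OF _ borel_measurable_norm] measurable_mat_lebesgue_component) auto

text \<open>A left-invariant set of positive finite volume on which Gram-Schmidt is nondegenerate;
  normalized Lebesgue measure on it is the law that is pushed forward.\<close>

definition gs_domain :: "nat \<Rightarrow> (nat \<times> nat \<Rightarrow> complex) set" where
  "gs_domain N = {x \<in> space (mat_lebesgue N). frob N x < 1 \<and> gs_generic N x}"

lemma frob_ball_sets: "{x \<in> space (mat_lebesgue N). frob N x < 1} \<in> sets (mat_lebesgue N)"
proof -
  note [measurable] = frob_measurable[of N]
  show ?thesis by measurable
qed

lemma gs_domain_sets: "gs_domain N \<in> sets (mat_lebesgue N)"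
proof -
  note [measurable] = frob_measurable[of N] gs_generic_measurable[of N]
  show ?thesis unfolding gs_domain_def by measurable
qed

text \<open>A product of small discs around a scalar matrix lies inside the domain. With c = 1/(2 N)
  and radius c/(2 N), the diagonal adds at most 9/16 and the deviations at most 1/16 to the bound
  for the squared norm.\<close>

lemma gs_domain_pos: 
  assumes "N > 0"
  shows "emeasure (mat_lebesgue N) (gs_domain N) \<noteq> 0"
proof -
  interpret product_sigma_finite "\<lambda>_::nat \<times> nat. lborel :: complex measure" by standard
  define c where "c = 1 / (2 * real N)"
  define \<eta> where "\<eta> = c / (2 * real N)"
  have c: "0 < c" using assms by (simp add: c_def)
  have \<eta>: "0 < \<eta>" using c assms by (simp add: \<eta>_def)
  let ?o = "\<lambda>p::nat \<times> nat. if fst p = snd p then complex_of_real c else 0"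
  let ?B = "\<Pi>\<^sub>E p\<in>gs_index N. ball (?o p) \<eta>"
  have sub: "?B \<subseteq> gs_domain N"
  proof
    fix x assume x: "x \<in> ?B"
    have d: "cmod (x (a, b) - (if a = b then of_real c else 0)) < c / (2 * real N)" if "a < N" "b < N" for a b
    proof -
      have "x (a, b) \<in> ball (?o (a, b)) \<eta>" using x that by (intro PiE_mem[OF x]) auto
      then show ?thesis by (simp add: dist_norm norm_minus_commute \<eta>_def)
    qed
    have "gs_generic N x" by (rule gs_generic_near_scalar[OF c d])
    moreover have "frob N x < 1"
    proof -
      have le: "(cmod (x (a, j)))\<^sup>2 \<le> (if a = j then (c + \<eta>)\<^sup>2 else 0) + \<eta>\<^sup>2" if "a < N" "j < N" for a j
      proof (cases "a = j")
        case True
        have "cmod (x (a, j)) \<le> cmod (x (a, j) - of_real c) + cmod (of_real c)" by (metis diff_add_cancel norm_triangle_ineq)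
        also have "\<dots> \<le> c + \<eta>" using d[OF that] True c by (simp add: \<eta>_def)
        finally have "(cmod (x (a, j)))\<^sup>2 \<le> (c + \<eta>)\<^sup>2" by (intro power_mono) auto
        then show ?thesis using True by (simp add: add_increasing2)
      next
        case False
        then have "cmod (x (a, j)) \<le> \<eta>" using d[OF that] by (simp add: \<eta>_def)
        then show ?thesis using False by (simp add: power_mono)
      qed
      have "frob N x \<le> (\<Sum>j<N. \<Sum>a<N. (if a = j then (c + \<eta>)\<^sup>2 else 0) + \<eta>\<^sup>2)"
        unfolding frob_def by (intro sum_mono le) simp_all
      also have "\<dots> = real N * (c + \<eta>)\<^sup>2 + real N * (real N * \<eta>\<^sup>2)"
        by (simp add: sum.distrib distrib_left)
      also have "\<dots> < 1"
      proof -
        have n: "1 \<le> real N" using assms by simp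
        have ec: "real N * c = 1 / 2" using assms by (simp add: c_def)
        have e\<eta>: "real N * \<eta> = c / 2" using assms by (simp add: \<eta>_def)
        have c2: "c \<le> 1 / 2"
          unfolding c_def using n by (intro frac_le) auto
        have "c / (2 * real N) \<le> c / 2"
          using n c by (intro divide_left_mono) auto
        then have \<eta>2: "\<eta> \<le> c / 2" by (simp add: \<eta>_def)
        have "real N * (c + \<eta>)\<^sup>2 = (real N * c + real N * \<eta>) * (c + \<eta>)"
          by (simp add: power2_eq_square algebra_simps)
        also have "\<dots> = (1 / 2 + c / 2) * (c + \<eta>)" unfolding ec e\<eta> ..
        also have "\<dots> \<le> (3 / 4) * (3 / 4)"
        proof (rule mult_mono)
          show "1 / 2 + c / 2 \<le> 3 / 4" "c + \<eta> \<le> 3 / 4" "0 \<le> c + \<eta>"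
            using c2 \<eta>2 c \<eta> by argo+
        qed simp
        finally have 1: "real N * (c + \<eta>)\<^sup>2 \<le> 9 / 16" by simp
        have "real N * (real N * \<eta>\<^sup>2) = (real N * \<eta>)\<^sup>2" by (simp add: power2_eq_square)
        also have "\<dots> \<le> (1 / 4)\<^sup>2" unfolding e\<eta> using c c2 by (intro power_mono) argo+
        also have "\<dots> = 1 / 16" by (simp add: power2_eq_square)
        finally show ?thesis using 1 by simp
      qed
      finally show ?thesis .
    qed
    moreover have "x \<in> space (mat_lebesgue N)" using x by (auto simp: space_mat_lebesgue PiE_iff)
    ultimately show "x \<in> gs_domain N" by (simp add: gs_domain_def)
  qed
  have "emeasure (mat_lebesgue N) ?B = (\<Prod>p\<in>gs_index N. emeasure lborel (ball (?o p) \<eta>))"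
    unfolding mat_lebesgue_def by (intro emeasure_PiM) auto
  also have "\<dots> \<noteq> 0"
  proof -
    have "emeasure lborel (ball (?o p) \<eta>) \<noteq> 0" for p
      using \<eta> open_not_negligible[of "ball (?o p) \<eta>"] by (auto simp: negligible_iff_null_sets null_sets_def)
    then show ?thesis by simp
  qed
  finally show ?thesis
    using emeasure_mono[OF sub gs_domain_sets] by auto
qed

lemma frob_ball_finite: "emeasure (mat_lebesgue N) {x \<in> space (mat_lebesgue N). frob N x < 1} \<noteq> \<infinity>"
proof -
  interpret product_sigma_finite "\<lambda>_::nat \<times> nat. lborel :: complex measure" by standard
  let ?B = "\<Pi>\<^sub>E p\<in>gs_index N. ball (0::complex) 1"
  have sub: "{x \<in> space (mat_lebesgue N). frob N x < 1} \<subseteq> ?B"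
  proof
    fix x assume "x \<in> {x \<in> space (mat_lebesgue N). frob N x < 1}"
    then have x: "x \<in> gs_index N \<rightarrow>\<^sub>E UNIV" "frob N x < 1" by (auto simp: space_mat_lebesgue)
    have "cmod (x (a, j)) < 1" if "a < N" "j < N" for a j
    proof -
      have "(cmod (x (a, j)))\<^sup>2 \<le> (\<Sum>a<N. (cmod (x (a, j)))\<^sup>2)"
        using that by (intro member_le_sum) auto
      also have "\<dots> \<le> frob N x"
        unfolding frob_def using that
        by (intro member_le_sum[of j "{..<N}" "\<lambda>j. \<Sum>a<N. (cmod (x (a, j)))\<^sup>2"]) (auto intro: sum_nonneg)
      finally have "(cmod (x (a, j)))\<^sup>2 < 1\<^sup>2" using x by simp
      then show ?thesis by (rule power2_less_imp_less) simp
    qed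
    then show "x \<in> ?B" using x(1) by (auto simp: PiE_iff)
  qed
  have "emeasure (mat_lebesgue N) {x \<in> space (mat_lebesgue N). frob N x < 1} \<le> emeasure (mat_lebesgue N) ?B"
    by (intro emeasure_mono sub) (auto simp: mat_lebesgue_def intro!: sets_PiM_I_finite)
  also have "\<dots> = (\<Prod>p\<in>gs_index N. emeasure lborel (ball (0::complex) 1))"
    unfolding mat_lebesgue_def by (intro emeasure_PiM) auto
  also have "\<dots> < \<infinity>"
    using emeasure_lborel_ball_finite[of "0::complex" 1]
    by (simp add: less_top[symmetric] power_eq_top_ennreal)
  finally show ?thesis by simp
qed

text \<open>The isometry argument again, now on functions restricted to the index set with pointwise
  addition and subtraction; the radial function is the indicator of the Frobenius ball.\<close>

lemma nn_integral_mat_lebesgue_left_act: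
  assumes N: "N > 0" and V: "V \<in> unitary_group N" and g: "g \<in> borel_measurable (mat_lebesgue N)"
  shows "(\<integral>\<^sup>+x. g (left_act N V x) \<partial>mat_lebesgue N) = (\<integral>\<^sup>+x. g x \<partial>mat_lebesgue N)"
proof -
  interpret p: product_sigma_finite "\<lambda>_::nat \<times> nat. lborel :: complex measure" by standard
  let ?add = "\<lambda>x y. \<lambda>p\<in>gs_index N. x p + y p :: complex" and ?sub = "\<lambda>x y. \<lambda>p\<in>gs_index N. x p - y p :: complex"
  let ?F = "{x \<in> space (mat_lebesgue N). frob N x < 1}"
  have sps: "?sub x y \<in> space (mat_lebesgue N)" for x y
    by (auto simp: space_mat_lebesgue)
  have comp: "(\<lambda>z. fst z p) \<in> borel_measurable (mat_lebesgue N \<Otimes>\<^sub>M mat_lebesgue N)"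
     "(\<lambda>z. snd z p) \<in> borel_measurable (mat_lebesgue N \<Otimes>\<^sub>M mat_lebesgue N)" if "p \<in> gs_index N" for p
    using measurable_compose[OF measurable_fst measurable_mat_lebesgue_component[OF that]]
      measurable_compose[OF measurable_snd measurable_mat_lebesgue_component[OF that]] by auto
  have tr: "(\<integral>\<^sup>+y. h (?add y x) \<partial>mat_lebesgue N) = (\<integral>\<^sup>+y. h y \<partial>mat_lebesgue N)"
    if "h \<in> borel_measurable (mat_lebesgue N)" for h x
    using nn_integral_PiM_lborel_translate[of "gs_index N" h x] that
    by (simp add: mat_lebesgue_def[symmetric] measurable_cong_sets[OF sets_mat_lebesgue refl])
  show ?thesis
  proof (rule nn_integral_isometry_invariant[where V = "left_act N V" and V' = "left_act N (mat_adjoint V)"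
        and add = ?add and sub = ?sub and f = "indicator ?F"])
    show "sigma_finite_measure (mat_lebesgue N)" unfolding mat_lebesgue_def by (rule p.sigma_finite) simp
    show "(\<lambda>(x, y). ?add x y) \<in> mat_lebesgue N \<Otimes>\<^sub>M mat_lebesgue N \<rightarrow>\<^sub>M mat_lebesgue N"
      unfolding split_beta' by (intro measurable_mat_lebesgueI borel_measurable_add comp)
    show "(\<lambda>(x, y). ?sub x y) \<in> mat_lebesgue N \<Otimes>\<^sub>M mat_lebesgue N \<rightarrow>\<^sub>M mat_lebesgue N"
      unfolding split_beta' by (intro measurable_mat_lebesgueI borel_measurable_diff comp)
    show "(\<integral>\<^sup>+y. h (?add y x) \<partial>mat_lebesgue N) = (\<integral>\<^sup>+y. h y \<partial>mat_lebesgue N)"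
      if "h \<in> borel_measurable (mat_lebesgue N)" for h x by (rule tr[OF that])
    show "(\<integral>\<^sup>+y. h (?sub y x) \<partial>mat_lebesgue N) = (\<integral>\<^sup>+y. h y \<partial>mat_lebesgue N)"
      if "h \<in> borel_measurable (mat_lebesgue N)" for h x using tr[OF that, of "\<lambda>p. - x p"] by simp
    show "left_act N V (?add y (left_act N (mat_adjoint V) x)) = ?add (left_act N V y) x" for x y
    proof
      fix p
      show "left_act N V (?add y (left_act N (mat_adjoint V) x)) p = ?add (left_act N V y) x p"
      proof (cases "p \<in> gs_index N")
        case True
        then show ?thesis by (simp only: left_act_add[OF True] left_act_inverse[OF V True] restrict_apply if_True)
      qed (simp add: left_act_def)
    qed
    show "?add v (?sub x v) = x" if "x \<in> space (mat_lebesgue N)" for x v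
      using that by (auto simp: space_mat_lebesgue PiE_iff extensional_def)
    show "indicator ?F (?sub x (left_act N V y)) = (indicator ?F (?sub y (left_act N (mat_adjoint V) x)) :: ennreal)" for x y
    proof -
      have "frob N (?sub y (left_act N (mat_adjoint V) x)) = frob N (left_act N V (?sub y (left_act N (mat_adjoint V) x)))"
        by (rule frob_left_act[OF V, symmetric])
      also have "\<dots> = frob N (\<lambda>p. left_act N V y p - x p)"
        by (rule frob_cong) (simp only: left_act_diff left_act_inverse[OF V])
      also have "\<dots> = frob N (?sub x (left_act N V y))"
        unfolding frob_def by (intro sum.cong refl) (auto simp: norm_minus_commute)
      finally show ?thesis using sps by (simp add: indicator_def)
    qed
    have sub: "gs_domain N \<subseteq> ?F" by (auto simp: gs_domain_def)
    have "emeasure (mat_lebesgue N) ?F \<noteq> 0"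
      using gs_domain_pos[OF N] emeasure_mono[OF sub frob_ball_sets] by auto
    then show "(\<integral>\<^sup>+x. indicator ?F x \<partial>mat_lebesgue N) \<noteq> 0"
      using frob_ball_sets by simp
    show "(\<integral>\<^sup>+x. indicator ?F x \<partial>mat_lebesgue N) \<noteq> \<infinity>"
      using frob_ball_finite frob_ball_sets by simp
    show "indicator ?F \<in> borel_measurable (mat_lebesgue N)"
      by (rule borel_measurable_indicator[OF frob_ball_sets])
  qed (auto intro: left_act_measurable g)
qed

text \<open>Gram-Schmidt intertwines left multiplication on matrices with left multiplication on the
  unitary group, and both the domain and Lebesgue measure are invariant, so the image law is
  invariant too.\<close>

lemma haar_exists:
  assumes N: "N > 0"
  shows "\<exists>H. is_haar_unitary N H"
proof -
  let ?M = "mat_lebesgue N" and ?D = "gs_domain N"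
  let ?c = "emeasure ?M ?D"
  have c0: "?c \<noteq> 0" by (rule gs_domain_pos[OF N])
  have "?c \<le> emeasure ?M {x \<in> space ?M. frob N x < 1}"
    by (rule emeasure_mono[OF _ frob_ball_sets]) (auto simp: gs_domain_def)
  then have cf: "?c \<noteq> \<infinity>" using frob_ball_finite[of N] by (auto simp: top_unique)
  define H where "H = distr (uniform_measure ?M ?D) (unitary_borel N) (gs_matrix N)"
  have m: "gs_matrix N \<in> uniform_measure ?M ?D \<rightarrow>\<^sub>M unitary_borel N"
    using gs_matrix_measurable by (simp add: measurable_cong_sets[OF sets_uniform_measure refl])
  interpret U: prob_space "uniform_measure ?M ?D"
    by (rule prob_space_uniform_measure[OF c0 cf])
  have eH: "emeasure H A = (\<integral>\<^sup>+x. indicator A (gs_matrix N x) * indicator ?D x \<partial>?M) / ?c" if A: "A \<in> sets (unitary_borel N)" for A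
  proof -
    have "emeasure H A = (\<integral>\<^sup>+x. indicator A (gs_matrix N x) \<partial>uniform_measure ?M ?D)"
      unfolding H_def by (rule emeasure_distr_nn_integral[OF m A])
    also have "\<dots> = (\<integral>\<^sup>+x. indicator A (gs_matrix N x) * indicator ?D x \<partial>?M) / ?c"
      by (intro nn_integral_uniform_measure gs_domain_sets measurable_compose[OF gs_matrix_measurable] borel_measurable_indicator A)
    finally show ?thesis .
  qed
  have "is_haar_unitary N H"
    unfolding is_haar_unitary_def
  proof (intro conjI ballI)
    show "prob_space H" unfolding H_def by (rule U.prob_space_distr[OF m])
    show sH: "sets H = sets (restrict_space (mat_borel N) (unitary_group N))"
      by (simp add: H_def unitary_borel_def)
    have sH': "sets H = sets (unitary_borel N)" by (simp add: H_def)
    fix V assume V: "V \<in> unitary_group N"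
    have mV: "(\<lambda>U. V * U) \<in> H \<rightarrow>\<^sub>M H"
      unfolding measurable_cong_sets[OF sH' sH']
      by (intro measurable_unitary_mult measurable_const measurable_ident_sets[OF refl]) (simp_all add: V)
    show "distr H H (\<lambda>U. V * U) = H"
    proof (rule measure_eqI)
      fix A assume "A \<in> sets (distr H H (\<lambda>U. V * U))"
      then have A: "A \<in> sets (unitary_borel N)" by (simp add: sH')
      let ?A = "(\<lambda>U. V * U) -` A \<inter> space H"
      have spH: "space H = unitary_group N" by (simp add: H_def)
      have A': "?A \<in> sets (unitary_borel N)"
        using measurable_sets[OF mV, of A] A by (simp add: sH')
      have "emeasure (distr H H (\<lambda>U. V * U)) A = emeasure H ?A"
        using A by (intro emeasure_distr mV) (simp add: sH')
      also have "\<dots> = (\<integral>\<^sup>+x. indicator ?A (gs_matrix N x) * indicator ?D x \<partial>?M) / ?c"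
        by (rule eH[OF A'])
      \<comment> \<open>Equality holds pointwise: equivariance on the domain, and both indicators of
        the domain vanish outside it.\<close>
      also have "(\<integral>\<^sup>+x. indicator ?A (gs_matrix N x) * indicator ?D x \<partial>?M)
          = (\<integral>\<^sup>+x. indicator A (gs_matrix N (left_act N V x)) * indicator ?D (left_act N V x) \<partial>?M)"
      proof (rule nn_integral_cong)
        fix x assume x: "x \<in> space ?M"
        have D: "left_act N V x \<in> ?D \<longleftrightarrow> x \<in> ?D"
          using x by (simp add: gs_domain_def frob_left_act[OF V] gs_generic_left_act[OF V] left_act_space)
        show "(indicator ?A (gs_matrix N x) * indicator ?D x :: ennreal)
            = indicator A (gs_matrix N (left_act N V x)) * indicator ?D (left_act N V x)"
        proof (cases "x \<in> ?D")
          case True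
          then have "gs_matrix N (left_act N V x) = V * gs_matrix N x"
            by (intro gs_matrix_left_act[OF V]) (simp add: gs_domain_def)
          then show ?thesis using D True gs_matrix_unitary[of N x] by (simp add: indicator_def spH)
        qed (simp add: D)
      qed
      also have "\<dots> = (\<integral>\<^sup>+x. indicator A (gs_matrix N x) * indicator ?D x \<partial>?M)"
        by (rule nn_integral_mat_lebesgue_left_act[OF N V, of "\<lambda>x. indicator A (gs_matrix N x) * indicator ?D x"])
          (intro borel_measurable_times_ennreal measurable_compose[OF gs_matrix_measurable] borel_measurable_indicator A gs_domain_sets)
      also have "\<dots> / ?c = emeasure H A" by (rule eH[OF A, symmetric])
      finally show "emeasure (distr H H (\<lambda>U. V * U)) A = emeasure H A" .
    qed simp
  qed
  then show ?thesis ..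
qed

lemma is_haar_haar_unitary:
  assumes "N > 0"
  shows "is_haar_unitary N (haar_unitary N)"
proof -
  obtain H where H: "is_haar_unitary N H" using haar_exists[OF assms] by blast
  have "haar_unitary N = H"
    unfolding haar_unitary_def by (rule the_equality, rule H, rule haar_unique[OF _ H])
  then show ?thesis using H by simp
qed

subsection \<open>The heat kernel measure as an image of a product of probability measures\<close>

definition hk_weight :: "nat \<Rightarrow> real \<Rightarrow> (nat \<Rightarrow> real) \<Rightarrow> real" where
  "hk_weight N T l = vandermonde N l * vandermonde N (\<lambda>j. exp (l j)) * exp (- (1 / (4 * T)) * (\<Sum>j<N. (l j)\<^sup>2))"

definition hk_mass :: "nat \<Rightarrow> real \<Rightarrow> ennreal" where
  "hk_mass N T = (\<integral>\<^sup>+l. ennreal (hk_weight N T l) \<partial>delta_sum N)"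

definition hk_radial :: "nat \<Rightarrow> real \<Rightarrow> (nat \<Rightarrow> real) measure" where
  "hk_radial N T = density (delta_sum N) (\<lambda>l. ennreal (hk_weight N T l) / hk_mass N T)"

definition hk_matrix :: "nat \<Rightarrow> (nat \<Rightarrow> real) \<times> complex mat \<Rightarrow> complex mat" where
  "hk_matrix N = (\<lambda>(l, U). mat_adjoint U * mat_diag N (\<lambda>j. complex_of_real (exp (l j))) * U)"

lemma hk_weight_measurable: "hk_weight N T \<in> borel_measurable (delta_sum N)"
  unfolding hk_weight_def[abs_def] by (rule measurable_delta_sum) measurable

lemma sets_hk_radial: "sets (hk_radial N T) = sets (delta_sum N)"
  by (simp add: hk_radial_def)

lemma space_hk_radial: "space (hk_radial N T) = {l \<in> {..<N} \<rightarrow>\<^sub>E UNIV. (\<Sum>j<N. l j) = 0}"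
  by (simp add: hk_radial_def space_delta_sum)

lemma hk_weight_hyperplane:
  assumes "(\<Sum>j<N. l j) = 0"
  shows "vdm_weight N l * exp (- (1 / (4 * T)) * (\<Sum>j<N. (l j)\<^sup>2)) = hk_weight N T l"
  using assms by (simp add: vdm_weight_def hk_weight_def)

text \<open>The constant \<open>K\<close> does not depend on \<open>h\<close>, so normalized
  expectations under the eigenvalue law are quotients of integrals over the Gaussian
  product.\<close>

lemma nn_integral_gauss_prod_weight:
  assumes "N > 0" "T > 0"
  obtains K where "K > 0"
    "\<And>h. h \<in> borel_measurable (PiM {..<N} (\<lambda>_. borel)) \<Longrightarrow> (\<And>y. 0 \<le> h y) \<Longrightarrow>
       (\<And>y c. h (\<lambda>j\<in>{..<N}. y j + c) = h y) \<Longrightarrow>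
       (\<integral>\<^sup>+y. ennreal (h y * vdm_weight N y) \<partial>gauss_prod N T)
         = ennreal K * (\<integral>\<^sup>+l. ennreal (h l) * ennreal (hk_weight N T l) \<partial>delta_sum N)"
proof -
  obtain K where K: "K > 0" "\<And>h. h \<in> borel_measurable (PiM {..<N} (\<lambda>_. borel)) \<Longrightarrow>
       (\<And>y c. h (\<lambda>j\<in>{..<N}. y j + c) = h y) \<Longrightarrow>
       (\<integral>\<^sup>+y. h y \<partial>gauss_prod N T)
         = ennreal K * (\<integral>\<^sup>+l. h l * ennreal (exp (- (1 / (4 * T)) * (\<Sum>j<N. (l j)\<^sup>2))) \<partial>delta_sum N)"
    using nn_integral_gauss_prod_hyperplane[OF assms] by blast
  show ?thesis
  proof (rule that[OF K(1)])
    fix h :: "(nat \<Rightarrow> real) \<Rightarrow> real"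
    assume h [measurable]: "h \<in> borel_measurable (PiM {..<N} (\<lambda>_. borel))" and h0: "\<And>y. 0 \<le> h y"
      and inv: "\<And>y c. h (\<lambda>j\<in>{..<N}. y j + c) = h y"
    have vinv: "vdm_weight N (\<lambda>j\<in>{..<N}. y j + c) = vdm_weight N y" for y c
    proof -
      have "vdm_weight N (\<lambda>j\<in>{..<N}. y j + c) = vdm_weight N (\<lambda>j. y j + c)"
        by (rule vdm_weight_cong) simp
      then show ?thesis by (simp add: vdm_weight_translate)
    qed
    have "(\<integral>\<^sup>+y. ennreal (h y * vdm_weight N y) \<partial>gauss_prod N T)
       = ennreal K * (\<integral>\<^sup>+l. ennreal (h l * vdm_weight N l) * ennreal (exp (- (1 / (4 * T)) * (\<Sum>j<N. (l j)\<^sup>2))) \<partial>delta_sum N)"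
      by (rule K(2)) (measurable, simp only: inv vinv)
    also have "(\<integral>\<^sup>+l. ennreal (h l * vdm_weight N l) * ennreal (exp (- (1 / (4 * T)) * (\<Sum>j<N. (l j)\<^sup>2))) \<partial>delta_sum N)
        = (\<integral>\<^sup>+l. ennreal (h l) * ennreal (hk_weight N T l) \<partial>delta_sum N)"
    proof (rule nn_integral_cong)
      fix l assume "l \<in> space (delta_sum N)"
      then have l: "(\<Sum>j<N. l j) = 0" by (simp add: space_delta_sum)
      have "ennreal (h l * vdm_weight N l) * ennreal (exp (- (1 / (4 * T)) * (\<Sum>j<N. (l j)\<^sup>2)))
          = ennreal (h l) * ennreal (vdm_weight N l * exp (- (1 / (4 * T)) * (\<Sum>j<N. (l j)\<^sup>2)))"
        by (simp only: ennreal_mult h0 vdm_weight_nonneg exp_ge_zero mult_nonneg_nonneg mult.assoc)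
      then show "ennreal (h l * vdm_weight N l) * ennreal (exp (- (1 / (4 * T)) * (\<Sum>j<N. (l j)\<^sup>2)))
          = ennreal (h l) * ennreal (hk_weight N T l)"
        unfolding hk_weight_hyperplane[OF l] .
    qed
    finally show "(\<integral>\<^sup>+y. ennreal (h y * vdm_weight N y) \<partial>gauss_prod N T)
         = ennreal K * (\<integral>\<^sup>+l. ennreal (h l) * ennreal (hk_weight N T l) \<partial>delta_sum N)" .
  qed
qed

lemma vandermonde_weyl_pos: "T > 0 \<Longrightarrow> 0 < vandermonde N (\<lambda>i. 2 * T * weyl N i)"
  unfolding vandermonde_def by (intro prod_pos) (auto simp: weyl_def)

lemma nn_integral_vdm_weight:
  assumes "T > 0"
  shows "(\<integral>\<^sup>+y. ennreal (vdm_weight N y) \<partial>gauss_prod N T) \<noteq> 0" "(\<integral>\<^sup>+y. ennreal (vdm_weight N y) \<partial>gauss_prod N T) \<noteq> \<infinity>"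
proof -
  have "(\<integral>\<^sup>+y. ennreal (vdm_weight N y) \<partial>gauss_prod N T)
      = ennreal (fact N * (\<Prod>i<N. exp (T * (weyl N i)\<^sup>2)) * vandermonde N (\<lambda>i. 2 * T * weyl N i))"
    using vdm_weight_has_integral[OF assms(1), of N]
    by (simp add: has_bochner_integral_iff nn_integral_eq_integral vdm_weight_nonneg)
  moreover have "0 < fact N * (\<Prod>i<N. exp (T * (weyl N i)\<^sup>2)) * vandermonde N (\<lambda>i. 2 * T * weyl N i)"
    using vandermonde_weyl_pos[OF assms, of N] by (intro mult_pos_pos prod_pos) auto
  ultimately show "(\<integral>\<^sup>+y. ennreal (vdm_weight N y) \<partial>gauss_prod N T) \<noteq> 0" "(\<integral>\<^sup>+y. ennreal (vdm_weight N y) \<partial>gauss_prod N T) \<noteq> \<infinity>"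
    by (simp_all del: ennreal_eq_0_iff add: ennreal_eq_0_iff not_le)
qed

lemma hk_mass_pos_finite:
  assumes "N > 0" "T > 0"
  shows "hk_mass N T \<noteq> 0" "hk_mass N T \<noteq> \<infinity>"
proof -
  obtain K where K: "K > 0"
    "\<And>h. h \<in> borel_measurable (PiM {..<N} (\<lambda>_. borel)) \<Longrightarrow> (\<And>y. 0 \<le> h y) \<Longrightarrow>
       (\<And>y c. h (\<lambda>j\<in>{..<N}. y j + c) = h y) \<Longrightarrow>
       (\<integral>\<^sup>+y. ennreal (h y * vdm_weight N y) \<partial>gauss_prod N T)
         = ennreal K * (\<integral>\<^sup>+l. ennreal (h l) * ennreal (hk_weight N T l) \<partial>delta_sum N)"
    using nn_integral_gauss_prod_weight[OF assms] by blast
  have "(\<integral>\<^sup>+y. ennreal (vdm_weight N y) \<partial>gauss_prod N T) = ennreal K * hk_mass N T"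
    using K(2)[of "\<lambda>_. 1"] by (simp add: hk_mass_def)
  then show "hk_mass N T \<noteq> 0" "hk_mass N T \<noteq> \<infinity>"
    using nn_integral_vdm_weight[OF assms(2), of N] K(1) by (auto simp: ennreal_mult_eq_top_iff)
qed

lemma nn_integral_hk_radial:
  assumes "f \<in> borel_measurable (delta_sum N)"
  shows "(\<integral>\<^sup>+l. f l \<partial>hk_radial N T) = (\<integral>\<^sup>+l. f l * ennreal (hk_weight N T l) \<partial>delta_sum N) / hk_mass N T"
proof -
  have [measurable]: "hk_weight N T \<in> borel_measurable (delta_sum N)" "f \<in> borel_measurable (delta_sum N)"
    using hk_weight_measurable assms by auto
  have "(\<integral>\<^sup>+l. f l \<partial>hk_radial N T) = (\<integral>\<^sup>+l. ennreal (hk_weight N T l) / hk_mass N T * f l \<partial>delta_sum N)"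
    unfolding hk_radial_def by (rule nn_integral_density) auto
  also have "\<dots> = (\<integral>\<^sup>+l. f l * ennreal (hk_weight N T l) / hk_mass N T \<partial>delta_sum N)"
    by (simp add: divide_ennreal_def mult_ac)
  also have "\<dots> = (\<integral>\<^sup>+l. f l * ennreal (hk_weight N T l) \<partial>delta_sum N) / hk_mass N T"
    by (rule nn_integral_divide) measurable
  finally show ?thesis .
qed

lemma prob_hk_radial:
  assumes "N > 0" "T > 0"
  shows "prob_space (hk_radial N T)"
proof (rule prob_spaceI)
  have "emeasure (hk_radial N T) (space (hk_radial N T)) = (\<integral>\<^sup>+l. 1 \<partial>hk_radial N T)" by simp
  also have "\<dots> = hk_mass N T / hk_mass N T"
    by (subst nn_integral_hk_radial) (simp_all add: hk_mass_def)
  also have "\<dots> = 1" using hk_mass_pos_finite[OF assms] by (intro ennreal_divide_self) (auto simp: less_top)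
  finally show "emeasure (hk_radial N T) (space (hk_radial N T)) = 1" .
qed

lemma top_gap_factor_cong: "(\<And>i. i < N \<Longrightarrow> y i = y' i) \<Longrightarrow> N \<ge> 2 \<Longrightarrow> top_gap_factor N y = top_gap_factor N y'"
proof -
  assume e: "\<And>i. i < N \<Longrightarrow> y i = y' i" and N: "N \<ge> 2"
  have "(indicator (chamber N) (\<lambda>i. y (\<sigma> i)) :: real) * exp (- (y (\<sigma> (N - 1)) - y (\<sigma> (N - 2))) / 2)
     = indicator (chamber N) (\<lambda>i. y' (\<sigma> i)) * exp (- (y' (\<sigma> (N - 1)) - y' (\<sigma> (N - 2))) / 2)"
    if "\<sigma> permutes {..<N}" for \<sigma>
  proof -
    have s: "\<sigma> i < N" if "i < N" for i using permutes_in_image[OF \<open>\<sigma> permutes {..<N}\<close>, of i] that by simp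
    have "(\<lambda>i. y (\<sigma> i)) \<in> chamber N \<longleftrightarrow> (\<lambda>i. y' (\<sigma> i)) \<in> chamber N"
      by (rule chamber_cong) (simp add: e s)
    then show ?thesis using e[OF s[of "N - 1"]] e[OF s[of "N - 2"]] N by (simp add: indicator_def)
  qed
  then show ?thesis unfolding top_gap_factor_def by (intro sum.cong) auto
qed

lemma top_gap_factor_nonneg: "0 \<le> top_gap_factor N y"
  unfolding top_gap_factor_def by (intro sum_nonneg) auto

lemma top_gap_factor_translate:
  assumes "N \<ge> 2"
  shows "top_gap_factor N (\<lambda>j\<in>{..<N}. y j + c) = top_gap_factor N y"
proof -
  have "top_gap_factor N (\<lambda>j\<in>{..<N}. y j + c) = top_gap_factor N (\<lambda>j. y j + c)"
    by (rule top_gap_factor_cong) (use assms in auto)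
  also have "\<dots> = top_gap_factor N y"
    by (simp add: top_gap_factor_def chamber_def indicator_def)
  finally show ?thesis .
qed

lemma top_gap_factor_measurable:
  assumes "N \<ge> 2"
  shows "top_gap_factor N \<in> borel_measurable (PiM {..<N} (\<lambda>_. borel))"
  unfolding top_gap_factor_def[abs_def]
proof (rule borel_measurable_sum)
  fix \<sigma> assume "\<sigma> \<in> {\<sigma>. \<sigma> permutes {..<N}}"
  then have s: "\<sigma> \<in> {..<N} \<rightarrow> {..<N}" by (simp add: permutes_imp_bij bij_betw_imp_funcset)
  have m: "(\<lambda>y. \<lambda>i\<in>{..<N}. y (\<sigma> i)) \<in> PiM {..<N} (\<lambda>_. borel) \<rightarrow>\<^sub>M PiM {..<N} (\<lambda>_. borel :: real measure)"
    using s by (intro measurable_restrict measurable_component_singleton) auto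
  have "Measurable.pred (PiM {..<N} (\<lambda>_. borel)) (\<lambda>y :: nat \<Rightarrow> real. y \<in> chamber N)"
    using chamber_measurable[of N] by (simp add: pred_def)
  from measurable_compose[OF m this] have "Measurable.pred (PiM {..<N} (\<lambda>_. borel)) (\<lambda>y :: nat \<Rightarrow> real. (\<lambda>i\<in>{..<N}. y (\<sigma> i)) \<in> chamber N)" .
  moreover have "(\<lambda>i\<in>{..<N}. y (\<sigma> i)) \<in> chamber N \<longleftrightarrow> (\<lambda>i. y (\<sigma> i)) \<in> chamber N" for y :: "nat \<Rightarrow> real"
    by (rule chamber_cong) simp
  ultimately have [measurable]: "Measurable.pred (PiM {..<N} (\<lambda>_. borel)) (\<lambda>y :: nat \<Rightarrow> real. (\<lambda>i. y (\<sigma> i)) \<in> chamber N)" by simp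
  have "\<sigma> (N - 1) \<in> {..<N}" "\<sigma> (N - 2) \<in> {..<N}" using s assms by auto
  then have [measurable]: "(\<lambda>y. y (\<sigma> (N - 1))) \<in> borel_measurable (PiM {..<N} (\<lambda>_. borel :: real measure))"
      "(\<lambda>y. y (\<sigma> (N - 2))) \<in> borel_measurable (PiM {..<N} (\<lambda>_. borel :: real measure))"
    by (auto intro!: measurable_component_singleton)
  show "(\<lambda>y. indicator (chamber N) (\<lambda>i. y (\<sigma> i)) * exp (- (y (\<sigma> (N - 1)) - y (\<sigma> (N - 2))) / 2)) \<in> borel_measurable (PiM {..<N} (\<lambda>_. borel))"
    unfolding indicator_def by measurable
qed

text \<open>The Gaussian estimate is transferred by applying the previous identity once to the gap
  factor and once to the constant 1; \<open>K\<close> cancels.\<close>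

lemma hk_radial_top_gap:
  assumes "N \<ge> 2" "T > 0"
  shows "(\<integral>\<^sup>+l. ennreal (top_gap_factor N l) \<partial>hk_radial N T) \<le> ennreal (exp (real N / T - T / 2))"
proof -
  have N: "N > 0" using assms by simp
  obtain K where K: "K > 0"
    "\<And>h. h \<in> borel_measurable (PiM {..<N} (\<lambda>_. borel)) \<Longrightarrow> (\<And>y. 0 \<le> h y) \<Longrightarrow>
       (\<And>y c. h (\<lambda>j\<in>{..<N}. y j + c) = h y) \<Longrightarrow>
       (\<integral>\<^sup>+y. ennreal (h y * vdm_weight N y) \<partial>gauss_prod N T)
         = ennreal K * (\<integral>\<^sup>+l. ennreal (h l) * ennreal (hk_weight N T l) \<partial>delta_sum N)"
    using nn_integral_gauss_prod_weight[OF N assms(2)] by blast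
  let ?E = "ennreal (exp (real N / T - T / 2))"
  note m = hk_mass_pos_finite[OF N assms(2)]
  have 1: "(\<integral>\<^sup>+y. ennreal (vdm_weight N y) \<partial>gauss_prod N T) = ennreal K * hk_mass N T"
    using K(2)[of "\<lambda>_. 1"] by (simp add: hk_mass_def)
  have 2: "(\<integral>\<^sup>+y. ennreal (top_gap_factor N y * vdm_weight N y) \<partial>gauss_prod N T)
     = ennreal K * (\<integral>\<^sup>+l. ennreal (top_gap_factor N l) * ennreal (hk_weight N T l) \<partial>delta_sum N)"
    by (rule K(2)) (simp_all add: top_gap_factor_measurable[OF assms(1)] top_gap_factor_nonneg top_gap_factor_translate[OF assms(1)])
  have "ennreal K * (\<integral>\<^sup>+l. ennreal (top_gap_factor N l) * ennreal (hk_weight N T l) \<partial>delta_sum N) \<le> ennreal K * (?E * hk_mass N T)"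
    using top_gap_bound[OF assms(2,1)] unfolding 1 2 by (simp only: mult.left_commute)
  then have le: "(\<integral>\<^sup>+l. ennreal (top_gap_factor N l) * ennreal (hk_weight N T l) \<partial>delta_sum N) \<le> ?E * hk_mass N T"
    using K(1) by (subst (asm) ennreal_mult_le_mult_iff) auto
  have "(\<integral>\<^sup>+l. ennreal (top_gap_factor N l) \<partial>hk_radial N T)
      = (\<integral>\<^sup>+l. ennreal (top_gap_factor N l) * ennreal (hk_weight N T l) \<partial>delta_sum N) / hk_mass N T"
    by (intro nn_integral_hk_radial measurable_delta_sum measurable_compose[OF top_gap_factor_measurable[OF assms(1)] measurable_ennreal])
  also have "\<dots> \<le> ?E * hk_mass N T / hk_mass N T"
    by (rule divide_right_mono_ennreal[OF le])
  also have "\<dots> = ?E"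
    using m by (simp add: ennreal_mult_divide_eq)
  finally show ?thesis .
qed

text \<open>The sum of squares is not translation invariant. It is replaced by the sum of squared
  deviations from the mean, which is invariant, agrees with it on the hyperplane, and is at most the
  sum of squares elsewhere.\<close>

lemma hk_radial_second_moment:
  assumes "N > 0" "T > 0"
  shows "(\<integral>\<^sup>+l. ennreal (\<Sum>j<N. (l j)\<^sup>2) \<partial>hk_radial N T) < \<infinity>"
proof -
  obtain K where K: "K > 0"
    "\<And>h. h \<in> borel_measurable (PiM {..<N} (\<lambda>_. borel)) \<Longrightarrow> (\<And>y. 0 \<le> h y) \<Longrightarrow>
       (\<And>y c. h (\<lambda>j\<in>{..<N}. y j + c) = h y) \<Longrightarrow>
       (\<integral>\<^sup>+y. ennreal (h y * vdm_weight N y) \<partial>gauss_prod N T)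
         = ennreal K * (\<integral>\<^sup>+l. ennreal (h l) * ennreal (hk_weight N T l) \<partial>delta_sum N)"
    using nn_integral_gauss_prod_weight[OF assms] by blast
  define h where "h y = (\<Sum>j<N. (y j - (\<Sum>i<N. y i) / real N)\<^sup>2)" for y :: "nat \<Rightarrow> real"
  have hm: "h \<in> borel_measurable (PiM {..<N} (\<lambda>_. borel))" unfolding h_def[abs_def] by measurable
  have h0: "0 \<le> h y" for y unfolding h_def by (intro sum_nonneg) auto
  have hinv: "h (\<lambda>j\<in>{..<N}. y j + c) = h y" for y c
    using assms(1) by (simp add: h_def sum.distrib add_divide_distrib)
  have hle: "h y \<le> (\<Sum>j<N. (y j)\<^sup>2)" for y
  proof -
    define m where "m = (\<Sum>i<N. y i) / real N"
    have sm: "(\<Sum>j<N. y j) = real N * m" using assms(1) by (simp add: m_def)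
    have "h y = (\<Sum>j<N. (y j)\<^sup>2 - 2 * m * y j + m\<^sup>2)"
      unfolding h_def m_def[symmetric] by (intro sum.cong refl) (simp add: power2_diff)
    also have "\<dots> = (\<Sum>j<N. (y j)\<^sup>2) - 2 * m * (\<Sum>j<N. y j) + real N * m\<^sup>2"
      by (simp only: sum.distrib sum_subtractf sum_distrib_left[symmetric]) simp
    also have "\<dots> = (\<Sum>j<N. (y j)\<^sup>2) - real N * m\<^sup>2"
      unfolding sm by (simp add: power2_eq_square algebra_simps)
    finally show ?thesis by simp
  qed
  have "integrable (gauss_prod N T) (\<lambda>y. \<Sum>j<N. (y j)\<^sup>2 * vdm_weight N y)"
    using vdm_weight_second_moment_integrable[OF assms(2)] by (intro Bochner_Integration.integrable_sum) auto
  then have i: "integrable (gauss_prod N T) (\<lambda>y. (\<Sum>j<N. (y j)\<^sup>2) * vdm_weight N y)"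
    by (simp add: sum_distrib_right)
  have "ennreal K * (\<integral>\<^sup>+l. ennreal (h l) * ennreal (hk_weight N T l) \<partial>delta_sum N) = (\<integral>\<^sup>+y. ennreal (h y * vdm_weight N y) \<partial>gauss_prod N T)"
    by (rule K(2)[symmetric, OF hm h0 hinv])
  also have "\<dots> \<le> (\<integral>\<^sup>+y. ennreal ((\<Sum>j<N. (y j)\<^sup>2) * vdm_weight N y) \<partial>gauss_prod N T)"
    by (intro nn_integral_mono ennreal_leI mult_right_mono hle vdm_weight_nonneg)
  also have "\<dots> = ennreal (\<integral>y. (\<Sum>j<N. (y j)\<^sup>2) * vdm_weight N y \<partial>gauss_prod N T)"
    by (intro nn_integral_eq_integral i AE_I2 mult_nonneg_nonneg sum_nonneg vdm_weight_nonneg) simp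
  also have "\<dots> < \<infinity>" by simp
  finally have fin: "(\<integral>\<^sup>+l. ennreal (h l) * ennreal (hk_weight N T l) \<partial>delta_sum N) < \<infinity>"
    using K(1) by (auto simp: ennreal_mult_less_top)
  have circle_mean: "(\<lambda>l. ennreal (\<Sum>j<N. (l j)\<^sup>2)) \<in> borel_measurable (delta_sum N)"
    by (rule measurable_delta_sum) measurable
  have "(\<integral>\<^sup>+l. ennreal (\<Sum>j<N. (l j)\<^sup>2) * ennreal (hk_weight N T l) \<partial>delta_sum N) = (\<integral>\<^sup>+l. ennreal (h l) * ennreal (hk_weight N T l) \<partial>delta_sum N)"
    by (intro nn_integral_cong) (simp add: space_delta_sum h_def)
  then show ?thesis
    unfolding nn_integral_hk_radial[OF circle_mean]
    using fin hk_mass_pos_finite[OF assms] by (simp add: ennreal_divide_eq_top_iff less_top[symmetric])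
qed

section \<open>The quadratic form in spectral coordinates\<close>

text \<open>The value of the form of U^* e^\<Lambda> U at a vector, diagonalized by
  \<open>U\<close>. Vectors are functions on the naturals, so that no dimension has to be carried
  along.\<close>

definition quadf :: "nat \<Rightarrow> (nat \<Rightarrow> real) \<Rightarrow> complex mat \<Rightarrow> (nat \<Rightarrow> complex) \<Rightarrow> real" where
  "quadf N l U f = (\<Sum>k<N. exp (l k) * (cmod (\<Sum>j<N. U $$ (k, j) * f j))\<^sup>2)"

lemma index_hk_matrix:
  assumes U: "U \<in> carrier_mat N N" and ij: "i < N" "j < N"
  shows "hk_matrix N (l, U) $$ (i, j) = (\<Sum>k<N. cnj (U $$ (k, i)) * complex_of_real (exp (l k)) * U $$ (k, j))"
proof -
  let ?D = "mat_diag N (\<lambda>j. complex_of_real (exp (l j)))"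
  have D: "?D \<in> carrier_mat N N" by simp
  have Ua: "mat_adjoint U \<in> carrier_mat N N" using U by simp
  have 1: "(mat_adjoint U * ?D) $$ (i, k) = cnj (U $$ (k, i)) * complex_of_real (exp (l k))" if "k < N" for k
  proof -
    have "(mat_adjoint U * ?D) $$ (i, k) = (\<Sum>m<N. mat_adjoint U $$ (i, m) * ?D $$ (m, k))"
      by (rule index_mult_mat_sum[OF Ua D ij(1) that])
    also have "\<dots> = (\<Sum>m<N. if m = k then mat_adjoint U $$ (i, m) * complex_of_real (exp (l k)) else 0)"
      using that by (intro sum.cong) (auto simp: mat_diag_def)
    also have "\<dots> = cnj (U $$ (k, i)) * complex_of_real (exp (l k))"
      using that by (simp add: index_mat_adjoint[OF U ij(1) that])
    finally show ?thesis .
  qed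
  have "hk_matrix N (l, U) $$ (i, j) = (\<Sum>k<N. (mat_adjoint U * ?D) $$ (i, k) * U $$ (k, j))"
    unfolding hk_matrix_def prod.case by (rule index_mult_mat_sum[OF mult_carrier_mat[OF Ua D] U ij])
  also have "\<dots> = (\<Sum>k<N. cnj (U $$ (k, i)) * complex_of_real (exp (l k)) * U $$ (k, j))"
    using 1 by (intro sum.cong) auto
  finally show ?thesis .
qed

lemma hk_matrix_carrier: "U \<in> carrier_mat N N \<Longrightarrow> hk_matrix N (l, U) \<in> carrier_mat N N"
  by (auto simp: hk_matrix_def)

lemma quad_form_hk_matrix:
  assumes U: "U \<in> carrier_mat N N" and v: "v \<in> carrier_vec N"
  shows "(hk_matrix N (l, U) *\<^sub>v v) \<bullet>c v = complex_of_real (quadf N l U (vec_index v))"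
proof -
  let ?P = "hk_matrix N (l, U)" and ?f = "vec_index v"
  have P: "?P \<in> carrier_mat N N" using U by (rule hk_matrix_carrier)
  have "(?P *\<^sub>v v) \<bullet>c v = (\<Sum>i<N. (\<Sum>j<N. ?P $$ (i, j) * ?f j) * cnj (?f i))"
    using P v by (auto simp: scalar_prod_def atLeast0LessThan intro!: sum.cong)
  also have "\<dots> = (\<Sum>i<N. \<Sum>j<N. \<Sum>k<N. (complex_of_real (exp (l k)) * (U $$ (k, j) * ?f j)) * cnj (U $$ (k, i) * ?f i))"
    unfolding sum_distrib_right
    by (intro sum.cong refl) (simp add: index_hk_matrix[OF U] sum_distrib_right sum_distrib_left mult_ac)
  also have "\<dots> = (\<Sum>i<N. \<Sum>k<N. \<Sum>j<N. (complex_of_real (exp (l k)) * (U $$ (k, j) * ?f j)) * cnj (U $$ (k, i) * ?f i))"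
    by (intro sum.cong refl sum.swap)
  also have "\<dots> = (\<Sum>k<N. \<Sum>i<N. \<Sum>j<N. (complex_of_real (exp (l k)) * (U $$ (k, j) * ?f j)) * cnj (U $$ (k, i) * ?f i))"
    by (rule sum.swap)
  also have "\<dots> = (\<Sum>k<N. complex_of_real (exp (l k)) * ((\<Sum>j<N. U $$ (k, j) * ?f j) * cnj (\<Sum>i<N. U $$ (k, i) * ?f i)))"
  proof (rule sum.cong[OF refl])
    fix k
    let ?a = "\<lambda>j. U $$ (k, j) * ?f j"
    have "(\<Sum>i<N. \<Sum>j<N. (complex_of_real (exp (l k)) * ?a j) * cnj (?a i)) = (\<Sum>j<N. \<Sum>i<N. complex_of_real (exp (l k)) * (?a j * cnj (?a i)))"
      by (subst sum.swap) (simp only: mult.assoc)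
    also have "\<dots> = complex_of_real (exp (l k)) * ((\<Sum>j<N. ?a j) * cnj (\<Sum>i<N. ?a i))"
    proof -
      have "(\<Sum>j<N. ?a j) * cnj (\<Sum>i<N. ?a i) = (\<Sum>j<N. \<Sum>i<N. ?a j * cnj (?a i))"
        by (simp only: cnj_sum sum_product)
      then show ?thesis by (simp only: sum_distrib_left)
    qed
    finally show "(\<Sum>i<N. \<Sum>j<N. (complex_of_real (exp (l k)) * ?a j) * cnj (?a i))
        = complex_of_real (exp (l k)) * ((\<Sum>j<N. ?a j) * cnj (\<Sum>i<N. ?a i))" .
  qed
  also have "\<dots> = complex_of_real (quadf N l U ?f)"
    unfolding quadf_def of_real_sum of_real_mult complex_norm_square ..
  finally show ?thesis .
qed

lemma unitary_norm:
  assumes "U \<in> unitary_group N"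
  shows "(\<Sum>k<N. (cmod (\<Sum>j<N. U $$ (k, j) * f j))\<^sup>2) = (\<Sum>j<N. (cmod (f j))\<^sup>2)"
proof -
  have "complex_of_real (\<Sum>k<N. (cmod (\<Sum>j<N. U $$ (k, j) * f j))\<^sup>2) = complex_of_real (\<Sum>j<N. (cmod (f j))\<^sup>2)"
    unfolding of_real_sum complex_norm_square by (rule unitary_inner_product[OF assms])
  then show ?thesis by (simp only: of_real_eq_iff)
qed

text \<open>The form is a weighted mean of the numbers exp(l k) with weights of sum 1, hence lies
  between exp(-s) and exp(s), where s is the Euclidean norm of \<open>l\<close> and bounds each
  entry.\<close>

lemma quadf_bounds:
  assumes U: "U \<in> unitary_group N" and f: "(\<Sum>j<N. (cmod (f j))\<^sup>2) = 1"
  shows "0 < quadf N l U f" "(ln (quadf N l U f))\<^sup>2 \<le> (\<Sum>j<N. (l j)\<^sup>2)"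
proof -
  let ?S = "\<Sum>j<N. (l j)\<^sup>2"
  define s where "s = sqrt ?S"
  have S0: "0 \<le> ?S" by (intro sum_nonneg) auto
  have ab: "\<bar>l k\<bar> \<le> s" if "k < N" for k
  proof -
    have "(l k)\<^sup>2 \<le> ?S" using that by (intro member_le_sum) auto
    then show ?thesis unfolding s_def by (metis real_sqrt_abs real_sqrt_le_mono)
  qed
  have n: "(\<Sum>k<N. (cmod (\<Sum>j<N. U $$ (k, j) * f j))\<^sup>2) = 1" using unitary_norm[OF U, of f] f by simp
  have lo: "exp (- s) \<le> quadf N l U f"
  proof -
    have "exp (- s) * (\<Sum>k<N. (cmod (\<Sum>j<N. U $$ (k, j) * f j))\<^sup>2) \<le> quadf N l U f"
      unfolding quadf_def sum_distrib_left using ab by (intro sum_mono mult_right_mono) (auto simp: abs_le_iff, smt (verit))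
    then show ?thesis using n by simp
  qed
  have hi: "quadf N l U f \<le> exp s"
  proof -
    have "quadf N l U f \<le> exp s * (\<Sum>k<N. (cmod (\<Sum>j<N. U $$ (k, j) * f j))\<^sup>2)"
      unfolding quadf_def sum_distrib_left using ab by (intro sum_mono mult_right_mono) (auto simp: abs_le_iff)
    then show ?thesis using n by simp
  qed
  show pos: "0 < quadf N l U f" using lo exp_gt_zero[of "- s"] by linarith
  have "\<bar>ln (quadf N l U f)\<bar> \<le> s"
    using lo hi pos by (simp add: abs_le_iff ln_ge_iff) (metis exp_le_cancel_iff exp_ln minus_le_iff)
  then have "(ln (quadf N l U f))\<^sup>2 \<le> s\<^sup>2" by (rule power2_le_iff_abs_le[THEN iffD2, rotated]) (simp add: s_def S0)
  then show "(ln (quadf N l U f))\<^sup>2 \<le> ?S" by (simp add: s_def S0)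
qed

lemma hk_matrix_SL_SU:
  assumes l: "(\<Sum>j<N. l j) = 0" and U: "U \<in> unitary_group N"
  shows "hk_matrix N (l, U) \<in> SL_SU N"
proof -
  note Uc = unitary_carrier[OF U]
  let ?P = "hk_matrix N (l, U)" and ?D = "mat_diag N (\<lambda>j. complex_of_real (exp (l j)))"
  have P: "?P \<in> carrier_mat N N" using Uc by (rule hk_matrix_carrier)
  have "mat_adjoint ?P = ?P"
    by (rule eq_matI) (use P in \<open>auto simp: index_mat_adjoint[OF P] index_hk_matrix[OF Uc] mult_ac intro!: sum.cong\<close>)
  moreover have "Determinant.det ?P = 1"
  proof -
    have Ua: "mat_adjoint U \<in> carrier_mat N N" and D: "?D \<in> carrier_mat N N" using Uc by auto
    have "Determinant.det ?P = Determinant.det (mat_adjoint U) * Determinant.det ?D * Determinant.det U"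
      unfolding hk_matrix_def prod.case
      using det_mult[OF mult_carrier_mat[OF Ua D] Uc] det_mult[OF Ua D] by simp
    also have "\<dots> = Determinant.det ?D * (Determinant.det (mat_adjoint U) * Determinant.det U)" by (simp only: mult_ac)
    also have "Determinant.det (mat_adjoint U) * Determinant.det U = Determinant.det (mat_adjoint U * U)"
      by (rule det_mult[OF Ua Uc, symmetric])
    also have "\<dots> = 1" by (simp add: unitary_left[OF U])
    also have "Determinant.det ?D = prod_list (diag_mat ?D)"
      by (rule det_upper_triangular[OF _ D]) (auto simp: upper_triangular_def mat_diag_def)
    also have "\<dots> = (\<Prod>j<N. complex_of_real (exp (l j)))"
      by (auto simp: diag_mat_def mat_diag_def prod.list_conv_set_nth atLeast0LessThan intro!: prod.cong)
    also have "\<dots> = complex_of_real (exp (\<Sum>j<N. l j))"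
      unfolding exp_sum[OF finite_lessThan] of_real_prod ..
    finally show ?thesis using l by simp
  qed
  moreover have "0 < Re ((?P *\<^sub>v v) \<bullet>c v)" if v: "v \<in> carrier_vec N" "v \<noteq> 0\<^sub>v N" for v
  proof -
    let ?n = "\<Sum>j<N. (cmod (vec_index v j))\<^sup>2"
    obtain i where i: "i < N" "vec_index v i \<noteq> 0" using v by (metis carrier_vecD eq_vecI index_zero_vec)
    have "0 < (cmod (vec_index v i))\<^sup>2" using i by simp
    also have "\<dots> \<le> ?n" using i by (intro member_le_sum) auto
    also have "?n = (\<Sum>k<N. (cmod (\<Sum>j<N. U $$ (k, j) * vec_index v j))\<^sup>2)"
      by (rule unitary_norm[OF U, symmetric])
    finally have pos: "0 < (\<Sum>k<N. (cmod (\<Sum>j<N. U $$ (k, j) * vec_index v j))\<^sup>2)" .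
    then obtain k where k: "k < N" "0 < (cmod (\<Sum>j<N. U $$ (k, j) * vec_index v j))\<^sup>2"
      by (metis (no_types, lifting) lessThan_iff not_less sum_nonpos)
    have "0 < exp (l k) * (cmod (\<Sum>j<N. U $$ (k, j) * vec_index v j))\<^sup>2" using k by simp
    also have "\<dots> \<le> quadf N l U (vec_index v)"
      unfolding quadf_def using k by (intro member_le_sum[of k "{..<N}" "\<lambda>k. exp (l k) * (cmod (\<Sum>j<N. U $$ (k, j) * vec_index v j))\<^sup>2"]) auto
    finally show ?thesis by (simp add: quad_form_hk_matrix[OF Uc v(1)])
  qed
  ultimately show ?thesis using P by (simp add: SL_SU_def)
qed

lemma quad_hk_matrix:
  assumes "U \<in> carrier_mat N N" "v \<in> carrier_vec N"
  shows "quad (hk_matrix N (l, U)) v = quadf N l U (vec_index v)"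
  unfolding quad_def quad_form_hk_matrix[OF assms] by simp

definition hk_prod :: "nat \<Rightarrow> real \<Rightarrow> ((nat \<Rightarrow> real) \<times> complex mat) measure" where
  "hk_prod N T = hk_radial N T \<Otimes>\<^sub>M haar_unitary N"

lemma sets_haar: "N > 0 \<Longrightarrow> sets (haar_unitary N) = sets (unitary_borel N)"
  using is_haar_unitaryD[OF is_haar_haar_unitary] by auto

lemma space_haar: "N > 0 \<Longrightarrow> space (haar_unitary N) = unitary_group N"
  using is_haar_unitaryD[OF is_haar_haar_unitary] by auto

lemma prob_haar: "N > 0 \<Longrightarrow> prob_space (haar_unitary N)"
  using is_haar_unitaryD[OF is_haar_haar_unitary] by auto

lemma space_hk_prod:
  "N > 0 \<Longrightarrow> space (hk_prod N T) = {l \<in> {..<N} \<rightarrow>\<^sub>E UNIV. (\<Sum>j<N. l j) = 0} \<times> unitary_group N"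
  by (simp add: hk_prod_def space_pair_measure space_hk_radial space_haar)

lemma measurable_hk_prod_fst:
  assumes "N > 0" "j < N"
  shows "(\<lambda>x. fst x j) \<in> borel_measurable (hk_prod N T)"
proof -
  have "(\<lambda>l. l j) \<in> borel_measurable (hk_radial N T)"
    unfolding measurable_cong_sets[OF sets_hk_radial refl]
    by (rule measurable_delta_sum) (use assms in \<open>auto intro!: measurable_component_singleton\<close>)
  from measurable_compose[OF measurable_fst this] show ?thesis by (simp add: hk_prod_def)
qed

lemma measurable_hk_prod_snd:
  assumes "N > 0"
  shows "snd \<in> hk_prod N T \<rightarrow>\<^sub>M unitary_borel N"
  using measurable_snd[of "hk_radial N T" "haar_unitary N"]
  by (simp add: hk_prod_def measurable_cong_sets[OF refl sets_haar[OF assms]])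

lemma measurable_hk_prod_entry:
  assumes "N > 0" "i < N" "j < N"
  shows "(\<lambda>x. snd x $$ (i, j)) \<in> borel_measurable (hk_prod N T)"
  by (rule measurable_unitary_entry[OF assms(2,3) measurable_hk_prod_snd[OF assms(1)]])

lemma prob_hk_prod:
  assumes "N > 0" "T > 0"
  shows "prob_space (hk_prod N T)"
  unfolding hk_prod_def by (intro prob_space_pair prob_hk_radial prob_haar assms)

definition hk_space :: "nat \<Rightarrow> complex mat measure" where
  "hk_space N = restrict_space (mat_borel N) (SL_SU N)"

lemma hk_matrix_measurable:
  assumes "N > 0" and s: "sets M = sets (hk_prod N T)"
  shows "hk_matrix N \<in> M \<rightarrow>\<^sub>M hk_space N"
  unfolding hk_space_def measurable_cong_sets[OF s refl]
proof (rule measurable_restrict_space2)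
  show "hk_matrix N \<in> space (hk_prod N T) \<rightarrow> SL_SU N"
    by (auto simp: space_hk_prod[OF assms(1)] intro: hk_matrix_SL_SU)
  show "hk_matrix N \<in> hk_prod N T \<rightarrow>\<^sub>M mat_borel N"
  proof (rule measurable_mat_borelI)
    show "hk_matrix N x \<in> carrier_mat N N" if "x \<in> space (hk_prod N T)" for x
      using that by (cases x) (auto simp: space_hk_prod[OF assms(1)] intro: hk_matrix_carrier unitary_carrier)
    fix i j assume ij: "i < N" "j < N"
    have cn: "(\<lambda>x. cnj (f x)) \<in> borel_measurable (hk_prod N T)" if "f \<in> borel_measurable (hk_prod N T)" for f
      using measurable_compose[OF that, of cnj borel] by (simp add: borel_measurable_continuous_onI continuous_on_cnj)
    have ex: "(\<lambda>x. complex_of_real (exp (fst x k))) \<in> borel_measurable (hk_prod N T)" if "k < N" for k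
    proof -
      note [measurable] = measurable_hk_prod_fst[OF assms(1) that, of T]
      show ?thesis by measurable
    qed
    have "(\<lambda>x. \<Sum>k<N. cnj (snd x $$ (k, i)) * complex_of_real (exp (fst x k)) * snd x $$ (k, j)) \<in> borel_measurable (hk_prod N T)"
      using ij assms(1) by (intro borel_measurable_sum borel_measurable_times cn ex measurable_hk_prod_entry) auto
    moreover have "(\<Sum>k<N. cnj (snd x $$ (k, i)) * complex_of_real (exp (fst x k)) * snd x $$ (k, j)) = hk_matrix N x $$ (i, j)"
      if "x \<in> space (hk_prod N T)" for x
    proof -
      have "snd x \<in> unitary_group N" using that unfolding space_hk_prod[OF assms(1)] by (simp add: mem_Times_iff)
      then have "snd x \<in> carrier_mat N N" by (rule unitary_carrier)
      from index_hk_matrix[OF this ij, of "fst x"] show ?thesis by simp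
    qed
    ultimately show "(\<lambda>x. hk_matrix N x $$ (i, j)) \<in> borel_measurable (hk_prod N T)"
      by (rule measurable_cong[THEN iffD1, rotated])
  qed
qed

text \<open>Haar measure has mass 1, so the total mass of the unnormalized measure is that of the
  eigenvalue density, and normalizing the eigenvalues first gives the same measure. Expectations
  then become integrals over a product of two probability spaces.\<close>

lemma heat_kernel_measure_eq:
  assumes N: "N > 0" and T: "T > 0"
  shows "heat_kernel_measure N T = distr (hk_prod N T) (hk_space N) (hk_matrix N)"
proof -
  interpret H: prob_space "haar_unitary N" by (rule prob_haar[OF N])
  let ?Q = "density (delta_sum N) (\<lambda>l. ennreal (hk_weight N T l)) \<Otimes>\<^sub>M haar_unitary N"
  let ?M = "heat_kernel_unnormalized N T"
  note m = hk_mass_pos_finite[OF N T]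
  have M: "?M = distr ?Q (hk_space N) (hk_matrix N)"
    by (simp add: heat_kernel_unnormalized_def hk_weight_def hk_space_def hk_matrix_def)
  have sQ: "sets ?Q = sets (hk_prod N T)"
    unfolding hk_prod_def by (intro sets_pair_measure_cong) (simp_all add: sets_hk_radial)
  have mQ: "hk_matrix N \<in> ?Q \<rightarrow>\<^sub>M hk_space N" by (rule hk_matrix_measurable[OF N sQ])
  have mX: "hk_matrix N \<in> hk_prod N T \<rightarrow>\<^sub>M hk_space N" by (rule hk_matrix_measurable[OF N refl])
  have sec: "(\<lambda>l. emeasure (haar_unitary N) (Pair l -` B)) \<in> borel_measurable (delta_sum N)" if "B \<in> sets (hk_prod N T)" for B
  proof -
    have "B \<in> sets (delta_sum N \<Otimes>\<^sub>M haar_unitary N)"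
      using that unfolding hk_prod_def by (metis sets_pair_measure_cong sets_hk_radial)
    then show ?thesis by (rule H.measurable_emeasure_Pair)
  qed
  have eQ: "emeasure ?Q B = (\<integral>\<^sup>+l. emeasure (haar_unitary N) (Pair l -` B) * ennreal (hk_weight N T l) \<partial>delta_sum N)" if B: "B \<in> sets (hk_prod N T)" for B
  proof -
    have "emeasure ?Q B = (\<integral>\<^sup>+l. emeasure (haar_unitary N) (Pair l -` B) \<partial>density (delta_sum N) (\<lambda>l. ennreal (hk_weight N T l)))"
      using B sQ by (intro H.emeasure_pair_measure_alt) simp
    also have "\<dots> = (\<integral>\<^sup>+l. ennreal (hk_weight N T l) * emeasure (haar_unitary N) (Pair l -` B) \<partial>delta_sum N)"
      using hk_weight_measurable[of N T] by (intro nn_integral_density sec[OF B]) auto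
    finally show ?thesis by (simp only: mult.commute)
  qed
  have eX: "emeasure (hk_prod N T) B = emeasure ?Q B / hk_mass N T" if B: "B \<in> sets (hk_prod N T)" for B
  proof -
    have "emeasure (hk_prod N T) B = (\<integral>\<^sup>+l. emeasure (haar_unitary N) (Pair l -` B) \<partial>hk_radial N T)"
      using B unfolding hk_prod_def by (intro H.emeasure_pair_measure_alt) simp
    then show ?thesis unfolding eQ[OF B] using nn_integral_hk_radial[OF sec[OF B]] by simp
  qed
  have eM: "emeasure ?M A = hk_mass N T * emeasure (distr (hk_prod N T) (hk_space N) (hk_matrix N)) A" if A: "A \<in> sets (hk_space N)" for A
  proof -
    let ?B = "hk_matrix N -` A \<inter> space (hk_prod N T)"
    have B: "?B \<in> sets (hk_prod N T)" by (rule measurable_sets[OF mX A])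
    have sp: "space ?Q = space (hk_prod N T)" by (rule sets_eq_imp_space_eq[OF sQ])
    have "emeasure ?M A = emeasure ?Q ?B"
      unfolding M using emeasure_distr[OF mQ A] by (simp only: sp)
    also have "\<dots> = hk_mass N T * (emeasure ?Q ?B / hk_mass N T)"
    proof -
      have "hk_mass N T * (emeasure ?Q ?B / hk_mass N T) = emeasure ?Q ?B * hk_mass N T / hk_mass N T"
        by (simp only: ennreal_times_divide mult.commute)
      also have "\<dots> = emeasure ?Q ?B" using m by (intro ennreal_mult_divide_eq) auto
      finally show ?thesis ..
    qed
    also have "\<dots> = hk_mass N T * emeasure (distr (hk_prod N T) (hk_space N) (hk_matrix N)) A"
      unfolding emeasure_distr[OF mX A] eX[OF B] ..
    finally show ?thesis .
  qed
  interpret X: prob_space "hk_prod N T" by (rule prob_hk_prod[OF N T])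
  interpret D: prob_space "distr (hk_prod N T) (hk_space N) (hk_matrix N)" by (rule X.prob_space_distr[OF mX])
  have tot: "emeasure ?M (space ?M) = hk_mass N T"
    using eM[of "space (hk_space N)"] D.emeasure_space_1 by (simp add: M)
  show ?thesis
  proof (rule measure_eqI)
    show "sets (heat_kernel_measure N T) = sets (distr (hk_prod N T) (hk_space N) (hk_matrix N))"
      by (simp add: heat_kernel_measure_def Let_def M)
    fix A assume "A \<in> sets (heat_kernel_measure N T)"
    then have A: "A \<in> sets (hk_space N)" by (simp add: heat_kernel_measure_def Let_def M)
    have "emeasure (heat_kernel_measure N T) A = 1 / hk_mass N T * emeasure ?M A"
      unfolding heat_kernel_measure_def Let_def tot by simp
    also have "\<dots> = emeasure (distr (hk_prod N T) (hk_space N) (hk_matrix N)) A"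
    proof -
      have "1 / hk_mass N T * hk_mass N T = hk_mass N T / hk_mass N T"
        by (simp add: divide_ennreal_def mult.commute)
      also have "\<dots> = 1" using m by (intro ennreal_divide_self) (auto simp: less_top)
      finally show ?thesis unfolding eM[OF A] mult.assoc[symmetric] by simp
    qed
    finally show "emeasure (heat_kernel_measure N T) A = emeasure (distr (hk_prod N T) (hk_space N) (hk_matrix N)) A" .
  qed
qed

section \<open>Unitary invariance of the correlation of two logarithms\<close>

definition mat_act :: "nat \<Rightarrow> complex mat \<Rightarrow> (nat \<Rightarrow> complex) \<Rightarrow> nat \<Rightarrow> complex" where
  "mat_act N W f k = (\<Sum>j<N. W $$ (k, j) * f j)"

text \<open>The expectation behind the variance term, for arbitrary vectors and on the product space
  of eigenvalues and unitary matrices.\<close>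

definition corr :: "nat \<Rightarrow> real \<Rightarrow> (nat \<Rightarrow> complex) \<Rightarrow> (nat \<Rightarrow> complex) \<Rightarrow> real" where
  "corr N T f g = (\<integral>x. ln (quadf N (fst x) (snd x) f) * ln (quadf N (fst x) (snd x) g) \<partial>hk_prod N T)"

lemma quadf_cong: "(\<And>j. j < N \<Longrightarrow> f j = g j) \<Longrightarrow> quadf N l U f = quadf N l U g"
  unfolding quadf_def by (intro sum.cong arg_cong2[where f = "(*)"] arg_cong[where f = "\<lambda>z. (cmod z)\<^sup>2"] refl) simp

lemma corr_cong: "(\<And>j. j < N \<Longrightarrow> f j = f' j) \<Longrightarrow> (\<And>j. j < N \<Longrightarrow> g j = g' j) \<Longrightarrow> corr N T f g = corr N T f' g'"
  unfolding corr_def using quadf_cong[of N f f'] quadf_cong[of N g g'] by simp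

lemma quadf_phase:
  assumes "cmod c = 1"
  shows "quadf N l U (\<lambda>j. c * f j) = quadf N l U f"
proof -
  have "(\<Sum>j<N. U $$ (k, j) * (c * f j)) = c * (\<Sum>j<N. U $$ (k, j) * f j)" for k
    by (simp add: sum_distrib_left mult_ac)
  then show ?thesis by (simp add: quadf_def norm_mult assms)
qed

lemma quadf_mult:
  assumes "U \<in> carrier_mat N N" "W \<in> carrier_mat N N"
  shows "quadf N l (U * W) f = quadf N l U (mat_act N W f)"
proof -
  have "(\<Sum>j<N. (U * W) $$ (k, j) * f j) = (\<Sum>i<N. U $$ (k, i) * mat_act N W f i)" if "k < N" for k
  proof -
    have "(\<Sum>j<N. (U * W) $$ (k, j) * f j) = (\<Sum>j<N. \<Sum>i<N. U $$ (k, i) * W $$ (i, j) * f j)"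
      using that by (intro sum.cong refl) (simp only: lessThan_iff index_mult_mat_sum[OF assms] sum_distrib_right)
    also have "\<dots> = (\<Sum>i<N. U $$ (k, i) * mat_act N W f i)"
      by (subst sum.swap) (simp only: mat_act_def sum_distrib_left mult.assoc)
    finally show ?thesis .
  qed
  then show ?thesis unfolding quadf_def by (intro sum.cong refl) simp
qed

lemma measurable_quadf:
  assumes "N > 0" and s: "sets M = sets (hk_prod N T)"
  shows "(\<lambda>x. quadf N (fst x) (snd x) f) \<in> borel_measurable M"
  unfolding measurable_cong_sets[OF s refl]
proof -
  have "(\<lambda>x. exp (fst x k) * (cmod (\<Sum>j<N. snd x $$ (k, j) * f j))\<^sup>2) \<in> borel_measurable (hk_prod N T)" if "k < N" for k
  proof -
    have [measurable]: "(\<lambda>x. \<Sum>j<N. snd x $$ (k, j) * f j) \<in> borel_measurable (hk_prod N T)"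
      using that assms by (intro borel_measurable_sum borel_measurable_times borel_measurable_const measurable_hk_prod_entry) auto
    note [measurable] = measurable_hk_prod_fst[OF assms(1) that, of T]
    show ?thesis by measurable
  qed
  then show "(\<lambda>x. quadf N (fst x) (snd x) f) \<in> borel_measurable (hk_prod N T)"
    unfolding quadf_def by (intro borel_measurable_sum) auto
qed

lemma hk_prod_snd_unitary: "N > 0 \<Longrightarrow> x \<in> space (hk_prod N T) \<Longrightarrow> snd x \<in> unitary_group N"
  by (simp only: space_hk_prod mem_Times_iff)

text \<open>Replacing U by U W conjugates the positive matrix by W and leaves the eigenvalues alone;
  right invariance of Haar measure is applied for each fixed \<open>l\<close>.\<close>

lemma hk_prod_right_invariant:
  assumes N: "N > 0" and T: "T > 0" and W: "W \<in> unitary_group N" and h: "h \<in> borel_measurable (hk_prod N T)"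
  shows "(\<integral>x. h (fst x, snd x * W) \<partial>hk_prod N T) = (\<integral>x. h x \<partial>hk_prod N T :: real)"
proof -
  interpret H: prob_space "haar_unitary N" by (rule prob_haar[OF N])
  interpret R: prob_space "hk_radial N T" by (rule prob_hk_radial[OF N T])
  let ?X = "hk_prod N T" and ?t = "\<lambda>x. (fst x, snd x * W)"
  have sndW: "(\<lambda>x. snd x * W) \<in> ?X \<rightarrow>\<^sub>M haar_unitary N"
    unfolding measurable_cong_sets[OF refl sets_haar[OF N]]
    by (intro measurable_unitary_mult measurable_hk_prod_snd N measurable_const) (simp add: W)
  have m: "?t \<in> ?X \<rightarrow>\<^sub>M ?X"
    using measurable_Pair[OF measurable_fst[of "hk_radial N T" "haar_unitary N", folded hk_prod_def] sndW]
    by (simp add: hk_prod_def)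
  have "distr ?X ?X ?t = ?X"
  proof (rule measure_eqI)
    fix A assume "A \<in> sets (distr ?X ?X ?t)"
    then have A: "A \<in> sets ?X" by simp
    have iA: "indicator A \<in> borel_measurable (hk_radial N T \<Otimes>\<^sub>M haar_unitary N)"
      using A by (simp add: hk_prod_def)
    have iAt: "(\<lambda>x. indicator A (?t x)) \<in> borel_measurable (hk_radial N T \<Otimes>\<^sub>M haar_unitary N)"
      using measurable_compose[OF m borel_measurable_indicator[OF A]] by (simp add: hk_prod_def)
    have "emeasure (distr ?X ?X ?t) A = (\<integral>\<^sup>+x. indicator A (?t x) \<partial>?X)"
      by (rule emeasure_distr_nn_integral[OF m A])
    also have "\<dots> = (\<integral>\<^sup>+l. \<integral>\<^sup>+U. indicator A (l, U * W) \<partial>haar_unitary N \<partial>hk_radial N T)"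
      unfolding hk_prod_def using H.nn_integral_fst[OF iAt] by simp
    also have "\<dots> = (\<integral>\<^sup>+l. \<integral>\<^sup>+U. indicator A (l, U) \<partial>haar_unitary N \<partial>hk_radial N T)"
    proof (rule nn_integral_cong)
      fix l assume l: "l \<in> space (hk_radial N T)"
      have "(\<lambda>U. indicator A (l, U)) \<in> borel_measurable (unitary_borel N)"
        using measurable_compose[OF measurable_Pair1'[OF l] iA] by (simp add: measurable_cong_sets[OF sets_haar[OF N] refl])
      then show "(\<integral>\<^sup>+U. indicator A (l, U * W) \<partial>haar_unitary N) = (\<integral>\<^sup>+U. indicator A (l, U) \<partial>haar_unitary N)"
        by (rule haar_right_nn_integral[OF is_haar_haar_unitary[OF N] W])
    qed
    also have "\<dots> = emeasure ?X A"
      unfolding H.nn_integral_fst[OF iA] using A by (simp add: hk_prod_def)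
    finally show "emeasure (distr ?X ?X ?t) A = emeasure ?X A" .
  qed simp
  then show ?thesis
    using integral_distr[OF m h] by simp
qed

lemma corr_unitary:
  assumes N: "N > 0" and T: "T > 0" and W: "W \<in> unitary_group N"
  shows "corr N T (mat_act N W f) (mat_act N W g) = corr N T f g"
proof -
  let ?h = "\<lambda>x. ln (quadf N (fst x) (snd x) f) * ln (quadf N (fst x) (snd x) g)"
  have "?h \<in> borel_measurable (hk_prod N T)"
    by (intro borel_measurable_times borel_measurable_ln measurable_quadf[OF N refl])
  then have "(\<integral>x. ?h (fst x, snd x * W) \<partial>hk_prod N T) = (\<integral>x. ?h x \<partial>hk_prod N T)"
    by (rule hk_prod_right_invariant[OF N T W, of ?h])
  moreover have "(\<integral>x. ?h (fst x, snd x * W) \<partial>hk_prod N T) = corr N T (mat_act N W f) (mat_act N W g)"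
    unfolding corr_def
  proof (rule Bochner_Integration.integral_cong[OF refl])
    fix x assume "x \<in> space (hk_prod N T)"
    note q = quadf_mult[OF unitary_carrier[OF hk_prod_snd_unitary[OF N this]] unitary_carrier[OF W]]
    show "?h (fst x, snd x * W) = ln (quadf N (fst x) (snd x) (mat_act N W f)) * ln (quadf N (fst x) (snd x) (mat_act N W g))"
      by (simp only: fst_conv snd_conv q)
  qed
  ultimately show ?thesis by (simp add: corr_def)
qed

lemma corr_phase: "cmod c = 1 \<Longrightarrow> cmod c' = 1 \<Longrightarrow> corr N T (\<lambda>j. c * f j) (\<lambda>j. c' * g j) = corr N T f g"
  by (simp add: corr_def quadf_phase)

subsection \<open>Transitivity of the unitary group on pairs of unit vectors\<close>

lemma cmod_one_cnj: "cmod z = 1 \<Longrightarrow> z * cnj z = 1" "cmod z = 1 \<Longrightarrow> cnj z * z = 1"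
  using complex_norm_square[of z] by (simp_all add: mult.commute)

lemma mat_act_diag:
  assumes "k < N"
  shows "mat_act N (mat_diag N d) f k = d k * f k"
proof -
  have "mat_act N (mat_diag N d) f k = (\<Sum>j<N. if j = k then d k * f k else 0)"
    unfolding mat_act_def using assms by (intro sum.cong) (auto simp: mat_diag_def)
  then show ?thesis using assms by simp
qed

lemma unitary_groupI:
  assumes "U \<in> carrier_mat N N" "\<And>i j. i < N \<Longrightarrow> j < N \<Longrightarrow> (\<Sum>a<N. cnj (U $$ (a, i)) * U $$ (a, j)) = (if i = j then 1 else 0)"
  shows "U \<in> unitary_group N"
proof -
  have Ua: "mat_adjoint U \<in> carrier_mat N N" using assms(1) by simp
  have "mat_adjoint U * U = 1\<^sub>m N"
  proof (rule eq_matI)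
    fix i j assume "i < dim_row (1\<^sub>m N :: complex mat)" "j < dim_col (1\<^sub>m N :: complex mat)"
    then have ij: "i < N" "j < N" by auto
    have "(mat_adjoint U * U) $$ (i, j) = (\<Sum>a<N. mat_adjoint U $$ (i, a) * U $$ (a, j))"
      by (rule index_mult_mat_sum[OF Ua assms(1) ij])
    also have "\<dots> = (\<Sum>a<N. cnj (U $$ (a, i)) * U $$ (a, j))"
      using ij by (intro sum.cong refl) (simp add: index_mat_adjoint[OF assms(1)])
    finally show "(mat_adjoint U * U) $$ (i, j) = 1\<^sub>m N $$ (i, j)"
      using ij assms(2)[OF ij] by simp
  qed (use assms(1) in auto)
  then show ?thesis using assms(1) by (simp add: unitary_group_def)
qed

lemma unitary_diag:
  assumes "\<And>k. k < N \<Longrightarrow> cmod (d k) = 1"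
  shows "mat_diag N d \<in> unitary_group N"
proof (rule unitary_groupI)
  fix i j assume ij: "i < N" "j < N"
  have "(\<Sum>a<N. cnj (mat_diag N d $$ (a, i)) * mat_diag N d $$ (a, j)) = (\<Sum>a<N. if a = i then (if i = j then cnj (d i) * d i else 0) else 0)"
    using ij by (intro sum.cong) (auto simp: mat_diag_def)
  also have "\<dots> = (if i = j then 1 else 0)"
    using ij cmod_one_cnj(2)[OF assms[OF ij(1)]] by auto
  finally show "(\<Sum>a<N. cnj (mat_diag N d $$ (a, i)) * mat_diag N d $$ (a, j)) = (if i = j then 1 else 0)" .
qed simp

lemma mat_act_inner:
  assumes "W \<in> unitary_group N"
  shows "(\<Sum>k<N. mat_act N W f k * cnj (mat_act N W g k)) = (\<Sum>k<N. f k * cnj (g k))"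
  unfolding mat_act_def by (rule unitary_inner_product[OF assms])

text \<open>The reflection along w = x - y. Equal norms and a real inner product are what makes 2
  <x, w> equal to |w|^2, so that x is sent to y. Vectors orthogonal to w are fixed. For x = y
  division by zero turns \<open>W\<close> into the identity.\<close>

lemma householder:
  assumes nrm: "(\<Sum>k<N. x k * cnj (x k)) = (\<Sum>k<N. y k * cnj (y k))"
    and re: "(\<Sum>k<N. x k * cnj (y k)) \<in> \<real>"
  shows "\<exists>W\<in>unitary_group N. (\<forall>k<N. mat_act N W x k = y k) \<and>
     (\<forall>z. (\<Sum>k<N. z k * cnj (x k - y k)) = 0 \<longrightarrow> (\<forall>k<N. mat_act N W z k = z k))"
proof -
  define w where "w k = x k - y k" for k
  define n where "n = (\<Sum>k<N. w k * cnj (w k))"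
  define W where "W = mat N N (\<lambda>(i, j). (if i = j then 1 else 0) - 2 * w i * cnj (w j) / n)"
  have Wc: "W \<in> carrier_mat N N" by (simp add: W_def)
  have Wmv: "mat_act N W z k = z k - 2 * w k * (\<Sum>j<N. z j * cnj (w j)) / n" if "k < N" for z k
  proof -
    have "mat_act N W z k = (\<Sum>j<N. (if j = k then z k else 0) - 2 * w k / n * (z j * cnj (w j)))"
      unfolding mat_act_def using that by (intro sum.cong refl) (auto simp: W_def left_diff_distrib right_diff_distrib mult_ac)
    also have "\<dots> = z k - 2 * w k / n * (\<Sum>j<N. z j * cnj (w j))"
      using that by (simp add: sum_subtractf sum_distrib_left)
    finally show ?thesis by simp
  qed
  have nr: "cnj n = n" unfolding n_def by (simp add: mult.commute)
  have "W \<in> unitary_group N"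
  proof (cases "n = 0")
    case True
    have "W = 1\<^sub>m N" by (rule eq_matI) (auto simp: W_def True)
    then show ?thesis by (simp add: unitary_one)
  next
    case False
    show ?thesis
    proof (rule unitary_groupI[OF Wc])
      fix i j assume ij: "i < N" "j < N"
      define c where "c j = 2 * cnj (w j) / n" for j
      let ?d = "\<lambda>a i :: nat. if a = i then 1 else 0 :: complex"
      have We: "W $$ (a, j) = ?d a j - w a * c j" if "a < N" "j < N" for a j
        using that by (simp add: W_def c_def mult_ac)
      have cc: "cnj (c i) = 2 * w i / n" by (simp add: c_def nr)
      have expand: "(p - x) * (q - y) = p * q - p * y - q * x + x * y" for p q x y :: complex
        by (simp add: algebra_simps)
      have "(\<Sum>a<N. cnj (W $$ (a, i)) * W $$ (a, j)) = (\<Sum>a<N. (?d a i - cnj (w a) * cnj (c i)) * (?d a j - w a * c j))"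
        using ij by (intro sum.cong refl) (simp add: We)
      also have "\<dots> = (\<Sum>a<N. ?d a i * ?d a j) - (\<Sum>a<N. ?d a i * (w a * c j)) - (\<Sum>a<N. ?d a j * (cnj (w a) * cnj (c i)))
          + (\<Sum>a<N. cnj (w a) * cnj (c i) * (w a * c j))"
        unfolding expand by (simp only: sum.distrib sum_subtractf)
      also have "(\<Sum>a<N. ?d a i * ?d a j) = ?d i j"
        using ij by (simp add: if_distrib[of "\<lambda>c. c * _"] cong: if_cong)
      also have "(\<Sum>a<N. ?d a i * (w a * c j)) = w i * c j"
        using ij by (simp add: if_distrib[of "\<lambda>c. c * _"] cong: if_cong)
      also have "(\<Sum>a<N. ?d a j * (cnj (w a) * cnj (c i))) = cnj (w j) * cnj (c i)"
        using ij by (simp add: if_distrib[of "\<lambda>c. c * _"] cong: if_cong)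
      also have "(\<Sum>a<N. cnj (w a) * cnj (c i) * (w a * c j)) = n * (cnj (c i) * c j)"
        unfolding n_def sum_distrib_right by (intro sum.cong refl) (simp only: mult_ac)
      also have "?d i j - w i * c j - cnj (w j) * cnj (c i) + n * (cnj (c i) * c j) = ?d i j"
        unfolding cc c_def using False by (simp add: mult_ac nr)
      finally show "(\<Sum>a<N. cnj (W $$ (a, i)) * W $$ (a, j)) = (if i = j then 1 else 0)" .
    qed
  qed
  moreover have "mat_act N W x k = y k" if k: "k < N" for k
  proof (cases "n = 0")
    case True
    have "complex_of_real (\<Sum>k<N. (cmod (w k))\<^sup>2) = 0"
      using True unfolding n_def of_real_sum complex_norm_square .
    then have "(\<Sum>k<N. (cmod (w k))\<^sup>2) = 0" by (simp only: of_real_eq_0_iff)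
    then have "\<forall>k\<in>{..<N}. (cmod (w k))\<^sup>2 = 0" by (subst (asm) sum_nonneg_eq_0_iff) auto
    then have "w k = 0" using k by auto
    then show ?thesis by (simp add: Wmv[OF k] w_def)
  next
    case False
    let ?p = "\<Sum>k<N. x k * cnj (y k)" and ?q = "\<Sum>k<N. x k * cnj (x k)"
    have "cnj ?p = ?p" using re by (simp only: Reals_cnj_iff)
    then have pc: "(\<Sum>k<N. y k * cnj (x k)) = ?p" by (simp add: mult.commute)
    have xw: "(\<Sum>j<N. x j * cnj (w j)) = ?q - ?p" by (simp add: w_def right_diff_distrib sum_subtractf)
    have "n = ?q - ?p - (\<Sum>k<N. y k * cnj (x k)) + (\<Sum>k<N. y k * cnj (y k))"
      by (simp add: n_def w_def algebra_simps sum_subtractf sum.distrib)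
    also have "\<dots> = 2 * (?q - ?p)" unfolding pc nrm[symmetric] by simp
    finally have "2 * (\<Sum>j<N. x j * cnj (w j)) / n = 1" using False unfolding xw by simp
    moreover have "2 * w k * (\<Sum>j<N. x j * cnj (w j)) / n = w k * (2 * (\<Sum>j<N. x j * cnj (w j)) / n)"
      by (simp only: mult_ac times_divide_eq_right)
    ultimately have "2 * w k * (\<Sum>j<N. x j * cnj (w j)) / n = w k" by (simp only: mult_1_right)
    then show ?thesis by (simp add: Wmv[OF k]) (simp add: w_def)
  qed
  moreover have "mat_act N W z k = z k" if "(\<Sum>k<N. z k * cnj (x k - y k)) = 0" "k < N" for z k
    using that by (simp add: Wmv w_def[symmetric] del: complex_cnj_diff)
  ultimately show ?thesis by blast
qed

definition e0 :: "nat \<Rightarrow> complex" where "e0 j = (if j = 0 then 1 else 0)"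

text \<open>Together with \<open>e0\<close>, the normal form of a pair of unit vectors with squared
  overlap \<rho>. The phase \<theta> is kept free because averaging over it is used later.\<close>

definition pair_vec :: "real \<Rightarrow> complex \<Rightarrow> nat \<Rightarrow> complex" where
  "pair_vec \<rho> \<theta> j = (if j = 0 then of_real (sqrt \<rho>) else if j = 1 then of_real (sqrt (1 - \<rho>)) * \<theta> else 0)"

lemma sum_first_two:
  fixes f :: "nat \<Rightarrow> 'a::comm_monoid_add"
  assumes "N \<ge> 2" "\<And>j. 2 \<le> j \<Longrightarrow> j < N \<Longrightarrow> f j = 0"
  shows "(\<Sum>j<N. f j) = f 0 + f 1"
proof -
  have "f i = 0" if "i \<in> {..<N} - {0, 1}" for i
    using that by (intro assms(2)) auto
  then have "(\<Sum>j<N. f j) = (\<Sum>j\<in>{0, 1}. f j)"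
    using assms(1) by (intro sum.mono_neutral_right) auto
  then show ?thesis by simp
qed

lemma sum_e0: "N \<ge> 1 \<Longrightarrow> (\<Sum>j<N. f j * cnj (e0 j)) = f 0"
proof -
  assume "N \<ge> 1"
  have "(\<Sum>j<N. f j * cnj (e0 j)) = (\<Sum>j<N. if j = 0 then f 0 else 0)"
    by (intro sum.cong) (auto simp: e0_def)
  then show ?thesis using \<open>N \<ge> 1\<close> by simp
qed

lemma pair_vec_norm:
  assumes "N \<ge> 2" "0 \<le> \<rho>" "\<rho> \<le> 1" "cmod \<theta> = 1"
  shows "(\<Sum>j<N. pair_vec \<rho> \<theta> j * cnj (pair_vec \<rho> \<theta> j)) = 1"
proof -
  have "(\<Sum>j<N. pair_vec \<rho> \<theta> j * cnj (pair_vec \<rho> \<theta> j)) = pair_vec \<rho> \<theta> 0 * cnj (pair_vec \<rho> \<theta> 0) + pair_vec \<rho> \<theta> 1 * cnj (pair_vec \<rho> \<theta> 1)"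
    by (rule sum_first_two[OF assms(1)]) (simp add: pair_vec_def)
  also have "\<dots> = complex_of_real ((cmod (pair_vec \<rho> \<theta> 0))\<^sup>2 + (cmod (pair_vec \<rho> \<theta> 1))\<^sup>2)"
    by (simp only: complex_norm_square of_real_add)
  also have "(cmod (pair_vec \<rho> \<theta> 0))\<^sup>2 + (cmod (pair_vec \<rho> \<theta> 1))\<^sup>2 = 1"
    using assms by (simp add: pair_vec_def norm_mult)
  finally show ?thesis by simp
qed

text \<open>A diagonal unitary fixes \<open>e0\<close> and changes only the phase of the second
  coordinate.\<close>

lemma corr_pair_vec_phase:
  assumes N: "N \<ge> 2" and T: "T > 0" and \<theta>: "cmod \<theta> = 1" "cmod \<theta>' = 1"
  shows "corr N T e0 (pair_vec \<rho> \<theta>) = corr N T e0 (pair_vec \<rho> \<theta>')"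
proof -
  let ?W = "mat_diag N (\<lambda>k. if k = 1 then \<theta>' * cnj \<theta> else 1)"
  have W: "?W \<in> unitary_group N" by (rule unitary_diag) (auto simp: norm_mult \<theta>)
  have "\<theta>' * cnj \<theta> * \<theta> = \<theta>' * (\<theta> * cnj \<theta>)" by simp
  also have "\<dots> = \<theta>'" by (simp only: cmod_one_cnj[OF \<theta>(1)] mult_1_right)
  finally have t: "\<theta>' * cnj \<theta> * \<theta> = \<theta>'" .
  have "corr N T e0 (pair_vec \<rho> \<theta>) = corr N T (mat_act N ?W e0) (mat_act N ?W (pair_vec \<rho> \<theta>))"
    using N by (intro corr_unitary[symmetric] T W) auto
  also have "\<dots> = corr N T e0 (pair_vec \<rho> \<theta>')"
  proof (rule corr_cong)
    fix j assume j: "j < N"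
    show "mat_act N ?W e0 j = e0 j" unfolding mat_act_diag[OF j] by (simp add: e0_def)
    show "mat_act N ?W (pair_vec \<rho> \<theta>) j = pair_vec \<rho> \<theta>' j" unfolding mat_act_diag[OF j] using t cmod_one_cnj(1)[OF \<theta>(1)] by (auto simp: pair_vec_def mult_ac)
  qed
  finally show ?thesis .
qed

lemma exists_phase: "\<exists>c. cmod c = 1 \<and> c * z = of_real (cmod z)"
proof (cases "z = 0")
  case False
  then show ?thesis
    by (intro exI[of _ "cnj z / of_real (cmod z)"])
      (simp add: norm_divide complex_norm_square[symmetric] mult.commute power2_eq_square)
qed (auto intro: exI[of _ 1])

text \<open>Up to phases, which the form ignores, one reflection moves \<open>f\<close> to
  \<open>e0\<close> and a second one, fixing \<open>e0\<close>, moves \<open>g\<close> to the normal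
  form. Phases come first because a complex reflection needs a real inner product.\<close>

lemma corr_pair:
  assumes N: "N \<ge> 2" and T: "T > 0" and \<rho>: "0 \<le> \<rho>" "\<rho> \<le> 1"
    and f: "(\<Sum>j<N. f j * cnj (f j)) = 1" and g: "(\<Sum>j<N. g j * cnj (g j)) = 1"
    and fg: "(cmod (\<Sum>j<N. g j * cnj (f j)))\<^sup>2 = \<rho>"
  shows "corr N T f g = corr N T e0 (pair_vec \<rho> 1)"
proof -
  have N0: "N > 0" and N1: "N \<ge> 1" using N by auto
  have e0n: "(\<Sum>j<N. e0 j * cnj (e0 j)) = 1" using sum_e0[OF N1, of e0] by (simp add: e0_def)
  obtain c where c: "cmod c = 1" "c * f 0 = of_real (cmod (f 0))" using exists_phase by blast
  define cf where "cf j = c * f j" for j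
  have cc: "c * cnj c = 1" by (rule cmod_one_cnj[OF c(1)])
  have cfn: "(\<Sum>j<N. cf j * cnj (cf j)) = 1"
  proof -
    have "cf j * cnj (cf j) = (c * cnj c) * (f j * cnj (f j))" for j by (simp add: cf_def)
    then show ?thesis using f by (simp add: cc)
  qed
  have "(\<Sum>j<N. cf j * cnj (e0 j)) \<in> \<real>" using sum_e0[OF N1, of cf] c by (simp add: cf_def)
  with cfn e0n obtain W1 where W1: "W1 \<in> unitary_group N" "\<And>k. k < N \<Longrightarrow> mat_act N W1 cf k = e0 k"
    using householder[where N = N and x = cf and y = e0] by auto
  define g1 where "g1 = mat_act N W1 g"
  have "corr N T f g = corr N T cf g"
    using corr_phase[OF c(1), of 1 N T f g] by (simp add: cf_def[abs_def])
  also have "\<dots> = corr N T (mat_act N W1 cf) g1"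
    unfolding g1_def by (rule corr_unitary[OF N0 T W1(1), symmetric])
  also have "\<dots> = corr N T e0 g1" by (rule corr_cong) (auto simp: W1)
  finally have s1: "corr N T f g = corr N T e0 g1" .
  have g1n: "(\<Sum>j<N. g1 j * cnj (g1 j)) = 1" unfolding g1_def using mat_act_inner[OF W1(1)] g by simp
  have g10: "cmod (g1 0) = sqrt \<rho>"
  proof -
    have "g1 0 = (\<Sum>j<N. g1 j * cnj (e0 j))" by (rule sum_e0[OF N1, symmetric])
    also have "\<dots> = (\<Sum>j<N. mat_act N W1 g j * cnj (mat_act N W1 cf j))"
      unfolding g1_def by (intro sum.cong refl) (simp add: W1)
    also have "\<dots> = (\<Sum>j<N. g j * cnj (cf j))" by (rule mat_act_inner[OF W1(1)])
    also have "\<dots> = cnj c * (\<Sum>j<N. g j * cnj (f j))" by (simp add: cf_def sum_distrib_left mult_ac)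
    finally have "cmod (g1 0) = cmod (\<Sum>j<N. g j * cnj (f j))" using c by (simp add: norm_mult)
    then show ?thesis using fg by (metis norm_ge_zero real_sqrt_abs abs_of_nonneg)
  qed
  obtain c' where c': "cmod c' = 1" "c' * g1 0 = of_real (cmod (g1 0))" using exists_phase by blast
  define g2 where "g2 j = c' * g1 j" for j
  have s2: "corr N T e0 g1 = corr N T e0 g2"
    using corr_phase[of 1 c' N T e0 g1] c' by (simp add: g2_def[abs_def])
  have cc': "c' * cnj c' = 1" by (rule cmod_one_cnj[OF c'(1)])
  have g2n: "(\<Sum>j<N. g2 j * cnj (g2 j)) = 1"
  proof -
    have "g2 j * cnj (g2 j) = (c' * cnj c') * (g1 j * cnj (g1 j))" for j by (simp add: g2_def)
    then show ?thesis using g1n by (simp add: cc')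
  qed
  have g20: "g2 0 = of_real (sqrt \<rho>)" using c' g10 by (simp add: g2_def)
  \<comment> \<open>The phase of the target vector is chosen to make its inner product with
    \<open>g2\<close> real, as the reflection demands.\<close>
  obtain t where t: "cmod t = 1" "t * g2 1 = of_real (cmod (g2 1))" using exists_phase by blast
  define \<theta> where "\<theta> = cnj t"
  have th: "cmod \<theta> = 1" using t by (simp add: \<theta>_def)
  have "(\<Sum>j<N. g2 j * cnj (pair_vec \<rho> \<theta> j)) = g2 0 * cnj (pair_vec \<rho> \<theta> 0) + g2 1 * cnj (pair_vec \<rho> \<theta> 1)"
    by (rule sum_first_two[OF N]) (simp add: pair_vec_def)
  also have "\<dots> = of_real (sqrt \<rho>) * of_real (sqrt \<rho>) + of_real (sqrt (1 - \<rho>)) * (t * g2 1)"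
    by (simp add: pair_vec_def g20 \<theta>_def mult_ac)
  also have "\<dots> \<in> \<real>" unfolding t(2) by (intro Reals_add Reals_mult Reals_of_real)
  finally have re: "(\<Sum>j<N. g2 j * cnj (pair_vec \<rho> \<theta> j)) \<in> \<real>" .
  obtain W2 where W2: "W2 \<in> unitary_group N" "\<And>k. k < N \<Longrightarrow> mat_act N W2 g2 k = pair_vec \<rho> \<theta> k"
     "\<And>z k. (\<Sum>k<N. z k * cnj (g2 k - pair_vec \<rho> \<theta> k)) = 0 \<Longrightarrow> k < N \<Longrightarrow> mat_act N W2 z k = z k"
    using householder[where N = N and x = g2 and y = "pair_vec \<rho> \<theta>"] re g2n pair_vec_norm[OF N \<rho> th] by auto
  \<comment> \<open>\<open>g2\<close> and its target have the same coordinate 0, so their difference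
    is orthogonal to \<open>e0\<close> and the reflection leaves \<open>e0\<close> in place.\<close>
  have "(\<Sum>k<N. e0 k * cnj (g2 k - pair_vec \<rho> \<theta> k)) = cnj (\<Sum>k<N. (g2 k - pair_vec \<rho> \<theta> k) * cnj (e0 k))"
    by (simp add: mult.commute e0_def)
  also have "\<dots> = 0" unfolding sum_e0[OF N1] by (simp add: g20 pair_vec_def)
  finally have We0: "mat_act N W2 e0 k = e0 k" if "k < N" for k using W2(3) that by blast
  have "corr N T e0 g2 = corr N T (mat_act N W2 e0) (mat_act N W2 g2)"
    by (rule corr_unitary[OF N0 T W2(1), symmetric])
  also have "\<dots> = corr N T e0 (pair_vec \<rho> \<theta>)" by (rule corr_cong) (auto simp: We0 W2(2))
  also have "\<dots> = corr N T e0 (pair_vec \<rho> 1)" by (rule corr_pair_vec_phase[OF N T th]) simp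
  finally show ?thesis using s1 s2 by simp
qed

lemma unit_vectors_sum:
  assumes "u \<in> unit_vectors N"
  shows "u \<in> carrier_vec N" "(\<Sum>j<N. vec_index u j * cnj (vec_index u j)) = 1"
  using assms by (auto simp: unit_vectors_def scalar_prod_def atLeast0LessThan)

lemma measurable_quad:
  assumes "v \<in> carrier_vec N"
  shows "(\<lambda>P. quad P v) \<in> borel_measurable (hk_space N)"
proof -
  have e: "(\<lambda>P. P $$ (i, j)) \<in> borel_measurable (hk_space N)" if "i < N" "j < N" for i j
    unfolding hk_space_def by (rule measurable_restrict_space1[OF measurable_mat_entry[OF that]])
  have "(\<lambda>P. \<Sum>i<N. (\<Sum>j<N. P $$ (i, j) * vec_index v j) * cnj (vec_index v i)) \<in> borel_measurable (hk_space N)"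
    by (intro borel_measurable_sum borel_measurable_times borel_measurable_const e) auto
  then have "(\<lambda>P. Re (\<Sum>i<N. (\<Sum>j<N. P $$ (i, j) * vec_index v j) * cnj (vec_index v i))) \<in> borel_measurable (hk_space N)"
    by measurable
  moreover have "Re (\<Sum>i<N. (\<Sum>j<N. P $$ (i, j) * vec_index v j) * cnj (vec_index v i)) = quad P v" if "P \<in> space (hk_space N)" for P
  proof -
    have P: "P \<in> carrier_mat N N" using that by (simp add: hk_space_def space_restrict_space)
    have "(P *\<^sub>v v) \<bullet>c v = (\<Sum>i<N. (\<Sum>j<N. P $$ (i, j) * vec_index v j) * cnj (vec_index v i))"
      using P assms by (auto simp: scalar_prod_def atLeast0LessThan intro!: sum.cong)
    then show ?thesis by (simp add: quad_def)
  qed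
  ultimately show ?thesis by (rule measurable_cong[THEN iffD1, rotated])
qed

lemma heat_integral_eq_corr:
  assumes N: "N > 0" and T: "T > 0" and u: "u \<in> carrier_vec N" and v: "v \<in> carrier_vec N"
  shows "(\<integral>P. ln (quad P u) * ln (quad P v) \<partial>heat_kernel_measure N T) = corr N T (vec_index u) (vec_index v)"
proof -
  have m: "(\<lambda>P. ln (quad P u) * ln (quad P v)) \<in> borel_measurable (hk_space N)"
    by (intro borel_measurable_times borel_measurable_ln measurable_quad u v)
  have "(\<integral>P. ln (quad P u) * ln (quad P v) \<partial>heat_kernel_measure N T)
     = (\<integral>x. ln (quad (hk_matrix N x) u) * ln (quad (hk_matrix N x) v) \<partial>hk_prod N T)"
    unfolding heat_kernel_measure_eq[OF N T] by (rule integral_distr[OF hk_matrix_measurable[OF N refl] m])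
  also have "\<dots> = corr N T (vec_index u) (vec_index v)"
    unfolding corr_def
  proof (rule Bochner_Integration.integral_cong[OF refl])
    fix x assume "x \<in> space (hk_prod N T)"
    then have "snd x \<in> carrier_mat N N" by (intro unitary_carrier hk_prod_snd_unitary[OF N])
    note q = quad_hk_matrix[OF this u, of "fst x", unfolded prod.collapse] quad_hk_matrix[OF this v, of "fst x", unfolded prod.collapse]
    show "ln (quad (hk_matrix N x) u) * ln (quad (hk_matrix N x) v)
        = ln (quadf N (fst x) (snd x) (vec_index u)) * ln (quadf N (fst x) (snd x) (vec_index v))" by (simp only: q)
  qed
  finally show ?thesis .
qed

text \<open>The definite description denotes, because all admissible pairs give the same integral
  and, for N >= 2, the normal form provides an admissible pair.\<close>

lemma I2_eq_corr:
  assumes N: "N \<ge> 2" and T: "T > 0" and \<rho>: "0 \<le> \<rho>" "\<rho> \<le> 1"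
  shows "I2 N T \<rho> = corr N T e0 (pair_vec \<rho> 1)"
proof -
  have N0: "N > 0" using N by simp
  have all: "(\<integral>P. ln (quad P u) * ln (quad P v) \<partial>heat_kernel_measure N T) = corr N T e0 (pair_vec \<rho> 1)"
    if u: "u \<in> unit_vectors N" and v: "v \<in> unit_vectors N" and uv: "(cmod (v \<bullet>c u))\<^sup>2 = \<rho>" for u v
  proof -
    note u' = unit_vectors_sum[OF u] and v' = unit_vectors_sum[OF v]
    have "v \<bullet>c u = (\<Sum>j<N. vec_index v j * cnj (vec_index u j))"
      using u'(1) v'(1) by (auto simp: scalar_prod_def atLeast0LessThan intro!: sum.cong)
    then show ?thesis
      using uv by (simp add: heat_integral_eq_corr[OF N0 T u'(1) v'(1)] corr_pair[OF N T \<rho> u'(2) v'(2)])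
  qed
  let ?u = "Matrix.vec N e0" and ?v = "Matrix.vec N (pair_vec \<rho> 1)"
  have N1: "N \<ge> 1" using N by simp
  have e0n: "(\<Sum>j<N. e0 j * cnj (e0 j)) = 1" using sum_e0[OF N1, of e0] by (simp add: e0_def)
  have ip: "Matrix.vec N f \<bullet>c Matrix.vec N g = (\<Sum>j<N. f j * cnj (g j))" for f g :: "nat \<Rightarrow> complex"
    by (auto simp: scalar_prod_def atLeast0LessThan intro!: sum.cong)
  have u: "?u \<in> unit_vectors N" and v: "?v \<in> unit_vectors N"
    using e0n pair_vec_norm[OF N \<rho>, of 1] by (simp_all add: unit_vectors_def ip)
  have uv: "(cmod (?v \<bullet>c ?u))\<^sup>2 = \<rho>"
    unfolding ip sum_e0[OF N1] using \<rho> by (simp add: pair_vec_def)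
  show ?thesis
    unfolding I2_def
  proof (rule the_equality)
    show "\<forall>u\<in>unit_vectors N. \<forall>v\<in>unit_vectors N. (cmod (v \<bullet>c u))\<^sup>2 = \<rho> \<longrightarrow>
        corr N T e0 (pair_vec \<rho> 1) = (\<integral>P. ln (quad P u) * ln (quad P v) \<partial>heat_kernel_measure N T)"
      using all by simp
  qed (use all[OF u v uv] u v uv in auto)
qed

subsection \<open>Averaging over the three-sphere\<close>

definition hform :: "real \<Rightarrow> real \<Rightarrow> complex \<Rightarrow> complex \<times> complex \<Rightarrow> real" where
  "hform A B c p = A * (cmod (fst p))\<^sup>2 + B * (cmod (snd p))\<^sup>2 + 2 * Re (c * (fst p * cnj (snd p)))"

definition rot :: "complex \<Rightarrow> complex \<Rightarrow> complex \<times> complex \<Rightarrow> complex \<times> complex" where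
  "rot \<alpha> \<beta> p = (\<alpha> * fst p - cnj \<beta> * snd p, \<beta> * fst p + cnj \<alpha> * snd p)"

text \<open>sqrt(\<rho>) p + sqrt(1 - \<rho>) e p', where p' = (- conj (snd p), conj (fst p)) is
  orthogonal to p and of the same norm. For a unit p and |e| = 1 it is a unit vector with squared
  overlap \<rho> with p. The map is only real linear.\<close>

definition mix :: "real \<Rightarrow> complex \<Rightarrow> complex \<times> complex \<Rightarrow> complex \<times> complex" where
  "mix \<rho> e p = (of_real (sqrt \<rho>) * fst p - of_real (sqrt (1 - \<rho>)) * e * cnj (snd p),
     of_real (sqrt \<rho>) * snd p + of_real (sqrt (1 - \<rho>)) * e * cnj (fst p))"

text \<open>The transformation rule of a Hermitian form under \<open>rot\<close>; the vanishing of
  the third coefficient is the condition for diagonality.\<close>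

lemma hform_rot:
  "hform A B c (rot \<alpha> \<beta> p)
   = hform (A * (cmod \<alpha>)\<^sup>2 + B * (cmod \<beta>)\<^sup>2 + 2 * Re (c * (\<alpha> * cnj \<beta>)))
       (A * (cmod \<beta>)\<^sup>2 + B * (cmod \<alpha>)\<^sup>2 - 2 * Re (c * (\<alpha> * cnj \<beta>)))
       (of_real (B - A) * (\<alpha> * \<beta>) + c * \<alpha>\<^sup>2 - cnj c * \<beta>\<^sup>2) p"
  unfolding hform_def rot_def cmod_power2
  by (simp add: power2_eq_square algebra_simps)

lemma rot_norm:
  assumes "(cmod \<alpha>)\<^sup>2 + (cmod \<beta>)\<^sup>2 = 1"
  shows "(cmod (fst (rot \<alpha> \<beta> p)))\<^sup>2 + (cmod (snd (rot \<alpha> \<beta> p)))\<^sup>2 = (cmod (fst p))\<^sup>2 + (cmod (snd p))\<^sup>2"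
proof -
  have "(cmod (fst (rot \<alpha> \<beta> p)))\<^sup>2 + (cmod (snd (rot \<alpha> \<beta> p)))\<^sup>2 = hform 1 1 0 (rot \<alpha> \<beta> p)" by (simp add: hform_def)
  also have "\<dots> = (cmod (fst p))\<^sup>2 + (cmod (snd p))\<^sup>2" unfolding hform_rot using assms by (simp add: hform_def add.commute)
  finally show ?thesis .
qed

lemma rot_inverse:
  assumes "(cmod \<alpha>)\<^sup>2 + (cmod \<beta>)\<^sup>2 = 1"
  shows "rot \<alpha> \<beta> (rot (cnj \<alpha>) (- \<beta>) p) = p"
proof -
  have "\<alpha> * cnj \<alpha> + \<beta> * cnj \<beta> = complex_of_real ((cmod \<alpha>)\<^sup>2 + (cmod \<beta>)\<^sup>2)"
    by (simp only: of_real_add complex_norm_square)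
  then have "\<alpha> * cnj \<alpha> + \<beta> * cnj \<beta> = 1" using assms by simp
  moreover have "\<alpha> * (cnj \<alpha> * x + cnj \<beta> * y) - cnj \<beta> * (\<alpha> * y - \<beta> * x) = (\<alpha> * cnj \<alpha> + \<beta> * cnj \<beta>) * x"
    "\<beta> * (cnj \<alpha> * x + cnj \<beta> * y) + cnj \<alpha> * (\<alpha> * y - \<beta> * x) = (\<alpha> * cnj \<alpha> + \<beta> * cnj \<beta>) * y" for x y
    by (simp_all add: algebra_simps)
  ultimately show ?thesis by (simp add: rot_def prod_eq_iff)
qed

text \<open>\<open>rot\<close> acts like multiplication by a quaternion and therefore commutes with
  the antilinear map p to p', hence with \<open>mix\<close>. So one change of coordinates
  diagonalizes the form for both vectors of a pair.\<close>

lemma mix_rot: "mix \<rho> e (rot \<alpha> \<beta> p) = rot \<alpha> \<beta> (mix \<rho> e p)"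
  by (simp add: mix_def rot_def algebra_simps)

lemma norm_pair_square: "(norm p)\<^sup>2 = (cmod (fst p))\<^sup>2 + (cmod (snd p))\<^sup>2" for p :: "complex \<times> complex"
  by (simp add: norm_prod_def)

text \<open>The norm identity behind \<open>mix\<close> in real coordinates, with s and t for the
  two square roots and x + i y for the phase, so that it is a polynomial identity.\<close>

lemma mix_identity:
  fixes s t :: real
  shows "(s * a - (t * x * c + t * y * d))\<^sup>2 + (s * b - (t * y * c - t * x * d))\<^sup>2
      + ((s * c + (t * x * a + t * y * b))\<^sup>2 + (s * d + (t * y * a - t * x * b))\<^sup>2)
     = (s\<^sup>2 + t\<^sup>2 * (x\<^sup>2 + y\<^sup>2)) * (a\<^sup>2 + b\<^sup>2 + (c\<^sup>2 + d\<^sup>2))"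
  by (simp add: power2_eq_square algebra_simps)

lemma mix_identity_fst:
  fixes s t :: real
  shows "(s * a - (t * x * c + t * y * d))\<^sup>2 + (s * b - (t * y * c - t * x * d))\<^sup>2
     = s\<^sup>2 * (a\<^sup>2 + b\<^sup>2) + t\<^sup>2 * ((x\<^sup>2 + y\<^sup>2) * (c\<^sup>2 + d\<^sup>2)) - 2 * (s * t) * ((a * c - b * d) * x - (- (a * d) - b * c) * y)"
  by (simp add: power2_eq_square algebra_simps)

lemma mix_norm:
  assumes "0 \<le> \<rho>" "\<rho> \<le> 1" "cmod e = 1"
  shows "norm (mix \<rho> e p) = norm p"
proof -
  have ee: "(Re e)\<^sup>2 + (Im e)\<^sup>2 = 1" using assms(3) by (metis cmod_power2 one_power2)
  have s: "(sqrt \<rho>)\<^sup>2 + (sqrt (1 - \<rho>))\<^sup>2 = 1" using assms by simp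
  have "(cmod (fst (mix \<rho> e p)))\<^sup>2 + (cmod (snd (mix \<rho> e p)))\<^sup>2 = (cmod (fst p))\<^sup>2 + (cmod (snd p))\<^sup>2"
    unfolding mix_def cmod_power2 fst_conv snd_conv
    using mix_identity[of "sqrt \<rho>" "Re (fst p)" "sqrt (1 - \<rho>)" "Re e" "Re (snd p)" "Im e" "Im (snd p)" "Im (fst p)"] ee s
    by simp
  then have "(norm (mix \<rho> e p))\<^sup>2 = (norm p)\<^sup>2" by (simp only: norm_pair_square)
  then show ?thesis by (rule power2_eq_imp_eq) auto
qed

text \<open>The rotation angle solves \<open>\<bar>c\<bar> cos (2x) + (B - A) / 2 * sin (2x) = 0\<close>.\<close>

lemma hform_diagonal:
  obtains \<alpha> \<beta> a b where "(cmod \<alpha>)\<^sup>2 + (cmod \<beta>)\<^sup>2 = 1" "b \<le> a"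
    "\<And>p. hform A B c (rot \<alpha> \<beta> p) = a * (cmod (fst p))\<^sup>2 + b * (cmod (snd p))\<^sup>2"
proof -
  obtain u where u: "cmod u = 1" "c = of_real (cmod c) * u"
    using rcis_cmod_Arg[of c] that[of "cis (Arg c)"] by (simp add: rcis_def)
  define g where "g x = cmod c * ((cos x)\<^sup>2 - (sin x)\<^sup>2) + (B - A) * (cos x * sin x)" for x
  \<comment> \<open>\<open>g\<close> runs from |c| at 0 to -|c| at \<pi>/2.\<close>
  have "\<exists>x\<ge>0. x \<le> pi / 2 \<and> g x = 0"
    by (rule IVT2'[of g]) (auto simp: g_def intro!: continuous_intros)
  then obtain x where x: "g x = 0" by blast
  define \<alpha> \<beta> where "\<alpha> = complex_of_real (cos x)" and "\<beta> = complex_of_real (sin x) * u"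
  have n: "(cmod \<alpha>)\<^sup>2 + (cmod \<beta>)\<^sup>2 = 1" by (simp add: \<alpha>_def \<beta>_def norm_mult u)
  have uu: "u * cnj u = 1" by (rule cmod_one_cnj[OF u(1)])
  have "cnj c * u\<^sup>2 = c"
  proof -
    have "cnj c * u\<^sup>2 = of_real (cmod c) * u * (u * cnj u)" by (subst u(2)) (simp add: power2_eq_square)
    then show ?thesis using u(2) uu by simp
  qed
  then have "cnj c * \<beta>\<^sup>2 = of_real ((sin x)\<^sup>2) * c" by (simp add: \<beta>_def power_mult_distrib)
  then have "of_real (B - A) * (\<alpha> * \<beta>) + c * \<alpha>\<^sup>2 - cnj c * \<beta>\<^sup>2
      = of_real (B - A) * (\<alpha> * \<beta>) + of_real (cmod c) * u * \<alpha>\<^sup>2 - of_real ((sin x)\<^sup>2) * (of_real (cmod c) * u)"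
    using u(2) by simp
  also have "\<dots> = of_real (g x) * u" by (simp add: g_def \<alpha>_def \<beta>_def algebra_simps power2_eq_square)
  finally have z: "of_real (B - A) * (\<alpha> * \<beta>) + c * \<alpha>\<^sup>2 - cnj c * \<beta>\<^sup>2 = 0" using x by simp
  define a where "a = A * (cmod \<alpha>)\<^sup>2 + B * (cmod \<beta>)\<^sup>2 + 2 * Re (c * (\<alpha> * cnj \<beta>))"
  define b where "b = A * (cmod \<beta>)\<^sup>2 + B * (cmod \<alpha>)\<^sup>2 - 2 * Re (c * (\<alpha> * cnj \<beta>))"
  have d: "hform A B c (rot \<alpha> \<beta> p) = a * (cmod (fst p))\<^sup>2 + b * (cmod (snd p))\<^sup>2" for p
    unfolding hform_rot z a_def[symmetric] b_def[symmetric] by (simp add: hform_def)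
  show ?thesis
  proof (cases "b \<le> a")
    case True
    then show ?thesis using n d that by blast
  next
    case False
    \<comment> \<open>If the eigenvalues come in the wrong order, the rotation is composed with the
      one that exchanges the coordinates up to sign.\<close>
    have "rot (- cnj \<beta>) (cnj \<alpha>) p = rot \<alpha> \<beta> (- snd p, fst p)" for p by (simp add: rot_def)
    then have "hform A B c (rot (- cnj \<beta>) (cnj \<alpha>) p) = b * (cmod (fst p))\<^sup>2 + a * (cmod (snd p))\<^sup>2" for p
      by (simp add: d)
    then show ?thesis using n False that[of "- cnj \<beta>" "cnj \<alpha>" a b] by (simp add: add.commute)
  qed
qed

lemma rot_sph:
  assumes "(cmod \<alpha>)\<^sup>2 + (cmod \<beta>)\<^sup>2 = 1"
  shows "distr sph borel (rot \<alpha> \<beta>) = sph"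
proof (rule sph_isometry)
  show "linear (rot \<alpha> \<beta>)" by (rule linearI) (simp_all add: rot_def algebra_simps)
  fix p
  have "(norm (rot \<alpha> \<beta> p))\<^sup>2 = (norm p)\<^sup>2" by (simp only: norm_pair_square rot_norm[OF assms])
  then show "norm (rot \<alpha> \<beta> p) = norm p" by (rule power2_eq_imp_eq) auto
qed

lemma mix_sph:
  assumes "0 \<le> \<rho>" "\<rho> \<le> 1" "cmod e = 1"
  shows "distr sph borel (mix \<rho> e) = sph"
proof (rule sph_isometry)
  show "linear (mix \<rho> e)" by (rule linearI) (simp_all add: mix_def algebra_simps scaleR_conv_of_real)
  show "norm (mix \<rho> e p) = norm p" for p by (rule mix_norm[OF assms])
qed

lemma continuous_rot [continuous_intros]: "continuous_on S (rot \<alpha> \<beta>)"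
  unfolding rot_def[abs_def] by (intro continuous_intros)

lemma rot_measurable [measurable]: "rot \<alpha> \<beta> \<in> borel_measurable borel"
  by (intro borel_measurable_continuous_onI continuous_rot)

lemma cis_measurable [measurable]: "cis \<in> borel_measurable borel"
  by (intro borel_measurable_continuous_onI continuous_intros)

lemma mix_measurable [measurable]:
  "(\<lambda>(p, \<tau>). mix \<rho> (cis (2 * pi * \<tau>)) p) \<in> borel_measurable (borel \<Otimes>\<^sub>M borel)"
  unfolding borel_prod mix_def case_prod_beta
  by (intro borel_measurable_continuous_onI continuous_intros)

lemma integral_sph_fst:
  assumes [measurable]: "f \<in> borel_measurable borel"
  shows "(\<integral>p. f ((cmod (fst p))\<^sup>2) \<partial>sph) = (\<integral>x. f x \<partial>unif01 :: real)"
proof -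
  have m: "(\<lambda>p. (cmod (fst p))\<^sup>2) \<in> sph \<rightarrow>\<^sub>M borel"
    unfolding measurable_cong_sets[OF sets_sph refl] by (intro borel_measurable_continuous_onI continuous_intros)
  show ?thesis using integral_distr[OF m assms] by (simp add: distr_sph_fst)
qed

lemma AE_pair_fst:
  assumes "prob_space M2" "AE x in M1. P x"
  shows "AE z in M1 \<Otimes>\<^sub>M M2. P (fst z)"
proof -
  interpret prob_space M2 by fact
  have "AE x in distr (M1 \<Otimes>\<^sub>M M2) M1 fst. P x" unfolding distr_pair_fst by (rule assms(2))
  then show ?thesis by (rule AE_distrD[OF measurable_fst])
qed

lemma AE_sph_norm: "AE p in sph. norm p = 1"
  using AE_sph by eventually_elim (simp add: norm_prod_def)

subsection \<open>The two-dimensional average\<close>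

context
  fixes r :: real
  assumes r: "0 < r" "r \<le> 1"
begin

text \<open>This bound depends on \<open>r\<close> and serves only integrability and Fubini; the
  estimates that survive r to 0 are the earlier ones in terms of -ln x.\<close>

lemma compression_ln_bound:
  assumes "0 \<le> x" "x \<le> 1"
  shows "\<bar>ln (r + (1 - r) * x)\<bar> \<le> - ln r"
proof -
  have "r \<le> r + (1 - r) * x" "r + (1 - r) * x \<le> r + (1 - r) * 1"
    using r assms by (simp, intro add_left_mono mult_left_mono, auto)
  then have "ln r \<le> ln (r + (1 - r) * x)" "ln (r + (1 - r) * x) \<le> ln 1" using r by (auto intro!: ln_mono)
  then show ?thesis by simp
qed

lemma circle_mean_ln_bound:
  assumes "0 \<le> x" "x \<le> 1" "0 \<le> \<rho>" "\<rho> \<le> 1"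
  shows "\<bar>ln (circle_mean r \<rho> x)\<bar> \<le> - ln (r / 2)"
proof -
  note n = less_imp_le[OF r(1)] r(2) assms(3,4,1,2)
  have p: "0 \<le> pp r \<rho> x" "0 \<le> qq r \<rho> x" using pp_nonneg[OF n] qq_nonneg[OF n] by auto
  have "ss r \<rho> x \<ge> 0" using ss_ge[OF n] by linarith
  then have lo: "r / 2 \<le> circle_mean r \<rho> x" using p by (simp add: circle_mean_def)
  have "ss r \<rho> x \<le> sqrt ((r + pp r \<rho> x + qq r \<rho> x)\<^sup>2)"
    unfolding ss_alt using p by (intro real_sqrt_le_mono) simp
  then have "ss r \<rho> x \<le> r + pp r \<rho> x + qq r \<rho> x" using p r by simp
  moreover have "r + pp r \<rho> x + qq r \<rho> x \<le> 1"
  proof -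
    have "x * \<rho> + (1 - x) * (1 - \<rho>) \<le> x * 1 + (1 - x) * 1" using assms by (intro add_mono mult_left_mono) auto
    then have "(1 - r) * (x * \<rho> + (1 - x) * (1 - \<rho>)) \<le> (1 - r) * 1" using r by (intro mult_left_mono) auto
    then show ?thesis by (simp add: pp_def qq_def algebra_simps)
  qed
  ultimately have "circle_mean r \<rho> x \<le> 1" by (simp add: circle_mean_def)
  then have "ln (r / 2) \<le> ln (circle_mean r \<rho> x)" "ln (circle_mean r \<rho> x) \<le> ln 1" using r lo by (auto intro!: ln_mono)
  then show ?thesis by simp
qed

text \<open>As a function of the phase e, the argument of the logarithm is A + 2 Re (d e) with A = r
  + p + q and |d|^2 = p q, so the quadratic circle average applies. It is positive because A^2 - 4
  |d|^2 is the radicand of \<open>ss\<close>.\<close>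

lemma circle_average_mix:
  assumes \<rho>: "0 \<le> \<rho>" "\<rho> \<le> 1" and p: "(cmod (fst p))\<^sup>2 + (cmod (snd p))\<^sup>2 = 1"
  shows "has_bochner_integral unif01 (\<lambda>\<tau>. ln (r + (1 - r) * (cmod (fst (mix \<rho> (cis (2 * pi * \<tau>)) p)))\<^sup>2))
     (ln (circle_mean r \<rho> ((cmod (fst p))\<^sup>2)))"
proof -
  let ?x = "(cmod (fst p))\<^sup>2"
  let ?A = "r + pp r \<rho> ?x + qq r \<rho> ?x"
  define d where "d = - of_real ((1 - r) * (sqrt \<rho> * sqrt (1 - \<rho>))) * cnj (fst p * snd p)"
  have x: "0 \<le> ?x" "?x \<le> 1" using p by (simp, metis le_add_same_cancel1 zero_le_power2)
  have y: "(cmod (snd p))\<^sup>2 = 1 - ?x" using p by simp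
  note n = less_imp_le[OF r(1)] r(2) \<rho> x
  have cd: "(cmod d)\<^sup>2 = pp r \<rho> ?x * qq r \<rho> ?x"
  proof -
    have "(cmod d)\<^sup>2 = (1 - r)\<^sup>2 * ((sqrt \<rho>)\<^sup>2 * (sqrt (1 - \<rho>))\<^sup>2) * (?x * (cmod (snd p))\<^sup>2)"
      by (simp only: d_def norm_mult norm_minus_cancel norm_of_real complex_mod_cnj power_mult_distrib power2_abs)
    also have "\<dots> = pp r \<rho> ?x * qq r \<rho> ?x"
      unfolding y using \<rho> by (simp add: pp_def qq_def power2_eq_square)
    finally show ?thesis .
  qed
  have "2 * cmod d < ?A"
  proof (rule power2_less_imp_less)
    have "?A\<^sup>2 - (2 * cmod d)\<^sup>2 = r\<^sup>2 + 2 * r * (pp r \<rho> ?x + qq r \<rho> ?x) + (pp r \<rho> ?x - qq r \<rho> ?x)\<^sup>2"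
      unfolding power_mult_distrib cd by (simp add: power2_eq_square algebra_simps)
    also have "\<dots> > 0" using pp_nonneg[OF n] qq_nonneg[OF n] r by (intro add_pos_nonneg) auto
    finally show "(2 * cmod d)\<^sup>2 < ?A\<^sup>2" by simp
    show "0 \<le> ?A" using pp_nonneg[OF n] qq_nonneg[OF n] r by simp
  qed
  from circle_average_ln_quadratic[OF this]
  have "has_bochner_integral unif01 (\<lambda>\<tau>. ln (?A + 2 * Re (d * cis (2 * pi * \<tau>)))) (ln (circle_mean r \<rho> ?x))"
    by (simp add: circle_mean_def ss_alt cd)
  moreover have "?A + 2 * Re (d * cis (2 * pi * \<tau>)) = r + (1 - r) * (cmod (fst (mix \<rho> (cis (2 * pi * \<tau>)) p)))\<^sup>2" for \<tau>
  proof -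
    define e where "e = cis (2 * pi * \<tau>)"
    have ee: "(Re e)\<^sup>2 + (Im e)\<^sup>2 = 1" unfolding cmod_power2[symmetric] by (simp add: e_def)
    have "(cmod (fst (mix \<rho> e p)))\<^sup>2 = (sqrt \<rho>)\<^sup>2 * (cmod (fst p))\<^sup>2 + (sqrt (1 - \<rho>))\<^sup>2 * (cmod (snd p))\<^sup>2
        - 2 * (sqrt \<rho> * sqrt (1 - \<rho>)) * Re (cnj (fst p * snd p) * e)"
      unfolding mix_def cmod_power2 fst_conv
      using mix_identity_fst[of "sqrt \<rho>" "Re (fst p)" "sqrt (1 - \<rho>)" "Re e" "Re (snd p)" "Im e" "Im (snd p)" "Im (fst p)", unfolded ee mult_1_left]
      by (simp add: algebra_simps)
    also have "\<dots> = ?x * \<rho> + (1 - ?x) * (1 - \<rho>) - 2 * (sqrt \<rho> * sqrt (1 - \<rho>)) * Re (cnj (fst p * snd p) * e)"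
      unfolding y using \<rho> by simp
    finally have m: "(cmod (fst (mix \<rho> e p)))\<^sup>2 = \<dots>" .
    have "Re (d * e) = - ((1 - r) * (sqrt \<rho> * sqrt (1 - \<rho>))) * Re (cnj (fst p * snd p) * e)"
      by (simp only: d_def mult.assoc Re_complex_of_real[symmetric] of_real_minus[symmetric] minus_mult_left[symmetric]
        uminus_complex.sel times_complex.sel(1)[of "of_real _"] Im_complex_of_real) simp
    then show ?thesis unfolding e_def[symmetric] m by (simp add: pp_def qq_def algebra_simps)
  qed
  ultimately show ?thesis by (simp only:)
qed

lemma circle_mean_section_measurable: "(\<lambda>x. ln (circle_mean r \<rho> x)) \<in> borel_measurable borel"
  using measurable_compose[OF measurable_Pair1'[of r borel borel] circle_mean_measurable[of \<rho>]] by simp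

text \<open>\<open>mix\<close> preserves the uniform law on the sphere, so averaging a function of
  \<open>mix\<close> over sphere and circle equals averaging it at the original point. The value
  therefore does not depend on \<rho>, which removes all linear terms from differences of the
  variance.\<close>

lemma integral_ln_circle_mean:
  assumes \<rho>: "0 \<le> \<rho>" "\<rho> \<le> 1"
  shows "(\<integral>x. ln (circle_mean r \<rho> x) \<partial>unif01) = (\<integral>x. ln (r + (1 - r) * x) \<partial>unif01)"
proof -
  interpret S: prob_space sph by (rule prob_sph)
  interpret U: prob_space unif01 by (rule prob_unif01)
  interpret P: pair_prob_space sph unif01 ..
  note circle_mean_section_measurable[measurable]
  let ?f = "\<lambda>p \<tau>. ln (r + (1 - r) * (cmod (fst (mix \<rho> (cis (2 * pi * \<tau>)) p)))\<^sup>2)"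
  have m: "(\<lambda>(p, \<tau>). ?f p \<tau>) \<in> borel_measurable (sph \<Otimes>\<^sub>M unif01)"
  proof -
    have "(\<lambda>q. case q of (p, \<tau>) \<Rightarrow> mix \<rho> (cis (2 * pi * \<tau>)) p) \<in> borel_measurable (sph \<Otimes>\<^sub>M unif01)"
      using mix_measurable by (simp add: measurable_cong_sets[OF sets_pair_measure_cong[OF sets_sph sets_unif01] refl])
    from measurable_compose[OF this, of "\<lambda>v. ln (r + (1 - r) * (cmod (fst v))\<^sup>2)" borel]
    show ?thesis by (simp add: case_prod_beta borel_prod[symmetric])
  qed
  have int: "integrable (sph \<Otimes>\<^sub>M unif01) (\<lambda>(p, \<tau>). ?f p \<tau>)"
  proof (rule P.P.integrable_const_bound[where B = "- ln r"])
    show "AE q in sph \<Otimes>\<^sub>M unif01. norm (case q of (p, \<tau>) \<Rightarrow> ?f p \<tau>) \<le> - ln r"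
      using AE_pair_fst[OF prob_unif01 AE_sph_norm]
    proof eventually_elim
      case (elim q)
      obtain p \<tau> where q: "q = (p, \<tau>)" by (cases q)
      have "norm (fst (mix \<rho> (cis (2 * pi * \<tau>)) p)) \<le> 1"
        using norm_fst_le[of "fst (mix \<rho> (cis (2 * pi * \<tau>)) p)" "snd (mix \<rho> (cis (2 * pi * \<tau>)) p)"] elim q
        by (simp add: mix_norm[OF \<rho>])
      then have "(cmod (fst (mix \<rho> (cis (2 * pi * \<tau>)) p)))\<^sup>2 \<le> 1" by (simp add: power_le_one)
      then show ?case using compression_ln_bound[OF zero_le_power2] by (simp add: q)
    qed
  qed (rule m)
  have "(\<integral>x. ln (circle_mean r \<rho> x) \<partial>unif01) = (\<integral>p. ln (circle_mean r \<rho> ((cmod (fst p))\<^sup>2)) \<partial>sph)"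
    by (rule integral_sph_fst[symmetric]) measurable
  also have "\<dots> = (\<integral>p. \<integral>\<tau>. ?f p \<tau> \<partial>unif01 \<partial>sph)"
  proof (rule integral_cong_AE)
    show "(\<lambda>p. ln (circle_mean r \<rho> ((cmod (fst p))\<^sup>2))) \<in> borel_measurable sph"
      unfolding measurable_cong_sets[OF sets_sph refl]
      by (rule measurable_compose[OF _ circle_mean_section_measurable]) (intro borel_measurable_continuous_onI continuous_intros)
    show "(\<lambda>p. \<integral>\<tau>. ?f p \<tau> \<partial>unif01) \<in> borel_measurable sph" by (rule U.borel_measurable_lebesgue_integral[OF m])
    show "AE p in sph. ln (circle_mean r \<rho> ((cmod (fst p))\<^sup>2)) = (\<integral>\<tau>. ?f p \<tau> \<partial>unif01)"
      using AE_sph by eventually_elim (simp add: has_bochner_integral_integral_eq[OF circle_average_mix[OF \<rho>]])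
  qed
  also have "\<dots> = (\<integral>\<tau>. \<integral>p. ?f p \<tau> \<partial>sph \<partial>unif01)" by (rule P.Fubini_integral[OF int, symmetric])
  also have "\<dots> = (\<integral>\<tau>. (\<integral>x. ln (r + (1 - r) * x) \<partial>unif01) \<partial>unif01)"
  proof (rule Bochner_Integration.integral_cong[OF refl])
    fix \<tau> :: real
    let ?e = "cis (2 * pi * \<tau>)"
    have mx: "mix \<rho> ?e \<in> sph \<rightarrow>\<^sub>M borel"
      unfolding measurable_cong_sets[OF sets_sph refl] mix_def[abs_def]
      by (intro borel_measurable_continuous_onI continuous_intros)
    have mf: "(\<lambda>v :: complex \<times> complex. ln (r + (1 - r) * (cmod (fst v))\<^sup>2)) \<in> borel_measurable borel"
      unfolding borel_prod[symmetric] by measurable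
    have "(\<integral>p. ?f p \<tau> \<partial>sph) = (\<integral>v. ln (r + (1 - r) * (cmod (fst v))\<^sup>2) \<partial>distr sph borel (mix \<rho> ?e))"
      by (rule integral_distr[OF mx mf, symmetric])
    also have "\<dots> = (\<integral>v. ln (r + (1 - r) * (cmod (fst v))\<^sup>2) \<partial>sph)" by (simp add: mix_sph[OF \<rho>])
    also have "\<dots> = (\<integral>x. ln (r + (1 - r) * x) \<partial>unif01)" by (rule integral_sph_fst) measurable
    finally show "(\<integral>p. ?f p \<tau> \<partial>sph) = (\<integral>x. ln (r + (1 - r) * x) \<partial>unif01)" .
  qed
  also have "\<dots> = (\<integral>x. ln (r + (1 - r) * x) \<partial>unif01)" using U.prob_space by simp
  finally show ?thesis .
qed

lemma integrable_ln_circle_mean: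
  assumes \<rho>: "0 \<le> \<rho>" "\<rho> \<le> 1"
  shows "integrable unif01 (\<lambda>x. ln (circle_mean r \<rho> x))" "integrable unif01 (\<lambda>x. ln (r + (1 - r) * x) * ln (circle_mean r \<rho> x))"
proof -
  interpret U: prob_space unif01 by (rule prob_unif01)
  note circle_mean_section_measurable[measurable]
  show "integrable unif01 (\<lambda>x. ln (circle_mean r \<rho> x))"
  proof (rule U.integrable_const_bound[where B = "- ln (r / 2)"])
    show "AE x in unif01. norm (ln (circle_mean r \<rho> x)) \<le> - ln (r / 2)"
      using AE_unif01 by eventually_elim (use circle_mean_ln_bound[OF _ _ \<rho>] in auto)
  qed measurable
  show "integrable unif01 (\<lambda>x. ln (r + (1 - r) * x) * ln (circle_mean r \<rho> x))"
  proof (rule U.integrable_const_bound[where B = "- ln r * - ln (r / 2)"])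
    show "AE x in unif01. norm (ln (r + (1 - r) * x) * ln (circle_mean r \<rho> x)) \<le> - ln r * - ln (r / 2)"
      using AE_unif01
    proof eventually_elim
      case (elim x)
      have "\<bar>ln (r + (1 - r) * x)\<bar> * \<bar>ln (circle_mean r \<rho> x)\<bar> \<le> - ln r * - ln (r / 2)"
        using elim r circle_mean_ln_bound[of x \<rho>] compression_ln_bound[of x] \<rho> by (intro mult_mono) auto
      then show ?case by (simp add: abs_mult)
    qed
  qed measurable
qed

end

text \<open>The average over pairs of unit vectors of C^2 with squared overlap \<rho>: the first is
  uniform on the sphere, the second has a uniform relative phase.\<close>

definition sphere_average :: "(complex \<times> complex \<Rightarrow> real) \<Rightarrow> real \<Rightarrow> real" where
  "sphere_average Q \<rho> = (\<integral>p. \<integral>\<tau>. ln (Q p) * ln (Q (mix \<rho> (cis (2 * pi * \<tau>)) p)) \<partial>unif01 \<partial>sph)"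

text \<open>The diagonalizing rotation preserves \<open>sph\<close> and commutes with
  \<open>mix\<close>, so Q may be taken diagonal. On the unit sphere it is then a (r + (1 - r) x)
  with r = b/a; the logarithm splits, and the phase integral is the circle average.\<close>

lemma sphere_average_diagonal:
  assumes n: "(cmod \<alpha>)\<^sup>2 + (cmod \<beta>)\<^sup>2 = 1" and ab: "0 < b" "b \<le> a" and [measurable]: "Q \<in> borel_measurable borel"
    and Q: "\<And>p. Q (rot \<alpha> \<beta> p) = a * (cmod (fst p))\<^sup>2 + b * (cmod (snd p))\<^sup>2"
    and \<rho>: "0 \<le> \<rho>" "\<rho> \<le> 1"
  shows "sphere_average Q \<rho> = (\<integral>x. (ln a + ln (b / a + (1 - b / a) * x)) * (ln a + ln (circle_mean (b / a) \<rho> x)) \<partial>unif01)"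
proof -
  interpret S: prob_space sph by (rule prob_sph)
  interpret U: prob_space unif01 by (rule prob_unif01)
  define r where "r = b / a"
  have r: "0 < r" "r \<le> 1" and a: "a > 0" using ab by (auto simp: r_def)
  note circle_mean_section_measurable[OF r, measurable]
  let ?h = "\<lambda>p \<tau>. ln (Q p) * ln (Q (mix \<rho> (cis (2 * pi * \<tau>)) p))"
  have mmix: "(\<lambda>(p, \<tau>). mix \<rho> (cis (2 * pi * \<tau>)) p) \<in> borel_measurable (sph \<Otimes>\<^sub>M unif01)"
    using mix_measurable by (simp add: measurable_cong_sets[OF sets_pair_measure_cong[OF sets_sph sets_unif01] refl])
  have m: "(\<lambda>(p, \<tau>). ?h p \<tau>) \<in> borel_measurable (sph \<Otimes>\<^sub>M unif01)"
  proof -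
    have "(\<lambda>q. Q (fst q)) \<in> borel_measurable (sph \<Otimes>\<^sub>M unif01)"
      by (rule measurable_compose[OF measurable_fst]) (simp add: measurable_cong_sets[OF sets_sph refl] assms)
    moreover have "(\<lambda>q. Q (case q of (p, \<tau>) \<Rightarrow> mix \<rho> (cis (2 * pi * \<tau>)) p)) \<in> borel_measurable (sph \<Otimes>\<^sub>M unif01)"
      by (rule measurable_compose[OF mmix]) (rule assms)
    ultimately show ?thesis unfolding case_prod_beta by (intro borel_measurable_times borel_measurable_ln)
  qed
  have Qr: "Q (rot \<alpha> \<beta> p) = a * (r + (1 - r) * (cmod (fst p))\<^sup>2)" if "(cmod (fst p))\<^sup>2 + (cmod (snd p))\<^sup>2 = 1" for p
  proof -
    have y: "(cmod (snd p))\<^sup>2 = 1 - (cmod (fst p))\<^sup>2" using that by simp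
    have b: "b = a * r" using a by (simp add: r_def)
    show ?thesis unfolding Q y b by (simp add: algebra_simps)
  qed
  have lnQ: "ln (Q (rot \<alpha> \<beta> p)) = ln a + ln (r + (1 - r) * (cmod (fst p))\<^sup>2)" if "(cmod (fst p))\<^sup>2 + (cmod (snd p))\<^sup>2 = 1" for p
  proof -
    have "r + (1 - r) * (cmod (fst p))\<^sup>2 > 0" using r by (intro add_pos_nonneg mult_nonneg_nonneg) auto
    then show ?thesis using a by (simp add: Qr[OF that] ln_mult)
  qed
  have "sphere_average Q \<rho> = (\<integral>p. \<integral>\<tau>. ?h p \<tau> \<partial>unif01 \<partial>distr sph borel (rot \<alpha> \<beta>))"
    by (simp add: sphere_average_def rot_sph[OF n])
  also have "\<dots> = (\<integral>p. \<integral>\<tau>. ?h (rot \<alpha> \<beta> p) \<tau> \<partial>unif01 \<partial>sph)"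
  proof (rule integral_distr)
    show "rot \<alpha> \<beta> \<in> sph \<rightarrow>\<^sub>M borel" by (simp add: measurable_cong_sets[OF sets_sph refl])
    show "(\<lambda>p. \<integral>\<tau>. ?h p \<tau> \<partial>unif01) \<in> borel_measurable borel"
      using U.borel_measurable_lebesgue_integral[OF m] by (simp add: measurable_cong_sets[OF sets_sph refl])
  qed
  also have "\<dots> = (\<integral>p. (ln a + ln (r + (1 - r) * (cmod (fst p))\<^sup>2)) * (ln a + ln (circle_mean r \<rho> ((cmod (fst p))\<^sup>2))) \<partial>sph)"
  proof (rule integral_cong_AE)
    have "(\<lambda>(p, \<tau>). ?h (rot \<alpha> \<beta> p) \<tau>) \<in> borel_measurable (sph \<Otimes>\<^sub>M unif01)"
    proof -
      have "(\<lambda>q. (rot \<alpha> \<beta> (fst q), snd q)) \<in> sph \<Otimes>\<^sub>M unif01 \<rightarrow>\<^sub>M sph \<Otimes>\<^sub>M unif01"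
        by (intro measurable_Pair measurable_compose[OF measurable_fst] measurable_snd)
          (simp add: measurable_cong_sets[OF sets_sph sets_sph])
      from measurable_compose[OF this m] show ?thesis by (simp add: case_prod_beta)
    qed
    then show "(\<lambda>p. \<integral>\<tau>. ?h (rot \<alpha> \<beta> p) \<tau> \<partial>unif01) \<in> borel_measurable sph" by (rule U.borel_measurable_lebesgue_integral)
    have "(\<lambda>x. (ln a + ln (r + (1 - r) * x)) * (ln a + ln (circle_mean r \<rho> x))) \<in> borel_measurable borel" by measurable
    from measurable_compose[OF _ this, of "\<lambda>p. (cmod (fst p))\<^sup>2"]
    show "(\<lambda>p. (ln a + ln (r + (1 - r) * (cmod (fst p))\<^sup>2)) * (ln a + ln (circle_mean r \<rho> ((cmod (fst p))\<^sup>2)))) \<in> borel_measurable sph"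
      unfolding measurable_cong_sets[OF sets_sph refl] by (simp add: borel_measurable_continuous_onI continuous_intros)
    show "AE p in sph. (\<integral>\<tau>. ?h (rot \<alpha> \<beta> p) \<tau> \<partial>unif01)
        = (ln a + ln (r + (1 - r) * (cmod (fst p))\<^sup>2)) * (ln a + ln (circle_mean r \<rho> ((cmod (fst p))\<^sup>2)))"
      using AE_sph
    proof eventually_elim
      case (elim p)
      have "(cmod (fst (mix \<rho> (cis (2 * pi * \<tau>)) p)))\<^sup>2 + (cmod (snd (mix \<rho> (cis (2 * pi * \<tau>)) p)))\<^sup>2 = 1" for \<tau>
        using elim mix_norm[OF \<rho>, of "cis (2 * pi * \<tau>)" p] by (simp only: norm_pair_square[symmetric]) simp
      then have h: "?h (rot \<alpha> \<beta> p) \<tau> = (ln a + ln (r + (1 - r) * (cmod (fst p))\<^sup>2))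
          * (ln a + ln (r + (1 - r) * (cmod (fst (mix \<rho> (cis (2 * pi * \<tau>)) p)))\<^sup>2))" for \<tau>
        by (simp only: mix_rot lnQ[OF elim] lnQ)
      have "has_bochner_integral unif01 (\<lambda>\<tau>. ln a) (ln a)"
        using U.prob_space by (simp add: has_bochner_integral_iff)
      from has_bochner_integral_add[OF this circle_average_mix[OF r \<rho> elim]]
      have "has_bochner_integral unif01 (?h (rot \<alpha> \<beta> p))
          ((ln a + ln (r + (1 - r) * (cmod (fst p))\<^sup>2)) * (ln a + ln (circle_mean r \<rho> ((cmod (fst p))\<^sup>2))))"
        unfolding h by (rule has_bochner_integral_mult_right)
      then show ?case by (rule has_bochner_integral_integral_eq)
    qed
  qed
  also have "\<dots> = (\<integral>x. (ln a + ln (r + (1 - r) * x)) * (ln a + ln (circle_mean r \<rho> x)) \<partial>unif01)"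
    by (rule integral_sph_fst) measurable
  finally show ?thesis by (simp only: r_def)
qed

text \<open>On expanding the product, every term with ln a is independent of \<rho> by
  \<open>integral_ln_circle_mean\<close> and cancels. The increment thus depends on the form only
  through the ratio of its eigenvalues.\<close>

lemma sphere_average_diff:
  assumes n: "(cmod \<alpha>)\<^sup>2 + (cmod \<beta>)\<^sup>2 = 1" and ab: "0 < b" "b \<le> a" and Qm: "Q \<in> borel_measurable borel"
    and Q: "\<And>p. Q (rot \<alpha> \<beta> p) = a * (cmod (fst p))\<^sup>2 + b * (cmod (snd p))\<^sup>2"
    and \<rho>: "0 \<le> \<rho>" "\<rho> \<le> 1" and \<rho>': "0 \<le> \<rho>'" "\<rho>' \<le> 1"
  shows "sphere_average Q \<rho> - sphere_average Q \<rho>'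
     = (\<integral>x. ln (b / a + (1 - b / a) * x) * (ln (circle_mean (b / a) \<rho> x) - ln (circle_mean (b / a) \<rho>' x)) \<partial>unif01)"
proof -
  interpret U: prob_space unif01 by (rule prob_unif01)
  define r where "r = b / a"
  have r: "0 < r" "r \<le> 1" using ab by (auto simp: r_def)
  note I = integrable_ln_circle_mean[OF r]
  let ?L = "\<lambda>x. ln (r + (1 - r) * x)"
  have LI: "integrable unif01 ?L"
  proof (rule U.integrable_const_bound[where B = "- ln r"])
    show "AE x in unif01. norm (?L x) \<le> - ln r" using AE_unif01 by eventually_elim (use compression_ln_bound[OF r] in auto)
  qed measurable
  have val: "sphere_average Q \<rho> = ln a * ln a + ln a * (\<integral>x. ?L x \<partial>unif01) + ln a * (\<integral>x. ?L x \<partial>unif01) + (\<integral>x. ?L x * ln (circle_mean r \<rho> x) \<partial>unif01)"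
    if \<rho>: "0 \<le> \<rho>" "\<rho> \<le> 1" for \<rho>
  proof -
    have "sphere_average Q \<rho> = (\<integral>x. ln a * ln a + ln a * ?L x + ln a * ln (circle_mean r \<rho> x) + ?L x * ln (circle_mean r \<rho> x) \<partial>unif01)"
      unfolding sphere_average_diagonal[OF n ab Qm Q \<rho>] r_def[symmetric] by (simp add: algebra_simps)
    also have "\<dots> = ln a * ln a + ln a * (\<integral>x. ?L x \<partial>unif01) + ln a * (\<integral>x. ln (circle_mean r \<rho> x) \<partial>unif01) + (\<integral>x. ?L x * ln (circle_mean r \<rho> x) \<partial>unif01)"
      using I[OF \<rho>] LI U.prob_space by simp
    finally show ?thesis unfolding integral_ln_circle_mean[OF r \<rho>] .
  qed
  have "(\<integral>x. ?L x * (ln (circle_mean r \<rho> x) - ln (circle_mean r \<rho>' x)) \<partial>unif01) = (\<integral>x. ?L x * ln (circle_mean r \<rho> x) - ?L x * ln (circle_mean r \<rho>' x) \<partial>unif01)"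
    by (simp only: right_diff_distrib)
  also have "\<dots> = (\<integral>x. ?L x * ln (circle_mean r \<rho> x) \<partial>unif01) - (\<integral>x. ?L x * ln (circle_mean r \<rho>' x) \<partial>unif01)"
    by (rule Bochner_Integration.integral_diff[OF I(2)[OF \<rho>] I(2)[OF \<rho>']])
  finally show ?thesis unfolding val[OF \<rho>] val[OF \<rho>'] r_def[symmetric] by simp
qed

subsection \<open>Differentiation of the variance term\<close>

text \<open>Only increments from \<rho> occur in the hypotheses, which suits functions known through
  their differences. Derivatives are tested along sequences, so that dominated convergence applies
  to the difference quotients.\<close>

lemma has_real_derivative_integral_dominated:
  fixes f :: "real \<Rightarrow> real" and D :: "real \<Rightarrow> 'a \<Rightarrow> real"
  assumes S: "open S" "\<rho> \<in> S"
    and f: "\<And>y. y \<in> S \<Longrightarrow> f y - f \<rho> = (\<integral>x. D y x \<partial>M)"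
    and m: "\<And>y. y \<in> S \<Longrightarrow> D y \<in> borel_measurable M"
    and w: "integrable M w" "\<And>y. y \<in> S \<Longrightarrow> AE x in M. \<bar>D y x\<bar> \<le> w x * \<bar>y - \<rho>\<bar>"
    and d: "d \<in> borel_measurable M" "AE x in M. D \<rho> x = 0 \<and> ((\<lambda>y. D y x) has_real_derivative d x) (at \<rho>)"
  shows "(f has_real_derivative (\<integral>x. d x \<partial>M)) (at \<rho>)"
  unfolding has_field_derivative_iff tendsto_at_iff_sequentially
proof (intro allI impI)
  fix X :: "nat \<Rightarrow> real" assume X: "\<forall>i. X i \<in> UNIV - {\<rho>}" "X \<longlonglongrightarrow> \<rho>"
  \<comment> \<open>Finitely many indices are discarded, since the integral formula is available
    only inside \<open>S\<close>.\<close>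
  have "eventually (\<lambda>i. X i \<in> S) sequentially" using topological_tendstoD[OF X(2) S] .
  then obtain n0 where n0: "\<And>i. i \<ge> n0 \<Longrightarrow> X i \<in> S" by (auto simp: eventually_sequentially)
  define Y where "Y i = X (i + n0)" for i
  have Y: "Y i \<in> S" "Y i \<noteq> \<rho>" for i using n0 X(1) by (auto simp: Y_def)
  have Yl: "Y \<longlonglongrightarrow> \<rho>" unfolding Y_def using X(2) by (rule LIMSEQ_ignore_initial_segment)
  have "(\<lambda>i. \<integral>x. D (Y i) x / (Y i - \<rho>) \<partial>M) \<longlonglongrightarrow> (\<integral>x. d x \<partial>M)"
  proof (rule integral_dominated_convergence[OF d(1) _ w(1)])
    show "(\<lambda>x. D (Y i) x / (Y i - \<rho>)) \<in> borel_measurable M" for i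
      using m[OF Y(1)] by (intro borel_measurable_divide) auto
    show "AE x in M. (\<lambda>i. D (Y i) x / (Y i - \<rho>)) \<longlonglongrightarrow> d x"
      using d(2)
    proof eventually_elim
      case (elim x)
      then have "D \<rho> x = 0" "((\<lambda>y. (D y x - D \<rho> x) / (y - \<rho>)) \<longlongrightarrow> d x) (at \<rho>)"
        by (auto simp only: has_field_derivative_iff)
      then have "((\<lambda>y. D y x / (y - \<rho>)) \<longlongrightarrow> d x) (at \<rho>)" by simp
      then have "((\<lambda>y. D y x / (y - \<rho>)) \<circ> Y) \<longlonglongrightarrow> d x"
        unfolding tendsto_at_iff_sequentially using Y Yl by blast
      then show ?case by (simp add: comp_def)
    qed
    show "AE x in M. norm (D (Y i) x / (Y i - \<rho>)) \<le> w x" for i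
      using w(2)[OF Y(1), of i]
    proof eventually_elim
      case (elim x)
      then show ?case using Y(2)[of i] by (simp add: abs_divide pos_divide_le_eq)
    qed
  qed
  then have "(\<lambda>i. (f (Y i) - f \<rho>) / (Y i - \<rho>)) \<longlonglongrightarrow> (\<integral>x. d x \<partial>M)"
    by (simp add: f[OF Y(1)])
  then have "(\<lambda>i. (f (X (i + n0)) - f \<rho>) / (X (i + n0) - \<rho>)) \<longlonglongrightarrow> (\<integral>x. d x \<partial>M)" by (simp add: Y_def)
  then show "((\<lambda>y. (f y - f \<rho>) / (y - \<rho>)) \<circ> X) \<longlonglongrightarrow> (\<integral>x. d x \<partial>M)"
    unfolding comp_def by (rule LIMSEQ_offset)
qed

definition quadf_pair :: "nat \<Rightarrow> (nat \<Rightarrow> real) \<Rightarrow> complex mat \<Rightarrow> complex \<times> complex \<Rightarrow> real" where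
  "quadf_pair N l U p = (\<Sum>k<N. exp (l k) * (cmod (U $$ (k, 0) * fst p + U $$ (k, 1) * snd p))\<^sup>2)"

lemma quadf_two:
  assumes "N \<ge> 2" "\<And>j. 2 \<le> j \<Longrightarrow> j < N \<Longrightarrow> f j = 0"
  shows "quadf N l U f = quadf_pair N l U (f 0, f 1)"
proof -
  have "(\<Sum>j<N. U $$ (k, j) * f j) = U $$ (k, 0) * f 0 + U $$ (k, 1) * f 1" for k
    by (rule sum_first_two[OF assms(1)]) (simp add: assms(2))
  then show ?thesis by (simp add: quadf_def quadf_pair_def)
qed

text \<open>Acts on the coordinates 0 and \<open>i\<close> as \<open>rot (fst p) (snd p)\<close> and
  as the identity elsewhere; it sends the first basis vector to \<open>p\<close> placed in these two
  coordinates.\<close>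

definition givens :: "nat \<Rightarrow> nat \<Rightarrow> complex \<times> complex \<Rightarrow> complex mat" where
  "givens N i p = mat N N (\<lambda>(a, b). if b = 0 then (if a = 0 then fst p else if a = i then snd p else 0)
     else if b = i then (if a = 0 then - cnj (snd p) else if a = i then cnj (fst p) else 0)
     else if a = b then 1 else 0)"

lemma givens_carrier [simp]: "givens N i p \<in> carrier_mat N N"
  by (simp add: givens_def)

lemma unit_pair_cnj:
  assumes "norm p = 1"
  shows "fst p * cnj (fst p) + snd p * cnj (snd p) = (1 :: complex)"
proof -
  have "fst p * cnj (fst p) + snd p * cnj (snd p) = complex_of_real ((norm p)\<^sup>2)"
    unfolding norm_pair_square of_real_add complex_norm_square ..
  then show ?thesis using assms by simp
qed

lemma sum_split_two:
  fixes f :: "nat \<Rightarrow> 'a::comm_monoid_add"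
  assumes "0 < i" "i < N"
  shows "(\<Sum>a<N. f a) = f 0 + f i + (\<Sum>a\<in>{..<N} - {0, i}. f a)"
proof -
  have "(\<Sum>a<N. f a) = (\<Sum>a\<in>{..<N} - {0, i}. f a) + (\<Sum>a\<in>{0, i}. f a)"
    using assms by (intro sum.subset_diff) auto
  then show ?thesis using assms by (simp add: add.commute)
qed

lemma givens_unitary:
  assumes p: "norm p = 1" and i: "0 < i" "i < N"
  shows "givens N i p \<in> unitary_group N"
proof (rule unitary_groupI[OF givens_carrier])
  fix b c assume bc: "b < N" "c < N"
  note u = unit_pair_cnj[OF p]
  let ?f = "\<lambda>a. cnj (givens N i p $$ (a, b)) * givens N i p $$ (a, c)"
  have "(\<Sum>a\<in>{..<N} - {0, i}. ?f a) = (\<Sum>a\<in>{..<N} - {0, i}. if a = b then (if b = c then 1 else 0) else 0)"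
    using bc i by (intro sum.cong refl) (auto simp: givens_def)
  also have "\<dots> = (if b \<in> {..<N} - {0, i} then (if b = c then 1 else 0) else 0)" by simp
  finally have rest: "(\<Sum>a\<in>{..<N} - {0, i}. ?f a) = (if b \<noteq> 0 \<and> b \<noteq> i \<and> b = c then 1 else 0)" using bc by auto
  have two: "?f 0 + ?f i = (if (b = 0 \<or> b = i) \<and> b = c then 1 else 0)"
    using u bc i by (auto simp: givens_def mult.commute add.commute)
  show "(\<Sum>a<N. ?f a) = (if b = c then 1 else 0)"
    unfolding sum_split_two[OF i] rest two by auto
qed

lemma mat_act_givens:
  assumes i: "0 < i" "i < N" and k: "k < N"
  shows "mat_act N (givens N i p) f k = (if k = 0 then fst p * f 0 - cnj (snd p) * f i
    else if k = i then snd p * f 0 + cnj (fst p) * f i else f k)"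
proof -
  have "(\<Sum>j\<in>{..<N} - {0, i}. givens N i p $$ (k, j) * f j) = (\<Sum>j\<in>{..<N} - {0, i}. if j = k then f k else 0)"
    using k i by (intro sum.cong refl) (auto simp: givens_def)
  also have "\<dots> = (if k \<noteq> 0 \<and> k \<noteq> i then f k else 0)" using k by simp
  finally show ?thesis
    unfolding mat_act_def sum_split_two[OF i] using i k by (simp add: givens_def)
qed

lemma quadf_pair_bounds:
  assumes N: "N \<ge> 2" and U: "U \<in> unitary_group N" and p: "norm p = 1"
  shows "0 < quadf_pair N l U p" "(ln (quadf_pair N l U p))\<^sup>2 \<le> (\<Sum>j<N. (l j)\<^sup>2)"
    "(\<Sum>k<N. (cmod (U $$ (k, 0) * fst p + U $$ (k, 1) * snd p))\<^sup>2) = 1"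
proof -
  define f where "f j = (if j = 0 then fst p else if j = 1 then snd p else 0)" for j :: nat
  have "(\<Sum>j<N. (cmod (f j))\<^sup>2) = (cmod (f 0))\<^sup>2 + (cmod (f 1))\<^sup>2"
    by (rule sum_first_two[OF N]) (simp add: f_def)
  also have "\<dots> = (norm p)\<^sup>2" by (simp add: f_def norm_pair_square)
  finally have n: "(\<Sum>j<N. (cmod (f j))\<^sup>2) = 1" using p by simp
  have q: "quadf N l U f = quadf_pair N l U p" using quadf_two[OF N, of f l U] by (simp add: f_def)
  show "0 < quadf_pair N l U p" "(ln (quadf_pair N l U p))\<^sup>2 \<le> (\<Sum>j<N. (l j)\<^sup>2)"
    using quadf_bounds[OF U n, of l] by (simp_all add: q)
  have "(\<Sum>j<N. U $$ (k, j) * f j) = U $$ (k, 0) * fst p + U $$ (k, 1) * snd p" for k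
    using sum_first_two[OF N, of "\<lambda>j. U $$ (k, j) * f j"] by (simp add: f_def)
  then show "(\<Sum>k<N. (cmod (U $$ (k, 0) * fst p + U $$ (k, 1) * snd p))\<^sup>2) = 1"
    using unitary_norm[OF U, of f] n by simp
qed

text \<open>The Givens matrix of \<open>p\<close> carries the normal form with phase
  \<open>e\<close> to the pair of \<open>p\<close> and \<open>mix\<close> of \<open>p\<close>, so
  the correlation is the same for every such pair.\<close>

lemma corr_mix:
  assumes N: "N \<ge> 2" and T: "T > 0" and p: "norm p = 1" and e: "cmod e = 1"
  shows "corr N T e0 (pair_vec \<rho> 1) = (\<integral>x. ln (quadf_pair N (fst x) (snd x) p) * ln (quadf_pair N (fst x) (snd x) (mix \<rho> e p)) \<partial>hk_prod N T)"
proof -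
  have N0: "N > 0" and i: "0 < (1::nat)" "1 < N" using N by auto
  let ?G = "givens N 1 p"
  have G: "?G \<in> unitary_group N" by (rule givens_unitary[OF p i])
  have "corr N T e0 (pair_vec \<rho> 1) = corr N T (mat_act N ?G e0) (mat_act N ?G (pair_vec \<rho> e))"
    unfolding corr_unitary[OF N0 T G] by (rule corr_pair_vec_phase[OF N T]) (simp_all add: e)
  moreover have "quadf N l U (mat_act N ?G e0) = quadf_pair N l U p" for l U
  proof -
    have "quadf N l U (mat_act N ?G e0) = quadf_pair N l U (mat_act N ?G e0 0, mat_act N ?G e0 1)"
      by (rule quadf_two[OF N]) (use i in \<open>auto simp: mat_act_givens[OF i] e0_def simp del: One_nat_def\<close>)
    then show ?thesis using N0 i by (simp add: mat_act_givens[OF i] e0_def del: One_nat_def)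
  qed
  moreover have "quadf N l U (mat_act N ?G (pair_vec \<rho> e)) = quadf_pair N l U (mix \<rho> e p)" for l U
  proof -
    have "quadf N l U (mat_act N ?G (pair_vec \<rho> e)) = quadf_pair N l U (mat_act N ?G (pair_vec \<rho> e) 0, mat_act N ?G (pair_vec \<rho> e) 1)"
      by (rule quadf_two[OF N]) (use i in \<open>auto simp: mat_act_givens[OF i] pair_vec_def simp del: One_nat_def\<close>)
    moreover have "(mat_act N ?G (pair_vec \<rho> e) 0, mat_act N ?G (pair_vec \<rho> e) 1) = mix \<rho> e p"
      using N0 i by (simp add: mat_act_givens[OF i] pair_vec_def mix_def mult_ac del: One_nat_def)
    ultimately show ?thesis by simp
  qed
  ultimately show ?thesis by (simp add: corr_def)
qed

lemma quadf_pair_measurable: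
  assumes N: "N \<ge> 2" and u: "u \<in> M \<rightarrow>\<^sub>M hk_prod N T" and v: "v \<in> borel_measurable M"
  shows "(\<lambda>z. quadf_pair N (fst (u z)) (snd (u z)) (v z)) \<in> borel_measurable M"
  unfolding quadf_pair_def
proof (rule borel_measurable_sum)
  fix k assume "k \<in> {..<N}"
  then have k: "k < N" and N0: "N > 0" "1 < N" using N by auto
  have [measurable]: "(\<lambda>z. fst (u z) k) \<in> borel_measurable M" "(\<lambda>z. snd (u z) $$ (k, 0)) \<in> borel_measurable M"
    "(\<lambda>z. snd (u z) $$ (k, 1)) \<in> borel_measurable M" "(\<lambda>z. fst (v z)) \<in> borel_measurable M" "(\<lambda>z. snd (v z)) \<in> borel_measurable M"
    using k N0 v by (auto intro!: measurable_compose[OF u] measurable_compose[OF v] measurable_hk_prod_fst measurable_hk_prod_entry borel_measurable_fst_snd)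
  show "(\<lambda>z. exp (fst (u z) k) * (cmod (snd (u z) $$ (k, 0) * fst (v z) + snd (u z) $$ (k, 1) * snd (v z)))\<^sup>2) \<in> borel_measurable M"
    by measurable
qed

lemma hk_prod_second_moment:
  assumes N: "N > 0" and T: "T > 0"
  shows "integrable (hk_prod N T) (\<lambda>x. \<Sum>j<N. (fst x j)\<^sup>2)"
proof (rule integrableI_nonneg)
  interpret H: prob_space "haar_unitary N" by (rule prob_haar[OF N])
  have m: "(\<lambda>x. \<Sum>j<N. (fst x j)\<^sup>2) \<in> borel_measurable (hk_prod N T)"
    by (intro borel_measurable_sum borel_measurable_power measurable_hk_prod_fst N) auto
  then show "(\<lambda>x. \<Sum>j<N. (fst x j)\<^sup>2) \<in> borel_measurable (hk_prod N T)" .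
  show "AE x in hk_prod N T. 0 \<le> (\<Sum>j<N. (fst x j)\<^sup>2)" by (simp add: sum_nonneg)
  have "(\<integral>\<^sup>+x. ennreal (\<Sum>j<N. (fst x j)\<^sup>2) \<partial>hk_prod N T) = (\<integral>\<^sup>+l. \<integral>\<^sup>+U. ennreal (\<Sum>j<N. (l j)\<^sup>2) \<partial>haar_unitary N \<partial>hk_radial N T)"
    using H.nn_integral_fst[of "\<lambda>x. ennreal (\<Sum>j<N. (fst x j)\<^sup>2)" "hk_radial N T"] m by (simp add: hk_prod_def)
  also have "\<dots> = (\<integral>\<^sup>+l. ennreal (\<Sum>j<N. (l j)\<^sup>2) \<partial>hk_radial N T)"
    by (simp add: H.emeasure_space_1)
  also have "\<dots> < \<infinity>" by (rule hk_radial_second_moment[OF N T])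
  finally show "(\<integral>\<^sup>+x. ennreal (\<Sum>j<N. (fst x j)\<^sup>2) \<partial>hk_prod N T) < \<infinity>" .
qed

lemma ln_product_bound:
  assumes "a\<^sup>2 \<le> s" "b\<^sup>2 \<le> (s::real)"
  shows "\<bar>a * b\<bar> \<le> s"
proof -
  have "2 * \<bar>a * b\<bar> \<le> a\<^sup>2 + b\<^sup>2"
    using zero_le_power2[of "\<bar>a\<bar> - \<bar>b\<bar>"] by (simp add: power2_diff abs_mult)
  then show ?thesis using assms by linarith
qed

text \<open>The expectation has the same value for every \<open>p\<close> and every phase, hence may
  be averaged over them, and the integrals are exchanged. The sum of squared eigenvalue logarithms
  majorizes the integrand and is integrable.\<close>

lemma I2_eq_sphere_average:
  assumes N: "N \<ge> 2" and T: "T > 0" and \<rho>: "0 \<le> \<rho>" "\<rho> \<le> 1"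
  shows "integrable (hk_prod N T) (\<lambda>x. sphere_average (quadf_pair N (fst x) (snd x)) \<rho>)" (is ?int)
    "I2 N T \<rho> = (\<integral>x. sphere_average (quadf_pair N (fst x) (snd x)) \<rho> \<partial>hk_prod N T)" (is ?eq)
proof -
  have N0: "N > 0" using N by simp
  define Y where "Y = sph \<Otimes>\<^sub>M unif01"
  define X where "X = hk_prod N T"
  define h where "h y x = ln (quadf_pair N (fst x) (snd x) (fst y)) * ln (quadf_pair N (fst x) (snd x) (mix \<rho> (cis (2 * pi * snd y)) (fst y)))" for y x
  interpret S: prob_space sph by (rule prob_sph)
  interpret U: prob_space unif01 by (rule prob_unif01)
  interpret SU: pair_prob_space sph unif01 ..
  interpret Y: prob_space Y unfolding Y_def by (rule SU.P.prob_space_axioms)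
  interpret X: prob_space X unfolding X_def by (rule prob_hk_prod[OF N0 T])
  interpret YX: pair_prob_space Y X ..
  let ?s = "\<lambda>x. \<Sum>j<N. (fst x j)\<^sup>2"
  have sI: "integrable X ?s" unfolding X_def by (rule hk_prod_second_moment[OF N0 T])
  have mfst: "fst \<in> borel_measurable Y"
    unfolding Y_def using measurable_fst[of sph unif01] by (simp add: measurable_cong_sets[OF refl sets_sph])
  have mmix: "(\<lambda>y. mix \<rho> (cis (2 * pi * snd y)) (fst y)) \<in> borel_measurable Y"
    using mix_measurable[of \<rho>] unfolding Y_def
    by (simp add: measurable_cong_sets[OF sets_pair_measure_cong[OF sets_sph sets_unif01] refl] case_prod_beta)
  have m: "case_prod h \<in> borel_measurable (Y \<Otimes>\<^sub>M X)"
    unfolding h_def[abs_def] case_prod_beta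
    by (intro borel_measurable_times borel_measurable_ln quadf_pair_measurable[OF N measurable_snd[of Y X, unfolded X_def], folded X_def]
      measurable_compose[OF measurable_fst mfst] measurable_compose[OF measurable_fst mmix])
  have unit: "AE y in Y. norm (fst y) = 1" unfolding Y_def by (rule AE_pair_fst[OF prob_unif01 AE_sph_norm])
  have bound: "\<bar>h y x\<bar> \<le> ?s x" if "norm (fst y) = 1" "x \<in> space X" for x y
    unfolding h_def using that
    by (intro ln_product_bound quadf_pair_bounds(2)[OF N] hk_prod_snd_unitary[OF N0]) (auto simp: X_def mix_norm[OF \<rho>])
  have mY: "h y \<in> borel_measurable X" if "y \<in> space Y" for y
    using measurable_compose[OF measurable_Pair1'[OF that] m] by simp
  have mX: "(\<lambda>y. h y x) \<in> borel_measurable Y" if "x \<in> space X" for x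
    using measurable_compose[OF measurable_Pair2'[OF that] m] by simp
  have hI: "integrable X (h y)" if "norm (fst y) = 1" "y \<in> space Y" for y
    using bound[OF that(1)] by (intro Bochner_Integration.integrable_bound[OF sI mY[OF that(2)]] AE_I2) (auto simp: sum_nonneg)
  have int: "integrable (Y \<Otimes>\<^sub>M X) (case_prod h)"
  proof (rule YX.Fubini_integrable[OF m])
    show "AE y in Y. integrable X (\<lambda>x. case_prod h (y, x))"
      using unit AE_space by eventually_elim (simp add: hI)
    show "integrable Y (\<lambda>y. \<integral>x. norm (case_prod h (y, x)) \<partial>X)"
    proof (rule Y.integrable_const_bound[where B = "\<integral>x. ?s x \<partial>X"])
      show "AE y in Y. norm (\<integral>x. norm (case_prod h (y, x)) \<partial>X) \<le> (\<integral>x. ?s x \<partial>X)"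
        using unit AE_space
      proof eventually_elim
        case (elim y)
        have "(\<integral>x. norm (h y x) \<partial>X) \<le> (\<integral>x. ?s x \<partial>X)"
          using bound[OF elim(1)] by (intro integral_mono integrable_norm hI elim sI) auto
        then show ?case by simp
      qed
      show "(\<lambda>y. \<integral>x. norm (case_prod h (y, x)) \<partial>X) \<in> borel_measurable Y"
        using m by (intro X.borel_measurable_lebesgue_integral) simp
    qed
  qed
  have avg: "(\<integral>y. h y x \<partial>Y) = sphere_average (quadf_pair N (fst x) (snd x)) \<rho>" if x: "x \<in> space X" for x
  proof -
    have "integrable Y (\<lambda>y. h y x)"
      by (rule Y.integrable_const_bound[OF _ mX[OF x], where B = "?s x"])
        (use unit in eventually_elim, simp add: bound[OF _ x])
    then show ?thesis
      using SU.integral_fst'[of "\<lambda>y. h y x"] by (simp add: Y_def sphere_average_def h_def)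
  qed
  have "integrable X (\<lambda>x. \<integral>y. h y x \<partial>Y)" by (rule YX.integrable_snd[OF int])
  moreover have "integrable X (\<lambda>x. \<integral>y. h y x \<partial>Y) \<longleftrightarrow> integrable X (\<lambda>x. sphere_average (quadf_pair N (fst x) (snd x)) \<rho>)"
    by (rule Bochner_Integration.integrable_cong[OF refl avg])
  ultimately show ?int by (simp add: X_def)
  have "I2 N T \<rho> = (\<integral>y. I2 N T \<rho> \<partial>Y)" using Y.prob_space by simp
  also have "\<dots> = (\<integral>y. \<integral>x. h y x \<partial>X \<partial>Y)"
  proof (rule integral_cong_AE)
    show "(\<lambda>y. \<integral>x. h y x \<partial>X) \<in> borel_measurable Y" by (rule X.borel_measurable_lebesgue_integral[OF m])
    show "AE y in Y. I2 N T \<rho> = (\<integral>x. h y x \<partial>X)"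
      using unit
    proof eventually_elim
      case (elim y)
      show ?case unfolding I2_eq_corr[OF N T \<rho>] h_def X_def by (rule corr_mix[OF N T elim]) simp
    qed
  qed simp
  also have "\<dots> = (\<integral>x. \<integral>y. h y x \<partial>Y \<partial>X)" by (rule YX.Fubini_integral[OF int, symmetric])
  also have "\<dots> = (\<integral>x. sphere_average (quadf_pair N (fst x) (snd x)) \<rho> \<partial>X)"
    by (rule Bochner_Integration.integral_cong[OF refl avg])
  finally show ?eq by (simp add: X_def)
qed

text \<open>Satisfied by the ratio \<open>r\<close> of the smaller to the larger eigenvalue of the compression of \<open>P\<close> to the plane of
  the first two coordinates.\<close>

definition compression_ratio :: "nat \<Rightarrow> (nat \<Rightarrow> real) \<Rightarrow> complex mat \<Rightarrow> real \<Rightarrow> bool" where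
  "compression_ratio N l U r \<longleftrightarrow> 0 < r \<and> r \<le> 1 \<and>
     (\<forall>\<rho>\<in>{0..1}. \<forall>\<rho>'\<in>{0..1}. sphere_average (quadf_pair N l U) \<rho> - sphere_average (quadf_pair N l U) \<rho>'
        = (\<integral>x. ln (r + (1 - r) * x) * (ln (circle_mean r \<rho> x) - ln (circle_mean r \<rho>' x)) \<partial>unif01)) \<and>
     (\<forall>m<N. \<forall>c. (\<forall>k<N. k \<noteq> m \<longrightarrow> l k \<le> c) \<longrightarrow> r * (cmod (U $$ (m, 0)))\<^sup>2 \<le> exp (c - l m))"

lemma quadf_pair_hform:
  "quadf_pair N l U p = hform (\<Sum>k<N. exp (l k) * (cmod (U $$ (k, 0)))\<^sup>2) (\<Sum>k<N. exp (l k) * (cmod (U $$ (k, 1)))\<^sup>2)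
     (\<Sum>k<N. of_real (exp (l k)) * (U $$ (k, 0) * cnj (U $$ (k, 1)))) p"
proof -
  have sq: "(cmod (a * z + b * w))\<^sup>2 = (cmod a)\<^sup>2 * (cmod z)\<^sup>2 + (cmod b)\<^sup>2 * (cmod w)\<^sup>2 + 2 * Re ((a * cnj b) * (z * cnj w))" for a b z w
    unfolding cmod_power2 by (simp add: power2_eq_square algebra_simps)
  have "quadf_pair N l U p = (\<Sum>k<N. exp (l k) * (cmod (U $$ (k, 0)))\<^sup>2 * (cmod (fst p))\<^sup>2 + exp (l k) * (cmod (U $$ (k, 1)))\<^sup>2 * (cmod (snd p))\<^sup>2
      + 2 * Re (of_real (exp (l k)) * (U $$ (k, 0) * cnj (U $$ (k, 1))) * (fst p * cnj (snd p))))"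
    unfolding quadf_pair_def sq
  proof (rule sum.cong[OF refl])
    fix k
    have "Re (of_real c * z * w) = c * Re (z * w)" for c z w by (simp add: algebra_simps)
    then show "exp (l k) * ((cmod (U $$ (k, 0)))\<^sup>2 * (cmod (fst p))\<^sup>2 + (cmod (U $$ (k, 1)))\<^sup>2 * (cmod (snd p))\<^sup>2
        + 2 * Re (U $$ (k, 0) * cnj (U $$ (k, 1)) * (fst p * cnj (snd p))))
      = exp (l k) * (cmod (U $$ (k, 0)))\<^sup>2 * (cmod (fst p))\<^sup>2 + exp (l k) * (cmod (U $$ (k, 1)))\<^sup>2 * (cmod (snd p))\<^sup>2
      + 2 * Re (of_real (exp (l k)) * (U $$ (k, 0) * cnj (U $$ (k, 1))) * (fst p * cnj (snd p)))"
      by (simp only: distrib_left mult.assoc mult.left_commute)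
  qed
  then show ?thesis
    by (simp only: hform_def sum.distrib sum_distrib_right[symmetric] sum_distrib_left[symmetric] Re_sum[symmetric])
qed

text \<open>Variational bounds for the eigenvalues a >= b of the compression: a is at least the form
  at (1, 0), hence at least exp(l m) |U_m0|^2, and b is at most the form at any unit vector killed
  by row \<open>m\<close>, where only exponents up to \<open>c\<close> remain.\<close>

lemma compression_ratio_exists:
  assumes N: "N \<ge> 2" and U: "U \<in> unitary_group N"
  shows "\<exists>r. compression_ratio N l U r"
proof -
  let ?Q = "quadf_pair N l U"
  obtain A B c where Qf: "\<And>p. ?Q p = hform A B c p" using quadf_pair_hform by blast
  have "\<exists>\<alpha> \<beta> a b. (cmod \<alpha>)\<^sup>2 + (cmod \<beta>)\<^sup>2 = 1 \<and> b \<le> a \<and>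
      (\<forall>p. hform A B c (rot \<alpha> \<beta> p) = a * (cmod (fst p))\<^sup>2 + b * (cmod (snd p))\<^sup>2)"
  proof (rule hform_diagonal[of A B c])
    fix \<alpha> \<beta> a b
    assume h: "(cmod \<alpha>)\<^sup>2 + (cmod \<beta>)\<^sup>2 = 1" "b \<le> a"
      "\<And>p. hform A B c (rot \<alpha> \<beta> p) = a * (cmod (fst p))\<^sup>2 + b * (cmod (snd p))\<^sup>2"
    show ?thesis by (intro exI conjI allI) (rule h)+
  qed
  then obtain \<alpha> \<beta> a b where n: "(cmod \<alpha>)\<^sup>2 + (cmod \<beta>)\<^sup>2 = 1" and ba: "b \<le> a"
    and Q0: "\<And>p. hform A B c (rot \<alpha> \<beta> p) = a * (cmod (fst p))\<^sup>2 + b * (cmod (snd p))\<^sup>2"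
    by (elim exE conjE) (rule that, auto)
  have Q: "?Q (rot \<alpha> \<beta> p) = a * (cmod (fst p))\<^sup>2 + b * (cmod (snd p))\<^sup>2" for p
    unfolding Qf by (rule Q0)
  have Qm: "?Q \<in> borel_measurable borel"
    unfolding quadf_pair_def[abs_def] by (intro borel_measurable_continuous_onI continuous_intros)
  have n': "(cmod (cnj \<alpha>))\<^sup>2 + (cmod (- \<beta>))\<^sup>2 = 1" using n by simp
  have sandwich: "b \<le> ?Q p" "?Q p \<le> a" if p: "norm p = 1" for p
  proof -
    let ?q = "rot (cnj \<alpha>) (- \<beta>) p"
    have "(cmod (fst ?q))\<^sup>2 + (cmod (snd ?q))\<^sup>2 = 1"
      unfolding rot_norm[OF n'] using p norm_pair_square[of p] by simp
    then have y: "(cmod (snd ?q))\<^sup>2 = 1 - (cmod (fst ?q))\<^sup>2" and x: "(cmod (fst ?q))\<^sup>2 \<le> 1" by (auto, metis le_add_same_cancel1 zero_le_power2)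
    have "?Q p = b + (a - b) * (cmod (fst ?q))\<^sup>2"
      using Q[of ?q] unfolding rot_inverse[OF n] y by (simp add: algebra_simps)
    moreover have "0 \<le> (a - b) * (cmod (fst ?q))\<^sup>2" "(a - b) * (cmod (fst ?q))\<^sup>2 \<le> (a - b) * 1"
      using ba mult_left_mono[OF x, of "a - b"] by auto
    ultimately show "b \<le> ?Q p" "?Q p \<le> a" by auto
  qed
  have b: "b > 0"
  proof -
    have "norm (rot \<alpha> \<beta> (0, 1)) = 1"
      using rot_norm[OF n, of "(0, 1)"] by (simp add: norm_prod_def)
    from quadf_pair_bounds(1)[OF N U this, of l] show ?thesis unfolding Q by simp
  qed
  then have a: "a > 0" using ba by simp
  have gap: "b / a * (cmod (U $$ (m, 0)))\<^sup>2 \<le> exp (c - l m)" if m: "m < N" and c: "\<And>k. k < N \<Longrightarrow> k \<noteq> m \<Longrightarrow> l k \<le> c" for m c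
  proof -
    let ?x = "U $$ (m, 0)" and ?y = "U $$ (m, 1)"
    have "exp (l m) * (cmod ?x)\<^sup>2 \<le> (\<Sum>k<N. exp (l k) * (cmod (U $$ (k, 0)))\<^sup>2)"
      using m by (intro member_le_sum[of m "{..<N}" "\<lambda>k. exp (l k) * (cmod (U $$ (k, 0)))\<^sup>2"]) auto
    also have "\<dots> = ?Q (1, 0)" by (simp add: quadf_pair_def)
    also have "\<dots> \<le> a" by (rule sandwich) (simp add: norm_prod_def)
    finally have A: "exp (l m) * (cmod ?x)\<^sup>2 \<le> a" .
    \<comment> \<open>A unit vector on which row \<open>m\<close>, restricted to the first two
      columns, vanishes; if these two entries are 0, any unit vector will do.\<close>
    obtain p :: "complex \<times> complex" where p: "norm p = 1" "?x * fst p + ?y * snd p = 0"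
    proof (cases "?x = 0 \<and> ?y = 0")
      case True
      then show ?thesis using that[of "(1, 0)"] by (simp add: norm_prod_def)
    next
      case False
      define q where "q = (?y, - ?x)"
      have "q \<noteq> 0" using False by (auto simp: q_def zero_prod_def)
      then have "norm (q /\<^sub>R norm q) = 1" by simp
      moreover have "?x * fst (q /\<^sub>R norm q) + ?y * snd (q /\<^sub>R norm q) = 0"
        by (simp add: q_def scaleR_conv_of_real mult_ac)
      ultimately show ?thesis using that by blast
    qed
    have "b \<le> ?Q p" by (rule sandwich[OF p(1)])
    also have "?Q p \<le> (\<Sum>k<N. exp c * (cmod (U $$ (k, 0) * fst p + U $$ (k, 1) * snd p))\<^sup>2)"
      unfolding quadf_pair_def
    proof (rule sum_mono)
      fix k assume "k \<in> {..<N}"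
      then show "exp (l k) * (cmod (U $$ (k, 0) * fst p + U $$ (k, 1) * snd p))\<^sup>2 \<le> exp c * (cmod (U $$ (k, 0) * fst p + U $$ (k, 1) * snd p))\<^sup>2"
        using c p(2) by (cases "k = m") (auto intro!: mult_right_mono)
    qed
    also have "\<dots> = exp c" using quadf_pair_bounds(3)[OF N U p(1)] by (simp add: sum_distrib_left[symmetric])
    finally have B: "b \<le> exp c" .
    have "b * (cmod ?x)\<^sup>2 \<le> exp c * (cmod ?x)\<^sup>2" using B by (intro mult_right_mono) auto
    also have "\<dots> = exp (c - l m) * (exp (l m) * (cmod ?x)\<^sup>2)" by (simp add: exp_diff)
    also have "\<dots> \<le> exp (c - l m) * a" using A by (intro mult_left_mono) auto
    finally show ?thesis using a by (simp add: pos_divide_le_eq)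
  qed
  have "compression_ratio N l U (b / a)"
    unfolding compression_ratio_def using a b ba gap sphere_average_diff[OF n b ba Qm Q] by auto
  then show ?thesis ..
qed

text \<open>Differentiation under the integral over x, majorized by -ln x / c, whose integral is
  1/c. The resulting Lipschitz constant does not involve \<open>r\<close> and so majorizes the outer
  expectation.\<close>

lemma sphere_average_derivative:
  assumes r: "compression_ratio N l U r" and c: "0 < c" and \<rho>: "c < \<rho>" "\<rho> < 1 - c"
  shows "((\<lambda>y. sphere_average (quadf_pair N l U) y - sphere_average (quadf_pair N l U) \<rho>) has_real_derivative var_deriv \<rho> r) (at \<rho>)"
    "y \<in> {c<..<1 - c} \<Longrightarrow> \<bar>sphere_average (quadf_pair N l U) y - sphere_average (quadf_pair N l U) \<rho>\<bar> \<le> 1 / c * \<bar>y - \<rho>\<bar>"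
proof -
  let ?F = "\<lambda>y. sphere_average (quadf_pair N l U) y"
  let ?D = "\<lambda>y x. ln (r + (1 - r) * x) * (ln (circle_mean r y x) - ln (circle_mean r \<rho> x))"
  have r01: "0 < r" "r \<le> 1" using r by (auto simp: compression_ratio_def)
  have F: "?F y - ?F \<rho> = (\<integral>x. ?D y x \<partial>unif01)" if "y \<in> {c<..<1 - c}" for y
    using r c \<rho> that by (auto simp: compression_ratio_def)
  note circle_mean_section_measurable[OF r01, measurable]
  have w: "integrable unif01 (\<lambda>x. 1 / c * - ln x)" "(\<integral>x. 1 / c * - ln x \<partial>unif01) = 1 / c"
    using unif01_ln by (auto simp: has_bochner_integral_iff)
  have b: "AE x in unif01. \<bar>?D y x\<bar> \<le> 1 / c * - ln x * \<bar>y - \<rho>\<bar>" if y: "y \<in> {c<..<1 - c}" for y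
    using AE_unif01
  proof eventually_elim
    case (elim x)
    have "\<bar>ln (r + (1 - r) * x)\<bar> * \<bar>ln (circle_mean r y x) - ln (circle_mean r \<rho> x)\<bar> \<le> - ln x * (1 / c * \<bar>y - \<rho>\<bar>)"
      using elim r01 c y \<rho> by (intro mult_mono ln_circle_mean_lipschitz ln_compression_bound) auto
    then show ?case by (simp add: abs_mult mult_ac)
  qed
  have m: "?D y \<in> borel_measurable unif01" for y by measurable
  have "(?F has_real_derivative (\<integral>x. ln (r + (1 - r) * x) * dlog_circle_mean r \<rho> x \<partial>unif01)) (at \<rho>)"
  proof (rule has_real_derivative_integral_dominated[where S = "{c<..<1 - c}" and D = ?D, OF _ _ F m w(1) b])
    show "AE x in unif01. ?D \<rho> x = 0 \<and> ((\<lambda>y. ?D y x) has_real_derivative ln (r + (1 - r) * x) * dlog_circle_mean r \<rho> x) (at \<rho>)"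
      using AE_unif01
    proof eventually_elim
      case (elim x)
      have "((\<lambda>y. ln (circle_mean r y x)) has_real_derivative dlog_circle_mean r \<rho> x) (at \<rho>)"
        using elim r01 \<rho> c by (intro circle_mean_has_derivative) auto
      from DERIV_cmult[OF DERIV_diff[OF this DERIV_const]] show ?case by simp
    qed
    have "(\<lambda>x. dlog_circle_mean r \<rho> x) \<in> borel_measurable borel"
      using measurable_compose[OF measurable_Pair1'[of r borel borel] dlog_circle_mean_measurable[of \<rho>]] by simp
    then show "(\<lambda>x. ln (r + (1 - r) * x) * dlog_circle_mean r \<rho> x) \<in> borel_measurable unif01" by measurable
  qed (use \<rho> in auto)
  from DERIV_diff[OF this DERIV_const, of "?F \<rho>"]
  show "((\<lambda>y. ?F y - ?F \<rho>) has_real_derivative var_deriv \<rho> r) (at \<rho>)" by (simp add: var_deriv_def)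
  show "\<bar>?F y - ?F \<rho>\<bar> \<le> 1 / c * \<bar>y - \<rho>\<bar>" if y: "y \<in> {c<..<1 - c}"
  proof -
    have "integrable unif01 (\<lambda>x. 1 / c * - ln x * \<bar>y - \<rho>\<bar>)" using w(1) by (rule integrable_mult_left)
    moreover from this have "integrable unif01 (?D y)"
    proof (rule Bochner_Integration.integrable_bound[OF _ m])
      show "AE x in unif01. norm (?D y x) \<le> norm (1 / c * - ln x * \<bar>y - \<rho>\<bar>)"
        using b[OF y]
      proof eventually_elim
        case (elim x)
        then show ?case unfolding real_norm_def by (rule order_trans) (rule abs_ge_self)
      qed
    qed
    ultimately have "norm (\<integral>x. ?D y x \<partial>unif01) \<le> (\<integral>x. 1 / c * - ln x * \<bar>y - \<rho>\<bar> \<partial>unif01)"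
      using b[OF y] by (intro order_trans[OF integral_norm_bound] integral_mono_AE) auto
    then show ?thesis unfolding F[OF y] by (simp only: integral_mult_left_zero w(2) real_norm_def)
  qed
qed

text \<open>A choice among admissible ratios, about whose measurability nothing is claimed. What is
  integrated is \<open>var_deriv\<close> of it, a limit of measurable difference quotients.\<close>

definition ratio :: "nat \<Rightarrow> (nat \<Rightarrow> real) \<times> complex mat \<Rightarrow> real" where
  "ratio N x = (SOME r. compression_ratio N (fst x) (snd x) r)"

text \<open>A second differentiation under the integral, now over the random matrix, with the
  constant 1/c as majorant.\<close>

lemma I2_has_derivative:
  assumes N: "N \<ge> 2" and T: "T > 0" and \<rho>: "0 < \<rho>" "\<rho> < 1"
  shows "(\<lambda>x. var_deriv \<rho> (ratio N x)) \<in> borel_measurable (hk_prod N T)"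
    "(I2 N T has_real_derivative (\<integral>x. var_deriv \<rho> (ratio N x) \<partial>hk_prod N T)) (at \<rho>)"
proof -
  have N0: "N > 0" using N by simp
  interpret X: prob_space "hk_prod N T" by (rule prob_hk_prod[OF N0 T])
  define c where "c = min \<rho> (1 - \<rho>) / 2"
  have c: "0 < c" "c < \<rho>" "\<rho> < 1 - c" using \<rho> by (auto simp: c_def min_def field_simps)
  let ?A = "\<lambda>y x. sphere_average (quadf_pair N (fst x) (snd x)) y"
  let ?D = "\<lambda>y x. ?A y x - ?A \<rho> x"
  have R: "compression_ratio N (fst x) (snd x) (ratio N x)" if "x \<in> space (hk_prod N T)" for x
    unfolding ratio_def using compression_ratio_exists[OF N hk_prod_snd_unitary[OF N0 that]] by (rule someI_ex)
  note der = sphere_average_derivative(1)[OF R c] and lip = sphere_average_derivative(2)[OF R c]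
  have I: "integrable (hk_prod N T) (?A y)" "I2 N T y = (\<integral>x. ?A y x \<partial>hk_prod N T)" if "y \<in> {c<..<1 - c}" for y
    using I2_eq_sphere_average[OF N T, of y] that c by auto
  have \<rho>c: "\<rho> \<in> {c<..<1 - c}" using c by auto
  have m: "?D y \<in> borel_measurable (hk_prod N T)" if "y \<in> {c<..<1 - c}" for y
    using I(1)[OF that] I(1)[OF \<rho>c] by (intro borel_measurable_diff borel_measurable_integrable)
  show md: "(\<lambda>x. var_deriv \<rho> (ratio N x)) \<in> borel_measurable (hk_prod N T)"
  proof (rule borel_measurable_LIMSEQ_real)
    define e where "e = min (\<rho> - c) (1 - c - \<rho>)"
    have e: "e > 0" using c by (simp add: e_def)
    \<comment> \<open>A sequence increasing to \<rho> inside the interval and never equal to it,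
      along which the difference quotients are taken.\<close>
    define Y where "Y i = \<rho> - e * inverse (real (Suc (Suc i)))" for i
    have i1: "0 < inverse (real (Suc (Suc i)))" "inverse (real (Suc (Suc i))) < 1" for i by (auto simp: field_simps)
    have "0 < e * inverse (real (Suc (Suc i)))" "e * inverse (real (Suc (Suc i))) < e * 1" for i
      using e i1[of i] by (auto intro!: mult_strict_left_mono)
    moreover have "e \<le> \<rho> - c" by (simp add: e_def)
    ultimately have "c < Y i" "Y i < \<rho>" for i unfolding Y_def by (smt (verit) mult_1_right)+
    then have Y: "Y i \<in> {c<..<1 - c}" "Y i \<noteq> \<rho>" for i
      using c(3) less_trans[of "Y i" \<rho> "1 - c"] by (auto simp: less_imp_neq)
    have "(\<lambda>i. inverse (real (Suc (Suc i)))) \<longlonglongrightarrow> 0"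
      using LIMSEQ_Suc[OF LIMSEQ_inverse_real_of_nat] .
    then have "Y \<longlonglongrightarrow> \<rho> - e * 0" unfolding Y_def by (intro tendsto_intros)
    then have Yl: "Y \<longlonglongrightarrow> \<rho>" by simp
    show "(\<lambda>x. ?D (Y i) x / (Y i - \<rho>)) \<in> borel_measurable (hk_prod N T)" for i
      using m[OF Y(1)] by (intro borel_measurable_divide) auto
    show "(\<lambda>i. ?D (Y i) x / (Y i - \<rho>)) \<longlonglongrightarrow> var_deriv \<rho> (ratio N x)" if x: "x \<in> space (hk_prod N T)" for x
    proof -
      have "((\<lambda>y. ?D y x / (y - \<rho>)) \<longlongrightarrow> var_deriv \<rho> (ratio N x)) (at \<rho>)"
        using der[OF x] by (simp add: has_field_derivative_iff)
      then have "((\<lambda>y. ?D y x / (y - \<rho>)) \<circ> Y) \<longlonglongrightarrow> var_deriv \<rho> (ratio N x)"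
        unfolding tendsto_at_iff_sequentially using Y Yl by blast
      then show ?thesis by (simp add: comp_def)
    qed
  qed
  show "(I2 N T has_real_derivative (\<integral>x. var_deriv \<rho> (ratio N x) \<partial>hk_prod N T)) (at \<rho>)"
  proof (rule has_real_derivative_integral_dominated[where S = "{c<..<1 - c}" and D = ?D and w = "\<lambda>_. 1 / c", OF _ \<rho>c _ m _ _ md])
    show "I2 N T y - I2 N T \<rho> = (\<integral>x. ?D y x \<partial>hk_prod N T)" if y: "y \<in> {c<..<1 - c}" for y
      unfolding I(2)[OF y] I(2)[OF \<rho>c] using I(1)[OF y] I(1)[OF \<rho>c] by simp
    show "AE x in hk_prod N T. \<bar>?D y x\<bar> \<le> 1 / c * \<bar>y - \<rho>\<bar>" if "y \<in> {c<..<1 - c}" for y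
      using lip that by (intro AE_I2) blast
    show "AE x in hk_prod N T. ?D \<rho> x = 0 \<and> ((\<lambda>y. ?D y x) has_real_derivative var_deriv \<rho> (ratio N x)) (at \<rho>)"
      using der by (intro AE_I2) simp
  qed auto
qed

subsection \<open>Small entries of a Haar distributed unitary matrix\<close>

lemma emeasure_unif01_atMost:
  assumes "0 \<le> c"
  shows "emeasure unif01 {..c} \<le> ennreal c"
proof -
  have "emeasure unif01 {..c} = (\<integral>\<^sup>+x. ennreal (indicator {0<..<1} x) * indicator {..c} x \<partial>lborel)"
    unfolding unif01_def by (rule emeasure_density) auto
  also have "\<dots> \<le> (\<integral>\<^sup>+x. indicator {0..c} x \<partial>lborel)"
    by (intro nn_integral_mono) (auto split: split_indicator)
  also have "\<dots> = ennreal c" using assms by simp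
  finally show ?thesis .
qed

text \<open>The form equals R times the first coordinate of a rotated point, with R^2 = S = |x|^2 +
  |y|^2. That coordinate has uniform squared modulus, so the probability is at most \<eta>/S, and S
  >= 1/N.\<close>

lemma linear_form_small_ball:
  assumes N: "N > 0" and R: "1 / real N \<le> (cmod x)\<^sup>2 + (cmod y)\<^sup>2" and \<eta>: "0 \<le> \<eta>"
  shows "(\<integral>\<^sup>+p. indicator {..\<eta>} ((cmod (x * fst p + y * snd p))\<^sup>2) \<partial>sph) \<le> ennreal (N * \<eta>)"
proof -
  define S where "S = (cmod x)\<^sup>2 + (cmod y)\<^sup>2"
  have "0 < 1 / real N" using N by simp
  then have S: "0 < S" using R unfolding S_def by linarith
  define R where "R = sqrt S"
  have R: "R > 0" "R\<^sup>2 = S" using S by (auto simp: R_def)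
  define \<alpha> \<beta> where "\<alpha> = x / of_real R" and "\<beta> = - cnj y / of_real R"
  have n: "(cmod \<alpha>)\<^sup>2 + (cmod \<beta>)\<^sup>2 = 1"
  proof -
    have "(cmod \<alpha>)\<^sup>2 + (cmod \<beta>)\<^sup>2 = S / R\<^sup>2"
      using R(1) by (simp add: \<alpha>_def \<beta>_def S_def norm_divide power_divide add_divide_distrib)
    then show ?thesis using S R(2) by simp
  qed
  have e: "(cmod (x * fst p + y * snd p))\<^sup>2 = S * (cmod (fst (rot \<alpha> \<beta> p)))\<^sup>2" for p
  proof -
    have "x * fst p + y * snd p = of_real R * fst (rot \<alpha> \<beta> p)"
      using R(1) by (simp add: rot_def \<alpha>_def \<beta>_def field_simps)
    then show ?thesis using R by (simp add: norm_mult power_mult_distrib)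
  qed
  let ?g = "\<lambda>p :: complex \<times> complex. indicator {..\<eta>} (S * (cmod (fst p))\<^sup>2) :: ennreal"
  have sqm: "(\<lambda>p :: complex \<times> complex. (cmod (fst p))\<^sup>2) \<in> borel_measurable borel"
    by (intro borel_measurable_continuous_onI continuous_intros)
  have gm: "?g \<in> borel_measurable borel"
    by (rule measurable_compose[of "\<lambda>p :: complex \<times> complex. S * (cmod (fst p))\<^sup>2" borel borel "indicator {..\<eta>}"])
      (auto intro!: borel_measurable_times sqm)
  have "(\<integral>\<^sup>+p. indicator {..\<eta>} ((cmod (x * fst p + y * snd p))\<^sup>2) \<partial>sph) = (\<integral>\<^sup>+p. ?g (rot \<alpha> \<beta> p) \<partial>sph)"
    by (simp only: e)
  also have "\<dots> = (\<integral>\<^sup>+p. ?g p \<partial>distr sph borel (rot \<alpha> \<beta>))"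
    by (rule nn_integral_distr[symmetric]) (simp_all add: gm measurable_cong_sets[OF sets_sph refl])
  also have "\<dots> = (\<integral>\<^sup>+p. ?g p \<partial>sph)" by (simp add: rot_sph[OF n])
  also have "\<dots> = (\<integral>\<^sup>+t. indicator {..\<eta>} (S * t) \<partial>distr sph borel (\<lambda>p. (cmod (fst p))\<^sup>2))"
    by (rule nn_integral_distr[symmetric]) (auto simp: measurable_cong_sets[OF sets_sph refl] intro!: sqm)
  also have "\<dots> = (\<integral>\<^sup>+t. indicator {..\<eta> / S} t \<partial>unif01)"
    unfolding distr_sph_fst using S by (intro nn_integral_cong) (auto split: split_indicator simp: field_simps)
  also have "\<dots> = emeasure unif01 {..\<eta> / S}" by simp
  also have "\<dots> \<le> ennreal (\<eta> / S)" using \<eta> S by (intro emeasure_unif01_atMost) auto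
  also have "\<dots> \<le> ennreal (N * \<eta>)"
  proof (rule ennreal_leI)
    have "1 \<le> S * N" using assms(2) N by (simp add: S_def[symmetric] field_simps)
    then have "\<eta> * 1 \<le> \<eta> * (S * N)" using \<eta> by (intro mult_left_mono)
    then show "\<eta> / S \<le> N * \<eta>" using S by (simp add: pos_divide_le_eq mult_ac)
  qed
  finally show ?thesis .
qed

lemma index_mult_givens:
  assumes U: "U \<in> carrier_mat N N" and i: "0 < i" "i < N" and m: "m < N"
  shows "(U * givens N i p) $$ (m, 0) = U $$ (m, 0) * fst p + U $$ (m, i) * snd p"
    "(U * givens N i p) $$ (m, i) = U $$ (m, i) * cnj (fst p) - U $$ (m, 0) * cnj (snd p)"
proof -
  have N: "0 < N" using i by simp
  have "(\<Sum>j\<in>{..<N} - {0, i}. U $$ (m, j) * givens N i p $$ (j, 0)) = 0"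
    using N by (intro sum.neutral) (auto simp: givens_def)
  then show "(U * givens N i p) $$ (m, 0) = U $$ (m, 0) * fst p + U $$ (m, i) * snd p"
    unfolding index_mult_mat_sum[OF U givens_carrier m N] sum_split_two[OF i] using i by (simp add: givens_def)
  have "(\<Sum>j\<in>{..<N} - {0, i}. U $$ (m, j) * givens N i p $$ (j, i)) = 0"
    using i by (intro sum.neutral) (auto simp: givens_def)
  then show "(U * givens N i p) $$ (m, i) = U $$ (m, i) * cnj (fst p) - U $$ (m, 0) * cnj (snd p)"
    unfolding index_mult_mat_sum[OF U givens_carrier m i(2)] sum_split_two[OF i] using i by (simp add: givens_def)
qed

lemma pair_norm_identity:
  fixes x y :: complex
  assumes "norm p = 1"
  shows "(cmod (x * fst p + y * snd p))\<^sup>2 + (cmod (y * cnj (fst p) - x * cnj (snd p)))\<^sup>2 = (cmod x)\<^sup>2 + (cmod y)\<^sup>2"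
proof -
  have "(cmod (x * fst p + y * snd p))\<^sup>2 + (cmod (y * cnj (fst p) - x * cnj (snd p)))\<^sup>2
      = ((cmod x)\<^sup>2 + (cmod y)\<^sup>2) * ((cmod (fst p))\<^sup>2 + (cmod (snd p))\<^sup>2)"
    unfolding cmod_power2 by (simp add: power2_eq_square algebra_simps)
  then show ?thesis using assms unfolding norm_pair_square[symmetric] by simp
qed

lemma indicator_pair_measurable:
  fixes x y z w :: "'a \<Rightarrow> complex"
  assumes [measurable]: "x \<in> borel_measurable M" "y \<in> borel_measurable M" "z \<in> borel_measurable M" "w \<in> borel_measurable M"
  shows "(\<lambda>q. indicator {..\<eta>} ((cmod (x q * z q + y q * w q))\<^sup>2) * indicator {c..} ((cmod (x q))\<^sup>2 + (cmod (y q))\<^sup>2) :: ennreal)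
    \<in> borel_measurable M"
  by measurable

text \<open>Row \<open>m\<close> has an entry \<open>i\<close> of modulus at least \<open>N powr (-1/2)\<close>; rotating columns \<open>0\<close> and \<open>i\<close> by
  a random element of \<open>SU(2)\<close> spreads it over both columns.\<close>

lemma haar_pair_small:
  assumes i: "0 < i" "i < N" and m: "m < N" and \<eta>: "0 \<le> \<eta>"
  shows "(\<integral>\<^sup>+U. indicator {..\<eta>} ((cmod (U $$ (m, 0)))\<^sup>2) * indicator {1 / real N..} ((cmod (U $$ (m, 0)))\<^sup>2 + (cmod (U $$ (m, i)))\<^sup>2) \<partial>haar_unitary N)
     \<le> ennreal (N * \<eta>)"
proof -
  have N: "N > 0" using m by simp
  let ?H = "haar_unitary N"
  interpret H: prob_space ?H by (rule prob_haar[OF N])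
  interpret S: prob_space sph by (rule prob_sph)
  interpret HS: pair_prob_space ?H sph ..
  define Z :: "complex mat \<Rightarrow> complex \<times> complex \<Rightarrow> ennreal" where
    "Z U p = indicator {..\<eta>} ((cmod (U $$ (m, 0) * fst p + U $$ (m, i) * snd p))\<^sup>2)
       * indicator {1 / real N..} ((cmod (U $$ (m, 0)))\<^sup>2 + (cmod (U $$ (m, i)))\<^sup>2)" for U p
  have entry: "(\<lambda>q. fst q $$ (m, j)) \<in> borel_measurable (?H \<Otimes>\<^sub>M sph)" if "j < N" for j
  proof (rule measurable_unitary_entry[OF m that])
    show "fst \<in> ?H \<Otimes>\<^sub>M sph \<rightarrow>\<^sub>M unitary_borel N"
      using measurable_fst[of ?H sph] by (simp add: measurable_cong_sets[OF refl sets_haar[OF N]])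
  qed
  have p: "(\<lambda>q. fst (snd q)) \<in> borel_measurable (?H \<Otimes>\<^sub>M sph)" "(\<lambda>q. snd (snd q)) \<in> borel_measurable (?H \<Otimes>\<^sub>M sph)"
    by (auto intro!: measurable_compose[OF measurable_snd] simp: measurable_cong_sets[OF sets_sph refl] borel_measurable_fst_snd)
  have Zm: "(\<lambda>q. Z (fst q) (snd q)) \<in> borel_measurable (?H \<Otimes>\<^sub>M sph)"
    unfolding Z_def by (rule indicator_pair_measurable[OF entry[OF N] entry[OF i(2)] p])
  have Zm1: "(\<lambda>U. Z U (1, 0)) \<in> borel_measurable (unitary_borel N)"
    using measurable_compose[OF measurable_Pair2'[of "(1, 0)" sph ?H] Zm]
    by (simp add: measurable_cong_sets[OF sets_haar[OF N] refl])
  \<comment> \<open>Right multiplication by the Givens matrix puts the linear form at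
    \<open>p\<close> into entry (m, 0) and keeps the sum of the two squared moduli, so the
    expectation is the same for every unit \<open>p\<close> and equals its average over the
    sphere.\<close>
  have inv: "(\<integral>\<^sup>+U. Z U p \<partial>?H) = (\<integral>\<^sup>+U. Z U (1, 0) \<partial>?H)" if p: "norm p = 1" for p
  proof -
    have "(\<integral>\<^sup>+U. Z U p \<partial>?H) = (\<integral>\<^sup>+U. Z (U * givens N i p) (1, 0) \<partial>?H)"
    proof (rule nn_integral_cong)
      fix U assume "U \<in> space ?H"
      then have U: "U \<in> carrier_mat N N" by (simp add: space_haar[OF N] unitary_carrier)
      show "Z U p = Z (U * givens N i p) (1, 0)"
        by (simp add: Z_def index_mult_givens[OF U i m] pair_norm_identity[OF p])
    qed
    also have "\<dots> = (\<integral>\<^sup>+U. Z U (1, 0) \<partial>?H)"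
      by (rule haar_right_nn_integral[OF is_haar_haar_unitary[OF N] givens_unitary[OF p i] Zm1])
    finally show ?thesis .
  qed
  have "(\<integral>\<^sup>+U. Z U (1, 0) \<partial>?H) = (\<integral>\<^sup>+p. (\<integral>\<^sup>+U. Z U (1, 0) \<partial>?H) \<partial>sph)" using S.emeasure_space_1 by simp
  also have "\<dots> = (\<integral>\<^sup>+p. (\<integral>\<^sup>+U. Z U p \<partial>?H) \<partial>sph)"
    by (rule nn_integral_cong_AE) (use AE_sph_norm in eventually_elim, rule inv[symmetric])
  also have "\<dots> = (\<integral>\<^sup>+U. (\<integral>\<^sup>+p. Z U p \<partial>sph) \<partial>?H)"
    using HS.Fubini[OF Zm] by simp
  also have "\<dots> \<le> (\<integral>\<^sup>+U. ennreal (N * \<eta>) \<partial>?H)"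
  proof (rule nn_integral_mono)
    fix U
    show "(\<integral>\<^sup>+p. Z U p \<partial>sph) \<le> ennreal (N * \<eta>)"
    proof (cases "1 / real N \<le> (cmod (U $$ (m, 0)))\<^sup>2 + (cmod (U $$ (m, i)))\<^sup>2")
      case True
      then show ?thesis using linear_form_small_ball[OF N True \<eta>] by (simp add: Z_def)
    qed (simp add: Z_def)
  qed
  also have "\<dots> = ennreal (N * \<eta>)" using H.emeasure_space_1 by simp
  finally show ?thesis by (simp add: Z_def)
qed

text \<open>Row \<open>m\<close> has norm 1, so one of its entries has squared modulus at least 1/N;
  a union bound over its position costs the second factor N.\<close>

lemma haar_small_entry:
  assumes m: "m < N" and \<eta>: "0 \<le> \<eta>"
  shows "emeasure (haar_unitary N) {U \<in> space (haar_unitary N). (cmod (U $$ (m, 0)))\<^sup>2 \<le> \<eta>} \<le> ennreal ((real N)\<^sup>2 * \<eta>)"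
    (is "emeasure ?H ?A \<le> _")
proof -
  have N: "N > 0" using m by simp
  interpret H: prob_space ?H by (rule prob_haar[OF N])
  have entry [measurable]: "(\<lambda>U. U $$ (m, j)) \<in> borel_measurable ?H" if "j < N" for j
    by (rule measurable_unitary_entry[OF m that]) (simp add: measurable_cong_sets[OF sets_haar[OF N] refl] measurable_ident_sets[OF refl])
  have sA: "?A \<in> sets ?H" using N by measurable
  let ?Z = "\<lambda>i U. indicator {..\<eta>} ((cmod (U $$ (m, 0)))\<^sup>2) * indicator {1 / real N..} ((cmod (U $$ (m, 0)))\<^sup>2 + (cmod (U $$ (m, i)))\<^sup>2) :: ennreal"
  have Zm: "?Z i \<in> borel_measurable ?H" if "i < N" for i
    using indicator_pair_measurable[OF entry[OF N] entry[OF that] borel_measurable_const[of 1] borel_measurable_const[of 0], of \<eta> "1 / real N"]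
    by simp
  have "emeasure ?H ?A = (\<integral>\<^sup>+U. indicator ?A U \<partial>?H)" using sA by simp
  also have "\<dots> \<le> (\<integral>\<^sup>+U. (\<Sum>i<N. if i = 0 then ennreal (N * \<eta>) else ?Z i U) \<partial>?H)"
  proof (rule nn_integral_mono)
    fix U assume "U \<in> space ?H"
    then have U: "U \<in> unitary_group N" by (simp add: space_haar[OF N])
    show "indicator ?A U \<le> (\<Sum>i<N. if i = 0 then ennreal (N * \<eta>) else ?Z i U)"
    proof (cases "U \<in> ?A")
      case True
      have "\<exists>i<N. 1 / real N \<le> (cmod (U $$ (m, i)))\<^sup>2"
      proof (rule ccontr)
        assume "\<not> ?thesis"
        then have "(\<Sum>i<N. (cmod (U $$ (m, i)))\<^sup>2) < (\<Sum>i<N. 1 / real N)"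
          using N by (intro sum_strict_mono) (auto simp: not_le)
        moreover have "complex_of_real (\<Sum>i<N. (cmod (U $$ (m, i)))\<^sup>2) = 1"
          unfolding of_real_sum complex_norm_square using unitary_rows[OF U m m] by simp
        ultimately show False using N by (simp only: of_real_eq_1_iff) simp
      qed
      then obtain i where i: "i < N" "1 / real N \<le> (cmod (U $$ (m, i)))\<^sup>2" by blast
      have "(1::ennreal) \<le> (if i = 0 then ennreal (N * \<eta>) else ?Z i U)"
      proof (cases "i = 0")
        case True
        \<comment> \<open>If the large entry is the small one itself, then N \<eta> >= 1 and the
          constant summand for i = 0 suffices.\<close>
        then have "1 / real N \<le> \<eta>" using i(2) \<open>U \<in> ?A\<close> by simp
        then have "1 \<le> N * \<eta>" using N by (simp add: field_simps)
        then show ?thesis using True ennreal_leI[of 1 "N * \<eta>"] by simp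
      next
        case False
        have "1 / real N \<le> (cmod (U $$ (m, 0)))\<^sup>2 + (cmod (U $$ (m, i)))\<^sup>2"
          using i(2) zero_le_power2[of "cmod (U $$ (m, 0))"] by linarith
        then show ?thesis using False \<open>U \<in> ?A\<close> by simp
      qed
      also have "\<dots> \<le> (\<Sum>i<N. if i = 0 then ennreal (N * \<eta>) else ?Z i U)"
        using i(1) by (intro member_le_sum[of i "{..<N}" "\<lambda>i. if i = 0 then ennreal (N * \<eta>) else ?Z i U"]) auto
      finally show ?thesis using True by simp
    qed simp
  qed
  also have "\<dots> = (\<Sum>i<N. \<integral>\<^sup>+U. (if i = 0 then ennreal (N * \<eta>) else ?Z i U) \<partial>?H)"
  proof (rule nn_integral_sum)
    fix i assume "i \<in> {..<N}"
    then show "(\<lambda>U. if i = 0 then ennreal (N * \<eta>) else ?Z i U) \<in> borel_measurable ?H"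
      using Zm[of i] by (cases "i = 0") auto
  qed
  also have "\<dots> \<le> (\<Sum>i<N. ennreal (N * \<eta>))"
  proof (rule sum_mono)
    fix i assume "i \<in> {..<N}"
    then show "(\<integral>\<^sup>+U. (if i = 0 then ennreal (N * \<eta>) else ?Z i U) \<partial>?H) \<le> ennreal (N * \<eta>)"
      using haar_pair_small[OF _ _ m \<eta>, of i] H.emeasure_space_1 by (cases "i = 0") auto
  qed
  also have "\<dots> = ennreal ((real N)\<^sup>2 * \<eta>)"
    using \<eta> by (simp add: power2_eq_square ennreal_mult[symmetric] ennreal_of_nat_eq_real_of_nat mult.assoc)
  finally show ?thesis .
qed

text \<open>With u = N sqrt(\<eta>), the bound u^2 is at most u for u <= 1, and for u > 1 a
  probability is trivially below u. The square root produces exp(-gap/2), the quantity whose mean is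
  controlled.\<close>

lemma haar_small_entry_sqrt:
  assumes m: "m < N" and \<eta>: "0 \<le> \<eta>"
  shows "emeasure (haar_unitary N) {U \<in> space (haar_unitary N). (cmod (U $$ (m, 0)))\<^sup>2 \<le> \<eta>} \<le> ennreal (N * sqrt \<eta>)"
    (is "emeasure ?H ?A \<le> _")
proof (cases "N * sqrt \<eta> \<le> 1")
  case True
  have "emeasure ?H ?A \<le> ennreal ((real N)\<^sup>2 * \<eta>)" by (rule haar_small_entry[OF assms])
  also have "(real N)\<^sup>2 * \<eta> = (N * sqrt \<eta>) * (N * sqrt \<eta>)" using \<eta> by (simp add: power2_eq_square)
  also have "ennreal \<dots> \<le> ennreal (N * sqrt \<eta>)"
    using True \<eta> mult_left_mono[OF True, of "N * sqrt \<eta>"] by (intro ennreal_leI) auto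
  finally show ?thesis .
next
  case False
  interpret H: prob_space ?H using m by (intro prob_haar) simp
  have "emeasure ?H ?A \<le> 1" by (rule H.emeasure_le_1)
  also have "\<dots> \<le> ennreal (N * sqrt \<eta>)" using False ennreal_leI[of 1 "N * sqrt \<eta>"] by simp
  finally show ?thesis .
qed

subsection \<open>Concentration of the compression ratio at zero\<close>

lemma sorting_permutation:
  assumes "inj_on l {..<N}"
  shows "\<exists>\<sigma>. \<sigma> permutes {..<N} \<and> (\<lambda>i. l (\<sigma> i)) \<in> chamber N"
proof -
  let ?A = "l ` {..<N}"
  define xs where "xs = sorted_list_of_set ?A"
  have xs: "length xs = N" "set xs = ?A" "distinct xs" "sorted_wrt (<) xs"
    using assms by (simp_all add: xs_def card_image)
  define \<sigma> where "\<sigma> i = (if i < N then inv_into {..<N} l (xs ! i) else i)" for i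
  have "bij_betw ((!) xs) {..<N} ?A" by (rule bij_betw_nth) (simp_all add: xs)
  moreover have "bij_betw (inv_into {..<N} l) ?A {..<N}" using assms by (intro bij_betw_inv_into) (simp add: bij_betw_def)
  ultimately have "bij_betw (inv_into {..<N} l \<circ> (!) xs) {..<N} {..<N}" by (rule bij_betw_trans)
  then have "bij_betw \<sigma> {..<N} {..<N}" by (rule bij_betw_cong[THEN iffD1, rotated]) (simp add: \<sigma>_def)
  then have "\<sigma> permutes {..<N}" by (rule bij_imp_permutes) (simp add: \<sigma>_def)
  moreover have l: "l (\<sigma> i) = xs ! i" if "i < N" for i
  proof -
    have "xs ! i \<in> ?A" using that xs nth_mem[of i xs] by simp
    then show ?thesis using that by (simp add: \<sigma>_def f_inv_into_f)
  qed
  have "(\<lambda>i. l (\<sigma> i)) \<in> chamber N"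
    using sorted_wrt_nth_less[OF xs(4)] by (auto simp: chamber_def l xs(1))
  ultimately show ?thesis by blast
qed

text \<open>The density contains the Vandermonde product, which vanishes when two entries
  coincide.\<close>

lemma AE_hk_radial_inj: "AE l in hk_radial N T. inj_on l {..<N}"
proof -
  have "inj_on l {..<N}" if "0 < ennreal (hk_weight N T l) / hk_mass N T" for l
  proof (rule ccontr)
    assume "\<not> inj_on l {..<N}"
    then obtain i j where ij: "i < N" "j < N" "i \<noteq> j" "l i = l j" by (auto simp: inj_on_def)
    have "\<exists>j<N. \<exists>i<j. l i = l j" using ij by (metis linorder_neqE_nat)
    then have "\<exists>j<N. \<exists>i<j. l j - l i = 0" by (metis diff_self)
    then have "vandermonde N l = 0" unfolding vandermonde_def by (auto simp: prod_zero_iff)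
    then show False using that by (simp add: hk_weight_def)
  qed
  moreover have "(\<lambda>l. ennreal (hk_weight N T l) / hk_mass N T) \<in> borel_measurable (delta_sum N)"
    using hk_weight_measurable[of N T] by measurable
  ultimately show ?thesis unfolding hk_radial_def by (subst AE_density) auto
qed

text \<open>If the entry of \<open>U\<close> in the row of the largest eigenvalue has squared
  modulus above \<eta> = exp(-gap)/\<delta>, the compression ratio is below \<delta> and
  \<open>F\<close> is at most \<epsilon>. The remaining event has probability at most N
  sqrt(\<eta>), and there \<open>F\<close> is at most \<open>C\<close>.\<close>

lemma haar_ratio_bound:
  assumes N: "N \<ge> 2" and \<delta>: "0 < \<delta>" and \<epsilon>: "0 \<le> \<epsilon>" and C: "0 \<le> C"
    and near: "\<And>r. 0 < r \<Longrightarrow> r < \<delta> \<Longrightarrow> F r \<le> \<epsilon>" and far: "\<And>r. 0 < r \<Longrightarrow> r \<le> 1 \<Longrightarrow> F r \<le> C"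
    and l: "inj_on l {..<N}"
  shows "(\<integral>\<^sup>+U. ennreal (F (ratio N (l, U))) \<partial>haar_unitary N) \<le> ennreal \<epsilon> + ennreal (C * N / sqrt \<delta>) * ennreal (top_gap_factor N l)"
proof -
  have N0: "N > 0" using N by simp
  let ?H = "haar_unitary N"
  interpret H: prob_space ?H by (rule prob_haar[OF N0])
  obtain \<sigma> where \<sigma>: "\<sigma> permutes {..<N}" "(\<lambda>i. l (\<sigma> i)) \<in> chamber N" using sorting_permutation[OF l] by blast
  define m c where "m = \<sigma> (N - 1)" and "c = l (\<sigma> (N - 2))"
  have m: "m < N" using \<sigma>(1) N permutes_in_image[OF \<sigma>(1), of "N - 1"] by (simp add: m_def)
  have mono: "l (\<sigma> i) < l (\<sigma> j)" if "i < j" "j < N" for i j using \<sigma>(2) that by (simp add: chamber_def)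
  have others: "l k \<le> c" if "k < N" "k \<noteq> m" for k
  proof -
    obtain j where j: "\<sigma> j = k" using permutes_surj[OF \<sigma>(1)] by (metis surjD)
    have "j < N" using that(1) j permutes_in_image[OF \<sigma>(1), of j] by simp
    moreover have "j \<noteq> N - 1" using that(2) j by (auto simp: m_def)
    ultimately have "j = N - 2 \<or> j < N - 2" by linarith
    then show ?thesis using mono[of j "N - 2"] j N by (auto simp: c_def)
  qed
  define \<eta> where "\<eta> = exp (c - l m) / \<delta>"
  have \<eta>: "0 \<le> \<eta>" using \<delta> by (simp add: \<eta>_def)
  let ?A = "{U \<in> space ?H. (cmod (U $$ (m, 0)))\<^sup>2 \<le> \<eta>}"
  have [measurable]: "(\<lambda>U. U $$ (m, 0)) \<in> borel_measurable ?H"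
    by (rule measurable_unitary_entry[OF m N0]) (simp add: measurable_cong_sets[OF sets_haar[OF N0] refl] measurable_ident_sets[OF refl])
  have sA: "?A \<in> sets ?H" by measurable
  have "(\<integral>\<^sup>+U. ennreal (F (ratio N (l, U))) \<partial>?H) \<le> (\<integral>\<^sup>+U. ennreal \<epsilon> + ennreal C * indicator ?A U \<partial>?H)"
  proof (rule nn_integral_mono)
    fix U assume Us: "U \<in> space ?H"
    then have U: "U \<in> unitary_group N" by (simp add: space_haar[OF N0])
    define r where "r = ratio N (l, U)"
    have "compression_ratio N l U r"
      unfolding r_def ratio_def fst_conv snd_conv using compression_ratio_exists[OF N U] by (rule someI_ex)
    then have r: "0 < r" "r \<le> 1" "r * (cmod (U $$ (m, 0)))\<^sup>2 \<le> exp (c - l m)"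
      using m others by (auto simp: compression_ratio_def)
    show "ennreal (F (ratio N (l, U))) \<le> ennreal \<epsilon> + ennreal C * indicator ?A U"
    proof (cases "U \<in> ?A")
      case True
      have "ennreal (F r) \<le> ennreal C" by (rule ennreal_leI[OF far[OF r(1,2)]])
      also have "\<dots> \<le> ennreal \<epsilon> + ennreal C" by (simp add: add_increasing)
      finally show ?thesis using True by (simp add: r_def)
    next
      case False
      then have "\<eta> < (cmod (U $$ (m, 0)))\<^sup>2" using Us by simp
      then have "exp (c - l m) < (cmod (U $$ (m, 0)))\<^sup>2 * \<delta>" using \<delta> by (simp add: \<eta>_def pos_divide_less_eq)
      then have "(cmod (U $$ (m, 0)))\<^sup>2 * r < (cmod (U $$ (m, 0)))\<^sup>2 * \<delta>" using r(3) by (simp add: mult.commute)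
      then have "r < \<delta>" by (rule mult_left_less_imp_less) simp
      from ennreal_leI[OF near[OF r(1) this]] show ?thesis using False by (simp add: r_def)
    qed
  qed
  also have "\<dots> = ennreal \<epsilon> + ennreal C * emeasure ?H ?A"
    using sA H.emeasure_space_1 by (simp add: nn_integral_add nn_integral_cmult)
  also have "\<dots> \<le> ennreal \<epsilon> + ennreal C * ennreal (N * sqrt \<eta>)"
    by (intro add_left_mono mult_left_mono haar_small_entry_sqrt[OF m \<eta>]) simp
  also have "ennreal C * ennreal (N * sqrt \<eta>) = ennreal (C * N / sqrt \<delta> * exp (- (l m - c) / 2))"
  proof -
    have "sqrt (exp (c - l m)) = exp ((c - l m) / 2)"
      by (rule real_sqrt_unique) (simp_all add: exp_double[symmetric] power2_eq_square exp_add[symmetric])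
    then have "C * (N * sqrt \<eta>) = C * N / sqrt \<delta> * exp (- (l m - c) / 2)" by (simp add: \<eta>_def real_sqrt_divide)
    then show ?thesis using C \<eta> by (simp add: ennreal_mult[symmetric])
  qed
  also have "\<dots> \<le> ennreal (C * N / sqrt \<delta> * top_gap_factor N l)"
  proof (intro ennreal_leI mult_left_mono)
    let ?f = "\<lambda>\<sigma>. indicator (chamber N) (\<lambda>i. l (\<sigma> i)) * exp (- (l (\<sigma> (N - 1)) - l (\<sigma> (N - 2))) / 2) :: real"
    have "?f \<sigma> \<le> sum ?f {\<sigma>. \<sigma> permutes {..<N}}"
      using \<sigma>(1) by (intro member_le_sum) (auto simp: finite_permutations)
    moreover have "?f \<sigma> = exp (- (l m - c) / 2)" using \<sigma>(2) by (simp add: m_def c_def)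
    ultimately show "exp (- (l m - c) / 2) \<le> top_gap_factor N l" unfolding top_gap_factor_def by (simp only:)
    show "0 \<le> C * N / sqrt \<delta>" using C \<delta> by simp
  qed
  also have "\<dots> = ennreal (C * N / sqrt \<delta>) * ennreal (top_gap_factor N l)"
    using C \<delta> by (intro ennreal_mult top_gap_factor_nonneg) simp
  finally show ?thesis by (simp add: add_left_mono)
qed

text \<open>The bound for fixed eigenvalues is integrated over them; the gap factor has mean at most
  exp(N/T - T/2).\<close>

lemma expectation_ratio_bound:
  assumes N: "N \<ge> 2" and T: "T > 0" and \<delta>: "0 < \<delta>" and \<epsilon>: "0 \<le> \<epsilon>"
    and near: "\<And>r. 0 < r \<Longrightarrow> r < \<delta> \<Longrightarrow> \<bar>f r - L\<bar> \<le> \<epsilon>" and far: "\<And>r. 0 < r \<Longrightarrow> r \<le> 1 \<Longrightarrow> \<bar>f r - L\<bar> \<le> C"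
    and m: "(\<lambda>x. f (ratio N x)) \<in> borel_measurable (hk_prod N T)"
  shows "\<bar>(\<integral>x. f (ratio N x) \<partial>hk_prod N T) - L\<bar> \<le> \<epsilon> + C * N / sqrt \<delta> * exp (N / T - T / 2)"
proof -
  have N0: "N > 0" using N by simp
  have C: "0 \<le> C" using far[of 1] by linarith
  interpret X: prob_space "hk_prod N T" by (rule prob_hk_prod[OF N0 T])
  interpret H: prob_space "haar_unitary N" by (rule prob_haar[OF N0])
  interpret R: prob_space "hk_radial N T" by (rule prob_hk_radial[OF N0 T])
  let ?g = "\<lambda>x. f (ratio N x) - L"
  let ?K = "C * N / sqrt \<delta>"
  have K: "0 \<le> ?K" using C \<delta> by simp
  have gm: "?g \<in> borel_measurable (hk_prod N T)" using m by measurable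
  have b: "norm (?g x) \<le> C" if x: "x \<in> space (hk_prod N T)" for x
  proof -
    have "compression_ratio N (fst x) (snd x) (ratio N x)"
      unfolding ratio_def using compression_ratio_exists[OF N hk_prod_snd_unitary[OF N0 x]] by (rule someI_ex)
    then show ?thesis using far by (simp add: compression_ratio_def)
  qed
  have gI: "integrable (hk_prod N T) ?g" using b by (intro X.integrable_const_bound[OF _ gm, where B = C] AE_I2)
  then have fI: "integrable (hk_prod N T) (\<lambda>x. f (ratio N x))" using Bochner_Integration.integrable_add[OF gI, of "\<lambda>_. L"] by simp
  have tm: "top_gap_factor N \<in> borel_measurable (hk_radial N T)"
    unfolding measurable_cong_sets[OF sets_hk_radial refl] by (rule measurable_delta_sum[OF top_gap_factor_measurable[OF N]])
  have "ennreal \<bar>(\<integral>x. f (ratio N x) \<partial>hk_prod N T) - L\<bar> = ennreal (norm (\<integral>x. ?g x \<partial>hk_prod N T))"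
    using fI X.prob_space by simp
  also have "\<dots> \<le> (\<integral>\<^sup>+x. ennreal \<bar>?g x\<bar> \<partial>hk_prod N T)"
    using integral_norm_bound_ennreal[OF gI] by simp
  also have "\<dots> = (\<integral>\<^sup>+l. \<integral>\<^sup>+U. ennreal \<bar>f (ratio N (l, U)) - L\<bar> \<partial>haar_unitary N \<partial>hk_radial N T)"
    using H.nn_integral_fst[of "\<lambda>x. ennreal \<bar>?g x\<bar>" "hk_radial N T"] gm unfolding hk_prod_def by simp
  also have "\<dots> \<le> (\<integral>\<^sup>+l. ennreal \<epsilon> + ennreal ?K * ennreal (top_gap_factor N l) \<partial>hk_radial N T)"
  proof (rule nn_integral_mono_AE)
    show "AE l in hk_radial N T. (\<integral>\<^sup>+U. ennreal \<bar>f (ratio N (l, U)) - L\<bar> \<partial>haar_unitary N) \<le> ennreal \<epsilon> + ennreal ?K * ennreal (top_gap_factor N l)"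
      using AE_hk_radial_inj
    proof eventually_elim
      case (elim l)
      show ?case by (rule haar_ratio_bound[OF N \<delta> \<epsilon> C near far elim])
    qed
  qed
  also have "\<dots> = ennreal \<epsilon> + ennreal ?K * (\<integral>\<^sup>+l. ennreal (top_gap_factor N l) \<partial>hk_radial N T)"
    using tm R.emeasure_space_1 by (simp add: nn_integral_add nn_integral_cmult)
  also have "\<dots> \<le> ennreal \<epsilon> + ennreal ?K * ennreal (exp (N / T - T / 2))"
    by (intro add_left_mono mult_left_mono hk_radial_top_gap[OF N T]) simp
  also have "\<dots> = ennreal (\<epsilon> + ?K * exp (N / T - T / 2))" 
    unfolding ennreal_plus[OF \<epsilon> mult_nonneg_nonneg[OF K exp_ge_zero]] ennreal_mult[OF K exp_ge_zero] ..
  finally have "ennreal \<bar>(\<integral>x. f (ratio N x) \<partial>hk_prod N T) - L\<bar> \<le> ennreal (\<epsilon> + ?K * exp (N / T - T / 2))" .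
  moreover have "0 \<le> \<epsilon> + ?K * exp (N / T - T / 2)" using \<epsilon> K by (intro add_nonneg_nonneg mult_nonneg_nonneg) auto
  ultimately show ?thesis by (simp only: ennreal_le_iff)
qed

subsection \<open>The dimension of the space of sections\<close>

text \<open>If at most one section spans, all sections are multiples of one. Some section is nonzero
  at a point x, so the spanning one is; a section vanishing at x is then identically zero, against
  the existence of one with zero value and nonzero derivative at x.\<close>

lemma very_ample_dimension:
  fixes A :: "('m::{t2_space, second_countable_topology}, 'n::finite) atlas"
  assumes A: "complex_atlas A" and L: "line_bundle A W g" and k: "very_ample_power A W g k"
    and s: "orthonormal_basis A W g h k N s"
  shows "N \<ge> 2"
proof (rule ccontr)
  assume "\<not> N \<ge> 2"
  then have "N \<le> 1" by simp
  have span: "\<exists>c. \<forall>a x. \<sigma> a x = c * s 0 a x" if \<sigma>: "\<sigma> \<in> H0 A W g k" for \<sigma>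
  proof -
    have "\<forall>\<sigma>\<in>H0 A W g k. \<exists>c. \<forall>a x. \<sigma> a x = (\<Sum>j<N. c j * s j a x)"
      using s unfolding orthonormal_basis_def by (elim conjE)
    from bspec[OF this \<sigma>] obtain c where c: "\<forall>a x. \<sigma> a x = (\<Sum>j<N. c j * s j a x)" ..
    have "N = 0 \<or> N = 1" using \<open>N \<le> 1\<close> by linarith
    \<comment> \<open>For N = 0 the sum is empty and \<open>s 0\<close> is arbitrary, so its
      coefficient is set to 0.\<close>
    then have "\<sigma> a x = (if N = 0 then 0 else c 0) * s 0 a x" for a x using c by auto
    then show ?thesis by blast
  qed
  define x :: 'm where "x = undefined"
  have "x \<in> (\<Union>(U, \<phi>)\<in>A. U)" using A by (simp add: complex_atlas_def)
  then obtain U \<phi> where U: "(U, \<phi>) \<in> A" "x \<in> U" by auto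
  have "x \<in> (\<Union>a. W a)" using L by (simp add: line_bundle_def)
  then obtain a where a: "x \<in> W a" by auto
  have jet: "\<exists>\<sigma>\<in>H0 A W g k. \<sigma> a x = c \<and>
      ((\<lambda>z. \<sigma> a (inv_into U \<phi> z)) has_derivative (\<lambda>w. \<Sum>i\<in>UNIV. vec_nth v i * vec_nth w i)) (at (\<phi> x))"
    for c :: complex and v :: "complex ^ 'n"
    using k U a unfolding very_ample_power_def by blast
  obtain \<sigma> where \<sigma>: "\<sigma> \<in> H0 A W g k" "\<sigma> a x = 1"
    using jet[of 1 0] by blast
  obtain \<tau> where \<tau>: "\<tau> \<in> H0 A W g k" "\<tau> a x = 0"
    "((\<lambda>z. \<tau> a (inv_into U \<phi> z)) has_derivative (\<lambda>w. \<Sum>i\<in>UNIV. vec_nth 1 i * vec_nth w i)) (at (\<phi> x))"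
    using jet[of 0 1] by blast
  obtain c d where c: "\<forall>a x. \<sigma> a x = c * s 0 a x" and d: "\<forall>a x. \<tau> a x = d * s 0 a x"
    using span[OF \<sigma>(1)] span[OF \<tau>(1)] by blast
  have "s 0 a x \<noteq> 0" using c \<sigma>(2) by auto
  then have "d = 0" using d \<tau>(2) by auto
  then have z: "(\<lambda>z. \<tau> a (inv_into U \<phi> z)) = (\<lambda>_. 0)" using d by auto
  have "((\<lambda>z. \<tau> a (inv_into U \<phi> z)) has_derivative (\<lambda>_. 0)) (at (\<phi> x))" unfolding z by (rule has_derivative_const)
  from has_derivative_unique[OF \<tau>(3) this]
  have "(\<Sum>i\<in>UNIV. vec_nth 1 i * vec_nth w i) = (0::complex)" for w :: "complex ^ 'n" by (rule fun_cong)
  from this[of 1] show False by simp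
qed

subsection \<open>The limit\<close>

text \<open>The error is split at \<delta>: below it the limit of \<open>var_deriv\<close> gives
  e/2. Above it N/T = 1/(k^2 t) stays bounded and exp(-T/2) <= 2/T turns the prefactor N into 2/(k^2
  t), so the rest vanishes uniformly in \<open>N\<close>.\<close>

lemma I2_derivative_limit:
  fixes N :: "nat \<Rightarrow> nat" and T :: "nat \<Rightarrow> real"
  assumes t: "t > 0" and \<rho>: "0 < \<rho>" "\<rho> < 1"
    and N: "\<forall>\<^sub>F k in sequentially. N k \<ge> 2"
    and T: "\<forall>\<^sub>F k in sequentially. T k = (real k)\<^sup>2 * real (N k) * t"
  shows "\<forall>\<^sub>F k in sequentially. I2 (N k) (T k) differentiable (at \<rho>)"
    "(\<lambda>k. deriv (I2 (N k) (T k)) \<rho>) \<longlonglongrightarrow> - ln (1 - \<rho>) / \<rho>"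
proof -
  have ev: "\<forall>\<^sub>F k in sequentially. k \<ge> 1 \<and> N k \<ge> 2 \<and> T k = (real k)\<^sup>2 * real (N k) * t"
    using N T eventually_ge_at_top[of 1] by eventually_elim simp
  have Tpos: "T k > 0" if "k \<ge> 1 \<and> N k \<ge> 2 \<and> T k = (real k)\<^sup>2 * real (N k) * t" for k
    using that t by simp
  show "\<forall>\<^sub>F k in sequentially. I2 (N k) (T k) differentiable (at \<rho>)"
    using ev
  proof eventually_elim
    case (elim k)
    from I2_has_derivative(2)[OF _ Tpos[OF elim] \<rho>] elim show ?case by (auto simp: real_differentiable_def)
  qed
  let ?L = "- ln (1 - \<rho>) / \<rho>"
  define C where "C = max (1 / \<rho>) (1 / (1 - \<rho>)) + \<bar>?L\<bar>"
  have "0 < max (1 / \<rho>) (1 / (1 - \<rho>))" using \<rho> by (simp add: less_max_iff_disj)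
  then have C: "0 \<le> C" unfolding C_def using abs_ge_zero[of ?L] by linarith
  have far: "\<bar>var_deriv \<rho> r - ?L\<bar> \<le> C" if "0 < r" "r \<le> 1" for r
  proof -
    have "\<bar>var_deriv \<rho> r\<bar> \<le> max (1 / \<rho>) (1 / (1 - \<rho>))" using that \<rho> by (intro var_deriv_bound) auto
    then show ?thesis unfolding C_def using abs_triangle_ineq4[of "var_deriv \<rho> r" ?L] by linarith
  qed
  show "(\<lambda>k. deriv (I2 (N k) (T k)) \<rho>) \<longlonglongrightarrow> ?L"
  proof (rule tendstoI)
    fix e :: real assume e: "0 < e"
    have "\<forall>\<^sub>F r in at_right 0. dist (var_deriv \<rho> r) ?L < e / 2"
      using tendstoD[OF var_deriv_tendsto[OF \<rho>], of "e / 2"] e by simp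
    then obtain \<delta> where \<delta>: "\<delta> > 0" "\<And>r. 0 < r \<Longrightarrow> r < \<delta> \<Longrightarrow> dist (var_deriv \<rho> r) ?L < e / 2"
      by (auto simp: eventually_at_right_field)
    have near: "\<bar>var_deriv \<rho> r - ?L\<bar> \<le> e / 2" if "0 < r" "r < \<delta>" for r
      using \<delta>(2)[OF that] by (simp add: dist_real_def)
    \<comment> \<open>The error bound after \<open>N\<close> has been eliminated through
      \<open>T k\<close>.\<close>
    define B where "B k = C / sqrt \<delta> * (2 / ((real k)\<^sup>2 * t)) * exp (1 / ((real k)\<^sup>2 * t))" for k :: nat
    have "B \<longlonglongrightarrow> 0"
      unfolding B_def using t by real_asymp
    then have Bsmall: "\<forall>\<^sub>F k in sequentially. B k < e / 2"
      by (rule order_tendstoD) (use e in simp)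
    show "\<forall>\<^sub>F k in sequentially. dist (deriv (I2 (N k) (T k)) \<rho>) ?L < e"
      using ev Bsmall
    proof eventually_elim
      case (elim k)
      have N2: "N k \<ge> 2" and k: "real k > 0" and n: "real (N k) > 0" using elim by auto
      have Tk: "T k = (real k)\<^sup>2 * real (N k) * t" using elim by simp
      have T0: "T k > 0" by (rule Tpos[OF elim(1)])
      note der = I2_has_derivative[OF N2 T0 \<rho>]
      have "\<bar>(\<integral>x. var_deriv \<rho> (ratio (N k) x) \<partial>hk_prod (N k) (T k)) - ?L\<bar>
          \<le> e / 2 + C * N k / sqrt \<delta> * exp (N k / T k - T k / 2)"
        using e by (intro expectation_ratio_bound[OF N2 T0 \<delta>(1) _ near far der(1)]) auto
      also have "C * N k / sqrt \<delta> * exp (N k / T k - T k / 2) \<le> B k"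
      proof -
        have NT: "N k / T k = 1 / ((real k)\<^sup>2 * t)" using n k t by (simp add: Tk)
        have "T k / 2 \<le> exp (T k / 2)" using exp_ge_add_one_self[of "T k / 2"] by linarith
        then have "exp (- (T k / 2)) \<le> 2 / T k"
          using T0 by (simp add: exp_minus field_simps)
        then have "N k * exp (- (T k / 2)) \<le> N k * (2 / T k)" using n by (intro mult_left_mono) auto
        also have "\<dots> = 2 * (N k / T k)" by simp
        finally have h: "N k * exp (- (T k / 2)) \<le> 2 / ((real k)\<^sup>2 * t)" unfolding NT by simp
        have "C * N k / sqrt \<delta> * exp (N k / T k - T k / 2)
            = C / sqrt \<delta> * (N k * exp (- (T k / 2))) * exp (1 / ((real k)\<^sup>2 * t))"
          unfolding NT diff_conv_add_uminus exp_add by simp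
        also have "\<dots> \<le> B k"
          unfolding B_def using C \<delta>(1) h by (intro mult_right_mono mult_left_mono) auto
        finally show ?thesis .
      qed
      finally have "\<bar>(\<integral>x. var_deriv \<rho> (ratio (N k) x) \<partial>hk_prod (N k) (T k)) - ?L\<bar> < e" using elim(2) by linarith
      then show ?case unfolding DERIV_imp_deriv[OF der(2)] dist_real_def .
    qed
  qed
qed

theorem mainTheorem3:
  fixes A :: "('m::{t2_space, second_countable_topology}, 'n::finite) atlas"
    and W :: "'i \<Rightarrow> 'm set"
    and g :: "'i \<Rightarrow> 'i \<Rightarrow> 'm \<Rightarrow> complex"
    and h :: "'i \<Rightarrow> 'm \<Rightarrow> real"
    and s :: "nat \<Rightarrow> nat \<Rightarrow> 'i \<Rightarrow> 'm \<Rightarrow> complex"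
    and N :: "nat \<Rightarrow> nat"
    and \<epsilon> :: "nat \<Rightarrow> real"
    and t \<rho> :: real
  assumes "compact (UNIV :: 'm set)" and "complex_atlas A"
    and "line_bundle A W g" and "ample A W g"
    and "hermitian_metric A W g h" and "positive_curvature A W h"
    and "\<And>k. N k = dim_H0 A W g k"
    and "\<forall>\<^sub>F k in sequentially. orthonormal_basis A W g h k (N k) (s k)"
    and "\<And>k. \<epsilon> k = 1 / (real k * sqrt (real (N k)))"
    and "t > 0" and "0 < \<rho>" and "\<rho> < 1"
  shows "(\<forall>\<^sub>F k in sequentially. I2 (N k) ((\<epsilon> k) powi (-2) * t) differentiable (at \<rho>)) \<and>
         (\<lambda>k. deriv (I2 (N k) ((\<epsilon> k) powi (-2) * t)) \<rho>) \<longlonglongrightarrow> - ln (1 - \<rho>) / \<rho>"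
proof -
  have "\<forall>\<^sub>F k in sequentially. very_ample_power A W g k"
    using assms(4) by (auto simp: ample_def eventually_sequentially)
  then have N: "\<forall>\<^sub>F k in sequentially. N k \<ge> 2"
    using assms(8) by eventually_elim (rule very_ample_dimension[OF assms(2,3)])
  \<comment> \<open>Valid for all \<open>k\<close>: where \<open>k\<close> or \<open>N k\<close> is
    0, division by zero makes both sides 0.\<close>
  have "\<epsilon> k powi (-2) * t = (real k)\<^sup>2 * real (N k) * t" for k
    by (simp add: assms(9) power_int_minus power_mult_distrib power_divide)
  then have T: "\<forall>\<^sub>F k in sequentially. \<epsilon> k powi (-2) * t = (real k)\<^sup>2 * real (N k) * t" by simp
  show ?thesis using I2_derivative_limit[OF assms(10-12) N T] by blast
qed

end
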